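(* Let $\varphi_1$ and $\varphi_2$ be univalent and regular self-maps of $\mathbb D$ (each being either parabolic or hyperbolic) with respective Denjoy-Wolff points $\alpha_1,\alpha_2\in\mathbb T$. When $\alpha_1\neq\alpha_2$, the composition operators $C_{\varphi_1}$ and $C_{\varphi_2}$ are always disjointly frequently hypercyclic on $H(\mathbb D)$. When $\alpha_1=\alpha_2=\alpha$, $C_{\varphi_1}$ and $C_{\varphi_2}$ are disjointly frequently hypercyclic on $H(\mathbb D)$ if and only if (a) either $\varphi_1$ and $\varphi_2$ are hyperbolic with $\varphi_1'(\alpha)\neq\varphi_2'(\alpha)$; (b) or $\varphi_1$ and $\varphi_2$ are parabolic with $(\varphi_1''(\alpha),\varphi_1^{(3)}(\alpha))\neq(\varphi_2''(\alpha),\varphi_2^{(3)}(\alpha))$; (c) or $\varphi_1$ is hyperbolic, $\varphi_2$ is parabolic and $\varphi_2''(\alpha)\in i\mathbb R$; (d) or $\varphi_1$ is parabolic, $\varphi_2$ is hyperbolic and $\varphi_1''(\alpha)\in i\mathbb R$.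
   Context: $\mathbb D$ is the open unit disc, $\mathbb T$ the unit circle, $H(\mathbb D)$ the space of holomorphic functions on $\mathbb D$ with the topology of uniform convergence on compact sets, $C_\varphi f=f\circ\varphi$. Self-map of $\mathbb D$ means holomorphic self-map. If a univalent self-map $\varphi$ has no fixed point in $\mathbb D$, its Denjoy-Wolff point is the unique $\alpha\in\mathbb T$ such that $\varphi^n\to\alpha$ uniformly on compact subsets of $\mathbb D$; $\varphi$ then has an angular derivative $\varphi'(\alpha)\in(0,1]$ at $\alpha$. $\varphi$ is parabolic if $\varphi'(\alpha)=1$ and hyperbolic if $\varphi'(\alpha)\in(0,1)$. A parabolic univalent self-map $\varphi$ with Denjoy-Wolff point $\alpha$ is regular if $\varphi$ is continuous on $\overline{\mathbb D}$, and there exist numbers $\varphi''(\alpha)\neq0$, $\varphi^{(3)}(\alpha)$ and $\varepsilon>0$ such that $$\varphi(z)=\alpha+(z-\alpha)+\frac{\varphi''(\alpha)}{2}(z-\alpha)^2+\frac{\varphi^{(3)}(\alpha)}{3!}(z-\alpha)^3+\gamma(z),\quad \gamma(z)=o(|z-\alpha|^{3+\varepsilon})\text{ as }z\to\alpha\text{ in }\mathbb D.$$ A hyperbolic univalent self-map $\varphi$ with Denjoy-Wolff point $\alpha$ is regular if $\varphi$ is continuous on $\overline{\mathbb D}$ and there is $\varepsilon>0$ such that $\varphi(z)=\alpha+\varphi'(\alpha)(z-\alpha)+\gamma(z)$ with $\gamma(z)=o(|z-\alpha|^{1+\varepsilon})$ as $z\to\alpha$ in $\mathbb D$. Continuous linear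 operators $T_1,\dots,T_N$ on a separable infinite-dimensional $F$-space $X$ are disjointly frequently hypercyclic if there is a vector $x\in X$ such that, for any nonempty open set $U\subset X^N$, the set $\{n\in\mathbb N:\ (T_1^n x,\dots,T_N^n x)\in U\}$ has positive lower density, where the lower density of $A\subset\mathbb N$ is $\liminf_{n\to\infty}\frac1n\#(A\cap[1,n])$.
   Formalization: In (c) and (d) the condition φ''(α) ∈ iℝ is replaced by αφ''(α) ∈ iℝ, which agrees with it when α = ±1; as printed the condition is not rotation invariant and the claim fails for other α, e.g. α = i. *)

theory Defs
  imports "HOL-Complex_Analysis.Complex_Analysis" "HOL-Library.Landau_Symbols"
begin

abbreviation unit_disc :: "complex set" where
  "unit_disc \<equiv> ball 0 1"

section \<open>The space of holomorphic functions on the unit disc\<close>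

text \<open>A holomorphic function on the disc is represented by its extension by zero to the whole
  plane, so that distinct elements of the carrier are distinct functions on the disc and the
  carrier is a linear subspace of the space of all functions.\<close>

definition hol_disc :: "(complex \<Rightarrow> complex) set" where
  "hol_disc = {f. f holomorphic_on unit_disc \<and> (\<forall>z. z \<notin> unit_disc \<longrightarrow> f z = 0)}"

definition hol_disc_nbhd ::
    "complex set \<Rightarrow> real \<Rightarrow> (complex \<Rightarrow> complex) \<Rightarrow> (complex \<Rightarrow> complex) set" where
  "hol_disc_nbhd K e f = {g \<in> hol_disc. \<forall>z\<in>K. dist (g z) (f z) < e}"

definition hol_disc_open :: "(complex \<Rightarrow> complex) set \<Rightarrow> bool" where
  "hol_disc_open U \<longleftrightarrow> U \<subseteq> hol_disc \<and>
     (\<forall>f\<in>U. \<exists>K e. compact K \<and> K \<subseteq> unit_disc \<and> e > 0 \<and> hol_disc_nbhd K e f \<subseteq> U)"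

definition hol_disc_topology :: "(complex \<Rightarrow> complex) topology" where
  "hol_disc_topology = topology hol_disc_open"

lemma istopology_hol_disc_open: "istopology hol_disc_open"
  unfolding istopology_def
proof (intro conjI allI impI)
  fix S T assume S: "hol_disc_open S" and T: "hol_disc_open T"
  show "hol_disc_open (S \<inter> T)"
    unfolding hol_disc_open_def
  proof (intro conjI ballI)
    show "S \<inter> T \<subseteq> hol_disc" using S by (auto simp: hol_disc_open_def)
    fix f assume f: "f \<in> S \<inter> T"
    obtain K e where 1: "compact K" "K \<subseteq> unit_disc" "e > 0" "hol_disc_nbhd K e f \<subseteq> S"
      using S f unfolding hol_disc_open_def by blast
    obtain L d where 2: "compact L" "L \<subseteq> unit_disc" "d > 0" "hol_disc_nbhd L d f \<subseteq> T"
      using T f unfolding hol_disc_open_def by blast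
    have "hol_disc_nbhd (K \<union> L) (min e d) f \<subseteq> hol_disc_nbhd K e f \<inter> hol_disc_nbhd L d f"
      by (simp add: hol_disc_nbhd_def subset_iff)
    then have "hol_disc_nbhd (K \<union> L) (min e d) f \<subseteq> S \<inter> T"
      using 1(4) 2(4) by blast
    moreover have "compact (K \<union> L)" "K \<union> L \<subseteq> unit_disc" "min e d > 0"
      using 1 2 by (simp_all add: compact_Un)
    ultimately show "\<exists>K e. compact K \<and> K \<subseteq> unit_disc \<and> e > 0 \<and> hol_disc_nbhd K e f \<subseteq> S \<inter> T"
      by blast
  qed
next
  fix \<K> assume *: "\<forall>K\<in>\<K>. hol_disc_open K"
  show "hol_disc_open (\<Union>\<K>)"
    unfolding hol_disc_open_def
  proof (intro conjI ballI)
    show "\<Union>\<K> \<subseteq> hol_disc" using * by (auto simp: hol_disc_open_def)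
    fix f assume "f \<in> \<Union>\<K>"
    then obtain S where S: "S \<in> \<K>" "f \<in> S" by blast
    have "hol_disc_open S" using * S(1) by (rule bspec)
    then obtain K e where "compact K" "K \<subseteq> unit_disc" "e > 0" "hol_disc_nbhd K e f \<subseteq> S"
      using S(2) unfolding hol_disc_open_def by blast
    moreover from this have "hol_disc_nbhd K e f \<subseteq> \<Union>\<K>"
      using Union_upper[OF S(1)] by (meson subset_trans)
    ultimately show "\<exists>K e. compact K \<and> K \<subseteq> unit_disc \<and> e > 0 \<and> hol_disc_nbhd K e f \<subseteq> \<Union>\<K>"
      by (intro exI conjI)
  qed
qed

lemma openin_hol_disc: "openin hol_disc_topology U \<longleftrightarrow> hol_disc_open U"
  unfolding hol_disc_topology_def using topology_inverse'[OF istopology_hol_disc_open] by simp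

lemma hol_disc_nbhd_self: "f \<in> hol_disc \<Longrightarrow> e > 0 \<Longrightarrow> f \<in> hol_disc_nbhd K e f"
  by (simp add: hol_disc_nbhd_def)

lemma topspace_hol_disc [simp]: "topspace hol_disc_topology = hol_disc"
proof -
  have "hol_disc_nbhd {} 1 f \<subseteq> hol_disc" for f
    by (simp add: hol_disc_nbhd_def)
  moreover have "compact {}" "{} \<subseteq> unit_disc" "(0::real) < 1" by simp_all
  ultimately have "openin hol_disc_topology hol_disc"
    unfolding openin_hol_disc hol_disc_open_def by blast
  moreover have "topspace hol_disc_topology \<subseteq> hol_disc"
    using openin_topspace[of hol_disc_topology] unfolding openin_hol_disc hol_disc_open_def by blast
  ultimately show ?thesis using openin_subset by blast
qed

lemma openin_hol_disc_nbhd_contains: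
  assumes "compact K" "K \<subseteq> unit_disc" "e > 0" "f \<in> hol_disc"
  obtains U where "openin hol_disc_topology U" "f \<in> U" "U \<subseteq> hol_disc_nbhd K e f"
proof
  define U where "U = {g \<in> hol_disc. \<exists>d>0. hol_disc_nbhd K d g \<subseteq> hol_disc_nbhd K e f}"
  show "openin hol_disc_topology U"
    unfolding openin_hol_disc hol_disc_open_def
  proof (intro conjI ballI)
    show "U \<subseteq> hol_disc" by (auto simp: U_def)
    fix g assume "g \<in> U"
    then obtain d where d: "d > 0" "hol_disc_nbhd K d g \<subseteq> hol_disc_nbhd K e f"
      by (auto simp: U_def)
    have "hol_disc_nbhd K (d/2) g \<subseteq> U"
    proof
      fix h assume h: "h \<in> hol_disc_nbhd K (d/2) g"
      have "hol_disc_nbhd K (d/2) h \<subseteq> hol_disc_nbhd K d g"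
      proof
        fix k assume k: "k \<in> hol_disc_nbhd K (d/2) h"
        show "k \<in> hol_disc_nbhd K d g"
          unfolding hol_disc_nbhd_def
        proof (intro CollectI conjI ballI)
          show "k \<in> hol_disc" using k by (simp add: hol_disc_nbhd_def)
          fix z assume "z \<in> K"
          then have "dist (k z) (h z) < d/2" "dist (h z) (g z) < d/2"
            using h k by (simp_all add: hol_disc_nbhd_def)
          then show "dist (k z) (g z) < d"
            using dist_triangle[of "k z" "g z" "h z"] by linarith
        qed
      qed
      then have "hol_disc_nbhd K (d/2) h \<subseteq> hol_disc_nbhd K e f" using d(2) by blast
      moreover have "h \<in> hol_disc" using h by (simp add: hol_disc_nbhd_def)
      moreover have "d/2 > 0" using d(1) by simp
      ultimately show "h \<in> U" unfolding U_def by blast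
    qed
    then show "\<exists>K e. compact K \<and> K \<subseteq> unit_disc \<and> e > 0 \<and> hol_disc_nbhd K e g \<subseteq> U"
      using assms d by (intro exI[of _ K] exI[of _ "d/2"]) auto
  qed
  show "f \<in> U" using assms(3,4) unfolding U_def by blast
  show "U \<subseteq> hol_disc_nbhd K e f"
    using hol_disc_nbhd_self unfolding U_def by blast
qed

lemma limitin_hol_disc_iff:
  "limitin hol_disc_topology f l F \<longleftrightarrow>
     l \<in> hol_disc \<and> (\<forall>\<^sub>F n in F. f n \<in> hol_disc) \<and>
     (\<forall>K. compact K \<longrightarrow> K \<subseteq> unit_disc \<longrightarrow> uniform_limit K f l F)"
  (is "?L \<longleftrightarrow> ?R")
proof
  assume L: ?L
  then have l: "l \<in> hol_disc" using limitin_topspace by fastforce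
  have ev: "\<forall>\<^sub>F n in F. f n \<in> hol_disc_nbhd K e l"
    if K: "compact K" "K \<subseteq> unit_disc" "e > 0" for K e
  proof -
    obtain U where "openin hol_disc_topology U" "l \<in> U" "U \<subseteq> hol_disc_nbhd K e l"
      using openin_hol_disc_nbhd_contains[OF K l] .
    then show ?thesis using L unfolding limitin_def
      by (metis (mono_tags, lifting) eventually_mono subsetD)
  qed
  show ?R
  proof (intro conjI allI impI)
    show "l \<in> hol_disc" by (fact l)
    show "\<forall>\<^sub>F n in F. f n \<in> hol_disc"
      using ev[of "{}" 1] by (simp add: hol_disc_nbhd_def)
    fix K :: "complex set" assume K: "compact K" "K \<subseteq> unit_disc"
    show "uniform_limit K f l F"
      unfolding uniform_limit_iff
    proof (intro allI impI)
      fix e :: real assume "e > 0"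
      from ev[OF K this] show "\<forall>\<^sub>F n in F. \<forall>z\<in>K. dist (f n z) (l z) < e"
        by (rule eventually_mono) (simp add: hol_disc_nbhd_def)
    qed
  qed
next
  assume R: ?R
  show ?L unfolding limitin_def
  proof (intro conjI allI impI)
    show "l \<in> topspace hol_disc_topology" using R by simp
    fix U assume "openin hol_disc_topology U \<and> l \<in> U"
    then obtain K e where K: "compact K" "K \<subseteq> unit_disc" "e > 0" "hol_disc_nbhd K e l \<subseteq> U"
      unfolding openin_hol_disc hol_disc_open_def by blast
    then have "\<forall>\<^sub>F n in F. \<forall>z\<in>K. dist (f n z) (l z) < e"
      using R by (auto simp: uniform_limit_iff)
    moreover have "\<forall>\<^sub>F n in F. f n \<in> hol_disc" using R by blast
    ultimately show "\<forall>\<^sub>F n in F. f n \<in> U"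
      by eventually_elim (use K(4) in \<open>auto simp: hol_disc_nbhd_def\<close>)
  qed
qed

definition composition_operator ::
    "(complex \<Rightarrow> complex) \<Rightarrow> (complex \<Rightarrow> complex) \<Rightarrow> (complex \<Rightarrow> complex)" where
  "composition_operator \<phi> f = (\<lambda>z. if z \<in> unit_disc then f (\<phi> z) else 0)"

section \<open>Self-maps of the disc\<close>

text \<open>Only the values of a self-map on the open disc are relevant in the following notions.\<close>

definition univalent_self_map :: "(complex \<Rightarrow> complex) \<Rightarrow> bool" where
  "univalent_self_map \<phi> \<longleftrightarrow>
     \<phi> holomorphic_on unit_disc \<and> \<phi> ` unit_disc \<subseteq> unit_disc \<and> inj_on \<phi> unit_disc"

definition denjoy_wolff_point :: "(complex \<Rightarrow> complex) \<Rightarrow> complex \<Rightarrow> bool" where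
  "denjoy_wolff_point \<phi> \<alpha> \<longleftrightarrow>
     (\<forall>z\<in>unit_disc. \<phi> z \<noteq> z) \<and> \<alpha> \<in> sphere 0 1 \<and>
     (\<forall>K. compact K \<longrightarrow> K \<subseteq> unit_disc \<longrightarrow>
        uniform_limit K (\<lambda>n. \<phi> ^^ n) (\<lambda>_. \<alpha>) sequentially)"

definition stolz_region :: "complex \<Rightarrow> real \<Rightarrow> complex set" where
  "stolz_region \<alpha> M = {z \<in> unit_disc. dist z \<alpha> < M * (1 - norm z)}"

text \<open>The point \<open>\<beta>\<close> below is the non-tangential limit of \<open>\<phi>\<close> at \<open>\<alpha>\<close>; it equals \<open>\<alpha>\<close> when
  \<open>\<alpha>\<close> is the Denjoy-Wolff point of \<open>\<phi>\<close>.\<close>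

definition has_angular_derivative :: "(complex \<Rightarrow> complex) \<Rightarrow> complex \<Rightarrow> complex \<Rightarrow> bool" where
  "has_angular_derivative \<phi> \<alpha> d \<longleftrightarrow>
     (\<exists>\<beta>\<in>sphere 0 1. \<forall>M>1.
        ((\<lambda>z. (\<phi> z - \<beta>) / (z - \<alpha>)) \<longlongrightarrow> d) (at \<alpha> within stolz_region \<alpha> M))"

definition angular_derivative :: "(complex \<Rightarrow> complex) \<Rightarrow> complex \<Rightarrow> complex" where
  "angular_derivative \<phi> \<alpha> = (THE d. has_angular_derivative \<phi> \<alpha> d)"

definition parabolic :: "(complex \<Rightarrow> complex) \<Rightarrow> complex \<Rightarrow> bool" where
  "parabolic \<phi> \<alpha> \<longleftrightarrow> denjoy_wolff_point \<phi> \<alpha> \<and> has_angular_derivative \<phi> \<alpha> 1"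

definition hyperbolic :: "(complex \<Rightarrow> complex) \<Rightarrow> complex \<Rightarrow> bool" where
  "hyperbolic \<phi> \<alpha> \<longleftrightarrow> denjoy_wolff_point \<phi> \<alpha> \<and>
     (\<exists>d::real. 0 < d \<and> d < 1 \<and> has_angular_derivative \<phi> \<alpha> (of_real d))"

definition continuous_up_to_boundary :: "(complex \<Rightarrow> complex) \<Rightarrow> bool" where
  "continuous_up_to_boundary \<phi> \<longleftrightarrow>
     (\<exists>\<psi>. continuous_on (cball 0 1) \<psi> \<and> (\<forall>z\<in>unit_disc. \<psi> z = \<phi> z))"

definition parabolic_expansion ::
    "(complex \<Rightarrow> complex) \<Rightarrow> complex \<Rightarrow> complex \<Rightarrow> complex \<Rightarrow> bool" where
  "parabolic_expansion \<phi> \<alpha> a b \<longleftrightarrow>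
     (\<exists>\<epsilon>>0. (\<lambda>z. \<phi> z - (\<alpha> + (z - \<alpha>) + a / 2 * (z - \<alpha>)^2 + b / fact 3 * (z - \<alpha>)^3))
        \<in> o[at \<alpha> within unit_disc](\<lambda>z. of_real (norm (z - \<alpha>) powr (3 + \<epsilon>))))"

definition hyperbolic_expansion :: "(complex \<Rightarrow> complex) \<Rightarrow> complex \<Rightarrow> complex \<Rightarrow> bool" where
  "hyperbolic_expansion \<phi> \<alpha> d \<longleftrightarrow>
     (\<exists>\<epsilon>>0. (\<lambda>z. \<phi> z - (\<alpha> + d * (z - \<alpha>)))
        \<in> o[at \<alpha> within unit_disc](\<lambda>z. of_real (norm (z - \<alpha>) powr (1 + \<epsilon>))))"

text \<open>Conjugating \<open>\<phi>\<close> by the rotation \<open>z \<mapsto> \<alpha> * z\<close>, which moves the Denjoy-Wolff point to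
  \<open>1\<close>, multiplies the second derivative by \<open>\<alpha>\<close>. A condition \<open>\<phi>''(1) \<in> i\<real>\<close> for maps with
  Denjoy-Wolff point \<open>1\<close> therefore reads \<open>\<alpha> * \<phi>''(\<alpha>) \<in> i\<real>\<close> in general.\<close>

definition boundary_deriv2 :: "(complex \<Rightarrow> complex) \<Rightarrow> complex \<Rightarrow> complex" where
  "boundary_deriv2 \<phi> \<alpha> = (THE a. \<exists>b. parabolic_expansion \<phi> \<alpha> a b)"

definition boundary_deriv3 :: "(complex \<Rightarrow> complex) \<Rightarrow> complex \<Rightarrow> complex" where
  "boundary_deriv3 \<phi> \<alpha> = (THE b. \<exists>a. parabolic_expansion \<phi> \<alpha> a b)"

definition regular_parabolic :: "(complex \<Rightarrow> complex) \<Rightarrow> complex \<Rightarrow> bool" where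
  "regular_parabolic \<phi> \<alpha> \<longleftrightarrow> parabolic \<phi> \<alpha> \<and> continuous_up_to_boundary \<phi> \<and>
     (\<exists>a b. a \<noteq> 0 \<and> parabolic_expansion \<phi> \<alpha> a b)"

definition regular_hyperbolic :: "(complex \<Rightarrow> complex) \<Rightarrow> complex \<Rightarrow> bool" where
  "regular_hyperbolic \<phi> \<alpha> \<longleftrightarrow> hyperbolic \<phi> \<alpha> \<and> continuous_up_to_boundary \<phi> \<and>
     hyperbolic_expansion \<phi> \<alpha> (angular_derivative \<phi> \<alpha>)"

section \<open>Disjoint frequent hypercyclicity\<close>

definition lower_density :: "nat set \<Rightarrow> ereal" where
  "lower_density A = liminf (\<lambda>n. ereal (real (card (A \<inter> {1..n})) / real n))"

text \<open>The operators are given as a list \<open>Ts\<close> of self-maps of the space \<open>X\<close>; the power of \<open>X\<close>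
  carries the product topology indexed by \<open>{..<length Ts}\<close>.\<close>

definition disjointly_frequently_hypercyclic :: "'a topology \<Rightarrow> ('a \<Rightarrow> 'a) list \<Rightarrow> bool" where
  "disjointly_frequently_hypercyclic X Ts \<longleftrightarrow>
     (\<exists>x\<in>topspace X. \<forall>U. openin (product_topology (\<lambda>_. X) {..<length Ts}) U \<and> U \<noteq> {} \<longrightarrow>
        lower_density {n. (\<lambda>i\<in>{..<length Ts}. ((Ts ! i) ^^ n) x) \<in> U} > 0)"

section \<open>Well-definedness\<close>

lemma composition_operator_in_hol_disc:
  assumes "univalent_self_map \<phi>" "f \<in> hol_disc"
  shows "composition_operator \<phi> f \<in> hol_disc"
proof -
  have "(f \<circ> \<phi>) holomorphic_on unit_disc"
    using assms holomorphic_on_compose_gen[of \<phi> unit_disc f unit_disc]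
    by (auto simp: univalent_self_map_def hol_disc_def)
  then have "composition_operator \<phi> f holomorphic_on unit_disc"
    by (rule holomorphic_transform) (auto simp: composition_operator_def)
  then show ?thesis by (auto simp: hol_disc_def composition_operator_def)
qed

lemma continuous_map_composition_operator:
  assumes \<phi>: "univalent_self_map \<phi>"
  shows "continuous_map hol_disc_topology hol_disc_topology (composition_operator \<phi>)"
  unfolding continuous_map_def
proof (intro conjI allI impI)
  show "composition_operator \<phi> \<in> topspace hol_disc_topology \<rightarrow> topspace hol_disc_topology"
    using composition_operator_in_hol_disc[OF \<phi>] by auto
  fix U assume U: "openin hol_disc_topology U"
  show "openin hol_disc_topology
          {f \<in> topspace hol_disc_topology. composition_operator \<phi> f \<in> U}"
    unfolding openin_hol_disc hol_disc_open_def
  proof (intro conjI ballI)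
    fix f assume f: "f \<in> {f \<in> topspace hol_disc_topology. composition_operator \<phi> f \<in> U}"
    then obtain K e where K: "compact K" "K \<subseteq> unit_disc" "e > 0"
        "hol_disc_nbhd K e (composition_operator \<phi> f) \<subseteq> U"
      using U unfolding openin_hol_disc hol_disc_open_def by blast
    have "continuous_on K \<phi>"
      using \<phi> K(2) by (meson continuous_on_subset holomorphic_on_imp_continuous_on univalent_self_map_def)
    then have 1: "compact (\<phi> ` K)" using K(1) compact_continuous_image by blast
    have 2: "\<phi> ` K \<subseteq> unit_disc" using \<phi> K(2) unfolding univalent_self_map_def by blast
    have "composition_operator \<phi> g \<in> U" if "g \<in> hol_disc_nbhd (\<phi> ` K) e f" for g
    proof -
      have "composition_operator \<phi> g \<in> hol_disc_nbhd K e (composition_operator \<phi> f)"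
        using that K(2) composition_operator_in_hol_disc[OF \<phi>]
        by (auto simp: hol_disc_nbhd_def composition_operator_def)
      then show ?thesis using K(4) by blast
    qed
    then have "hol_disc_nbhd (\<phi> ` K) e f \<subseteq>
        {f \<in> topspace hol_disc_topology. composition_operator \<phi> f \<in> U}"
      by (auto simp: hol_disc_nbhd_def)
    then show "\<exists>K e. compact K \<and> K \<subseteq> unit_disc \<and> e > 0 \<and> hol_disc_nbhd K e f \<subseteq>
        {f \<in> topspace hol_disc_topology. composition_operator \<phi> f \<in> U}"
      using 1 2 K(3) by blast
  qed auto
qed

lemma boundary_point_islimpt_stolz_region:
  assumes "\<alpha> \<in> sphere 0 1" "M > 1"
  shows "\<alpha> islimpt stolz_region \<alpha> M"
  unfolding islimpt_approachable
proof (intro allI impI)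
  fix e :: real assume e: "e > 0"
  define t where "t = min e 1 / 2"
  have t: "0 < t" "t < 1" "t < e" using e by (auto simp: t_def)
  have n: "norm \<alpha> = 1" using assms by simp
  have 1: "norm (of_real (1 - t) * \<alpha>) = 1 - t"
    using t n by (simp add: norm_mult del: of_real_diff)
  have "of_real (1 - t) * \<alpha> - \<alpha> = of_real (- t) * \<alpha>" by (simp add: algebra_simps)
  then have 2: "dist (of_real (1 - t) * \<alpha>) \<alpha> = t"
    using t n by (simp add: dist_norm norm_mult del: of_real_diff of_real_minus)
  have "t * 1 < t * M" using t assms by (intro mult_strict_left_mono) auto
  then have "of_real (1 - t) * \<alpha> \<in> stolz_region \<alpha> M"
    using 1 2 t by (simp add: stolz_region_def mult.commute)
  moreover have "of_real (1 - t) * \<alpha> \<noteq> \<alpha>" using 2 t by force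
  ultimately show "\<exists>x\<in>stolz_region \<alpha> M. x \<noteq> \<alpha> \<and> dist x \<alpha> < e"
    using 2 t(3) by (intro bexI[of _ "of_real (1 - t) * \<alpha>"] conjI) (simp_all only: 2, simp)
qed

lemma has_angular_derivative_unique:
  assumes "\<alpha> \<in> sphere 0 1" "has_angular_derivative \<phi> \<alpha> d" "has_angular_derivative \<phi> \<alpha> d'"
  shows "d = d'"
proof -
  let ?F = "at \<alpha> within stolz_region \<alpha> 2"
  have nt: "?F \<noteq> bot"
    using boundary_point_islimpt_stolz_region[OF assms(1), of 2] by (simp add: trivial_limit_within)
  obtain \<beta> \<beta>' where b: "((\<lambda>z. (\<phi> z - \<beta>) / (z - \<alpha>)) \<longlongrightarrow> d) ?F"
      "((\<lambda>z. (\<phi> z - \<beta>') / (z - \<alpha>)) \<longlongrightarrow> d') ?F"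
    using assms(2,3) unfolding has_angular_derivative_def by (metis one_less_numeral_iff semiring_norm(76))
  have lim: "(\<phi> \<longlongrightarrow> c) ?F" if "((\<lambda>z. (\<phi> z - c) / (z - \<alpha>)) \<longlongrightarrow> l) ?F" for c l
  proof -
    have "((\<lambda>z. (\<phi> z - c) / (z - \<alpha>) * (z - \<alpha>) + c) \<longlongrightarrow> l * (\<alpha> - \<alpha>) + c) ?F"
      by (intro tendsto_intros that)
    moreover have "\<forall>\<^sub>F z in ?F. (\<phi> z - c) / (z - \<alpha>) * (z - \<alpha>) + c = \<phi> z"
      by (simp add: eventually_at_filter)
    ultimately show ?thesis by (simp add: tendsto_cong)
  qed
  have "\<beta> = \<beta>'" using tendsto_unique[OF nt lim[OF b(1)] lim[OF b(2)]] .
  then show ?thesis using tendsto_unique[OF nt b(1)] b(2) by simp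
qed

lemma angular_derivative_eq:
  assumes "\<alpha> \<in> sphere 0 1" "has_angular_derivative \<phi> \<alpha> d"
  shows "angular_derivative \<phi> \<alpha> = d"
  unfolding angular_derivative_def
proof (rule the_equality)
  show "has_angular_derivative \<phi> \<alpha> d" by (fact assms(2))
  fix d' assume "has_angular_derivative \<phi> \<alpha> d'"
  then show "d' = d" by (rule has_angular_derivative_unique[OF assms(1) _ assms(2)])
qed

lemma parabolic_expansion_unique:
  assumes "\<alpha> \<in> sphere 0 1" "parabolic_expansion \<phi> \<alpha> a b" "parabolic_expansion \<phi> \<alpha> a' b'"
  shows "a = a' \<and> b = b'"
proof -
  let ?F = "at \<alpha> within unit_disc"
  define \<gamma> where
    "\<gamma> a b z = \<phi> z - (\<alpha> + (z - \<alpha>) + a / 2 * (z - \<alpha>)^2 + b / fact 3 * (z - \<alpha>)^3)" for a b z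
  have "\<alpha> islimpt unit_disc"
    using boundary_point_islimpt_stolz_region[OF assms(1), of 2]
    by (rule islimpt_subset) (auto simp: stolz_region_def)
  then have nt: "?F \<noteq> bot" by (simp add: trivial_limit_within)
  have lim3: "((\<lambda>z. \<gamma> a b z / (z - \<alpha>)^3) \<longlongrightarrow> 0) ?F"
    if exp: "parabolic_expansion \<phi> \<alpha> a b" for a b
  proof -
    have \<gamma>: "\<gamma> a b = (\<lambda>z. \<phi> z -
        (\<alpha> + (z - \<alpha>) + a / 2 * (z - \<alpha>)^2 + b / fact 3 * (z - \<alpha>)^3))"
      by (intro ext) (simp only: \<gamma>_def)
    obtain \<epsilon> where \<epsilon>: "\<epsilon> > 0"
      and o: "\<gamma> a b \<in> o[?F](\<lambda>z. of_real (norm (z - \<alpha>) powr (3 + \<epsilon>)))"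
      using exp unfolding parabolic_expansion_def \<gamma> by (elim exE conjE)
    have "\<forall>\<^sub>F z in ?F. dist z \<alpha> < 1"
      by (auto simp: eventually_at intro: exI[of _ 1])
    then have "\<forall>\<^sub>F z in ?F. norm (complex_of_real (norm (z - \<alpha>) powr (3 + \<epsilon>)))
        \<le> 1 * norm ((z - \<alpha>)^3)"
    proof eventually_elim
      fix z assume "dist z \<alpha> < 1"
      then have "norm (z - \<alpha>) powr (3 + \<epsilon>) \<le> norm (z - \<alpha>) powr 3"
        using \<epsilon> by (intro powr_mono') (auto simp: dist_norm)
      then show "norm (complex_of_real (norm (z - \<alpha>) powr (3 + \<epsilon>))) \<le> 1 * norm ((z - \<alpha>)^3)"
        by (simp add: norm_power)
    qed
    then have "(\<lambda>z. complex_of_real (norm (z - \<alpha>) powr (3 + \<epsilon>))) \<in> O[?F](\<lambda>z. (z - \<alpha>)^3)"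
      by (rule bigoI)
    with o have "\<gamma> a b \<in> o[?F](\<lambda>z. (z - \<alpha>)^3)" by (rule landau_o.small_big_trans)
    then show ?thesis by (rule smalloD_tendsto)
  qed
  have ne: "\<forall>\<^sub>F z in ?F. z \<noteq> \<alpha>" by (simp add: eventually_at_filter)
  have D: "((\<lambda>z. \<gamma> a' b' z / (z - \<alpha>)^3 - \<gamma> a b z / (z - \<alpha>)^3) \<longlongrightarrow> 0) ?F"
    using tendsto_diff[OF lim3[OF assms(3)] lim3[OF assms(2)]] by simp
  have eq: "\<gamma> a' b' z / (z - \<alpha>)^3 - \<gamma> a b z / (z - \<alpha>)^3
      = (a - a') / 2 / (z - \<alpha>) + (b - b') / fact 3" if "z \<noteq> \<alpha>" for z
  proof -
    have w: "z - \<alpha> \<noteq> 0" using that by simp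
    have "\<gamma> a' b' z - \<gamma> a b z = (a - a') / 2 * (z - \<alpha>)^2 + (b - b') / fact 3 * (z - \<alpha>)^3"
    proof -
      have "(p - (c + a' / 2 * s + b' / f * t)) - (p - (c + a / 2 * s + b / f * t))
          = (a - a') / 2 * s + (b - b') / f * t" for p c s f t :: complex
        by (simp add: diff_divide_distrib left_diff_distrib)
      then show ?thesis unfolding \<gamma>_def .
    qed
    then have "(\<gamma> a' b' z - \<gamma> a b z) / (z - \<alpha>)^3
        = ((a - a') / 2 * (z - \<alpha>)^2 + (b - b') / fact 3 * (z - \<alpha>)^3) / (z - \<alpha>)^3"
      by simp
    also have "\<dots> = (a - a') / 2 / (z - \<alpha>) + (b - b') / fact 3"
      using w by (simp add: add_divide_distrib power3_eq_cube power2_eq_square)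
    finally show ?thesis by (simp add: diff_divide_distrib)
  qed
  have D': "((\<lambda>z. (a - a') / 2 / (z - \<alpha>) + (b - b') / fact 3) \<longlongrightarrow> 0) ?F"
    by (rule Lim_transform_eventually[OF D]) (use ne in eventually_elim, rule eq)
  have "((\<lambda>z. ((a - a') / 2 / (z - \<alpha>) + (b - b') / fact 3) * (z - \<alpha>)
      - (b - b') / fact 3 * (z - \<alpha>)) \<longlongrightarrow> 0 * (\<alpha> - \<alpha>) - (b - b') / fact 3 * (\<alpha> - \<alpha>)) ?F"
    by (intro tendsto_intros D')
  then have "((\<lambda>z. ((a - a') / 2 / (z - \<alpha>) + (b - b') / fact 3) * (z - \<alpha>)
      - (b - b') / fact 3 * (z - \<alpha>)) \<longlongrightarrow> 0) ?F" by simp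
  then have "((\<lambda>_. (a - a') / 2) \<longlongrightarrow> 0) ?F"
  proof (rule Lim_transform_eventually)
    have "(p / w + q) * w - q * w = p" if "w \<noteq> 0" for p q w :: complex
      using that by (simp add: distrib_right)
    then have "((a - a') / 2 / (z - \<alpha>) + (b - b') / fact 3) * (z - \<alpha>)
        - (b - b') / fact 3 * (z - \<alpha>) = (a - a') / 2" if "z \<noteq> \<alpha>" for z
      using that by (metis right_minus_eq)
    then show "\<forall>\<^sub>F z in ?F. ((a - a') / 2 / (z - \<alpha>) + (b - b') / fact 3) * (z - \<alpha>)
        - (b - b') / fact 3 * (z - \<alpha>) = (a - a') / 2"
      using ne by (rule eventually_mono[rotated])
  qed
  then have "(a - a') / 2 = 0" by (rule tendsto_unique[OF nt tendsto_const])
  then have a: "a = a'" by simp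
  have "((\<lambda>_. (b - b') / fact 3) \<longlongrightarrow> 0) ?F" using D' by (simp add: a)
  then have "(b - b') / fact 3 = 0" by (rule tendsto_unique[OF nt tendsto_const])
  then show ?thesis using a by simp
qed

lemma boundary_deriv_eq:
  assumes "\<alpha> \<in> sphere 0 1" "parabolic_expansion \<phi> \<alpha> a b"
  shows "boundary_deriv2 \<phi> \<alpha> = a" "boundary_deriv3 \<phi> \<alpha> = b"
proof -
  have *: "a' = a \<and> b' = b" if "parabolic_expansion \<phi> \<alpha> a' b'" for a' b'
    using parabolic_expansion_unique[OF assms(1) that assms(2)] .
  show "boundary_deriv2 \<phi> \<alpha> = a"
    unfolding boundary_deriv2_def
    by (rule the_equality) (use assms(2) in \<open>rule exI\<close>, use * in \<open>elim exE, simp\<close>)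
  show "boundary_deriv3 \<phi> \<alpha> = b"
    unfolding boundary_deriv3_def
    by (rule the_equality) (use assms(2) in \<open>rule exI\<close>, use * in \<open>elim exE, simp\<close>)
qed

end

theory Submission
  imports Defs
begin

text \<open>
  In the half-plane coordinate \<open>v = \<alpha> / (\<alpha> - z)\<close> a parabolic map reads
  \<open>v \<mapsto> v + p + q / v + \<dots>\<close>, with \<open>p\<close> and \<open>q\<close> determined by its second and third derivatives at
  \<open>\<alpha>\<close>, so its orbits are \<open>n p + (q / p) ln n + O(1)\<close>; a hyperbolic map reads
  \<open>v \<mapsto> L v + \<dots>\<close> with \<open>L = 1 / \<phi>'(\<alpha>)\<close>, and its orbits have size comparable to \<open>L ^ n\<close> and stay
  in a sector.  If the data differ as required, the iterated images of a compact set under the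
  two maps can meet only when \<open>\<tau> n + \<kappa> ln n - m\<close> is bounded, for some \<open>\<tau> > 0\<close> and real \<open>\<kappa>\<close> with
  \<open>(\<tau>, \<kappa>) \<noteq> (1, 0)\<close>.  Then there are sets of times \<open>A k\<close> of positive lower density, made of
  geometric blocks of arithmetic progressions, along which the images of the discs
  \<open>cball 0 (r k)\<close> are pairwise disjoint and locally finite.  A Runge argument yields a
  holomorphic function with prescribed approximate values on all of these images at once, and
  such a function is a disjointly frequently hypercyclic vector.

  Conversely, two parabolic maps with the same \<open>(p, q)\<close>, or two hyperbolic maps with the same
  \<open>L\<close>, have orbits that remain so close that \<open>\<phi>^n(z)\<close> lies in \<open>\<psi>^n(K)\<close> for one compact \<open>K\<close> and all
  \<open>n\<close>.  If \<open>\<phi>\<close> is hyperbolic and \<open>\<psi>\<close> is parabolic with \<open>Re p > 0\<close>, the orbit of \<open>\<psi>\<close> also stays in a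
  sector, and \<open>\<phi>^n(K)\<close> contains \<open>\<psi>^m(0)\<close> for all \<open>m\<close> in an interval \<open>[x, T x]\<close> with \<open>T\<close> as large as
  desired; this leaves gaps that no set of positive lower density can have.
\<close>

section \<open>Approximation on disjoint families of univalent images\<close>

text \<open>Univalence enters topologically: an iterate carries a closed disc to a homeomorphic
  copy, which does not separate the plane, and a finite disjoint union of such copies does not
  either. This makes Runge approximation available on all images together. The logarithm comes from
  summing increments \<open>p + q / v\<close> along \<open>v = n p + o(n)\<close>. It is the only
  trace left by \<open>q\<close> when \<open>p\<close> agrees, so the times must avoid collisions
  under a shift that grows more slowly than any power. On a range where \<open>n\<close> varies by a
  bounded factor this shift is constant up to O(1), hence the geometric blocks. For
  \<open>(\<tau>, \<kappa>) = (1, 0)\<close> collisions at equal times could not be avoided. If the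
  orbits approach different points, or one point in incompatible directions, all images at large
  times are disjoint and \<open>(2, 0)\<close> is taken as an admissible pair. In the converse,
  closeness of two orbits in the half-plane coordinate is not enough, since a function may vary fast
  there. An open mapping argument with constants independent of \<open>n\<close> turns it into exact
  coincidence with the orbit of another point of a fixed compact set.\<close>

definition disc_approximable :: "complex set \<Rightarrow> (complex \<Rightarrow> complex) \<Rightarrow> bool" where
  "disc_approximable Y f \<longleftrightarrow>
     (\<forall>e>0. \<exists>h. h holomorphic_on unit_disc \<and> (\<forall>z\<in>Y. cmod (h z - f z) < e))"

lemma disc_approximable_holomorphic: "h holomorphic_on unit_disc \<Longrightarrow> disc_approximable Y h"
  unfolding disc_approximable_def by (intro allI impI exI[of _ h]) auto

lemma disc_approximable_closed:
  assumes "\<And>e. e > 0 \<Longrightarrow> \<exists>g. disc_approximable Y g \<and> (\<forall>z\<in>Y. cmod (g z - f z) < e)"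
  shows "disc_approximable Y f"
  unfolding disc_approximable_def
proof (intro allI impI)
  fix e :: real assume "e > 0"
  then have e2: "e / 2 > 0" by simp
  then obtain g where g: "disc_approximable Y g" "\<forall>z\<in>Y. cmod (g z - f z) < e / 2"
    using assms by blast
  then obtain h where h: "h holomorphic_on unit_disc" "\<forall>z\<in>Y. cmod (h z - g z) < e / 2"
    using e2 unfolding disc_approximable_def by blast
  have "cmod (h z - f z) < e" if "z \<in> Y" for z
    using g(2) h(2) that norm_triangle_ineq[of "h z - g z" "g z - f z"] by fastforce
  then show "\<exists>h. h holomorphic_on unit_disc \<and> (\<forall>z\<in>Y. cmod (h z - f z) < e)" using h(1) by blast
qed

lemma disc_approximable_add:
  assumes "disc_approximable Y f" "disc_approximable Y g"
  shows "disc_approximable Y (\<lambda>z. f z + g z)"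
  unfolding disc_approximable_def
proof (intro allI impI)
  fix e :: real assume "e > 0"
  then have e2: "e / 2 > 0" by simp
  obtain h where h: "h holomorphic_on unit_disc" "\<forall>z\<in>Y. cmod (h z - f z) < e / 2"
    using e2 assms(1) unfolding disc_approximable_def by blast
  obtain k where k: "k holomorphic_on unit_disc" "\<forall>z\<in>Y. cmod (k z - g z) < e / 2"
    using e2 assms(2) unfolding disc_approximable_def by blast
  have "cmod (h z + k z - (f z + g z)) < e" if "z \<in> Y" for z
  proof -
    have "cmod (h z + k z - (f z + g z)) = cmod ((h z - f z) + (k z - g z))" by (simp add: algebra_simps)
    moreover have "cmod (h z - f z) < e / 2" "cmod (k z - g z) < e / 2" using h(2) k(2) that by auto
    ultimately show ?thesis
      using norm_triangle_ineq[of "h z - f z" "k z - g z"] by linarith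
  qed
  then show "\<exists>h. h holomorphic_on unit_disc \<and> (\<forall>z\<in>Y. cmod (h z - (f z + g z)) < e)"
    using holomorphic_on_add[OF h(1) k(1)] by (intro exI[of _ "\<lambda>z. h z + k z"]) auto
qed

lemma disc_approximable_mult:
  assumes "disc_approximable Y f" "disc_approximable Y g"
    and bf: "\<And>z. z \<in> Y \<Longrightarrow> cmod (f z) \<le> B" and bg: "\<And>z. z \<in> Y \<Longrightarrow> cmod (g z) \<le> B"
  shows "disc_approximable Y (\<lambda>z. f z * g z)"
  unfolding disc_approximable_def
proof (intro allI impI)
  fix e :: real assume e: "e > 0"
  define M where "M = max B 0 + 1"
  \<comment> \<open>If both errors are below \<open>d \<le> 1\<close>, the approximant of
    \<open>g\<close> is bounded by \<open>M + 1\<close> and the product has error below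
    \<open>d * (M + 1) + M * d\<close>.\<close>
  define d where "d = min 1 (e / (2 * M + 1))"
  have M: "M > 0" by (auto simp: M_def)
  have "d \<le> e / (2 * M + 1)" by (simp add: d_def)
  then have "d * (2 * M + 1) \<le> e" using M by (subst (asm) pos_le_divide_eq) auto
  then have d: "d > 0" "d \<le> 1" "d * (2 * M + 1) \<le> e" using e M by (auto simp: d_def)
  obtain h where h: "h holomorphic_on unit_disc" "\<forall>z\<in>Y. cmod (h z - f z) < d"
    using d(1) assms(1) unfolding disc_approximable_def by blast
  obtain k where k: "k holomorphic_on unit_disc" "\<forall>z\<in>Y. cmod (k z - g z) < d"
    using d(1) assms(2) unfolding disc_approximable_def by blast
  have "cmod (h z * k z - f z * g z) < e" if z: "z \<in> Y" for z
  proof -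
    have hf: "cmod (h z - f z) < d" and kg: "cmod (k z - g z) < d" using h(2) k(2) z by auto
    have gM: "cmod (g z) \<le> M" and fM: "cmod (f z) \<le> M" using bf[OF z] bg[OF z] by (auto simp: M_def)
    have kM: "cmod (k z) \<le> M + 1" using norm_triangle_ineq[of "k z - g z" "g z"] kg gM d(2) by simp
    have "h z * k z - f z * g z = (h z - f z) * k z + f z * (k z - g z)" by (simp add: algebra_simps)
    then have "cmod (h z * k z - f z * g z) \<le> cmod (h z - f z) * cmod (k z) + cmod (f z) * cmod (k z - g z)"
      by (metis norm_mult norm_triangle_ineq)
    also have "\<dots> \<le> cmod (h z - f z) * (M + 1) + M * cmod (k z - g z)"
      using kM fM by (intro add_mono mult_left_mono mult_right_mono) auto
    also have "\<dots> < d * (M + 1) + M * d"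
      using hf kg M by (intro add_strict_mono mult_strict_right_mono mult_strict_left_mono) auto
    also have "\<dots> \<le> e" using d(3) by (simp add: algebra_simps)
    finally show ?thesis .
  qed
  then show "\<exists>h. h holomorphic_on unit_disc \<and> (\<forall>z\<in>Y. cmod (h z - f z * g z) < e)"
    using holomorphic_on_mult[OF h(1) k(1)] by (intro exI[of _ "\<lambda>z. h z * k z"]) auto
qed

lemma disc_approximable_cmult:
  assumes "disc_approximable Y f"
  shows "disc_approximable Y (\<lambda>z. c * f z)"
  unfolding disc_approximable_def
proof (intro allI impI)
  fix e :: real assume e: "e > 0"
  define d where "d = e / (cmod c + 1)"
  have n: "cmod c + 1 > 0" using norm_ge_zero[of c] by linarith
  then have d: "d > 0" using e by (simp add: d_def)
  obtain h where h: "h holomorphic_on unit_disc" "\<forall>z\<in>Y. cmod (h z - f z) < d"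
    using d(1) assms(1) unfolding disc_approximable_def by blast
  have "cmod (c * h z - c * f z) < e" if z: "z \<in> Y" for z
  proof -
    have "cmod (c * h z - c * f z) = cmod c * cmod (h z - f z)"
      by (metis norm_mult right_diff_distrib)
    also have "\<dots> \<le> cmod c * d" using h(2) z by (intro mult_left_mono) auto
    also have "\<dots> < (cmod c + 1) * d" using d by simp
    also have "\<dots> = e" using n by (simp add: d_def)
    finally show ?thesis .
  qed
  then show "\<exists>h. h holomorphic_on unit_disc \<and> (\<forall>z\<in>Y. cmod (h z - c * f z) < e)"
    using h(1) by (intro exI[of _ "\<lambda>z. c * h z"]) (auto intro!: holomorphic_intros)
qed

lemma disc_approximable_sum:
  "(\<And>i. i \<in> I \<Longrightarrow> disc_approximable Y (f i)) \<Longrightarrow> disc_approximable Y (\<lambda>z. \<Sum>i\<in>I. f i z)"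
proof (induction I rule: infinite_finite_induct)
  case (insert x F)
  then show ?case using disc_approximable_add[of Y "f x" "\<lambda>z. \<Sum>i\<in>F. f i z"] by simp
qed (auto intro!: disc_approximable_holomorphic holomorphic_intros)

lemma disc_approximable_power:
  assumes "disc_approximable Y f" and bf: "\<And>z. z \<in> Y \<Longrightarrow> cmod (f z) \<le> B"
  shows "disc_approximable Y (\<lambda>z. f z ^ n)"
proof (induction n)
  case 0
  then show ?case by (auto intro!: disc_approximable_holomorphic holomorphic_intros)
next
  case (Suc n)
  define M where "M = max (max B 0) (max B 0 ^ n)"
  have "disc_approximable Y (\<lambda>z. f z * f z ^ n)"
  proof (rule disc_approximable_mult[OF assms(1) Suc])
    fix z assume z: "z \<in> Y"
    show "cmod (f z) \<le> M" using bf[OF z] by (auto simp: M_def)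
    have "cmod (f z) ^ n \<le> max B 0 ^ n" using bf[OF z] by (intro power_mono) auto
    then show "cmod (f z ^ n) \<le> M" by (auto simp: M_def norm_power)
  qed
  then show ?case by simp
qed

section \<open>Pushing poles, and integrals of Cauchy kernels\<close>

lemma disc_approximable_move_pole:
  assumes p: "disc_approximable Y (\<lambda>z. 1 / (p - z))"
    and d: "d > 0" "\<And>z. z \<in> Y \<Longrightarrow> d \<le> cmod (p - z)"
    and k: "\<kappa> < 1" "\<And>z. z \<in> Y \<Longrightarrow> cmod (p - q) \<le> \<kappa> * cmod (p - z)"
  shows "disc_approximable Y (\<lambda>z. 1 / (q - z))"
proof (cases "Y = {}")
  case True then show ?thesis unfolding disc_approximable_def by (auto intro!: exI[of _ "\<lambda>_. 0"])
next
  case False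
  then obtain z0 where "z0 \<in> Y" by auto
  have k0: "\<kappa> \<ge> 0"
  proof (rule ccontr)
    assume "\<not> \<kappa> \<ge> 0"
    then have "\<kappa> * cmod (p - z0) < 0" using d(1) d(2)[OF \<open>z0 \<in> Y\<close>] by (intro mult_neg_pos) auto
    then show False using k(2)[OF \<open>z0 \<in> Y\<close>] norm_ge_zero[of "p - q"] by linarith
  qed
  show ?thesis
  proof (rule disc_approximable_closed)
    fix e :: real assume e: "e > 0"
    have "(\<lambda>n. \<kappa> ^ n / ((1 - \<kappa>) * d)) \<longlonglongrightarrow> 0 / ((1 - \<kappa>) * d)"
      using k0 k(1) d(1) by (intro tendsto_divide LIMSEQ_power_zero tendsto_const) auto
    then have "\<forall>\<^sub>F n in sequentially. \<kappa> ^ n / ((1 - \<kappa>) * d) < e"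
      using e by (auto dest: order_tendstoD)
    then obtain n where n: "\<kappa> ^ n / ((1 - \<kappa>) * d) < e" by (auto simp: eventually_sequentially)
    \<comment> \<open>A partial sum of the geometric series for \<open>1 / (q - z)\<close> with
      ratio \<open>(p - q) / (p - z)\<close>; the ratio is at most \<open>\<kappa>\<close> in
      modulus, and the tail at most \<open>\<kappa> ^ n / ((1 - \<kappa>) * d)\<close> on
      \<open>Y\<close>.\<close>
    define g where "g z = (\<Sum>i<n. (p - q) ^ i * ((1 / (p - z)) ^ Suc i))" for z
    have "disc_approximable Y g"
      unfolding g_def
    proof (intro disc_approximable_sum disc_approximable_cmult disc_approximable_power[OF p, of "1 / d"])
      fix z assume "z \<in> Y"
      then show "cmod (1 / (p - z)) \<le> 1 / d" using d(1) d(2)[of z] by (simp add: norm_divide frac_le)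
    qed
    moreover have "cmod (g z - 1 / (q - z)) < e" if z: "z \<in> Y" for z
    proof -
      have pz: "cmod (p - z) > 0" using d(1) d(2)[OF z] by linarith
      have "cmod (p - z) \<le> cmod (p - q) + cmod (q - z)"
        using norm_triangle_ineq[of "p - q" "q - z"] by simp
      then have "(1 - \<kappa>) * cmod (p - z) \<le> cmod (q - z)" using k(2)[OF z] by (simp add: algebra_simps)
      moreover have "(1 - \<kappa>) * d \<le> (1 - \<kappa>) * cmod (p - z)" using d(2)[OF z] k(1) by simp
      ultimately have qz: "(1 - \<kappa>) * d \<le> cmod (q - z)" by linarith
      have pos: "0 < (1 - \<kappa>) * d" using d(1) k(1) by simp
      have nz: "p - z \<noteq> 0" "q - z \<noteq> 0" using pz qz pos by auto
      define x where "x = (p - q) / (p - z)"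
      have x: "cmod x \<le> \<kappa>" using k(2)[OF z] pz by (simp add: x_def norm_divide divide_le_eq)
      have x1: "1 - x = (q - z) / (p - z)" using nz by (simp add: x_def field_simps)
      have "g z = (\<Sum>i<n. x ^ i) * (1 / (p - z))"
        unfolding g_def x_def sum_distrib_right by (intro sum.cong) (auto simp: power_divide)
      also have "(\<Sum>i<n. x ^ i) = (1 - x ^ n) / (1 - x)"
        using nz x1 by (subst sum_gp_strict) auto
      finally have "g z = (1 - x ^ n) / (q - z)" using nz x1 by simp
      then have "g z - 1 / (q - z) = - (x ^ n) / (q - z)" by (simp add: diff_divide_distrib)
      then have "cmod (g z - 1 / (q - z)) = cmod x ^ n / cmod (q - z)"
        by (simp add: norm_divide norm_power)
      also have "\<dots> \<le> \<kappa> ^ n / ((1 - \<kappa>) * d)"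
        using x qz pos k0 by (intro frac_le power_mono) auto
      finally show ?thesis using n by simp
    qed
    ultimately show "\<exists>g. disc_approximable Y g \<and> (\<forall>z\<in>Y. cmod (g z - 1 / (q - z)) < e)" by blast
  qed
qed

text \<open>Approximability of the kernel is a locally constant property of the pole on the
  connected set \<open>- Y\<close>, and for the pole 2, outside the closed disc, the kernel is
  itself holomorphic on the disc.\<close>

lemma disc_approximable_pole:
  assumes Y: "compact Y" "Y \<subseteq> unit_disc" "connected (- Y)" and p: "p \<notin> Y"
  shows "disc_approximable Y (\<lambda>z. 1 / (p - z))"
proof -
  define S where "S q \<longleftrightarrow> disc_approximable Y (\<lambda>z. 1 / (q - z))" for q
  have "S p = S 2"
  proof (rule connected_local_const[OF Y(3)])
    show "p \<in> - Y" using p by simp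
    show "(2::complex) \<in> - Y" using Y(2) by auto
    show "\<forall>a\<in>- Y. \<forall>\<^sub>F b in at a within - Y. S a = S b"
    proof
      fix a assume a: "a \<in> - Y"
      have "open (- Y)" using Y(1) by (simp add: compact_imp_closed open_Compl)
      then obtain d where d: "d > 0" "ball a d \<subseteq> - Y" using a open_contains_ball by blast
      have dY: "d \<le> cmod (a - z)" if "z \<in> Y" for z using d(2) that by (force simp: dist_norm)
      have "S a = S b" if b: "dist b a < d / 4" for b
      proof -
        have ab: "cmod (a - b) < d / 4" using b by (simp add: dist_norm norm_minus_commute)
        \<comment> \<open>Within \<open>d / 4\<close> of \<open>a\<close> the distance to
          \<open>Y\<close> stays at least \<open>3/4 * d\<close>, so each of the two poles can be
          expanded about the other. Both directions are needed because \<open>S a = S b\<close> is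
          an equivalence.\<close>
        have bz: "3/4 * d \<le> cmod (b - z)" if "z \<in> Y" for z
          using dY[OF that] norm_triangle_ineq[of "a - b" "b - z"] ab by simp
        show ?thesis unfolding S_def
        proof
          assume "disc_approximable Y (\<lambda>z. 1 / (a - z))"
          then show "disc_approximable Y (\<lambda>z. 1 / (b - z))"
            by (rule disc_approximable_move_pole[of _ _ d "1/2"]) (use d dY ab in \<open>force+\<close>)
        next
          assume "disc_approximable Y (\<lambda>z. 1 / (b - z))"
          then show "disc_approximable Y (\<lambda>z. 1 / (a - z))"
          proof (rule disc_approximable_move_pole[of _ _ "3/4*d" "1/2"])
            fix z assume "z \<in> Y"
            then show "cmod (b - a) \<le> 1 / 2 * cmod (b - z)"
              using bz[of z] ab d(1) unfolding norm_minus_commute[of b a] by linarith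
          qed (use d bz in auto)
        qed
      qed
      then show "\<forall>\<^sub>F b in at a within - Y. S a = S b"
        using d(1) unfolding eventually_at by (intro exI[of _ "d/4"]) auto
    qed
  qed
  moreover have "S 2" unfolding S_def
    by (intro disc_approximable_holomorphic holomorphic_intros) auto
  ultimately show ?thesis unfolding S_def by simp
qed

text \<open>Riemann sums are finite linear combinations of the functions \<open>G t\<close>, and
  uniform continuity on the compact product makes them converge uniformly in
  \<open>z\<close>.\<close>

lemma disc_approximable_integral:
  assumes cont: "continuous_on ({0..1} \<times> Y) (\<lambda>(t, z). G t z)" and Y: "compact Y"
    and G: "\<And>t. t \<in> {0..1} \<Longrightarrow> disc_approximable Y (G t)"
  shows "disc_approximable Y (\<lambda>z. integral {0..1::real} (\<lambda>t. G t z))"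
proof (rule disc_approximable_closed)
  fix e :: real assume e: "e > 0"
  have "uniformly_continuous_on ({0..1} \<times> Y) (\<lambda>(t, z). G t z)"
    by (intro compact_uniformly_continuous cont compact_Times Y compact_Icc)
  then obtain d where d: "d > 0"
    "\<And>x x'. x \<in> {0..1} \<times> Y \<Longrightarrow> x' \<in> {0..1} \<times> Y \<Longrightarrow> dist x' x < d \<Longrightarrow>
       dist (case x' of (t, z) \<Rightarrow> G t z) (case x of (t, z) \<Rightarrow> G t z) < e / 2"
    unfolding uniformly_continuous_on_def using e by (metis half_gt_zero)
  obtain n where n: "n > 0" "1 / real n < d" using nat_approx_posE[OF d(1)] by (metis zero_less_Suc)
  define g where "g z = (\<Sum>i<n. of_real (1 / real n) * G (real i / n) z)" for z
  have "disc_approximable Y g" unfolding g_def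
    by (intro disc_approximable_sum disc_approximable_cmult G) (use n in auto)
  moreover have "cmod (g z - integral {0..1} (\<lambda>t. G t z)) < e" if z: "z \<in> Y" for z
  proof -
    have cz: "continuous_on {0..1} (\<lambda>t. G t z)"
      using continuous_on_compose2[OF cont, of "{0..1}" "\<lambda>t. (t, z)"] z
      by (force intro!: continuous_intros)
    \<comment> \<open>Each subinterval of length \<open>1 / n\<close> adds an error of at most
      \<open>e / 2 / n\<close>, so the first \<open>k\<close> of them are handled by
      induction.\<close>
    have "cmod (integral {0..real k / n} (\<lambda>t. G t z) - (\<Sum>i<k. of_real (1 / real n) * G (real i / n) z))
            \<le> real k / n * (e / 2)" if "k \<le> n" for k
      using that
    proof (induction k)
      case (Suc k)
      have k: "0 \<le> real k / n" "real k / n \<le> real (Suc k) / n" "real (Suc k) / n \<le> 1" "real (Suc k) / n - real k / n = 1 / n"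
        using Suc.prems n by (auto simp: field_simps)
      have sub: "{0..real (Suc k) / n} \<subseteq> {0..1}" "{real k / n..real (Suc k) / n} \<subseteq> {0..1}"
        using k(1-3) unfolding atLeastatMost_subset_iff by linarith+
      have c1: "continuous_on {0..real (Suc k) / n} (\<lambda>t. G t z)"
        by (rule continuous_on_subset[OF cz sub(1)])
      have c2: "continuous_on {real k / n..real (Suc k) / n} (\<lambda>t. G t z)"
        by (rule continuous_on_subset[OF cz sub(2)])
      have e1: "integral {0..real k / n} (\<lambda>t. G t z) + integral {real k / n..real (Suc k) / n} (\<lambda>t. G t z)
            = integral {0..real (Suc k) / n} (\<lambda>t. G t z)"
        using k n by (intro Henstock_Kurzweil_Integration.integral_combine integrable_continuous_real c1) auto
      have e2: "cmod (integral {real k / n..real (Suc k) / n} (\<lambda>t. G t z - G (real k / n) z)) \<le> e / 2 * (real (Suc k) / n - real k / n)"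
      proof (rule integral_bound)
        fix t assume t: "t \<in> {real k / n..real (Suc k) / n}"
        then have t1: "t \<in> {0..1}" using t k(1-3) unfolding atLeastAtMost_iff by (intro conjI; linarith)
        have k1: "real k / n \<in> {0..1}" using t k(1-3) unfolding atLeastAtMost_iff by (intro conjI; linarith)
        have "dist t (real k / n) < d" using t k n(2) by (auto simp: dist_real_def)
        then have "dist (t, z) (real k / n, z) < d" by (simp add: dist_Pair_Pair)
        from d(2)[OF _ _ this] show "cmod (G t z - G (real k / n) z) \<le> e / 2"
          using t1 k1 z by (simp add: dist_norm)
      qed (use k c2 in \<open>auto intro!: continuous_intros\<close>)
      have e3: "integral {real k / n..real (Suc k) / n} (\<lambda>t. G t z - G (real k / n) z)
          = integral {real k / n..real (Suc k) / n} (\<lambda>t. G t z) - of_real (1 / n) * G (real k / n) z"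
        using k(2,4)
        by (subst Henstock_Kurzweil_Integration.integral_diff[OF integrable_continuous_real[OF c2] integrable_const_ivl])
          (simp add: scaleR_conv_of_real del: of_nat_Suc)
      have "integral {0..real (Suc k) / n} (\<lambda>t. G t z) - (\<Sum>i<Suc k. of_real (1 / real n) * G (real i / n) z)
          = (integral {0..real k / n} (\<lambda>t. G t z) - (\<Sum>i<k. of_real (1 / real n) * G (real i / n) z))
            + integral {real k / n..real (Suc k) / n} (\<lambda>t. G t z - G (real k / n) z)"
        unfolding e3 e1[symmetric] by simp
      moreover have "cmod \<dots> \<le> real k / n * (e/2) + e / 2 * (real (Suc k) / n - real k / n)"
        using Suc.prems by (intro norm_triangle_mono Suc.IH e2) simp
      ultimately have "cmod (integral {0..real (Suc k) / n} (\<lambda>t. G t z) - (\<Sum>i<Suc k. of_real (1 / real n) * G (real i / n) z))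
          \<le> real k / n * (e/2) + e / 2 * (real (Suc k) / n - real k / n)" by (simp only:)
      also have "\<dots> = real (Suc k) / n * (e / 2)" by (simp add: algebra_simps)
      finally show ?case .
    qed auto
    from this[of n] have "cmod (integral {0..1} (\<lambda>t. G t z) - g z) \<le> e / 2"
      using n by (simp add: g_def)
    then show ?thesis using e by (simp add: norm_minus_commute)
  qed
  ultimately show "\<exists>g. disc_approximable Y g \<and> (\<forall>z\<in>Y. cmod (g z - integral {0..1} (\<lambda>t. G t z)) < e)"
    by blast
qed

section \<open>Cauchy's formula on univalent images of discs\<close>

lemma unit_disc_radius: "cball 0 r \<subseteq> unit_disc \<longleftrightarrow> r < 1" for r :: real
proof
  assume "cball 0 r \<subseteq> unit_disc"
  moreover have "complex_of_real r \<in> cball 0 r" if "r \<ge> 1" using that by simp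
  ultimately have "complex_of_real r \<in> unit_disc" if "r \<ge> 1" using that by blast
  then show "r < 1" by fastforce
qed auto

text \<open>Injectivity makes \<open>F\<close> a homeomorphism from the compact disc to its image,
  and a planar compact set homeomorphic to a convex one does not separate the plane.\<close>

lemma compact_univalent_image:
  assumes "univalent_self_map F" "r < 1"
  shows "compact (F ` cball 0 r)" "F ` cball 0 r \<subseteq> unit_disc" "connected (- (F ` cball 0 r))"
    "connected (F ` cball 0 r)"
proof -
  have sub: "cball 0 r \<subseteq> unit_disc" using assms(2) by (simp add: unit_disc_radius)
  have F: "F holomorphic_on unit_disc" "F ` unit_disc \<subseteq> unit_disc" "inj_on F unit_disc"
    using assms(1) by (auto simp: univalent_self_map_def)
  have cont: "continuous_on (cball 0 r) F"
    using F(1) sub holomorphic_on_imp_continuous_on continuous_on_subset by blast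
  show "compact (F ` cball 0 r)" by (intro compact_continuous_image cont compact_cball)
  show "F ` cball 0 r \<subseteq> unit_disc" using F(2) sub by blast
  show "connected (F ` cball 0 r)" by (intro connected_continuous_image cont connected_cball)
  have "cball (0::complex) r homeomorphic F ` cball 0 r"
    using cont inj_on_subset[OF F(3) sub] by (intro homeomorphic_compact[OF compact_cball _ refl]) auto
  then show "connected (- (F ` cball 0 r))"
    using connected_complement_homeomorphic_convex_compact[OF _ convex_cball compact_cball]
    by (metis DIM_complex homeomorphic_sym order_refl)
qed

text \<open>Cauchy's formula after the substitution \<open>z = F u\<close>: the integral represents
  \<open>P\<close> composed with the inverse of \<open>F\<close>. The parametrisation has derivative
  \<open>2 * pi * i * \<zeta>\<close>, whence the factor \<open>\<zeta> t\<close> in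
  \<open>G\<close> and the absence of \<open>1 / (2 * pi * i)\<close>.\<close>

lemma circle_integral_univalent:
  assumes F: "univalent_self_map F" and P: "P holomorphic_on unit_disc" and s: "0 < s" "s < 1"
  defines "\<zeta> \<equiv> circlepath 0 s"
  defines "G \<equiv> \<lambda>t z. P (\<zeta> t) * deriv F (\<zeta> t) * \<zeta> t / (F (\<zeta> t) - z)"
  shows "u \<in> ball 0 s \<Longrightarrow> integral {0..1} (\<lambda>t. G t (F u)) = P u"
    and "z \<notin> F ` cball 0 s \<Longrightarrow> integral {0..1} (\<lambda>t. G t z) = 0"
proof -
  have sub: "cball 0 s \<subseteq> unit_disc" using s(2) by (simp add: unit_disc_radius)
  have hF: "F holomorphic_on unit_disc" and inj: "inj_on F unit_disc"
    using F by (auto simp: univalent_self_map_def)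
  have dF: "deriv F holomorphic_on unit_disc" by (intro holomorphic_deriv hF open_ball)
  have circ: "\<zeta> t \<in> sphere 0 s" if "t \<in> {0..1}" for t
    using that s(1) by (simp add: \<zeta>_def circlepath norm_mult)
  have conv: "integral {0..1} (\<lambda>t. f (\<zeta> t) * \<zeta> t) = I"
    if "(f has_contour_integral 2 * of_real pi * \<i> * I) (circlepath 0 s)" for f I
  proof -
    have "((\<lambda>t. f (\<zeta> t) * vector_derivative \<zeta> (at t within {0..1})) has_integral 2 * of_real pi * \<i> * I) {0..1}"
      using that unfolding has_contour_integral_def \<zeta>_def .
    then have "((\<lambda>t. 2 * of_real pi * \<i> * (f (\<zeta> t) * \<zeta> t)) has_integral 2 * of_real pi * \<i> * I) {0..1}"
    proof (rule has_integral_eq[rotated])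
      fix t :: real assume "t \<in> {0..1}"
      then have "vector_derivative \<zeta> (at t within {0..1}) = 2 * of_real pi * \<i> * \<zeta> t"
        using vector_derivative_circlepath01[of t 0 s] by (simp add: \<zeta>_def circlepath)
      then show "f (\<zeta> t) * vector_derivative \<zeta> (at t within {0..1})
          = 2 * of_real pi * \<i> * (f (\<zeta> t) * \<zeta> t)" by simp
    qed
    from has_integral_mult_right[OF this, of "1 / (2 * of_real pi * \<i>)"]
    have "((\<lambda>t. f (\<zeta> t) * \<zeta> t) has_integral I) {0..1}" by (simp add: field_simps)
    then show ?thesis by (rule integral_unique)
  qed
  {
    assume z: "z \<notin> F ` cball 0 s"
    have "((\<lambda>w. P w * deriv F w / (F w - z)) has_contour_integral 0) (circlepath 0 s)"
    proof (rule Cauchy_theorem_convex_simple)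
      show "(\<lambda>w. P w * deriv F w / (F w - z)) holomorphic_on cball 0 s"
        using z sub by (intro holomorphic_intros holomorphic_on_subset[OF P] holomorphic_on_subset[OF hF]
            holomorphic_on_subset[OF dF]) auto
    qed (use s in auto)
    from conv[of _ 0, simplified, OF this]
    show "integral {0..1} (\<lambda>t. G t z) = 0" by (simp add: G_def)
  next
    assume u: "u \<in> ball 0 s"
    then have uD: "u \<in> unit_disc" using s(2) by auto
    \<comment> \<open>The divided difference of \<open>F\<close> at \<open>u\<close> has no zeros
      because \<open>F\<close> is injective, with \<open>deriv F u \<noteq> 0\<close> at
      \<open>u\<close>. It turns the kernel \<open>deriv F w / (F w - F u)\<close> into
      \<open>1 / (w - u)\<close> times a holomorphic factor that equals 1 at
      \<open>u\<close>.\<close>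
    define K where "K w = (if w = u then deriv F u else (F w - F u) / (w - u))" for w
    have K: "K holomorphic_on unit_disc" unfolding K_def by (rule pole_lemma_open[OF hF open_ball])
    have K0: "K w \<noteq> 0" if "w \<in> unit_disc" for w
      using holomorphic_injective_imp_regular[OF hF open_ball inj uD] inj_onD[OF inj _ that uD]
      by (auto simp: K_def)
    have "((\<lambda>w. (P w * deriv F w / K w) / (w - u)) has_contour_integral
             2 * of_real pi * \<i> * (P u * deriv F u / K u)) (circlepath 0 s)"
    proof (rule Cauchy_integral_circlepath_simple)
      show "(\<lambda>w. P w * deriv F w / K w) holomorphic_on cball 0 s"
        using K0 sub by (intro holomorphic_intros holomorphic_on_subset[OF P] holomorphic_on_subset[OF K]
            holomorphic_on_subset[OF dF]) auto
    qed (use u in auto)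
    from conv[OF this]
    have "integral {0..1} (\<lambda>t. (P (\<zeta> t) * deriv F (\<zeta> t) / K (\<zeta> t)) / (\<zeta> t - u) * \<zeta> t) = P u"
      using K0[OF uD] by (simp add: K_def)
    also have "integral {0..1} (\<lambda>t. (P (\<zeta> t) * deriv F (\<zeta> t) / K (\<zeta> t)) / (\<zeta> t - u) * \<zeta> t)
        = integral {0..1} (\<lambda>t. G t (F u))"
    proof (rule Henstock_Kurzweil_Integration.integral_cong)
      fix t :: real assume "t \<in> {0..1}"
      then have "\<zeta> t \<noteq> u" using circ[of t] u by auto
      then show "P (\<zeta> t) * deriv F (\<zeta> t) / K (\<zeta> t) / (\<zeta> t - u) * \<zeta> t = G t (F u)"
        by (simp add: G_def K_def)
    qed
    finally show "integral {0..1} (\<lambda>t. G t (F u)) = P u" .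
  }
qed

text \<open>Room for a contour between the image and \<open>X\<close>. By compactness the points of
  a larger closed disc that are mapped into \<open>X\<close> have a least modulus, and this exceeds
  \<open>r\<close>.\<close>

lemma larger_radius_disjoint:
  assumes F: "univalent_self_map F" and r: "0 \<le> r" "r < 1" and X: "closed X" "F ` cball 0 r \<inter> X = {}"
  obtains s where "r < s" "s < 1" "F ` cball 0 s \<inter> X = {}"
proof -
  define m where "m = (1 + r) / 2"
  have m: "r < m" "m < 1" using r by (auto simp: m_def)
  have cont: "continuous_on (cball 0 m) F"
    using F unit_disc_radius[of m] m(2)
    by (auto simp: univalent_self_map_def intro: continuous_on_subset[OF holomorphic_on_imp_continuous_on])
  define C where "C = cball 0 m \<inter> F -` X"
  have C: "compact C"
    unfolding C_def using continuous_closed_preimage[OF cont closed_cball X(1)] compact_cball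
    by (metis bounded_Int bounded_cball compact_eq_bounded_closed)
  show ?thesis
  proof (cases "C = {}")
    case True
    then have "F ` cball 0 m \<inter> X = {}" by (auto simp: C_def)
    then show ?thesis using that m by blast
  next
    case False
    obtain c where c: "c \<in> C" "\<And>x. x \<in> C \<Longrightarrow> cmod c \<le> cmod x"
      using continuous_attains_inf[OF C False continuous_on_norm_id] by auto
    have "cmod c > r" using c(1) X(2) by (force simp: C_def)
    moreover have "cmod c \<le> m" using c(1) by (auto simp: C_def)
    moreover have "F ` cball 0 ((r + cmod c) / 2) \<inter> X = {}"
    proof (rule ccontr)
      assume "F ` cball 0 ((r + cmod c) / 2) \<inter> X \<noteq> {}"
      then obtain x where x: "cmod x \<le> (r + cmod c) / 2" "F x \<in> X" by auto
      then have "x \<in> C" using \<open>cmod c \<le> m\<close> m by (auto simp: C_def)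
      then show False using c(2)[of x] x(1) \<open>cmod c > r\<close> by simp
    qed
    ultimately show ?thesis using that[of "(r + cmod c) / 2"] m by auto
  qed
qed

text \<open>The contour integral over the circle of radius \<open>s\<close> vanishes on
  \<open>X\<close> and gives \<open>P u\<close> at \<open>F u\<close>. Its kernels have their poles
  on the image of the circle, hence off the nonseparating set \<open>Y\<close>, so the integral is
  approximable on \<open>X\<close> and the image at once.\<close>

lemma approximate_on_univalent_image:
  assumes F: "univalent_self_map F" and P: "P holomorphic_on unit_disc" and r: "0 \<le> r" "r < 1"
    and X: "compact X" "X \<subseteq> unit_disc" "F ` cball 0 r \<inter> X = {}" "connected (- (X \<union> F ` cball 0 r))"
    and e: "e > 0"
  obtains h where "h holomorphic_on unit_disc" "\<And>z. z \<in> X \<Longrightarrow> cmod (h z) < e"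
    "\<And>u. u \<in> cball 0 r \<Longrightarrow> cmod (h (F u) - P u) < e"
proof -
  obtain s where s: "r < s" "s < 1" "F ` cball 0 s \<inter> X = {}"
    using larger_radius_disjoint[OF F r compact_imp_closed[OF X(1)] X(3)] .
  define Y where "Y = X \<union> F ` cball 0 r"
  define \<zeta> where "\<zeta> = circlepath 0 s"
  define G where "G = (\<lambda>t z. P (\<zeta> t) * deriv F (\<zeta> t) * \<zeta> t / (F (\<zeta> t) - z))"
  have Y: "compact Y" "Y \<subseteq> unit_disc" "connected (- Y)"
    using X compact_univalent_image[OF F r(2)] by (auto simp: Y_def)
  have s0: "s > 0" using r s by simp
  have sub: "cball 0 s \<subseteq> unit_disc" using s(2) by (simp add: unit_disc_radius)
  have hF: "F holomorphic_on unit_disc" and inj: "inj_on F unit_disc"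
    using F by (auto simp: univalent_self_map_def)
  have dF: "deriv F holomorphic_on unit_disc" by (intro holomorphic_deriv hF open_ball)
  have circ: "cmod (\<zeta> t) = s" for t
    using s0 by (simp add: \<zeta>_def circlepath norm_mult)
  then have zD: "\<zeta> t \<in> unit_disc" for t using s(2) by auto
  have off: "F (\<zeta> t) \<notin> Y" for t
  proof
    assume "F (\<zeta> t) \<in> Y"
    then consider "F (\<zeta> t) \<in> X" | u where "u \<in> cball 0 r" "F (\<zeta> t) = F u" by (auto simp: Y_def)
    then show False
    proof cases
      case 1 then show False using s(3) circ[of t] by fastforce
    next
      case 2
      then have "u \<in> unit_disc" using s by auto
      then have "\<zeta> t = u" using inj_onD[OF inj 2(2) zD] by blast
      then show False using 2(1) circ[of t] s(1) by auto
    qed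
  qed
  have "disc_approximable Y (\<lambda>z. integral {0..1} (\<lambda>t. G t z))"
  proof (rule disc_approximable_integral[OF _ Y(1)])
    have c: "continuous_on ({0..1::real} \<times> Y) (\<lambda>x. f (\<zeta> (fst x)))" if "f holomorphic_on unit_disc" for f
    proof (rule continuous_on_compose2[OF holomorphic_on_imp_continuous_on[OF that]])
      show "continuous_on ({0..1::real} \<times> Y) (\<lambda>x. \<zeta> (fst x))"
        unfolding \<zeta>_def circlepath by (intro continuous_intros)
    qed (use zD in auto)
    have "F (\<zeta> (fst x)) - snd x \<noteq> 0" if "x \<in> {0..1::real} \<times> Y" for x
      using off[of "fst x"] that by auto
    then show "continuous_on ({0..1} \<times> Y) (\<lambda>(t, z). G t z)"
      unfolding G_def case_prod_beta
      by (intro continuous_on_divide continuous_on_mult continuous_on_diff c[OF P] c[OF dF] c[OF hF]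
          c[OF holomorphic_on_ident] continuous_on_snd continuous_on_id) auto
    fix t :: real
    have "disc_approximable Y (\<lambda>z. P (\<zeta> t) * deriv F (\<zeta> t) * \<zeta> t * (1 / (F (\<zeta> t) - z)))"
      by (intro disc_approximable_cmult disc_approximable_pole Y off)
    then show "disc_approximable Y (G t)" by (simp add: G_def)
  qed
  then obtain h where h: "h holomorphic_on unit_disc"
      "\<And>z. z \<in> Y \<Longrightarrow> cmod (h z - integral {0..1} (\<lambda>t. G t z)) < e"
    using e unfolding disc_approximable_def by blast
  show ?thesis
  proof (rule that[OF h(1)])
    fix z assume z: "z \<in> X"
    then have "integral {0..1} (\<lambda>t. G t z) = 0"
      unfolding G_def \<zeta>_def using s(3) by (intro circle_integral_univalent(2)[OF F P s0 s(2)]) auto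
    then show "cmod (h z) < e" using h(2)[of z] z by (simp add: Y_def)
  next
    fix u :: complex assume u: "u \<in> cball 0 r"
    then have "integral {0..1} (\<lambda>t. G t (F u)) = P u"
      unfolding G_def \<zeta>_def using s(1) by (intro circle_integral_univalent(1)[OF F P s0 s(2)]) auto
    then show "cmod (h (F u) - P u) < e" using h(2)[of "F u"] u by (simp add: Y_def)
  qed
qed

section \<open>From one image to a locally finite family\<close>

lemma connected_Compl_Un_family:
  fixes E :: "'i \<Rightarrow> complex set"
  assumes "finite J" "compact K" "connected (- K)"
    and "\<And>j. j \<in> J \<Longrightarrow> compact (E j)" "\<And>j. j \<in> J \<Longrightarrow> connected (- E j)"
    and "\<And>j. j \<in> J \<Longrightarrow> E j \<inter> K = {}" "disjoint_family_on E J"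
  shows "connected (- (K \<union> (\<Union>j\<in>J. E j)))"
  using assms
proof (induction J rule: finite_induct)
  case (insert j J)
  have c: "compact (K \<union> (\<Union>j\<in>J. E j))"
    using insert by (intro compact_Un compact_UN) auto
  have "E j \<inter> E i = {}" if "i \<in> J" for i
    using insert.prems(6) insert.hyps that by (metis disjoint_family_onD insertCI)
  then have "(K \<union> (\<Union>j\<in>J. E j)) \<inter> E j = {}" using insert.prems(5)[of j] by auto
  moreover have "connected (- (K \<union> (\<Union>j\<in>J. E j)))"
    using insert by (intro insert.IH) (auto intro: disjoint_family_on_mono)
  moreover have "closed (E j)" "connected (- E j)"
    using insert.prems(3,4)[of j] by (auto intro: compact_imp_closed)
  \<comment> \<open>Janiszewski's theorem: a compact and a closed set that do not separate the plane
    have a nonseparating union if their intersection is connected; here it is empty.\<close>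
  ultimately have "connected (- ((K \<union> (\<Union>j\<in>J. E j)) \<union> E j))"
    by (intro Janiszewski_connected[OF c]) (simp_all only: connected_empty)
  moreover have "(K \<union> (\<Union>j\<in>J. E j)) \<union> E j = K \<union> (\<Union>j\<in>insert j J. E j)" by auto
  ultimately show ?case by simp
qed simp

text \<open>Each image receives its own correction to \<open>g\<close>: it is close to
  \<open>P j u - g (F j u)\<close> on that image and close to 0 on \<open>K\<close> and on all the
  other images, so the corrections can be added without disturbing one another.\<close>

lemma approximate_on_finite_family:
  assumes J: "finite J"
    and F: "\<And>j. j \<in> J \<Longrightarrow> univalent_self_map (F j)"
    and P: "\<And>j. j \<in> J \<Longrightarrow> P j holomorphic_on unit_disc"
    and r: "\<And>j. j \<in> J \<Longrightarrow> 0 \<le> r j \<and> r j < 1"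
    and dis: "disjoint_family_on (\<lambda>j. F j ` cball 0 (r j)) J"
    and K: "compact K" "K \<subseteq> unit_disc" "connected (- K)" "\<And>j. j \<in> J \<Longrightarrow> F j ` cball 0 (r j) \<inter> K = {}"
    and g: "g holomorphic_on unit_disc" and e: "e > 0"
  obtains h where "h holomorphic_on unit_disc" "\<And>z. z \<in> K \<Longrightarrow> cmod (h z - g z) < e"
    "\<And>j u. j \<in> J \<Longrightarrow> u \<in> cball 0 (r j) \<Longrightarrow> cmod (h (F j u) - P j u) < e"
proof -
  define E where "E j = F j ` cball 0 (r j)" for j
  \<comment> \<open>At every point at most \<open>card J\<close> errors below \<open>d\<close> add
    up; the \<open>+ 1\<close> makes their sum strictly less than \<open>e\<close> and covers empty
    \<open>J\<close>.\<close>
  define d where "d = e / (card J + 1)"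
  have d: "d > 0" using e by (simp add: d_def)
  define X where "X j = K \<union> (\<Union>i\<in>J - {j}. E i)" for j
  have E: "compact (E j)" "E j \<subseteq> unit_disc" "connected (- E j)" if "j \<in> J" for j
    using compact_univalent_image[OF F[OF that], of "r j"] r[OF that] by (auto simp: E_def)
  have "\<exists>h. h holomorphic_on unit_disc \<and> (\<forall>z\<in>X j. cmod (h z) < d) \<and>
          (\<forall>u\<in>cball 0 (r j). cmod (h (F j u) - (P j u - g (F j u))) < d)" if j: "j \<in> J" for j
  proof -
    have hF: "F j holomorphic_on unit_disc" "F j ` unit_disc \<subseteq> unit_disc"
      using F[OF j] by (auto simp: univalent_self_map_def)
    have "g \<circ> F j holomorphic_on unit_disc"
      by (rule holomorphic_on_compose_gen[OF hF(1) g hF(2)])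
    then have hol: "(\<lambda>u. P j u - g (F j u)) holomorphic_on unit_disc"
      using P[OF j] by (intro holomorphic_on_diff) (auto simp: o_def)
    have cX: "compact (X j)" unfolding X_def using J E K(1) by (intro compact_Un compact_UN) auto
    have sX: "X j \<subseteq> unit_disc" unfolding X_def using E K(2) by auto
    have "E j \<inter> E i = {}" if "i \<in> J - {j}" for i
      using disjoint_family_onD[OF dis j, of i] that by (auto simp: E_def)
    then have dX: "F j ` cball 0 (r j) \<inter> X j = {}"
      unfolding X_def using K(4)[OF j] by (auto simp: E_def)
    have "connected (- (K \<union> (\<Union>i\<in>J. E i)))"
      using J K E dis by (intro connected_Compl_Un_family) (auto simp: E_def)
    moreover have "X j \<union> F j ` cball 0 (r j) = K \<union> (\<Union>i\<in>J. E i)"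
      using j by (auto simp: X_def E_def)
    ultimately have con: "connected (- (X j \<union> F j ` cball 0 (r j)))" by simp
    have r': "0 \<le> r j" "r j < 1" using r[OF j] by auto
    obtain h where "h holomorphic_on unit_disc" "\<And>z. z \<in> X j \<Longrightarrow> cmod (h z) < d"
      "\<And>u. u \<in> cball 0 (r j) \<Longrightarrow> cmod (h (F j u) - (P j u - g (F j u))) < d"
      using approximate_on_univalent_image[OF F[OF j] hol r' cX sX dX con d] by metis
    then show ?thesis by blast
  qed
  then obtain h where h: "\<And>j. j \<in> J \<Longrightarrow> h j holomorphic_on unit_disc"
    "\<And>j z. j \<in> J \<Longrightarrow> z \<in> X j \<Longrightarrow> cmod (h j z) < d"
    "\<And>j u. j \<in> J \<Longrightarrow> u \<in> cball 0 (r j) \<Longrightarrow> cmod (h j (F j u) - (P j u - g (F j u))) < d"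
    by metis
  define f where "f z = g z + (\<Sum>j\<in>J. h j z)" for z
  have de: "d * card J < e" using e by (simp add: d_def field_simps)
  show ?thesis
  proof (rule that[of f])
    show "f holomorphic_on unit_disc" unfolding f_def using h(1) g by (intro holomorphic_intros)
    fix z assume z: "z \<in> K"
    have "cmod (f z - g z) \<le> (\<Sum>j\<in>J. cmod (h j z))" by (simp add: f_def norm_sum)
    also have "\<dots> \<le> (\<Sum>j\<in>J. d)" using h(2) z by (intro sum_mono less_imp_le) (auto simp: X_def)
    finally show "cmod (f z - g z) < e" using de by (simp add: mult.commute)
  next
    fix j and u :: complex assume j: "j \<in> J" and u: "u \<in> cball 0 (r j)"
    have "f (F j u) - P j u = (h j (F j u) - (P j u - g (F j u))) + (\<Sum>i\<in>J - {j}. h i (F j u))"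
      unfolding f_def using J j by (subst sum.remove[of J j]) auto
    also have "cmod \<dots> \<le> d + (\<Sum>i\<in>J - {j}. d)"
    proof (intro norm_triangle_mono order_trans[OF norm_sum] sum_mono less_imp_le h)
      fix i assume i: "i \<in> J - {j}"
      then have "j \<in> J - {i}" "F j u \<in> E j" using u j by (auto simp: E_def)
      then show "F j u \<in> X i" unfolding X_def by blast
    qed (use j u in auto)
    also have "\<dots> = d * card J"
    proof -
      have "real (card J) = real (card (J - {j})) + 1"
        using card_Suc_Diff1[OF J j] by linarith
      then show ?thesis by (simp add: algebra_simps)
    qed
    finally show "cmod (f (F j u) - P j u) < e" using de by simp
  qed
qed

lemma connected_subset_outside:
  fixes S :: "complex set"
  assumes "connected A" "A \<inter> S = {}" "A \<inter> outside S \<noteq> {}"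
  shows "A \<subseteq> outside S"
proof
  fix y assume y: "y \<in> A"
  obtain x where x: "x \<in> A" "x \<in> outside S" using assms(3) by auto
  have "A \<subseteq> - S" using assms(2) by auto
  then have "connected_component (- S) x y"
    using assms(1) x(1) y unfolding connected_component_def by blast
  then show "y \<in> outside S" using x(2) outside_same_component by blast
qed

lemma compact_subset_cball:
  assumes "compact K" "K \<subseteq> unit_disc"
  obtains t where "0 < t" "t < 1" "K \<subseteq> cball 0 t"
proof (cases "K = {}")
  case True then show ?thesis using that[of "1/2"] by simp
next
  case False
  obtain c where c: "c \<in> K" "\<And>x. x \<in> K \<Longrightarrow> cmod x \<le> cmod c"
    using continuous_attains_sup[OF assms(1) False continuous_on_norm_id] by auto
  then have "cmod c < 1" using assms(2) by auto
  moreover have "K \<subseteq> cball 0 ((cmod c + 1) / 2)"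
  proof
    fix x assume "x \<in> K"
    then show "x \<in> cball 0 ((cmod c + 1) / 2)" using c(2)[of x] \<open>cmod c < 1\<close> by simp
  qed
  ultimately show ?thesis using that[of "(cmod c + 1) / 2"] norm_ge_zero[of c] by simp
qed

text \<open>The disc is exhausted by compact sets \<open>K m\<close> that cut no image and do not
  separate the plane. Passing from \<open>K m\<close> to \<open>K (Suc m)\<close>, the finite
  version treats the images that are new in \<open>K (Suc m)\<close> while changing the function by
  less than \<open>e m\<close> on \<open>K m\<close>; the hypothesis \<open>fin\<close> makes each
  stage finite.\<close>

theorem approximate_on_disjoint_family:
  fixes I :: "'i set"
  assumes F: "\<And>j. j \<in> I \<Longrightarrow> univalent_self_map (F j)"
    and P: "\<And>j. j \<in> I \<Longrightarrow> P j holomorphic_on unit_disc"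
    and r: "\<And>j. j \<in> I \<Longrightarrow> 0 \<le> r j \<and> r j < 1"
    and dis: "disjoint_family_on (\<lambda>j. F j ` cball 0 (r j)) I"
    and fin: "\<And>s. s < 1 \<Longrightarrow> finite {j \<in> I. F j ` cball 0 (r j) \<inter> cball 0 s \<noteq> {}}"
    and \<epsilon>: "\<And>j. j \<in> I \<Longrightarrow> \<epsilon> j > 0"
  obtains f where "f holomorphic_on unit_disc"
    "\<And>j u. j \<in> I \<Longrightarrow> u \<in> cball 0 (r j) \<Longrightarrow> cmod (f (F j u) - P j u) < \<epsilon> j"
proof -
  define E where "E j = F j ` cball 0 (r j)" for j
  have E: "compact (E j)" "E j \<subseteq> unit_disc" "connected (- E j)" "connected (E j)" "E j \<noteq> {}"
    if "j \<in> I" for j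
    using compact_univalent_image[OF F[OF that], of "r j"] r[OF that] by (auto simp: E_def)
  \<comment> \<open>These radii increase to 1 from \<open>s 0 = -1\<close>, so the first disc is
    empty and no image counts as treated at stage 0.\<close>
  define s where "s m = 1 - 2 / (real m + 1)" for m
  have s: "s m < 1" for m by (simp add: s_def field_simps)
  have s_mono: "s m \<le> s n" if "m \<le> n" for m n
    using that by (simp add: s_def frac_le)
  have s_lim: "\<exists>m. t \<le> s m" if "t < 1" for t
  proof -
    have "1 - t > 0" using that by simp
    then obtain n where n: "1 / real (Suc n) < (1 - t) / 2" using nat_approx_posE[of "(1-t)/2"] by auto
    then have "t \<le> s n" by (simp add: s_def field_simps)
    then show ?thesis ..
  qed
  define N where "N m = {j \<in> I. E j \<inter> cball 0 (s m) \<noteq> {}}" for m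
  \<comment> \<open>Adjoining every image that meets the disc ensures that none is cut; filling the
    holes, which gives \<open>K m\<close>, makes the complement connected.\<close>
  define M where "M m = cball 0 (s m) \<union> (\<Union>j\<in>N m. E j)" for m
  define K where "K m = - outside (M m)" for m
  have finN: "finite (N m)" for m using fin[OF s] by (simp add: N_def E_def)
  have M: "compact (M m)" "M m \<subseteq> unit_disc" for m
    using finN E s[of m] unfolding M_def
    by (auto intro!: compact_Un compact_UN simp: unit_disc_radius N_def simp del: cball_eq_empty)
  have MK: "M m \<subseteq> K m" for m using outside_no_overlap[of "M m"] unfolding K_def by blast
  have M_mono: "M m \<subseteq> M n" if "m \<le> n" for m n
    using s_mono[OF that] unfolding M_def N_def by fastforce
  have K_mono: "K m \<subseteq> K n" if "m \<le> n" for m n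
    unfolding K_def using outside_mono[OF M_mono[OF that]] by auto
  have K_sub: "\<exists>t<1. K m \<subseteq> cball 0 t" for m
  proof -
    obtain t where t: "t < 1" "M m \<subseteq> cball 0 t" using compact_subset_cball[OF M] by metis
    have "- cball 0 t \<subseteq> outside (M m)" by (intro outside_subset_convex t) simp
    then show ?thesis using t(1) unfolding K_def by blast
  qed
  have K: "compact (K m)" "K m \<subseteq> unit_disc" "connected (- K m)" for m
  proof -
    obtain t where t: "t < 1" "K m \<subseteq> cball 0 t" using K_sub by blast
    have "closed (K m)" unfolding K_def using M(1) by (simp add: open_outside compact_imp_closed closed_Compl)
    then show "compact (K m)" using t(2) by (meson bounded_cball bounded_subset compact_eq_bounded_closed)
    show "K m \<subseteq> unit_disc" using t unit_disc_radius by blast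
    show "connected (- K m)" unfolding K_def using M(1) by (simp add: connected_outside compact_imp_bounded)
  qed
  \<comment> \<open>An image that was not adjoined misses \<open>M m\<close> and is connected, so it
    lies in one component of the complement of \<open>M m\<close>: entirely in a hole, hence in
    \<open>K m\<close>, or entirely outside.\<close>
  have EK: "E j \<subseteq> K m" if j: "j \<in> I" and meet: "E j \<inter> K m \<noteq> {}" for j m
  proof (cases "j \<in> N m")
    case True
    then show ?thesis using MK[of m] by (auto simp: M_def)
  next
    case False
    have "E j \<inter> E i = {}" if "i \<in> N m" for i
      using disjoint_family_onD[OF dis j, of i] that False by (auto simp: E_def N_def)
    moreover have "E j \<inter> cball 0 (s m) = {}" using False j by (auto simp: N_def)
    ultimately have "E j \<inter> M m = {}" unfolding M_def by blast
    from connected_subset_outside[OF E(4)[OF j] this] meet show ?thesis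
      unfolding K_def by blast
  qed
  define J where "J m = {j \<in> I. E j \<subseteq> K m}" for m
  have finJ: "finite (J m)" for m
  proof -
    obtain t where t: "t < 1" "K m \<subseteq> cball 0 t" using K_sub by blast
    have "J m \<subseteq> {j \<in> I. F j ` cball 0 (r j) \<inter> cball 0 t \<noteq> {}}"
    proof
      fix j assume "j \<in> J m"
      then have "j \<in> I" "E j \<subseteq> cball 0 t" using t by (auto simp: J_def)
      then show "j \<in> {j \<in> I. F j ` cball 0 (r j) \<inter> cball 0 t \<noteq> {}}"
        using E(5)[of j] unfolding E_def by blast
    qed
    then show ?thesis using fin[OF t(1)] finite_subset by blast
  qed
  have J_mono: "J m \<subseteq> J n" if "m \<le> n" for m n using K_mono[OF that] by (auto simp: J_def)
  have "M 0 = {}" by (auto simp: M_def N_def s_def)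
  then have "K 0 = {}" by (simp add: K_def)
  then have J0: "J 0 = {}" using E(5) by (auto simp: J_def)
  \<comment> \<open>The factor \<open>(1/2) ^ m\<close> makes all changes from stage
    \<open>m\<close> on sum to at most \<open>2 * e m\<close> on \<open>K m\<close>. A quarter of
    the least tolerance bounds this by half the tolerance of every image inside \<open>K m\<close>;
    the other half is allowed when an image is treated.\<close>
  define e where "e m = Min (insert 1 (\<epsilon> ` J m)) / 4 * (1/2) ^ m" for m
  have e0: "e m > 0" for m
  proof -
    have "Min (insert 1 (\<epsilon> ` J m)) > 0" using finJ \<epsilon> by (subst Min_gr_iff) (auto simp: J_def)
    then show ?thesis by (simp add: e_def)
  qed
  have e_dec: "e (m + d) \<le> e m * (1/2) ^ d" for m d
  proof -
    have "Min (insert 1 (\<epsilon> ` J (m + d))) \<le> Min (insert 1 (\<epsilon> ` J m))"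
      using J_mono[of m "m + d"] finJ by (intro Min_antimono) auto
    then show ?thesis by (simp add: e_def power_add)
  qed
  have e_le: "e m \<le> \<epsilon> j / 4" if "j \<in> J m" for j m
  proof -
    have 1: "Min (insert 1 (\<epsilon> ` J m)) \<le> \<epsilon> j" using that finJ by (intro Min_le) auto
    have "\<epsilon> j > 0" using that \<epsilon> by (auto simp: J_def)
    then have "Min (insert 1 (\<epsilon> ` J m)) * (1/2) ^ m \<le> \<epsilon> j * 1"
      using 1 by (intro mult_mono) (auto simp: power_le_one)
    then show ?thesis by (simp add: e_def)
  qed
  have e_le1: "e m \<le> (1/2) ^ m / 4" for m
  proof -
    have "Min (insert 1 (\<epsilon> ` J m)) \<le> 1" using finJ by (intro Min_le) auto
    then show ?thesis by (simp add: e_def)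
  qed
  have "\<exists>f. \<forall>m. f m holomorphic_on unit_disc \<and>
         ((\<forall>z\<in>K m. cmod (f (Suc m) z - f m z) < e m) \<and>
          (\<forall>j\<in>J (Suc m) - J m. \<forall>u\<in>cball 0 (r j). cmod (f (Suc m) (F j u) - P j u) < \<epsilon> j / 2))"
  proof (rule dependent_nat_choice)
    show "\<exists>f. f holomorphic_on unit_disc" by (intro exI[of _ "\<lambda>_. 0"]) simp
  next
    fix f m assume f: "f holomorphic_on unit_disc"
    define d where "d = Min (insert (e m) ((\<lambda>j. \<epsilon> j / 2) ` (J (Suc m) - J m)))"
    have d: "d > 0" unfolding d_def using finJ \<epsilon> e0 by (subst Min_gr_iff) (auto simp: J_def)
    have de: "d \<le> e m" unfolding d_def using finJ by (intro Min_le) auto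
    have d\<epsilon>: "d \<le> \<epsilon> j / 2" if "j \<in> J (Suc m) - J m" for j
      unfolding d_def using that finJ by (intro Min_le) auto
    have fJ: "finite (J (Suc m) - J m)" using finJ by auto
    have JI: "J (Suc m) - J m \<subseteq> I" by (auto simp: J_def)
    have off: "F j ` cball 0 (r j) \<inter> K m = {}" if "j \<in> J (Suc m) - J m" for j
      using EK[of j m] that by (auto simp: J_def E_def)
    obtain h where h: "h holomorphic_on unit_disc" "\<And>z. z \<in> K m \<Longrightarrow> cmod (h z - f z) < d"
      "\<And>j u. j \<in> J (Suc m) - J m \<Longrightarrow> u \<in> cball 0 (r j) \<Longrightarrow> cmod (h (F j u) - P j u) < d"
    proof (rule approximate_on_finite_family[OF fJ _ _ _ disjoint_family_on_mono[OF JI dis] K off f d])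
    qed (use JI F P r in blast)+
    show "\<exists>h. h holomorphic_on unit_disc \<and> ((\<forall>z\<in>K m. cmod (h z - f z) < e m) \<and>
          (\<forall>j\<in>J (Suc m) - J m. \<forall>u\<in>cball 0 (r j). cmod (h (F j u) - P j u) < \<epsilon> j / 2))"
      using h de d\<epsilon> by (intro exI[of _ h]) (meson less_le_trans)
  qed
  then obtain f where f: "\<And>m. f m holomorphic_on unit_disc"
    "\<And>m z. z \<in> K m \<Longrightarrow> cmod (f (Suc m) z - f m z) < e m"
    "\<And>m j u. j \<in> J (Suc m) - J m \<Longrightarrow> u \<in> cball 0 (r j) \<Longrightarrow> cmod (f (Suc m) (F j u) - P j u) < \<epsilon> j / 2"
    by blast
  have close: "cmod (f (m + d) z - f m z) \<le> e m * (2 - 2 * (1/2) ^ d)" if z: "z \<in> K m" for m d z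
  proof (induction d)
    case (Suc d)
    have "z \<in> K (m + d)" using z K_mono[of m "m + d"] by auto
    then have "cmod (f (Suc (m + d)) z - f (m + d) z) \<le> e m * (1/2) ^ d"
      using f(2)[of z "m + d"] e_dec[of m d] by linarith
    then have "cmod ((f (Suc (m + d)) z - f (m + d) z) + (f (m + d) z - f m z))
        \<le> e m * (1/2) ^ d + e m * (2 - 2 * (1/2) ^ d)"
      using Suc.IH by (intro norm_triangle_mono)
    then show ?case by (simp add: algebra_simps)
  qed simp
  have close2: "cmod (f n z - f m z) \<le> 2 * e m" if "z \<in> K m" "m \<le> n" for m n z
  proof -
    have "e m * (2 - 2 * (1/2) ^ (n - m)) \<le> e m * 2" using e0[of m] by (intro mult_left_mono) auto
    then show ?thesis using close[OF that(1), of "n - m"] that(2) by simp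
  qed
  have e_lim: "(\<lambda>m. 2 * e m) \<longlonglongrightarrow> 0"
  proof (rule tendsto_sandwich[of "\<lambda>_. 0" _ _ "\<lambda>m. 2 * ((1/2) ^ m / 4)"])
    show "(\<lambda>m. 2 * ((1 / 2) ^ m / 4)) \<longlonglongrightarrow> (0::real)"
      by (intro tendsto_eq_intros LIMSEQ_power_zero) auto
    show "\<forall>\<^sub>F m in sequentially. 0 \<le> 2 * e m" using e0 by (simp add: less_imp_le)
    show "\<forall>\<^sub>F m in sequentially. 2 * e m \<le> 2 * ((1 / 2) ^ m / 4)"
      using e_le1 by (intro always_eventually allI mult_left_mono) auto
  qed auto
  have inK: "\<exists>m. cball 0 t \<subseteq> K m" if "t < 1" for t
  proof -
    have "\<exists>m. t \<le> s m" by (rule s_lim[OF that])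
    then obtain m where m: "t \<le> s m" by blast
    then have "cball 0 t \<subseteq> M m" by (auto simp: M_def)
    then show ?thesis using MK by blast
  qed
  have "convergent (\<lambda>n. f n z)" if z: "z \<in> unit_disc" for z
  proof -
    obtain m where m: "z \<in> K m" using inK[of "cmod z"] z by auto
    have "Cauchy (\<lambda>n. f n z)"
    proof (rule metric_CauchyI)
      fix x :: real assume x: "x > 0"
      obtain n0 where n0: "\<And>n. n \<ge> n0 \<Longrightarrow> 2 * e n < x / 2"
        using order_tendstoD(2)[OF e_lim, of "x/2"] x by (auto simp: eventually_sequentially)
      define n1 where "n1 = max n0 m"
      have "z \<in> K n1" using m K_mono[of m n1] by (auto simp: n1_def)
      then have "dist (f n z) (f n1 z) < x / 2" if "n \<ge> n1" for n
        using close2[of z n1 n] that n0[of n1] by (simp add: dist_norm n1_def)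
      then show "\<exists>N. \<forall>m\<ge>N. \<forall>n\<ge>N. dist (f m z) (f n z) < x"
        by (meson dist_triangle_half_l)
    qed
    then show ?thesis by (simp add: Cauchy_convergent)
  qed
  then obtain g where g: "\<And>z. z \<in> unit_disc \<Longrightarrow> (\<lambda>n. f n z) \<longlonglongrightarrow> g z"
    unfolding convergent_def by metis
  have gK: "cmod (g z - f m z) \<le> 2 * e m" if "z \<in> K m" for m z
  proof (rule Lim_norm_ubound)
    show "(\<lambda>n. f n z - f m z) \<longlonglongrightarrow> g z - f m z"
      using g[of z] K(2)[of m] that by (intro tendsto_intros) auto
    show "\<forall>\<^sub>F n in sequentially. cmod (f n z - f m z) \<le> 2 * e m"
      using close2[OF that] by (auto simp: eventually_sequentially)
  qed simp
  show ?thesis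
  proof (rule that)
    show "g holomorphic_on unit_disc"
    proof (rule holomorphic_uniform_sequence[OF open_ball f(1)])
      fix x :: complex assume x: "x \<in> unit_disc"
      define d where "d = (1 - cmod x) / 2"
      have d: "0 < d" "cmod x + d < 1" using x by (auto simp: d_def field_simps)
      have sub: "cball x d \<subseteq> cball 0 (cmod x + d)"
        by (auto simp: dist_norm) (metis add.commute add_mono_thms_linordered_semiring(1) dist_norm norm_minus_commute norm_triangle_sub order_trans order_refl)
      obtain m where m: "cball 0 (cmod x + d) \<subseteq> K m" using inK[OF d(2)] by blast
      have "uniform_limit (cball x d) f g sequentially"
        unfolding uniform_limit_iff
      proof (intro allI impI)
        fix \<eta> :: real assume "\<eta> > 0"
        then have "\<forall>\<^sub>F n in sequentially. 2 * e n < \<eta>" using order_tendstoD(2)[OF e_lim] by blast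
        moreover have "\<forall>\<^sub>F n in sequentially. n \<ge> m" by (rule eventually_ge_at_top)
        ultimately show "\<forall>\<^sub>F n in sequentially. \<forall>y\<in>cball x d. dist (f n y) (g y) < \<eta>"
        proof eventually_elim
          case (elim n)
          show ?case
          proof
            fix y assume "y \<in> cball x d"
            then have "y \<in> K n" using sub m K_mono[OF elim(2)] by blast
            then show "dist (f n y) (g y) < \<eta>" using gK[of y n] elim(1) by (simp add: dist_norm norm_minus_commute)
          qed
        qed
      qed
      then show "\<exists>d>0. cball x d \<subseteq> unit_disc \<and> uniform_limit (cball x d) f g sequentially"
        using d sub unit_disc_radius[of "cmod x + d"] by blast
    qed
    fix j and u :: complex assume j: "j \<in> I" and u: "u \<in> cball 0 (r j)"
    obtain t where t: "t < 1" "E j \<subseteq> cball 0 t" using compact_subset_cball[OF E(1,2)[OF j]] by metis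
    obtain m where m: "cball 0 t \<subseteq> K m" using inK[OF t(1)] by blast
    have "j \<in> J m" using j t m by (auto simp: J_def)
    \<comment> \<open>The stage at which the image of \<open>j\<close> was treated. It is not 0
      since \<open>J 0\<close> is empty, so \<open>k = Suc l\<close> with
      \<open>j \<notin> J l\<close>, which is the situation of the recursion step.\<close>
    define k where "k = (LEAST k. j \<in> J k)"
    have jk: "j \<in> J k" unfolding k_def by (rule LeastI[of _ m]) fact
    have k0: "k \<noteq> 0" using jk J0 by (metis empty_iff)
    then obtain l where l: "k = Suc l" using not0_implies_Suc by blast
    have "j \<notin> J l" using not_less_Least[of l "\<lambda>k. j \<in> J k"] l unfolding k_def by auto
    then have "cmod (f k (F j u) - P j u) < \<epsilon> j / 2" using f(3)[of j l u] jk l u by auto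
    moreover have "cmod (g (F j u) - f k (F j u)) \<le> \<epsilon> j / 2"
      using gK[of "F j u" k] e_le[OF jk] jk u by (force simp: J_def E_def)
    moreover have "cmod (g (F j u) - P j u) \<le> cmod (g (F j u) - f k (F j u)) + cmod (f k (F j u) - P j u)"
      using norm_triangle_ineq[of "g (F j u) - f k (F j u)" "f k (F j u) - P j u"] by simp
    ultimately show "cmod (g (F j u) - P j u) < \<epsilon> j" by linarith
  qed
qed

section \<open>Separated sets of positive lower density\<close>

lemma lower_density_pos:
  assumes "c > 0" "\<forall>\<^sub>F n in sequentially. c * real n \<le> real (card (A \<inter> {1..n}))"
  shows "lower_density A > 0"
proof -
  have "\<forall>\<^sub>F n in sequentially. ereal c \<le> ereal (real (card (A \<inter> {1..n})) / real n)"
    using assms(2) eventually_gt_at_top[of 0]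
    by eventually_elim (simp add: pos_le_divide_eq)
  then have "ereal c \<le> lower_density A" unfolding lower_density_def by (rule Liminf_bounded)
  then show ?thesis using assms(1) by (metis ereal_less(2) less_le_trans)
qed

text \<open>Each complete period of length \<open>4 * (N * L')\<close> in the interval contributes
  the \<open>L'\<close> multiples of \<open>N\<close> in its first quarter; alignment and rounding
  lose at most three periods.\<close>

lemma card_arithmetic_pattern:
  fixes a c :: real and N L' :: nat
  assumes "N > 0" "L' > 0" "0 \<le> a" "a \<le> c"
  defines "S \<equiv> {n::nat. a \<le> real n \<and> real n \<le> c \<and> N dvd n \<and> n mod (4 * (N * L')) < N * L'}"
  shows "(c - a) / (4 * N) - 3 * L' \<le> card S"
proof -
  define L where "L = N * L'"
  have L: "L > 0" using assms by (simp add: L_def)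
  define q0 where "q0 = nat \<lceil>a / (4 * real L)\<rceil>"
  \<comment> \<open>One period is given up because the first aligned period may start almost
    \<open>4 * L\<close> after \<open>a\<close>, the other is a margin at \<open>c\<close>. On short
    intervals \<open>nat\<close> truncates to 0, and there the claimed lower bound is
    negative.\<close>
  define Q where "Q = nat (\<lfloor>(c - a) / (4 * real L)\<rfloor> - 2)"
  have q0: "a \<le> 4 * real L * q0" "4 * real L * q0 < a + 4 * real L"
  proof -
    have "real q0 = real_of_int \<lceil>a / (4 * real L)\<rceil>" unfolding q0_def using assms(3) L by simp
    then have "a / (4 * real L) \<le> real q0" "real q0 < a / (4 * real L) + 1" by linarith+
    then show "a \<le> 4 * real L * q0" "4 * real L * q0 < a + 4 * real L"
      using L by (simp_all add: divide_le_eq field_simps)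
  qed
  define g where "g = (\<lambda>(q, r). 4 * L * (q0 + q) + N * r)"
  have NrL: "N * r < L" if "r < L'" for r using that assms(1) by (simp add: L_def)
  have "g ` ({..<Q} \<times> {..<L'}) \<subseteq> S"
  proof
    fix n assume "n \<in> g ` ({..<Q} \<times> {..<L'})"
    then obtain q r where qr: "q < Q" "r < L'" "n = 4 * L * (q0 + q) + N * r" by (auto simp: g_def)
    have m: "n mod (4 * L) = N * r" unfolding qr(3) mod_mult_self4 using NrL[OF qr(2)] by simp
    have "N dvd n" unfolding qr(3) L_def by (intro dvd_add dvd_mult dvd_mult2) auto
    moreover have "a \<le> real n"
    proof -
      have "real n = 4 * real L * q0 + (4 * real L * q + N * r)" by (simp add: qr(3) algebra_simps)
      then show ?thesis using q0(1) by (simp add: add_increasing2)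
    qed
    moreover have "real n \<le> c"
    proof -
      have "real Q \<le> (c - a) / (4 * real L) - 2" using qr(1) unfolding Q_def by linarith
      then have Q: "4 * real L * Q \<le> c - a - 8 * real L" using L by (simp add: field_simps)
      have "real q + 1 \<le> real Q" using qr(1) by linarith
      then have "4 * real L * (q + 1) \<le> 4 * real L * Q" by (intro mult_left_mono) auto
      moreover have "real (N * r) < real L" using NrL[OF qr(2)] by linarith
      moreover have "real n = 4 * real L * q0 + 4 * real L * (q + 1) - 4 * real L + real (N * r)"
        by (simp add: qr(3) algebra_simps)
      ultimately show ?thesis using q0(2) Q by linarith
    qed
    ultimately show "n \<in> S" using m NrL[OF qr(2)] by (simp add: S_def L_def)
  qed
  moreover have "finite S"
    by (rule finite_subset[of _ "{..nat \<lfloor>c\<rfloor>}"]) (auto simp: S_def le_nat_floor)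
  ultimately have "card (g ` ({..<Q} \<times> {..<L'})) \<le> card S" by (intro card_mono)
  moreover have "inj_on g ({..<Q} \<times> {..<L'})"
  proof (rule inj_onI, clarify)
    fix q r q' r' assume *: "q < Q" "r < L'" "q' < Q" "r' < L'" "g (q, r) = g (q', r')"
    have "(4 * L * (q0 + q) + N * r) mod (4 * L) = (4 * L * (q0 + q') + N * r') mod (4 * L)"
      using *(5) by (simp add: g_def)
    then have "N * r = N * r'" unfolding mod_mult_self4 using NrL[OF *(2)] NrL[OF *(4)] by simp
    moreover from this have "4 * L * (q0 + q) = 4 * L * (q0 + q')" using *(5) unfolding g_def prod.case by linarith
    ultimately show "q = q' \<and> r = r'" using assms(1) L by simp
  qed
  ultimately have "Q * L' \<le> card S" by (simp add: card_image)
  then have "real Q * real L' \<le> card S" by (metis of_nat_le_iff of_nat_mult)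
  moreover have "(c - a) / (4 * real L) - 3 \<le> real Q" unfolding Q_def by linarith
  then have "((c - a) / (4 * real L) - 3) * real L' \<le> real Q * real L'" by (intro mult_right_mono) auto
  moreover have "((c - a) / (4 * real L) - 3) * real L' = (c - a) / (4 * N) - 3 * L'"
    using assms(1,2) by (simp add: L_def field_simps)
  ultimately show ?thesis by linarith
qed

lemma odd_part_unique:
  assumes "2 ^ k * (2 * i + 1) = (2 ^ l * (2 * j + 1) :: nat)"
  shows "k = l"
proof -
  have *: False if "k < l" "2 ^ k * (2 * i + 1) = (2 ^ l * (2 * j + 1) :: nat)" for k l i j
  proof -
    have "\<exists>c. l = Suc (k + c)" by (rule less_imp_Suc_add[OF that(1)])
    then obtain c where l: "l = Suc (k + c)" by blast
    have "2 ^ k * (2 * i + 1) = 2 ^ k * (2 * (2 ^ c * (2 * j + 1)) :: nat)"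
      using that(2) unfolding l power_Suc power_add by (simp only: mult_ac)
    then have "2 * i + 1 = 2 * (2 ^ c * (2 * j + 1))" by (simp only: mult_cancel1) simp
    then show False by presburger
  qed
  show ?thesis using *[of k l i j] *[of l k j i] assms nat_neq_iff[of k l] by auto
qed

text \<open>Numbers whose exponent of 2 is \<open>k\<close> form a progression with step
  \<open>2 ^ (k + 1)\<close>. The bounded gaps between blocks with the same label are what makes the
  lower density of each \<open>A k\<close> positive.\<close>

lemma odd_part_between:
  fixes b k :: nat
  obtains i where "b \<le> 2 ^ k * (2 * i + 1)" "2 ^ k * (2 * i + 1) < b + 2 ^ (k + 1)"
proof -
  define d where "d = (2::nat) ^ (k + 1)"
  have d: "d = 2 * 2 ^ k" "d > 0" by (auto simp: d_def)
  define i where "i = (b + 2 ^ k - 1) div d"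
  have p: "(2::nat) ^ k \<ge> 1" by simp
  have e: "2 ^ k * (2 * i + 1) = i * d + 2 ^ k" by (simp add: d algebra_simps)
  have 1: "i * d \<le> b + 2 ^ k - 1" unfolding i_def by simp
  have 2: "b + 2 ^ k - 1 < i * d + d" unfolding i_def using div_mult_mod_eq[of "b + 2 ^ k - 1" d] mod_less_divisor[OF d(2), of "b + 2 ^ k - 1"] by linarith
  have "b \<le> i * d + 2 ^ k" using 2 p unfolding d(1) by linarith
  moreover have "i * d + 2 ^ k < b + 2 ^ (k + 1)" using 1 p unfolding d(1) by (simp only: power_add power_one_right)
  ultimately show ?thesis using that[of i] unfolding e by blast
qed

lemma dominated_difference:
  fixes \<sigma> x y :: real
  assumes "\<sigma> > 1" "\<sigma> * x \<le> y" "0 \<le> x"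
  shows "(1 - 1 / \<sigma>) / 2 * (x + y) \<le> y - x"
proof -
  have "x \<le> \<sigma> * x" using assms mult_right_mono[of 1 \<sigma> x] by simp
  then have "x \<le> y" using assms by linarith
  have "x \<le> y / \<sigma>" using assms by (simp add: pos_le_divide_eq mult.commute)
  then have "(1 - 1 / \<sigma>) * y \<le> y - x" by (simp add: algebra_simps)
  moreover have "(1 - 1 / \<sigma>) * ((x + y) / 2) \<le> (1 - 1 / \<sigma>) * y"
    using \<open>x \<le> y\<close> assms(1) by (intro mult_left_mono) auto
  moreover have "(1 - 1 / \<sigma>) / 2 * (x + y) = (1 - 1 / \<sigma>) * ((x + y) / 2)" by simp
  ultimately show ?thesis by linarith
qed

text \<open>On the logarithmic scale to base \<sigma> the blocks are the intervals
  \<open>[4 b, 4 b + 1]\<close>. Multiplication by \<tau> shifts by 2 or by -2, after which the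
  distance to every block is at least 1; for \<open>\<tau> = 1\<close> two different blocks are at
  distance at least 3. So one of the numbers exceeds the other by a factor \<sigma>.\<close>

lemma geometric_blocks_far:
  fixes \<sigma> \<tau> :: real and n m b c :: nat
  assumes \<sigma>: "\<sigma> > 1" and \<tau>: "\<tau> = \<sigma> ^ 2 \<or> \<tau> * \<sigma> ^ 2 = 1 \<or> (\<tau> = 1 \<and> b \<noteq> c)"
    and n: "(\<sigma> ^ 4) ^ b \<le> real n" "real n \<le> \<sigma> * (\<sigma> ^ 4) ^ b"
    and m: "(\<sigma> ^ 4) ^ c \<le> real m" "real m \<le> \<sigma> * (\<sigma> ^ 4) ^ c"
  shows "\<bar>\<tau> * n - m\<bar> \<ge> (1 - 1 / \<sigma>) / 2 * (\<tau> * n + m)"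
proof -
  have step: "\<sigma> ^ 4 * (\<sigma> ^ 4) ^ i \<le> (\<sigma> ^ 4) ^ j" if "i < j" for i j :: nat
  proof -
    have "(\<sigma> ^ 4) ^ Suc i \<le> (\<sigma> ^ 4) ^ j" using that \<sigma> by (intro power_increasing) auto
    then show ?thesis by simp
  qed
  have mono: "(\<sigma> ^ 4) ^ i \<le> (\<sigma> ^ 4) ^ j" if "i \<le> j" for i j :: nat
    using that \<sigma> by (intro power_increasing) auto
  have s1: "1 \<le> \<sigma> ^ i" for i using \<sigma> by simp
  have sc: "\<sigma> ^ i * x \<le> \<sigma> ^ i * y \<longleftrightarrow> x \<le> y" for i x y using \<sigma> by simp
  have up: "x \<le> \<sigma> ^ i * x" if "x \<ge> 0" for i x
    using that s1[of i] mult_right_mono[of 1 "\<sigma> ^ i" x] by simp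
  define B C where "B = (\<sigma> ^ 4) ^ b" and "C = (\<sigma> ^ 4) ^ c"
  have BC: "B > 0" "C > 0" using \<sigma> by (auto simp: B_def C_def)
  have n': "B \<le> real n" "real n \<le> \<sigma> * B" and m': "C \<le> real m" "real m \<le> \<sigma> * C"
    using n m by (auto simp: B_def C_def)
  have "real m \<ge> \<sigma> * (\<tau> * n) \<or> \<tau> * n \<ge> \<sigma> * real m"
    using \<tau>
  proof (elim disjE conjE)
    assume t: "\<tau> = \<sigma> ^ 2"
    show ?thesis
    proof (cases "b < c")
      case True
      have "\<sigma> * (\<tau> * n) \<le> \<sigma> * (\<tau> * (\<sigma> * B))" using n' \<sigma> t by (intro mult_left_mono) auto
      also have "\<dots> = \<sigma> ^ 4 * B" by (simp add: t eval_nat_numeral)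
      also have "\<dots> \<le> C" using step[OF True] by (simp add: B_def C_def)
      finally show ?thesis using m' by linarith
    next
      case False
      then have CB: "C \<le> B" using mono[of c b] by (simp add: B_def C_def)
      have "\<sigma> * real m \<le> \<sigma> * (\<sigma> * C)" using m' \<sigma> by (intro mult_left_mono) auto
      also have "\<dots> \<le> \<sigma> * (\<sigma> * n)" using CB n' \<sigma> by (intro mult_left_mono) auto
      also have "\<dots> = \<tau> * n" by (simp add: t power2_eq_square)
      finally show ?thesis by blast
    qed
  next
    assume t: "\<tau> * \<sigma> ^ 2 = 1"
    have t': "\<sigma> ^ 2 * (\<tau> * x) = x" for x using t by (metis mult.assoc mult.commute mult_1)
    show ?thesis
    proof (cases "b \<le> c")
      case True
      then have CB: "B \<le> C" using mono[of b c] by (simp add: B_def C_def)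
      have "\<sigma> ^ 2 * (\<sigma> * (\<tau> * n)) = \<sigma> * n" using t'[of n] by (simp add: mult.left_commute)
      also have "\<dots> \<le> \<sigma> * (\<sigma> * B)" using n' \<sigma> by (intro mult_left_mono) auto
      also have "\<dots> \<le> \<sigma> * (\<sigma> * m)" using CB m' \<sigma> by (intro mult_left_mono) auto
      also have "\<dots> = \<sigma> ^ 2 * real m" by (simp add: power2_eq_square)
      finally show ?thesis unfolding sc by blast
    next
      case False
      then have CB: "\<sigma> ^ 4 * C \<le> B" using step[of c b] by (simp add: B_def C_def)
      have "\<sigma> ^ 2 * (\<sigma> * real m) \<le> \<sigma> ^ 2 * (\<sigma> * (\<sigma> * C))" using m' \<sigma> by (intro mult_left_mono) auto
      also have "\<dots> = \<sigma> ^ 4 * C" by (simp add: eval_nat_numeral)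
      also have "\<dots> \<le> n" using CB n' by linarith
      also have "\<dots> = \<sigma> ^ 2 * (\<tau> * n)" by (simp only: t')
      finally show ?thesis unfolding sc by blast
    qed
  next
    assume t: "\<tau> = 1" "b \<noteq> c"
    have *: "\<sigma> * x \<le> y" if "x \<le> \<sigma> * B'" "C' \<le> y" "\<sigma> ^ 4 * B' \<le> C'" "0 \<le> B'" for x y B' C'
    proof -
      have "\<sigma> * x \<le> \<sigma> * (\<sigma> * B')" using that \<sigma> by (intro mult_left_mono) auto
      also have "\<dots> = \<sigma> ^ 2 * B'" by (simp add: power2_eq_square)
      also have "\<dots> \<le> \<sigma> ^ 4 * B'" using that \<sigma> by (intro mult_right_mono power_increasing) auto
      finally show ?thesis using that by linarith
    qed
    show ?thesis
    proof (cases "b < c")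
      case True
      then show ?thesis using *[OF n'(2) m'(1)] step[of b c] BC t(1) by (simp add: B_def C_def)
    next
      case False
      then show ?thesis using *[OF m'(2) n'(1)] step[of c b] BC t by (simp add: B_def C_def)
    qed
  qed
  moreover have "\<tau> \<ge> 0"
  proof (rule ccontr)
    assume "\<not> \<tau> \<ge> 0"
    then have "\<tau> * \<sigma> ^ 2 < 0" using \<sigma> by (simp add: mult_neg_pos)
    then show False using \<tau> \<open>\<not> \<tau> \<ge> 0\<close> by auto
  qed
  ultimately show ?thesis
  proof (elim disjE)
    assume "\<sigma> * (\<tau> * n) \<le> real m"
    then have "(1 - 1 / \<sigma>) / 2 * (\<tau> * n + m) \<le> m - \<tau> * n"
      using \<sigma> \<open>\<tau> \<ge> 0\<close> by (intro dominated_difference) auto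
    then show ?thesis by linarith
  next
    assume "\<sigma> * real m \<le> \<tau> * n"
    then have "(1 - 1 / \<sigma>) / 2 * (m + \<tau> * n) \<le> \<tau> * n - m"
      using \<sigma> by (intro dominated_difference) auto
    then show ?thesis by (simp only: add.commute[of _ "real m"])
  qed
qed

text \<open>Modulo \<open>4 * L\<close> both numbers lie in \<open>[0, L)\<close>. A shift by an
  amount between \<open>2 * L\<close> and \<open>2 * L + C\<close>, in either direction, lands at
  distance at least \<open>L - C\<close> from every translate of that interval by a multiple of the
  period.\<close>

lemma logarithmic_shift_far:
  fixes s :: real and n m L :: nat
  assumes n: "n mod (4 * L) < L" and m: "m mod (4 * L) < L"
    and s: "2 * real L \<le> \<bar>s\<bar>" "\<bar>s\<bar> \<le> 2 * real L + C" and C: "0 \<le> C" "C \<le> L"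
  shows "real L - C \<le> \<bar>real n + s - real m\<bar>"
proof -
  define z where "z = int (n div (4 * L)) - int (m div (4 * L))"
  define d where "d = real (n mod (4 * L)) - real (m mod (4 * L))"
  have L: "L > 0" using n by auto
  have "real n = 4 * real L * real (n div (4 * L)) + real (n mod (4 * L))" for n
  proof -
    have "real n = real (4 * L * (n div (4 * L)) + n mod (4 * L))" by (simp only: mult_div_mod_eq)
    then show ?thesis unfolding of_nat_add of_nat_mult of_nat_numeral .
  qed
  from this[of n] this[of m] have e: "real n - real m = 4 * real L * of_int z + d"
    by (simp add: z_def d_def algebra_simps)
  have d: "- real L < d" "d < real L" using n m by (auto simp: d_def)
  consider "z \<ge> 1" | "z = 0" | "z \<le> -1" by linarith
  then show ?thesis
  proof cases
    case 1
    then have "4 * real L * of_int z \<ge> 4 * real L * 1" using L by (intro mult_left_mono) auto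
    then show ?thesis using e d s C by linarith
  next
    case 2
    then have "real n - real m = d" using e by simp
    then show ?thesis using d s C by linarith
  next
    case 3
    then have "4 * real L * of_int z \<le> 4 * real L * (-1)" using L by (intro mult_left_mono) auto
    then show ?thesis using e d s C by linarith
  qed
qed

text \<open>
  The times lie in the blocks \<open>[\<rho> ^ b, \<sigma> * \<rho> ^ b]\<close> with \<open>\<rho> = \<sigma> ^ 4\<close>, and block \<open>b\<close> is given to the set
  \<open>A k\<close> with \<open>k\<close> the exponent of 2 in \<open>b\<close>.  If \<open>\<tau> \<noteq> 1\<close>, then \<open>\<sigma>\<^sup>2\<close> is \<open>\<tau>\<close> or \<open>1 / \<tau>\<close> and multiplication by
  \<open>\<tau>\<close> moves each block into the gap between two others.  If \<open>\<tau> = 1\<close>, then block \<open>b\<close> is shifted by about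
  \<open>\<kappa> * b * ln \<rho>\<close>; its times are taken in the first quarter of each period of twice that length, so
  the shift by half a period moves them off one another.
\<close>

theorem separated_sets_exist:
  fixes \<tau> \<kappa> :: real and N :: "nat \<Rightarrow> nat"
  assumes \<tau>: "\<tau> > 0" "\<tau> \<noteq> 1 \<or> \<kappa> \<noteq> 0" and N: "\<And>k. N k > 0"
  obtains A :: "nat \<Rightarrow> nat set" where
    "\<And>k. lower_density (A k) > 0"
    "\<And>k n. n \<in> A k \<Longrightarrow> N k \<le> n"
    "\<And>k l n. n \<in> A k \<Longrightarrow> n \<in> A l \<Longrightarrow> k = l"
    "\<And>k l n m. n \<in> A k \<Longrightarrow> m \<in> A l \<Longrightarrow> n < m \<Longrightarrow> N k \<le> m - n \<and> N l \<le> m - n"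
    "\<And>k l n m. n \<in> A k \<Longrightarrow> m \<in> A l \<Longrightarrow>
       N k < \<bar>\<tau> * n + \<kappa> * ln n - m\<bar> \<and> N l < \<bar>\<tau> * n + \<kappa> * ln n - m\<bar>"
proof -
  define \<sigma> where "\<sigma> = (if \<tau> = 1 then 2 else sqrt (max \<tau> (1 / \<tau>)))"
  have \<sigma>: "\<sigma> > 1" and \<sigma>\<tau>: "\<tau> = \<sigma> ^ 2 \<or> \<tau> * \<sigma> ^ 2 = 1 \<or> \<tau> = 1"
  proof -
    consider "\<tau> = 1" | "\<tau> > 1" | "\<tau> < 1" by linarith
    then have "\<sigma> > 1 \<and> (\<tau> = \<sigma> ^ 2 \<or> \<tau> * \<sigma> ^ 2 = 1 \<or> \<tau> = 1)"
    proof cases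
      case 2
      then have "1 / \<tau> < \<tau>" by (smt (verit) divide_less_eq_1_pos)
      then have "\<sigma> = sqrt \<tau>" using 2 by (simp add: \<sigma>_def)
      then show ?thesis using 2 by simp
    next
      case 3
      then have "1 / \<tau> > 1" using \<tau>(1) by simp
      then have "\<sigma> = sqrt (1 / \<tau>)" using 3 by (simp add: \<sigma>_def max_def)
      then have "\<sigma> > 1" "\<sigma> ^ 2 = 1 / \<tau>" using \<open>1 / \<tau> > 1\<close> \<tau>(1) by simp_all
      then show ?thesis using \<tau>(1) by simp
    qed (simp add: \<sigma>_def)
    then show "\<sigma> > 1" "\<tau> = \<sigma> ^ 2 \<or> \<tau> * \<sigma> ^ 2 = 1 \<or> \<tau> = 1" by auto
  qed
  define \<rho> where "\<rho> = \<sigma> ^ 4"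
  have \<rho>: "\<rho> > 1" "\<sigma> \<le> \<rho>" using \<sigma> power_increasing[of 1 4 \<sigma>] by (auto simp: \<rho>_def)
  \<comment> \<open>By \<open>far\<close>, \<open>\<bar>\<tau> * n - m\<bar>\<close> is at least
    \<open>c1 * (n + m)\<close>. Half of this absorbs \<open>\<kappa> * ln n\<close>, which is at
    most \<open>c1 / 2 * n\<close> beyond \<open>x0\<close>; the other half exceeds the required
    separations.\<close>
  define c1 where "c1 = (1 - 1 / \<sigma>) / 2 * min \<tau> 1"
  have c1: "c1 > 0" using \<sigma> \<tau>(1) by (simp add: c1_def min_def)
  define c2 where "c2 = (1 - 1 / \<sigma>) / 2"
  have "(1 - t) / 2 > 0 \<and> (1 - t) / 2 \<le> 1" if "0 < t" "t < 1" for t :: real using that by simp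
  from this[of "1 / \<sigma>"] have c2: "c2 > 0" "c2 \<le> 1" using \<sigma> unfolding c2_def by simp_all
  \<comment> \<open>Throughout block \<open>b\<close> the size of \<open>\<kappa> * ln n\<close> is
    \<open>2 * w * b\<close> up to \<open>\<bar>\<kappa>\<bar> * ln \<sigma>\<close>. A quarter
    period of about \<open>w * b\<close> therefore makes it half a period. If
    \<open>\<kappa> = 0\<close> there is no shift to match, and 1 is a default.\<close>
  define w where "w = (if \<kappa> = 0 then 1 else \<bar>\<kappa>\<bar> * ln \<rho> / 2)"
  have w: "w > 0" using \<rho> by (simp add: w_def)
  obtain x0 where x0: "\<And>x. x \<ge> x0 \<Longrightarrow> \<bar>\<kappa> * ln x\<bar> \<le> c1 / 2 * x" "x0 \<ge> 1"
  proof -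
    have "((\<lambda>x. \<kappa> * (ln x / x)) \<longlongrightarrow> \<kappa> * 0) at_top" by (intro tendsto_intros ln_x_over_x_tendsto_0)
    then have "\<forall>\<^sub>F x in at_top. \<bar>\<kappa> * (ln x / x)\<bar> < c1 / 2"
      using c1 tendstoD[of "\<lambda>x. \<kappa> * (ln x / x)" 0 at_top "c1 / 2"] by (simp add: dist_real_def)
    then obtain y where y: "\<And>x. x \<ge> y \<Longrightarrow> \<bar>\<kappa> * (ln x / x)\<bar> < c1 / 2"
      unfolding eventually_at_top_linorder by blast
    have "\<bar>\<kappa> * ln x\<bar> \<le> c1 / 2 * x" if "x \<ge> max 1 y" for x
    proof -
      have "\<bar>\<kappa> * (ln x / x)\<bar> * x \<le> c1 / 2 * x" using y[of x] that by (intro mult_right_mono) auto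
      then show ?thesis using that by (simp add: abs_mult)
    qed
    then show ?thesis using that[of "max 1 y"] by (simp only: max.cobounded1)
  qed
  have rho_lim: "filterlim (\<lambda>b. \<rho> ^ b) at_top sequentially"
    using filterlim_realpow_sequentially_gt1[of \<rho>] \<rho>(1)
    by (intro filterlim_at_infinity_imp_filterlim_at_top) auto
  \<comment> \<open>Blocks before \<open>B k\<close> are withheld from label \<open>k\<close>.
    Beyond it a block is large against \<open>N k\<close> and against
    \<open>\<kappa> * ln n\<close>, its quarter period exceeds \<open>4 * N k\<close>, and the
    periods are short against the block, so that the pattern fills a fixed proportion of it.\<close>
  have "\<exists>B. \<forall>b\<ge>B. x0 \<le> \<rho> ^ b \<and> N k < c1 / 2 * \<rho> ^ b \<and> N k \<le> c2 * \<rho> ^ b \<and>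
          4 * N k + \<bar>\<kappa>\<bar> * ln \<sigma> < w * b \<and> 3 * w * b \<le> (\<sigma> - 1) * \<rho> ^ b / 8" for k
  proof -
    have ev: "\<forall>\<^sub>F b in sequentially. x \<le> \<rho> ^ b" for x
      using rho_lim unfolding filterlim_at_top by blast
    have "filterlim (\<lambda>b. w * real b) at_top sequentially"
      by (intro filterlim_tendsto_pos_mult_at_top[OF tendsto_const w] filterlim_real_sequentially)
    then have e1: "\<forall>\<^sub>F b in sequentially. 4 * N k + \<bar>\<kappa>\<bar> * ln \<sigma> < w * b"
      by (rule filterlim_at_top_dense[THEN iffD1, rule_format])
    have "(\<lambda>b. 3 * w * (real b * (1 / \<rho>) ^ b)) \<longlonglongrightarrow> 3 * w * 0"
      using \<rho> by (intro tendsto_intros powser_times_n_limit_0) auto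
    then have "\<forall>\<^sub>F b in sequentially. 3 * w * (real b * (1 / \<rho>) ^ b) < (\<sigma> - 1) / 8"
      using \<sigma> by (intro order_tendstoD(2)) auto
    then have e2: "\<forall>\<^sub>F b in sequentially. 3 * w * b \<le> (\<sigma> - 1) * \<rho> ^ b / 8"
    proof eventually_elim
      case (elim b)
      have "3 * w * (real b * (1 / \<rho>) ^ b) * \<rho> ^ b \<le> (\<sigma> - 1) / 8 * \<rho> ^ b"
        using elim \<rho> by (intro mult_right_mono) auto
      then show ?case using \<rho> by (simp add: power_divide)
    qed
    have "\<forall>\<^sub>F b in sequentially. x0 \<le> \<rho> ^ b \<and> N k < c1 / 2 * \<rho> ^ b \<and> N k \<le> c2 * \<rho> ^ b \<and>
          4 * N k + \<bar>\<kappa>\<bar> * ln \<sigma> < w * b \<and> 3 * w * b \<le> (\<sigma> - 1) * \<rho> ^ b / 8"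
      using ev[of x0] ev[of "(N k + 1) / (c1 / 2)"] ev[of "N k / c2"] e1 e2
    proof eventually_elim
      case (elim b)
      have "real (N k) + 1 \<le> \<rho> ^ b * (c1 / 2)" using elim(2) c1 by (simp add: pos_divide_le_eq)
      moreover have "real (N k) \<le> \<rho> ^ b * c2" using elim(3) c2 by (simp add: pos_divide_le_eq)
      ultimately show ?case using elim by (simp add: mult.commute)
    qed
    then show ?thesis by (simp add: eventually_sequentially)
  qed
  then obtain B where "\<forall>k. \<forall>b\<ge>B k. x0 \<le> \<rho> ^ b \<and> N k < c1 / 2 * \<rho> ^ b \<and> N k \<le> c2 * \<rho> ^ b \<and>
          4 * N k + \<bar>\<kappa>\<bar> * ln \<sigma> < w * real b \<and> 3 * w * b \<le> (\<sigma> - 1) * \<rho> ^ b / 8"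
    by metis
  then have B: "x0 \<le> \<rho> ^ b" "N k < c1 / 2 * \<rho> ^ b" "N k \<le> c2 * \<rho> ^ b"
    "4 * N k + \<bar>\<kappa>\<bar> * ln \<sigma> < w * real b" "3 * w * b \<le> (\<sigma> - 1) * \<rho> ^ b / 8"
    if "b \<ge> B k" for k b using that by blast+
  \<comment> \<open>The quarter period is rounded down to a multiple of \<open>N k\<close>, so that
    the multiples of \<open>N k\<close> occupy the same residues in every period.\<close>
  define L' where "L' k b = nat \<lfloor>w * b / N k\<rfloor>" for k b :: nat
  define L where "L k b = N k * L' k b" for k b
  have L: "w * b - N k < L k b" "L k b \<le> w * b" for k b :: nat
  proof -
    have "real (L' k b) = of_int \<lfloor>w * b / N k\<rfloor>" unfolding L'_def using w by simp
    then have "w * b / N k - 1 < L' k b" "L' k b \<le> w * b / N k" by linarith+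
    then show "w * b - N k < L k b" "L k b \<le> w * b"
      using N[of k] by (simp_all add: L_def field_simps)
  qed
  define lab where "lab k b \<longleftrightarrow> B k \<le> b \<and> (\<exists>i. b = 2 ^ k * (2 * i + 1))" for k b
  have lab_unique: "k = l" if "lab k b" "lab l b" for k l b
    using that odd_part_unique unfolding lab_def by metis
  define blk where "blk b n \<longleftrightarrow> \<rho> ^ b \<le> real n \<and> real n \<le> \<sigma> * \<rho> ^ b" for b n
  define A where "A k = {n. \<exists>b. lab k b \<and> blk b n \<and> N k dvd n \<and> n mod (4 * L k b) < L k b}" for k
  have far: "\<bar>\<tau> * n - m\<bar> \<ge> c1 * (real n + m)" if "blk b n" "blk c m" "\<tau> \<noteq> 1 \<or> b \<noteq> c" for b c n m
  proof -
    have "min \<tau> 1 * (real n + m) \<le> \<tau> * n + m"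
      using mult_right_mono[of "min \<tau> 1" \<tau> n] mult_right_mono[of "min \<tau> 1" 1 m] by (simp add: algebra_simps)
    then have "(1 - 1 / \<sigma>) / 2 * (min \<tau> 1 * (real n + m)) \<le> (1 - 1 / \<sigma>) / 2 * (\<tau> * n + m)"
      using \<sigma> by (intro mult_left_mono) auto
    also have "\<dots> \<le> \<bar>\<tau> * n - m\<bar>"
      using that \<sigma>\<tau> unfolding blk_def \<rho>_def by (intro geometric_blocks_far[OF \<sigma>, of _ b c]) auto
    finally show ?thesis by (simp add: c1_def mult.assoc)
  qed
  have apart: "\<bar>real n - m\<bar> \<ge> c2 * (real n + m)" if "blk b n" "blk c m" "b \<noteq> c" for b c n m
    using geometric_blocks_far[OF \<sigma>, of 1 b c n m] that unfolding blk_def \<rho>_def c2_def by auto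
  have nb: "real n \<ge> \<rho> ^ b" if "blk b n" for b n using that by (simp add: blk_def)
  have A_pos: "lower_density (A k) > 0" for k
  proof -
    \<comment> \<open>The ratio of two bounds: a block \<open>b\<close> with label \<open>k\<close>
      contains at least \<open>(\<sigma> - 1) / (8 * N k) * \<rho> ^ b\<close> elements of
      \<open>A k\<close>, and \<open>n\<close> is at most
      \<open>\<sigma> * \<rho> ^ (2 ^ (k + 1) + 1) * \<rho> ^ b\<close>.\<close>
    define c where "c = (\<sigma> - 1) / (8 * N k) / (\<sigma> * \<rho> ^ (2 ^ (k + 1) + 1))"
    define M where "M = B k + 2 ^ (k + 1)"
    have "c > 0" using \<sigma> \<rho> N by (auto simp: c_def)
    moreover have "\<forall>\<^sub>F n in sequentially. c * real n \<le> real (card (A k \<inter> {1..n}))"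
      using eventually_ge_at_top[of "nat \<lceil>\<sigma> * \<rho> ^ M\<rceil>"]
    proof eventually_elim
      case (elim n)
      then have n: "\<sigma> * \<rho> ^ M \<le> n" by linarith
      define P where "P j \<longleftrightarrow> \<sigma> * \<rho> ^ j \<le> n" for j :: nat
      obtain j1 where j1: "n < \<rho> ^ j1" using real_arch_pow[OF \<rho>(1)] by blast
      have Pb: "j \<le> j1" if "P j" for j
      proof (rule ccontr)
        assume "\<not> j \<le> j1"
        then have "\<rho> ^ j1 \<le> \<rho> ^ j" using \<rho> by (intro power_increasing) auto
        moreover have "1 * \<rho> ^ j \<le> \<sigma> * \<rho> ^ j" using \<sigma> \<rho> by (intro mult_right_mono) auto
        ultimately show False using that j1 unfolding P_def by linarith
      qed
      define j where "j = (GREATEST j. P j)"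
      have PM: "P M" using n by (simp add: P_def)
      have Pj: "P j" unfolding j_def by (rule GreatestI_nat[of P, OF PM]) (use Pb in auto)
      have Mj: "M \<le> j" unfolding j_def by (rule Greatest_le_nat[of P, OF PM]) (use Pb in auto)
      have "\<not> P (Suc j)" using Greatest_le_nat[of P "Suc j" j1] Pb unfolding j_def by force
      then have nj: "n < \<sigma> * \<rho> ^ Suc j" by (simp add: P_def)
      obtain i where i: "j + 1 - 2 ^ (k + 1) \<le> 2 ^ k * (2 * i + 1)"
        "2 ^ k * (2 * i + 1) < j + 1 - 2 ^ (k + 1) + 2 ^ (k + 1)"
        by (rule odd_part_between)
      \<comment> \<open>A block with label \<open>k\<close> among the last
        \<open>2 ^ (k + 1)\<close> blocks that end by \<open>n\<close>; block \<open>j\<close> is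
        the last of these.\<close>
      define b where "b = 2 ^ k * (2 * i + 1)"
      have b: "b \<le> j" "j + 1 \<le> b + 2 ^ (k + 1)" "B k \<le> b"
        using i Mj unfolding b_def[symmetric] M_def by auto
      have lab: "lab k b" using b by (auto simp: lab_def b_def)
      have wb: "4 * N k + \<bar>\<kappa>\<bar> * ln \<sigma> < w * b" "3 * w * b \<le> (\<sigma> - 1) * \<rho> ^ b / 8" using B(4,5)[OF b(3)] .
      have L'0: "L' k b > 0"
      proof (rule ccontr)
        assume "\<not> L' k b > 0"
        then have "L k b = 0" by (simp add: L_def)
        moreover have "\<bar>\<kappa>\<bar> * ln \<sigma> \<ge> 0" using \<sigma> by simp
        ultimately show False using L(1)[of b k] wb(1) by simp
      qed
      define S where "S = {n. \<rho> ^ b \<le> real n \<and> real n \<le> \<sigma> * \<rho> ^ b \<and> N k dvd n \<and> n mod (4 * (N k * L' k b)) < N k * L' k b}"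
      have bj: "\<sigma> * \<rho> ^ b \<le> n"
      proof -
        have "\<sigma> * \<rho> ^ b \<le> \<sigma> * \<rho> ^ j" using b(1) \<rho> \<sigma> by (intro mult_left_mono power_increasing) auto
        then show ?thesis using Pj by (simp add: P_def)
      qed
      have S_sub: "S \<subseteq> A k \<inter> {1..n}"
      proof
        fix m assume m: "m \<in> S"
        then have "m \<in> A k" using lab unfolding A_def S_def blk_def L_def by blast
        moreover have "1 \<le> \<rho> ^ b" using \<rho> by simp
        then have "real m \<ge> 1" using m by (simp only: S_def mem_Collect_eq) linarith
        moreover have "real m \<le> n" using m bj by (auto simp: S_def)
        ultimately show "m \<in> A k \<inter> {1..n}" by auto
      qed
      have "c * n \<le> c * (\<sigma> * \<rho> ^ Suc j)" using nj \<open>c > 0\<close> by (intro mult_left_mono) auto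
      also have "\<dots> \<le> c * (\<sigma> * \<rho> ^ (b + 2 ^ (k + 1)))"
        using b(2) \<rho> \<sigma> \<open>c > 0\<close> by (intro mult_left_mono power_increasing) auto
      also have "\<dots> \<le> c * (\<sigma> * (\<rho> ^ b * \<rho> ^ (2 ^ (k + 1) + 1)))"
        unfolding power_add[symmetric] using \<rho> \<sigma> \<open>c > 0\<close> by (intro mult_left_mono power_increasing) auto
      also have "\<dots> = (\<sigma> - 1) / (8 * N k) * \<rho> ^ b" using \<sigma> \<rho> by (simp add: c_def)
      also have "\<dots> = (\<sigma> * \<rho> ^ b - \<rho> ^ b) / (4 * N k) - (\<sigma> - 1) * \<rho> ^ b / 8 / N k"
        using N[of k] by (simp add: field_simps)
      also have "\<dots> \<le> (\<sigma> * \<rho> ^ b - \<rho> ^ b) / (4 * N k) - 3 * L' k b"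
      proof -
        have "3 * real (L' k b) = 3 * real (L k b) / N k" using N[of k] by (simp add: L_def)
        also have "\<dots> \<le> (\<sigma> - 1) * \<rho> ^ b / 8 / N k"
          using L(2)[of k b] wb(2) by (intro divide_right_mono) auto
        finally show ?thesis by simp
      qed
      also have "\<dots> \<le> card S"
        unfolding S_def using \<rho> \<sigma> mult_right_mono[of 1 \<sigma> "\<rho> ^ b"]
        by (intro card_arithmetic_pattern N L'0) auto
      also have "\<dots> \<le> card (A k \<inter> {1..n})" using S_sub by (intro of_nat_mono card_mono) auto
      finally show ?case .
    qed
    ultimately show ?thesis by (rule lower_density_pos)
  qed
  have block: "\<exists>b. lab k b \<and> B k \<le> b \<and> blk b n \<and> N k dvd n \<and> n mod (4 * L k b) < L k b" if "n \<in> A k" for n k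
    using that by (auto simp: A_def lab_def)
  show ?thesis
  proof (rule that[of A])
    show "lower_density (A k) > 0" for k by (rule A_pos)
    fix n k assume "n \<in> A k"
    then obtain b where b: "B k \<le> b" "blk b n" using block by blast
    have "c2 * \<rho> ^ b \<le> 1 * \<rho> ^ b" using c2 \<rho> by (intro mult_right_mono) auto
    then show "N k \<le> n" using B(3)[OF b(1)] nb[OF b(2)] by linarith
  next
    fix k l n assume "n \<in> A k" "n \<in> A l"
    then obtain b c where b: "lab k b" "blk b n" and c: "lab l c" "blk c n" using block by meson
    have "\<rho> ^ b > 0" using \<rho> by simp
    then have "real n > 0" using nb[OF b(2)] by linarith
    then have "b = c" using apart[OF b(2) c(2)] mult_pos_pos[OF c2(1), of "real n"] by (cases "b = c") auto
    then show "k = l" using lab_unique b c by blast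
  next
    fix k l n m assume nm: "n \<in> A k" "m \<in> A l" "n < m"
    obtain b where b: "lab k b" "B k \<le> b" "blk b n" "N k dvd n" using block[OF nm(1)] by blast
    obtain c where c: "lab l c" "B l \<le> c" "blk c m" "N l dvd m" using block[OF nm(2)] by blast
    show "N k \<le> m - n \<and> N l \<le> m - n"
    \<comment> \<open>Within one block the spacing comes from divisibility by \<open>N k\<close>,
      across blocks from geometric growth.\<close>
    proof (cases "b = c")
      case True
      then have kl: "k = l" using lab_unique b c by blast
      have "N k dvd m - n" using b(4) c(4) kl by (intro dvd_diff_nat) auto
      then show ?thesis using nm(3) kl by (auto dest: dvd_imp_le)
    next
      case False
      have "c2 * \<rho> ^ b \<le> c2 * (real n + m)" "c2 * \<rho> ^ c \<le> c2 * (real n + m)"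
        using nb[OF b(3)] nb[OF c(3)] c2 by (auto intro!: mult_left_mono)
      moreover have "\<bar>real n - m\<bar> = real (m - n)" using nm(3) by (simp add: of_nat_diff)
      ultimately have "real (N k) \<le> real (m - n)" "real (N l) \<le> real (m - n)"
        using apart[OF b(3) c(3) False] B(3)[OF b(2)] B(3)[OF c(2)] by linarith+
      then show ?thesis by simp
    qed
  next
    fix k l n m assume nm: "n \<in> A k" "m \<in> A l"
    obtain b where b: "lab k b" "B k \<le> b" "blk b n" "n mod (4 * L k b) < L k b" using block[OF nm(1)] by blast
    obtain c where c: "lab l c" "B l \<le> c" "blk c m" "m mod (4 * L l c) < L l c" using block[OF nm(2)] by blast
    show "N k < \<bar>\<tau> * n + \<kappa> * ln n - m\<bar> \<and> N l < \<bar>\<tau> * n + \<kappa> * ln n - m\<bar>"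
    proof (cases "\<tau> \<noteq> 1 \<or> b \<noteq> c")
      case True
      have "x0 \<le> real n" using B(1)[OF b(2)] nb[OF b(3)] by linarith
      then have "\<bar>\<kappa> * ln n\<bar> \<le> c1 / 2 * n" by (rule x0(1))
      moreover have "c1 / 2 * real n \<le> c1 / 2 * (real n + m)" using c1 by (intro mult_left_mono) auto
      moreover have "c1 / 2 * \<rho> ^ b \<le> c1 / 2 * (real n + m)" "c1 / 2 * \<rho> ^ c \<le> c1 / 2 * (real n + m)"
        using nb[OF b(3)] nb[OF c(3)] c1 by (intro mult_left_mono; simp)+
      moreover have "c1 * (real n + m) = c1 / 2 * (real n + m) + c1 / 2 * (real n + m)" by simp
      ultimately show ?thesis
        using far[OF b(3) c(3) True] B(2)[OF b(2)] B(2)[OF c(2)] by linarith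
    next
      case False
      then have t: "\<tau> = 1" "b = c" "\<kappa> \<noteq> 0" using \<tau>(2) by auto
      then have kl: "k = l" using lab_unique b c by blast
      \<comment> \<open>The excess of the shift over \<open>2 * L k b\<close>: the variation of
        \<open>\<kappa> * ln n\<close> over the block, at most
        \<open>\<bar>\<kappa>\<bar> * ln \<sigma>\<close>, and twice the rounding loss below
        \<open>N k\<close>. The term \<open>4 * N k\<close> in the choice of \<open>B\<close> leaves
        \<open>L k b - C\<close> larger than \<open>N k\<close>.\<close>
      define C where "C = 2 * N k + \<bar>\<kappa>\<bar> * ln \<sigma>"
      have C0: "0 \<le> \<bar>\<kappa>\<bar> * ln \<sigma>" using \<sigma> by simp
      have wb: "4 * N k + \<bar>\<kappa>\<bar> * ln \<sigma> < w * b" using B(4)[OF b(2)] .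
      have n: "\<rho> ^ b \<le> n" "n \<le> \<sigma> * \<rho> ^ b" using b(3) by (auto simp: blk_def)
      have r1: "\<rho> ^ b \<ge> 1" using \<rho> by simp
      have "ln (\<rho> ^ b) \<le> ln n" using n(1) r1 by (intro ln_mono) auto
      then have l1: "b * ln \<rho> \<le> ln n" using \<rho> by (simp add: ln_realpow)
      have "ln n \<le> ln (\<sigma> * \<rho> ^ b)" using n r1 by (intro ln_mono) auto
      also have "\<dots> = ln \<sigma> + b * ln \<rho>" using \<rho> \<sigma> by (simp add: ln_mult ln_realpow)
      finally have l2: "ln n \<le> ln \<sigma> + b * ln \<rho>" .
      have "ln n \<ge> 0" using l1 \<rho> by (meson dual_order.trans ln_ge_zero less_imp_le mult_nonneg_nonneg of_nat_0_le_iff)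
      then have s: "\<bar>\<kappa> * ln n\<bar> = \<bar>\<kappa>\<bar> * ln n" by (simp add: abs_mult)
      have 2: "2 * (w * b) = \<bar>\<kappa>\<bar> * (b * ln \<rho>)" using t by (simp add: w_def)
      have s1: "2 * (w * b) \<le> \<bar>\<kappa> * ln n\<bar>" unfolding s 2 using l1 by (intro mult_left_mono) auto
      have "\<bar>\<kappa> * ln n\<bar> \<le> \<bar>\<kappa>\<bar> * (ln \<sigma> + b * ln \<rho>)" unfolding s using l2 by (intro mult_left_mono) auto
      also have "\<dots> = \<bar>\<kappa>\<bar> * ln \<sigma> + 2 * (w * b)" unfolding 2 by (simp add: algebra_simps)
      finally have s2: "\<bar>\<kappa> * ln n\<bar> \<le> \<bar>\<kappa>\<bar> * ln \<sigma> + 2 * (w * b)" .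
      have "real (L k b) - C \<le> \<bar>real n + \<kappa> * ln n - real m\<bar>"
      proof (rule logarithmic_shift_far)
        show "n mod (4 * L k b) < L k b" "m mod (4 * L k b) < L k b" using b c kl t by auto
        show "2 * real (L k b) \<le> \<bar>\<kappa> * ln n\<bar>" using s1 L(2)[of k b] by linarith
        show "\<bar>\<kappa> * ln n\<bar> \<le> 2 * real (L k b) + C" using s2 L(1)[of b k] by (simp add: C_def)
        show "0 \<le> C" using C0 by (simp add: C_def)
        show "C \<le> real (L k b)" using L(1)[of b k] wb by (simp add: C_def)
      qed
      then show ?thesis using L(1)[of b k] wb t(1) kl by (simp add: C_def)
    qed
  qed
qed

section \<open>Orbits in the half-plane coordinate\<close>

text \<open>The Moebius map of the disc onto \<open>Re v > 1 / 2\<close> that takes 0 to 1 and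
  \<alpha> to infinity; \<open>cmod v\<close> is the reciprocal of the distance to \<alpha>. The
  numerator \<alpha> makes it invariant under rotation.\<close>

definition half_plane_coord :: "complex \<Rightarrow> complex \<Rightarrow> complex" where
  "half_plane_coord \<alpha> z = \<alpha> / (\<alpha> - z)"

definition half_plane_inv :: "complex \<Rightarrow> complex \<Rightarrow> complex" where
  "half_plane_inv \<alpha> v = \<alpha> * (1 - 1 / v)"

text \<open>In the coordinate \<open>z / \<alpha> = (v - 1) / v\<close>, so this translates the disc
  condition \<open>cmod z < 1\<close> into the half-plane condition.\<close>

lemma norm_minus_one_less_iff: "cmod (v - 1) < cmod v \<longleftrightarrow> Re v > 1 / 2"
proof -
  have "cmod (v - 1) < cmod v \<longleftrightarrow> (cmod (v - 1))\<^sup>2 < (cmod v)\<^sup>2"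
    by (simp add: power_mono_iff flip: not_le)
  also have "\<dots> \<longleftrightarrow> Re v > 1 / 2"
    unfolding cmod_power2 by (simp add: power2_eq_square algebra_simps)
  finally show ?thesis .
qed

lemma half_plane_inv_in_disc:
  assumes "cmod \<alpha> = 1" "Re v > 1 / 2"
  shows "half_plane_inv \<alpha> v \<in> unit_disc"
proof -
  have v: "v \<noteq> 0" using assms(2) by auto
  have "1 - 1 / v = (v - 1) / v" using v by (simp add: field_simps)
  then have "cmod (half_plane_inv \<alpha> v) = cmod (v - 1) / cmod v"
    using assms(1) by (simp add: half_plane_inv_def norm_mult norm_divide)
  then show ?thesis using norm_minus_one_less_iff[of v] assms(2) v by simp
qed

lemma half_plane_coord_inv:
  assumes "cmod \<alpha> = 1" "v \<noteq> 0"
  shows "half_plane_coord \<alpha> (half_plane_inv \<alpha> v) = v"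
proof -
  have "\<alpha> - half_plane_inv \<alpha> v = \<alpha> / v" by (simp add: half_plane_inv_def algebra_simps)
  moreover have "\<alpha> \<noteq> 0" using assms(1) by auto
  ultimately show ?thesis using assms(2) by (simp add: half_plane_coord_def)
qed

lemma half_plane_inv_coord:
  assumes "cmod \<alpha> = 1" "z \<noteq> \<alpha>"
  shows "half_plane_inv \<alpha> (half_plane_coord \<alpha> z) = z"
proof -
  have "\<alpha> \<noteq> 0" using assms(1) by auto
  then show ?thesis using assms(2) by (simp add: half_plane_coord_def half_plane_inv_def field_simps)
qed

lemma half_plane_coord_Re:
  assumes "cmod \<alpha> = 1" "z \<in> unit_disc"
  shows "Re (half_plane_coord \<alpha> z) > 1 / 2"
proof -
  have nz: "\<alpha> - z \<noteq> 0" using assms by auto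
  have "half_plane_coord \<alpha> z - 1 = z / (\<alpha> - z)"
    using nz by (simp add: half_plane_coord_def field_simps)
  then have "cmod (half_plane_coord \<alpha> z - 1) = cmod z / cmod (\<alpha> - z)" by (simp add: norm_divide)
  moreover have "cmod (half_plane_coord \<alpha> z) = 1 / cmod (\<alpha> - z)"
    using assms(1) by (simp add: half_plane_coord_def norm_divide)
  ultimately show ?thesis
    using norm_minus_one_less_iff[of "half_plane_coord \<alpha> z"] assms(2) nz by (simp add: divide_strict_right_mono)
qed

lemma norm_half_plane_coord: "cmod \<alpha> = 1 \<Longrightarrow> cmod (half_plane_coord \<alpha> z) = 1 / dist z \<alpha>"
  by (simp add: half_plane_coord_def norm_divide dist_norm norm_minus_commute)

lemma holomorphic_half_plane_coord:
  "cmod \<alpha> = 1 \<Longrightarrow> half_plane_coord \<alpha> holomorphic_on unit_disc"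
  unfolding half_plane_coord_def by (intro holomorphic_intros) auto

lemma holomorphic_half_plane_inv:
  "half_plane_inv \<alpha> holomorphic_on {v. Re v > 1 / 2}"
  unfolding half_plane_inv_def by (intro holomorphic_intros) auto

section \<open>Boundary expansions rewritten in the half-plane coordinate\<close>

lemma reciprocal_cubic_expansion:
  fixes u g p B :: complex
  defines "M \<equiv> cmod p + cmod B + 1"
  assumes u: "u \<noteq> 0" "cmod u \<le> 1" "M * cmod u \<le> 1 / 2"
    and e: "0 < e" "e \<le> 1" and g: "cmod g \<le> cmod u powr (3 + e)"
  shows "cmod (1 / (u - p * u^2 + B * u^3 + g) - (1 / u + p + (p^2 - B) * u))
    \<le> (1 + 2 * M^2 + 2 * M^3) * cmod u powr (1 + e)"
proof -
  define t where "t = cmod u"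
  have t: "t > 0" "t \<le> 1" using u by (auto simp: t_def)
  \<comment> \<open>The denominator is \<open>u * (1 - x)\<close> with \<open>x = p * u + y\<close>
    and \<open>y = O(u^2)\<close>. In \<open>1 / (1 - x) = 1 + x + x^2 + x^3 / (1 - x)\<close> the
    terms \<open>p * u\<close> and \<open>(p^2 - B) * u^2\<close> are kept; the rest, divided by
    \<open>u\<close>, has order \<open>cmod u powr (1 + e)\<close>.\<close>
  define y where "y = - B * u^2 - g / u"
  define x where "x = p * u + y"
  have M: "M \<ge> 1" by (simp add: M_def)
  have gu: "cmod (g / u) \<le> t powr (2 + e)"
  proof -
    have "t powr (3 + e) = t powr (2 + e) * t powr 1"
      using powr_add[of t "2 + e" 1] by (simp only: add.commute[of _ 1] add.assoc[symmetric]) simp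
    then have "cmod g \<le> t powr (2 + e) * t" using g t by (simp add: t_def)
    then show ?thesis using t by (simp add: norm_divide t_def divide_le_eq)
  qed
  have t3: "t ^ 3 \<le> t powr (2 + e)"
  proof -
    have "t powr 3 \<le> t powr (2 + e)" using t e by (intro powr_mono') auto
    then show ?thesis using t by simp
  qed
  have t2: "t powr (2 + e) \<le> t ^ 2"
  proof -
    have "t powr (2 + e) \<le> t powr 2" using t e by (intro powr_mono') auto
    then show ?thesis using t by simp
  qed
  have y: "cmod y \<le> (cmod B + 1) * t^2"
  proof -
    have "cmod y \<le> cmod (B * u^2) + cmod (g / u)" unfolding y_def using norm_triangle_ineq4[of "- B * u^2" "g / u"] by simp
    also have "\<dots> \<le> cmod B * t^2 + t^2" using gu t2 by (simp add: norm_mult norm_power t_def)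
    finally show ?thesis by (simp add: algebra_simps)
  qed
  have tt: "t^2 \<le> t" using t by (simp add: power2_eq_square mult_left_le)
  have x: "cmod x \<le> M * t"
  proof -
    have "cmod x \<le> cmod p * t + cmod y" unfolding x_def t_def using norm_triangle_ineq by (metis norm_mult)
    also have "\<dots> \<le> cmod p * t + (cmod B + 1) * t"
      using y mult_left_mono[OF tt, of "cmod B + 1"] by simp
    finally show ?thesis by (simp add: M_def algebra_simps)
  qed
  then have x2: "cmod x \<le> 1 / 2" using u(3) by (simp add: t_def)
  then have x1: "cmod (1 - x) \<ge> 1 / 2" using norm_triangle_ineq2[of 1 x] by simp
  then have nz: "1 - x \<noteq> 0" by auto
  have den: "u - p * u^2 + B * u^3 + g = u * (1 - x)"
    using u(1) by (simp add: x_def y_def algebra_simps power2_eq_square power3_eq_cube)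
  have inv: "1 / (1 - x) = 1 + x + x^2 + x^3 / (1 - x)"
    using nz by (simp add: field_simps power2_eq_square power3_eq_cube)
  have "u * (1 / (u * (1 - x)) - (1 / u + p + (p^2 - B) * u))
      = 1 / (1 - x) - (1 + p * u + (p^2 - B) * u^2)"
  proof -
    have "u * (1 / (u * (1 - x))) = 1 / (1 - x)" "u * (1 / u) = 1" using u(1) by simp_all
    then show ?thesis by (simp only: right_diff_distrib distrib_left) (simp add: algebra_simps power2_eq_square)
  qed
  also have "\<dots> = - (g / u) + y * (2 * p * u + y) + x^3 / (1 - x)"
    unfolding inv by (simp add: x_def y_def algebra_simps power2_eq_square)
  finally have eq: "u * (1 / (u * (1 - x)) - (1 / u + p + (p^2 - B) * u))
      = - (g / u) + y * (2 * p * u + y) + x^3 / (1 - x)" .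
  have b2: "cmod (y * (2 * p * u + y)) \<le> 2 * M^2 * t powr (2 + e)"
  proof -
    have "cmod y \<le> M * t^2" using y by (rule order_trans) (auto simp: M_def intro!: mult_right_mono)
    moreover have "cmod (2 * p * u + y) \<le> 2 * M * t"
    proof -
      have "cmod (2 * p * u + y) = cmod (p * u + x)" by (simp add: x_def algebra_simps)
      also have "\<dots> \<le> cmod p * t + M * t" using x unfolding t_def
        by (intro norm_triangle_mono) (auto simp: norm_mult)
      also have "cmod p * t \<le> M * t" using t by (intro mult_right_mono) (auto simp: M_def)
      finally show ?thesis by simp
    qed
    ultimately have "cmod (y * (2 * p * u + y)) \<le> (M * t^2) * (2 * M * t)"
      unfolding norm_mult using M t by (intro mult_mono) auto
    also have "\<dots> = 2 * M^2 * t^3" by (simp add: power2_eq_square power3_eq_cube)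
    also have "\<dots> \<le> 2 * M^2 * t powr (2 + e)" using t3 by (intro mult_left_mono) auto
    finally show ?thesis .
  qed
  have b3: "cmod (x^3 / (1 - x)) \<le> 2 * M^3 * t powr (2 + e)"
  proof -
    have "cmod (x^3 / (1 - x)) \<le> (M * t)^3 / (1/2)"
      unfolding norm_divide norm_power using x x1 M t by (intro frac_le power_mono) auto
    also have "\<dots> = 2 * M^3 * t^3" by (simp add: power_mult_distrib)
    also have "\<dots> \<le> 2 * M^3 * t powr (2 + e)" using t3 M by (intro mult_left_mono) auto
    finally show ?thesis .
  qed
  have "cmod (u * (1 / (u * (1 - x)) - (1 / u + p + (p^2 - B) * u)))
      \<le> t powr (2 + e) + 2 * M^2 * t powr (2 + e) + 2 * M^3 * t powr (2 + e)"
    unfolding eq using gu b2 b3 by (intro norm_triangle_mono) auto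
  also have "\<dots> = t * ((1 + 2 * M^2 + 2 * M^3) * t powr (1 + e))"
  proof -
    have "t powr (2 + e) = t powr 1 * t powr (1 + e)"
      using powr_add[of t 1 "1 + e"] by (simp only: add.assoc[symmetric]) simp
    then show ?thesis using t by (simp add: algebra_simps)
  qed
  finally have "t * cmod (1 / (u * (1 - x)) - (1 / u + p + (p^2 - B) * u))
     \<le> t * ((1 + 2 * M^2 + 2 * M^3) * t powr (1 + e))" by (simp only: norm_mult t_def)
  then show ?thesis using t unfolding den t_def by simp
qed

lemma reciprocal_linear_expansion:
  fixes u g :: complex and d e :: real
  assumes u: "u \<noteq> 0" and d: "d > 0" and g: "cmod g \<le> cmod u powr (1 + e)" and small: "cmod u powr e \<le> d / 2"
  shows "cmod (1 / (of_real d * u + g) - 1 / (of_real d * u)) \<le> 2 / d^2 * cmod u powr (e - 1)"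
proof -
  define t where "t = cmod u"
  have t: "t > 0" using u by (simp add: t_def)
  have g': "cmod g \<le> t * t powr e" using g t by (simp add: t_def powr_add)
  also have "\<dots> \<le> t * (d / 2)" using small t by (intro mult_left_mono) (auto simp: t_def)
  finally have gd: "cmod g \<le> d * t / 2" by (simp add: mult.commute)
  have "cmod (of_real d * u) = d * t" using d by (simp add: norm_mult t_def)
  then have low: "cmod (of_real d * u + g) \<ge> d * t / 2"
    using norm_triangle_ineq2[of "of_real d * u" "- g"] gd by simp
  have nz: "of_real d * u + g \<noteq> 0" "of_real d * u \<noteq> 0"
    using low mult_pos_pos[OF d t] d u by auto
  have "1 / (of_real d * u + g) - 1 / (of_real d * u) = - g / ((of_real d * u + g) * (of_real d * u))"
    using nz by (simp add: field_simps)
  then have "cmod (1 / (of_real d * u + g) - 1 / (of_real d * u))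
      = cmod g / (cmod (of_real d * u + g) * (d * t))"
    using \<open>cmod (of_real d * u) = d * t\<close> by (simp add: norm_divide norm_mult)
  also have "\<dots> \<le> (t * t powr e) / ((d * t / 2) * (d * t))"
    using g' low d t by (intro frac_le mult_right_mono mult_pos_pos) auto
  also have "\<dots> = 2 / d^2 * (t powr e / t)" using d t by (simp add: field_simps power2_eq_square)
  also have "t powr e / t = t powr (e - 1)" using t by (simp add: powr_diff)
  finally show ?thesis by (simp add: t_def)
qed

text \<open>The expansion \<open>v + p + q / v\<close> at infinity with explicit constants, so that
  one bound can be applied at every point of an orbit. The restriction \<open>e \<le> 1\<close>
  reflects the term of order \<open>cmod v powr (-2)\<close> left by inverting the cubic
  expansion.\<close>

definition parabolic_estimate ::
    "(complex \<Rightarrow> complex) \<Rightarrow> complex \<Rightarrow> complex \<Rightarrow> complex \<Rightarrow> real \<Rightarrow> real \<Rightarrow> real \<Rightarrow> bool" where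
  "parabolic_estimate \<phi> \<alpha> p q C e R \<longleftrightarrow> 0 \<le> C \<and> 0 < e \<and> e \<le> 1 \<and> 1 \<le> R \<and>
     (\<forall>z\<in>unit_disc. R \<le> cmod (half_plane_coord \<alpha> z) \<longrightarrow>
        cmod (half_plane_coord \<alpha> (\<phi> z) - (half_plane_coord \<alpha> z + p + q / half_plane_coord \<alpha> z))
          \<le> C * cmod (half_plane_coord \<alpha> z) powr (- 1 - e))"

definition hyperbolic_estimate ::
    "(complex \<Rightarrow> complex) \<Rightarrow> complex \<Rightarrow> real \<Rightarrow> real \<Rightarrow> real \<Rightarrow> real \<Rightarrow> bool" where
  "hyperbolic_estimate \<phi> \<alpha> L C e R \<longleftrightarrow> 0 \<le> C \<and> 0 < e \<and> 1 \<le> R \<and>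
     (\<forall>z\<in>unit_disc. R \<le> cmod (half_plane_coord \<alpha> z) \<longrightarrow>
        cmod (half_plane_coord \<alpha> (\<phi> z) - of_real L * half_plane_coord \<alpha> z)
          \<le> C * cmod (half_plane_coord \<alpha> z) powr (1 - e))"

lemma parabolic_estimate_mono:
  assumes "parabolic_estimate \<phi> \<alpha> p q C e R" "C \<le> C'" "0 < e'" "e' \<le> e" "R \<le> R'"
  shows "parabolic_estimate \<phi> \<alpha> p q C' e' R'"
  unfolding parabolic_estimate_def
proof (intro conjI ballI impI)
  fix z assume z: "z \<in> unit_disc" "R' \<le> cmod (half_plane_coord \<alpha> z)"
  let ?v = "cmod (half_plane_coord \<alpha> z)"
  have "?v \<ge> 1" using z(2) assms(1,5) by (auto simp: parabolic_estimate_def)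
  then have "?v powr (- 1 - e) \<le> ?v powr (- 1 - e')" using assms(4) by (intro powr_mono) auto
  then have "C * ?v powr (- 1 - e) \<le> C' * ?v powr (- 1 - e')"
    using assms(1,2) by (intro mult_mono) (auto simp: parabolic_estimate_def)
  then show "cmod (half_plane_coord \<alpha> (\<phi> z) - (half_plane_coord \<alpha> z + p + q / half_plane_coord \<alpha> z))
      \<le> C' * ?v powr (- 1 - e')"
    using z assms(1,5) unfolding parabolic_estimate_def by force
qed (use assms in \<open>auto simp: parabolic_estimate_def\<close>)

lemma small_o_powr_bound:
  fixes f :: "complex \<Rightarrow> complex"
  assumes "f \<in> o[at \<alpha> within unit_disc](\<lambda>z. of_real (cmod (z - \<alpha>) powr s))"
  obtains \<delta> where "\<delta> > 0" "\<And>z. z \<in> unit_disc \<Longrightarrow> z \<noteq> \<alpha> \<Longrightarrow> cmod (z - \<alpha>) < \<delta> \<Longrightarrow> cmod (f z) \<le> cmod (z - \<alpha>) powr s"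
proof -
  have "\<forall>\<^sub>F z in at \<alpha> within unit_disc. cmod (f z) \<le> 1 * cmod (complex_of_real (cmod (z - \<alpha>) powr s))"
    by (rule landau_o.smallD[OF assms]) simp
  then obtain \<delta> where "\<delta> > 0" "\<forall>z\<in>unit_disc. z \<noteq> \<alpha> \<and> dist z \<alpha> < \<delta> \<longrightarrow> cmod (f z) \<le> cmod (z - \<alpha>) powr s"
    unfolding eventually_at by auto
  then show ?thesis using that by (auto simp: dist_norm)
qed

text \<open>With \<open>u = (\<alpha> - z) / \<alpha> = 1 / v\<close> the expansion becomes
  \<open>(\<alpha> - \<phi> z) / \<alpha> = u - p * u^2 + B * u^3 + g\<close> for
  \<open>p = \<alpha> * a / 2\<close> and \<open>B = \<alpha>^2 * b / 6\<close>. Taking reciprocals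
  gives \<open>v + p + (p^2 - B) / v\<close>, hence \<open>q = p^2 - B\<close>.\<close>

lemma parabolic_expansion_estimate:
  assumes \<alpha>: "cmod \<alpha> = 1" and exp: "parabolic_expansion \<phi> \<alpha> a b"
  obtains C e R where "parabolic_estimate \<phi> \<alpha> (\<alpha> * a / 2) ((\<alpha> * a / 2)^2 - \<alpha>^2 * b / 6) C e R"
proof -
  obtain \<epsilon> where \<epsilon>: "\<epsilon> > 0" and o: "(\<lambda>z. \<phi> z - (\<alpha> + (z - \<alpha>) + a / 2 * (z - \<alpha>)^2 + b / fact 3 * (z - \<alpha>)^3))
        \<in> o[at \<alpha> within unit_disc](\<lambda>z. of_real (norm (z - \<alpha>) powr (3 + \<epsilon>)))"
    using exp unfolding parabolic_expansion_def by blast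
  define \<gamma> where "\<gamma> z = \<phi> z - (\<alpha> + (z - \<alpha>) + a / 2 * (z - \<alpha>)^2 + b / fact 3 * (z - \<alpha>)^3)" for z
  obtain \<delta> where \<delta>: "\<delta> > 0" "\<And>z. z \<in> unit_disc \<Longrightarrow> z \<noteq> \<alpha> \<Longrightarrow> cmod (z - \<alpha>) < \<delta> \<Longrightarrow> cmod (\<gamma> z) \<le> cmod (z - \<alpha>) powr (3 + \<epsilon>)"
    using small_o_powr_bound[OF o] unfolding \<gamma>_def by metis
  define e where "e = min \<epsilon> 1"
  have e: "0 < e" "e \<le> 1" using \<epsilon> by (auto simp: e_def)
  define p B where "p = \<alpha> * a / 2" and "B = \<alpha>^2 * b / 6"
  define M where "M = cmod p + cmod B + 1"
  have M: "M > 0" by (simp add: M_def add_nonneg_pos)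
  \<comment> \<open>For \<open>cmod v \<ge> R\<close> one has \<open>cmod u \<le> 1\<close>,
    \<open>2 * M * cmod u \<le> 1\<close> and \<open>cmod u < \<delta>\<close>; the
    \<open>+ 1\<close> makes the last inequality strict.\<close>
  define R where "R = max (2 * M) (max 1 (1 / \<delta> + 1))"
  have a0: "\<alpha> \<noteq> 0" using \<alpha> by auto
  have "parabolic_estimate \<phi> \<alpha> p (p^2 - B) (1 + 2 * M^2 + 2 * M^3) e R"
    unfolding parabolic_estimate_def
  proof (intro conjI ballI impI)
    fix z assume z: "z \<in> unit_disc" and R: "R \<le> cmod (half_plane_coord \<alpha> z)"
    have nz: "z \<noteq> \<alpha>" using z \<alpha> by auto
    define u where "u = (\<alpha> - z) / \<alpha>"
    have u0: "u \<noteq> 0" using nz a0 by (simp add: u_def)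
    have v: "half_plane_coord \<alpha> z = 1 / u" by (simp add: u_def half_plane_coord_def)
    have cu: "cmod u = cmod (z - \<alpha>)" using \<alpha> by (simp add: u_def norm_divide norm_minus_commute)
    have u1: "cmod u > 0" using u0 by simp
    have R': "R * cmod u \<le> 1" using R u1 unfolding v by (simp add: norm_divide pos_le_divide_eq)
    have le: "x * cmod u \<le> 1" if "x \<le> R" for x
      using mult_right_mono[OF that norm_ge_zero[of u]] R' by linarith
    have c1: "cmod u \<le> 1" "2 * M * cmod u \<le> 1" "(1 / \<delta> + 1) * cmod u \<le> 1"
      using le[of 1] le[of "2 * M"] le[of "1 / \<delta> + 1"] unfolding R_def by (simp_all only: max.cobounded1 max.coboundedI2 mult_1 simp_thms max.coboundedI1)
    have "1 / \<delta> * cmod u < (1 / \<delta> + 1) * cmod u" using u1 by (simp add: algebra_simps)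
    then have "1 / \<delta> * cmod u < 1" using c1(3) by linarith
    then have ud: "cmod u < \<delta>" using \<delta>(1) by (simp add: divide_less_eq)
    define g where "g = - \<gamma> z / \<alpha>"
    have "cmod g = cmod (\<gamma> z)" using \<alpha> by (simp add: g_def norm_divide)
    also have "\<dots> \<le> cmod u powr (3 + \<epsilon>)" unfolding cu using \<delta>(2)[OF z nz] ud unfolding cu by blast
    also have "\<dots> \<le> cmod u powr (3 + e)" using c1(1) by (intro powr_mono') (auto simp: e_def)
    finally have g: "cmod g \<le> cmod u powr (3 + e)" .
    have zu: "z - \<alpha> = - \<alpha> * u" using a0 by (simp add: u_def)
    have "\<alpha> - \<phi> z = \<alpha> * (u - p * u^2 + B * u^3 + g)"
    proof -
      have "\<phi> z = \<gamma> z + (\<alpha> + (z - \<alpha>) + a / 2 * (z - \<alpha>)^2 + b / fact 3 * (z - \<alpha>)^3)" by (simp add: \<gamma>_def)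
      moreover have "\<alpha> * g = - \<gamma> z" using a0 by (simp add: g_def)
      ultimately show ?thesis unfolding zu
        by (simp add: p_def B_def algebra_simps power2_eq_square power3_eq_cube fact_numeral)
    qed
    then have v': "half_plane_coord \<alpha> (\<phi> z) = 1 / (u - p * u^2 + B * u^3 + g)"
      using a0 by (simp add: half_plane_coord_def)
    have pw: "cmod (1 / u) powr (- 1 - e) = cmod u powr (1 + e)"
      using u1 powr_minus_divide[of "cmod u" "1 + e"] powr_minus_divide[of "cmod u" "1 - e"]
      by (simp add: norm_divide powr_divide powr_minus_divide powr_diff powr_add)
    have "cmod (1 / (u - p * u^2 + B * u^3 + g) - (1 / u + p + (p^2 - B) * u))
       \<le> (1 + 2 * M^2 + 2 * M^3) * cmod u powr (1 + e)"
      unfolding M_def using c1(2) by (intro reciprocal_cubic_expansion u0 c1(1) e g) (simp add: M_def algebra_simps)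
    then show "cmod (half_plane_coord \<alpha> (\<phi> z) - (half_plane_coord \<alpha> z + p + (p^2 - B) / half_plane_coord \<alpha> z))
        \<le> (1 + 2 * M^2 + 2 * M^3) * cmod (half_plane_coord \<alpha> z) powr (- 1 - e)"
      unfolding v v' pw using u0 by simp
  qed (use e M in \<open>auto simp: R_def\<close>)
  then show ?thesis using that unfolding p_def B_def by blast
qed

lemma hyperbolic_expansion_estimate:
  assumes \<alpha>: "cmod \<alpha> = 1" and d: "0 < d" and exp: "hyperbolic_expansion \<phi> \<alpha> (of_real d)"
  obtains C e R where "hyperbolic_estimate \<phi> \<alpha> (1 / d) C e R"
proof -
  obtain e where e: "e > 0" and o: "(\<lambda>z. \<phi> z - (\<alpha> + of_real d * (z - \<alpha>)))
        \<in> o[at \<alpha> within unit_disc](\<lambda>z. of_real (norm (z - \<alpha>) powr (1 + e)))"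
    using exp unfolding hyperbolic_expansion_def by blast
  define \<gamma> where "\<gamma> z = \<phi> z - (\<alpha> + of_real d * (z - \<alpha>))" for z
  obtain \<delta> where \<delta>: "\<delta> > 0" "\<And>z. z \<in> unit_disc \<Longrightarrow> z \<noteq> \<alpha> \<Longrightarrow> cmod (z - \<alpha>) < \<delta> \<Longrightarrow> cmod (\<gamma> z) \<le> cmod (z - \<alpha>) powr (1 + e)"
    using small_o_powr_bound[OF o] unfolding \<gamma>_def by metis
  \<comment> \<open>\<open>cmod u \<le> r\<close> gives \<open>cmod u powr e \<le> d / 2\<close>,
    which keeps the remainder below half of the linear term.\<close>
  define r where "r = (d / 2) powr (1 / e)"
  have r: "r > 0" using d by (simp add: r_def)
  define R where "R = max 1 (max (1 / r) (1 / \<delta> + 1))"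
  have a0: "\<alpha> \<noteq> 0" using \<alpha> by auto
  have "hyperbolic_estimate \<phi> \<alpha> (1 / d) (2 / d^2) e R"
    unfolding hyperbolic_estimate_def
  proof (intro conjI ballI impI)
    fix z assume z: "z \<in> unit_disc" and R: "R \<le> cmod (half_plane_coord \<alpha> z)"
    have nz: "z \<noteq> \<alpha>" using z \<alpha> by auto
    define u where "u = (\<alpha> - z) / \<alpha>"
    have u0: "u \<noteq> 0" using nz a0 by (simp add: u_def)
    have v: "half_plane_coord \<alpha> z = 1 / u" by (simp add: u_def half_plane_coord_def)
    have cu: "cmod u = cmod (z - \<alpha>)" using \<alpha> by (simp add: u_def norm_divide norm_minus_commute)
    have u1: "cmod u > 0" using u0 by simp
    have R': "R * cmod u \<le> 1" using R u1 unfolding v by (simp add: norm_divide pos_le_divide_eq)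
    have le: "x * cmod u \<le> 1" if "x \<le> R" for x
      using mult_right_mono[OF that norm_ge_zero[of u]] R' by linarith
    have c1: "1 / r * cmod u \<le> 1" "(1 / \<delta> + 1) * cmod u \<le> 1"
      using le[of "1 / r"] le[of "1 / \<delta> + 1"] unfolding R_def by (simp_all only: max.cobounded1 max.cobounded2 max.coboundedI2 simp_thms max.coboundedI1)
    have "1 / \<delta> * cmod u < (1 / \<delta> + 1) * cmod u" using u1 by (simp add: algebra_simps)
    then have "1 / \<delta> * cmod u < 1" using c1(2) by linarith
    then have ud: "cmod u < \<delta>" using \<delta>(1) by (simp add: divide_less_eq)
    have "cmod u \<le> r" using c1(1) r by (simp add: divide_le_eq)
    then have "cmod u powr e \<le> r powr e" using e by (intro powr_mono2) auto
    also have "\<dots> = d / 2" using e d by (simp add: r_def powr_powr)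
    finally have small: "cmod u powr e \<le> d / 2" .
    define g where "g = - \<gamma> z / \<alpha>"
    have "cmod g = cmod (\<gamma> z)" using \<alpha> by (simp add: g_def norm_divide)
    also have "\<dots> \<le> cmod u powr (1 + e)" unfolding cu using \<delta>(2)[OF z nz] ud unfolding cu by blast
    finally have g: "cmod g \<le> cmod u powr (1 + e)" .
    have zu: "z - \<alpha> = - \<alpha> * u" using a0 by (simp add: u_def)
    have "\<alpha> - \<phi> z = \<alpha> * (of_real d * u + g)"
    proof -
      have "\<phi> z = \<gamma> z + (\<alpha> + of_real d * (z - \<alpha>))" by (simp add: \<gamma>_def)
      moreover have "\<alpha> * g = - \<gamma> z" using a0 by (simp add: g_def)
      ultimately show ?thesis unfolding zu by (simp add: algebra_simps)
    qed
    then have v': "half_plane_coord \<alpha> (\<phi> z) = 1 / (of_real d * u + g)"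
      using a0 by (simp add: half_plane_coord_def)
    have pw: "cmod (1 / u) powr (1 - e) = cmod u powr (e - 1)"
      using u1 powr_minus_divide[of "cmod u" "1 + e"] powr_minus_divide[of "cmod u" "1 - e"]
      by (simp add: norm_divide powr_divide powr_minus_divide powr_diff powr_add)
    show "cmod (half_plane_coord \<alpha> (\<phi> z) - of_real (1 / d) * half_plane_coord \<alpha> z)
        \<le> 2 / d^2 * cmod (half_plane_coord \<alpha> z) powr (1 - e)"
      using reciprocal_linear_expansion[OF u0 d g small] unfolding v v' pw by simp
  qed (use e in \<open>auto simp: R_def\<close>)
  then show ?thesis using that by blast
qed

section \<open>Orbits of perturbed recursions\<close>

lemma hyperbolic_orbit:
  fixes L C e R0 \<delta> :: real
  assumes L: "L > 1" and C: "C \<ge> 0" and e: "e > 0" and \<delta>: "0 < \<delta>" "\<delta> \<le> 1 / 2"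
  obtains R where "R \<ge> 1" and
    "\<And>(v :: nat \<Rightarrow> complex) n. (\<And>n. R0 \<le> cmod (v n) \<Longrightarrow> cmod (v (Suc n) - of_real L * v n) \<le> C * cmod (v n) powr (1 - e)) \<Longrightarrow>
       R \<le> cmod (v 0) \<Longrightarrow> cmod (v n - of_real (L ^ n) * v 0) \<le> \<delta> * (L ^ n * cmod (v 0))"
proof -
  \<comment> \<open>At step \<open>n\<close> the orbit has size comparable to
    \<open>L ^ n * x\<close> with \<open>x = cmod (v 0)\<close>, so the relative error made there is
    of order \<open>\<theta> ^ n * x powr (- e)\<close>: a geometric series whose sum is small once
    \<open>x\<close> is large.\<close>
  define \<theta> where "\<theta> = L powr (- e)"
  have \<theta>: "0 < \<theta>" "\<theta> < 1" using L e powr_less_mono[of "- e" 0 L] by (auto simp: \<theta>_def)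
  have "((\<lambda>x. 2 * C * x powr (- e)) \<longlongrightarrow> 2 * C * 0) at_top"
    using e by (intro tendsto_intros tendsto_neg_powr filterlim_ident) auto
  then have "\<forall>\<^sub>F x in at_top. 2 * C * x powr (- e) < L * \<delta> * (1 - \<theta>)"
    using L \<delta> \<theta> by (intro order_tendstoD(2)) auto
  then obtain r where r: "\<And>x. x \<ge> r \<Longrightarrow> 2 * C * x powr (- e) < L * \<delta> * (1 - \<theta>)"
    unfolding eventually_at_top_linorder by blast
  define R where "R = max 1 (2 * max R0 r)"
  have R: "R \<ge> 1" "R / 2 \<ge> R0" "R / 2 \<ge> r" by (auto simp: R_def)
  show ?thesis
  proof (rule that[OF R(1)])
    fix v :: "nat \<Rightarrow> complex" and n
    assume step: "\<And>n. R0 \<le> cmod (v n) \<Longrightarrow> cmod (v (Suc n) - of_real L * v n) \<le> C * cmod (v n) powr (1 - e)"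
      and v0: "R \<le> cmod (v 0)"
    define x where "x = cmod (v 0)"
    have x: "x \<ge> R" "x > 0" using v0 R by (auto simp: x_def)
    \<comment> \<open>\<open>1 - \<theta> ^ n\<close> is the share of the tolerance \<delta> spent
      so far, and step \<open>n\<close> spends \<open>(1 - \<theta>) * \<theta> ^ n\<close> more.
      The bound \<open>\<delta> \<le> 1 / 2\<close> keeps \<open>cmod (v n)\<close> within a factor
      2 of \<open>L ^ n * x\<close>.\<close>
    have "cmod (v n - of_real (L ^ n) * v 0) \<le> \<delta> * (1 - \<theta> ^ n) * (L ^ n * x)"
    proof (induction n)
      case (Suc n)
      have Lx: "L ^ n * x > 0" using L x by simp
      have Ln: "cmod (of_real (L ^ n) * v 0) = L ^ n * x" using L by (simp add: norm_mult norm_power x_def)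
      have "\<delta> * (1 - \<theta> ^ n) \<le> \<delta> * 1" using \<delta> \<theta> by (intro mult_left_mono) auto
      then have "\<delta> * (1 - \<theta> ^ n) * (L ^ n * x) \<le> 1 / 2 * (L ^ n * x)"
        using \<delta>(2) Lx by (intro mult_right_mono) linarith+
      then have d: "cmod (v n - of_real (L ^ n) * v 0) \<le> L ^ n * x / 2" using Suc.IH by simp
      have low: "cmod (v n) \<ge> L ^ n * x / 2"
        using norm_triangle_ineq2[of "of_real (L ^ n) * v 0" "of_real (L ^ n) * v 0 - v n"] d Ln
        by (simp add: norm_minus_commute)
      have up: "cmod (v n) \<le> 2 * (L ^ n * x)"
        using norm_triangle_ineq[of "v n - of_real (L ^ n) * v 0" "of_real (L ^ n) * v 0"] d Ln Lx by simp
      have Lx2: "L ^ n * x \<ge> x" using L x mult_right_mono[of 1 "L ^ n" x] by simp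
      then have v1: "cmod (v n) \<ge> x / 2" using low by simp
      then have vn: "cmod (v n) > 0" using x by linarith
      have "cmod (v (Suc n) - of_real L * v n) \<le> C * cmod (v n) powr (1 - e)"
        using step[of n] v1 x R(2) by linarith
      also have "\<dots> \<le> C * (2 * (L ^ n * x) * (\<theta> ^ n * (x / 2) powr (- e)))"
      proof (intro mult_left_mono C)
        have "(L ^ n) powr (- e) = (L powr real n) powr (- e)" using L by (simp add: powr_realpow)
        also have "\<dots> = (L powr (- e)) powr real n" by (simp add: powr_powr mult.commute)
        also have "\<dots> = \<theta> ^ n" using \<theta> by (simp add: powr_realpow flip: \<theta>_def)
        finally have pn: "(L ^ n) powr (- e) = \<theta> ^ n" .
        have "cmod (v n) powr (1 - e) = cmod (v n) * cmod (v n) powr (- e)"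
          using vn powr_add[of "cmod (v n)" 1 "- e"] by simp
        also have "\<dots> \<le> 2 * (L ^ n * x) * (L ^ n * (x / 2)) powr (- e)"
          using low up e L x by (intro mult_mono powr_mono2') auto
        also have "(L ^ n * (x / 2)) powr (- e) = \<theta> ^ n * (x / 2) powr (- e)"
          using L x by (simp only: powr_mult pn)
        finally show "cmod (v n) powr (1 - e) \<le> 2 * (L ^ n * x) * (\<theta> ^ n * (x / 2) powr (- e))" .
      qed
      also have "\<dots> = (2 * C * (x / 2) powr (- e)) * (\<theta> ^ n * (L ^ n * x))" by simp
      also have "\<dots> \<le> L * \<delta> * (1 - \<theta>) * (\<theta> ^ n * (L ^ n * x))"
        using less_imp_le[OF r[of "x / 2"]] x R(3) \<theta> Lx by (intro mult_right_mono) auto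
      finally have s: "cmod (v (Suc n) - of_real L * v n) \<le> L * \<delta> * (1 - \<theta>) * (\<theta> ^ n * (L ^ n * x))" .
      have "v (Suc n) - of_real (L ^ Suc n) * v 0
          = (v (Suc n) - of_real L * v n) + of_real L * (v n - of_real (L ^ n) * v 0)"
        by (simp add: algebra_simps)
      also have "cmod \<dots> \<le> L * \<delta> * (1 - \<theta>) * (\<theta> ^ n * (L ^ n * x)) + L * (\<delta> * (1 - \<theta> ^ n) * (L ^ n * x))"
        using Suc.IH L by (intro norm_triangle_mono s) (simp add: norm_mult mult_left_mono)
      also have "\<dots> = \<delta> * (1 - \<theta> ^ Suc n) * (L ^ Suc n * x)" by (simp add: algebra_simps)
      finally show ?case .
    qed simp
    also have "\<delta> * (1 - \<theta> ^ n) * (L ^ n * x) \<le> \<delta> * (L ^ n * x)"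
    proof -
      have "\<delta> * (1 - \<theta> ^ n) \<le> \<delta> * 1" using \<delta> \<theta> by (intro mult_left_mono) auto
      then show ?thesis using L x by (intro mult_right_mono) auto
    qed
    finally show "cmod (v n - of_real (L ^ n) * v 0) \<le> \<delta> * (L ^ n * cmod (v 0))" by (simp add: x_def)
  qed
qed

lemma sum_powr_bounded:
  fixes s :: real
  assumes "s > 1"
  obtains S where "S > 0" "\<And>n. (\<Sum>k<n. real (Suc k) powr (- s)) \<le> S"
proof -
  have "summable (\<lambda>k. real k powr (- s))" using assms by (simp add: summable_real_powr_iff)
  then have sm: "summable (\<lambda>k. real (Suc k) powr (- s))" by (subst summable_Suc_iff)
  have "(\<Sum>k<n. real (Suc k) powr (- s)) \<le> (\<Sum>k. real (Suc k) powr (- s)) + 1" for n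
    using sum_le_suminf[OF sm, of "{..<n}"] by auto
  moreover have "(\<Sum>k. real (Suc k) powr (- s)) + 1 > 0" using suminf_nonneg[OF sm] by (simp add: add_nonneg_pos)
  ultimately show ?thesis using that by blast
qed

lemma telescope_bound:
  fixes t :: "nat \<Rightarrow> complex"
  assumes "\<And>k. k < n \<Longrightarrow> cmod (t (Suc k) - t k) \<le> f k"
  shows "cmod (t n - t 0) \<le> (\<Sum>k<n. f k)"
proof -
  have "cmod (t n - t 0) \<le> (\<Sum>k<n. cmod (t (Suc k) - t k))"
    unfolding sum_lessThan_telescope[symmetric] by (rule norm_sum)
  also have "\<dots> \<le> (\<Sum>k<n. f k)" using assms by (intro sum_mono) auto
  finally show ?thesis .
qed

text \<open>A crude bound in place of the logarithm. Any power of \<open>n\<close> below the first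
  would do: it has to show that \<open>v n - n p\<close> is so much smaller than \<open>n\<close>
  that \<open>q / v n\<close> differs from \<open>(q / p) / n\<close> by a summable amount.\<close>

lemma sum_inverse_le_sqrt: "(\<Sum>k<n. 1 / real (Suc k)) \<le> 2 * sqrt (real n)"
proof (induction n)
  case (Suc n)
  have "1 / real (Suc n) \<le> 2 * (sqrt (real (Suc n)) - sqrt (real n))"
  proof -
    have p: "sqrt (real (Suc n)) \<ge> 1" "sqrt (real n) \<ge> 0" "sqrt (real n) \<le> sqrt (real (Suc n))" by auto
    have "(sqrt (real (Suc n)) - sqrt (real n)) * (sqrt (real (Suc n)) + sqrt (real n)) = 1"
      by (simp add: algebra_simps)
    then have "sqrt (real (Suc n)) - sqrt (real n) = 1 / (sqrt (real (Suc n)) + sqrt (real n))"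
      using p by (subst eq_divide_eq) (auto simp del: of_nat_Suc)
    moreover have "1 / (2 * real (Suc n)) \<le> 1 / (sqrt (real (Suc n)) + sqrt (real n))"
    proof (rule divide_left_mono)
      have "sqrt (real (Suc n)) * 1 \<le> sqrt (real (Suc n)) * sqrt (real (Suc n))"
        using p by (intro mult_left_mono) auto
      then have "sqrt (real (Suc n)) \<le> real (Suc n)" by simp
      then show "sqrt (real (Suc n)) + sqrt (real n) \<le> 2 * real (Suc n)"
        using add_mono[OF _ order_trans[OF p(3)]] by (metis mult_2)
      have "0 < sqrt (real (Suc n)) + sqrt (real n)" using p by linarith
      then show "0 < 2 * real (Suc n) * (sqrt (real (Suc n)) + sqrt (real n))" by (intro mult_pos_pos) auto
    qed auto
    ultimately have "2 * (1 / (2 * real (Suc n))) \<le> 2 * (sqrt (real (Suc n)) - sqrt (real n))"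
      by (intro mult_left_mono) (simp_all only:)
    then show ?thesis by (simp del: of_nat_Suc)
  qed
  then show ?case using Suc by simp
qed simp

text \<open>A bootstrap: increments within \<open>cmod p / 4\<close> of \<open>p\<close> give linear
  growth; then they are \<open>p + O(1 / n)\<close>, so \<open>v n = n p + O(sqrt n)\<close>; then
  \<open>q / v n\<close> is \<open>(q / p) / n\<close> up to a summable error, which produces the
  logarithm. \<open>R\<close> comes before \<open>B\<close> because one first waits until the orbits
  are beyond \<open>R\<close> and only then has a bound \<open>B\<close> on the new starting
  points.\<close>

lemma parabolic_orbit:
  fixes p q :: complex and C e R0 :: real
  assumes p: "p \<noteq> 0" and C: "C \<ge> 0" and e: "e > 0"
  obtains R where "R \<ge> 1" and
    "\<And>B. \<exists>C'. \<forall>v :: nat \<Rightarrow> complex. cmod (v 0) \<le> B \<longrightarrow> (\<forall>n. R \<le> cmod (v n)) \<longrightarrow>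
       (\<forall>n. R0 \<le> cmod (v n) \<longrightarrow> cmod (v (Suc n) - (v n + p + q / v n)) \<le> C * cmod (v n) powr (- 1 - e)) \<longrightarrow>
       (\<forall>n. cmod (v n - (of_nat n * p + q / p * of_real (ln (real (Suc n))))) \<le> C')"
proof -
  have "((\<lambda>x. cmod q * inverse x + C * x powr (- 1 - e)) \<longlongrightarrow> cmod q * 0 + C * 0) at_top"
    using e by (intro tendsto_intros tendsto_neg_powr filterlim_ident tendsto_inverse_0_at_top) auto
  then have "\<forall>\<^sub>F x in at_top. cmod q * inverse x + C * x powr (- 1 - e) < cmod p / 4"
    using p by (intro order_tendstoD(2)) auto
  then obtain r where r: "\<And>x. x \<ge> r \<Longrightarrow> cmod q * inverse x + C * x powr (- 1 - e) < cmod p / 4"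
    unfolding eventually_at_top_linorder by blast
  define R where "R = max (max 1 R0) r"
  have R: "R \<ge> 1" "R \<ge> R0" "R \<ge> r" by (auto simp: R_def)
  \<comment> \<open>The errors to be summed have orders \<open>n powr (- 3/2)\<close>,
    \<open>n powr (- 2)\<close> and \<open>n powr (- 1 - e)\<close>;
    \<open>n powr (- (1 + e'))\<close> dominates all three and is summable.\<close>
  define e' where "e' = min e (1 / 2)"
  have e': "0 < e'" "e' \<le> e" "e' \<le> 1 / 2" using e by (auto simp: e'_def)
  obtain S where S: "S > 0" "\<And>n. (\<Sum>k<n. real (Suc k) powr (- (1 + e'))) \<le> S"
    using sum_powr_bounded[of "1 + e'"] e' by auto
  define \<beta> where "\<beta> = q / p"
  show ?thesis
  proof (rule that[OF R(1)])
    fix B :: real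
    \<comment> \<open>Chosen so that \<open>real (Suc n) \<le> K * cmod (v n)\<close>: the
      accumulated deviation is at most a quarter of the drift \<open>n * cmod p\<close>, which
      leaves three quarters of it, up to the starting point.\<close>
    define K where "K = 4 / (3 * cmod p) * (1 + \<bar>B\<bar>) + 1"
    have K: "K > 0" using p by (simp add: K_def add_nonneg_pos)
    define K2 where "K2 = cmod q * K + C * K powr (1 + e)"
    have K2: "K2 \<ge> 0" using C K by (simp add: K2_def)
    define K3 where "K3 = \<bar>B\<bar> + cmod p + 2 * K2"
    have K3: "K3 \<ge> 0" using K2 by (simp add: K3_def)
    define K5 where "K5 = cmod q * K3 * K / cmod p + cmod \<beta> + C * K powr (1 + e)"
    show "\<exists>C'. \<forall>v :: nat \<Rightarrow> complex. cmod (v 0) \<le> B \<longrightarrow> (\<forall>n. R \<le> cmod (v n)) \<longrightarrow>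
       (\<forall>n. R0 \<le> cmod (v n) \<longrightarrow> cmod (v (Suc n) - (v n + p + q / v n)) \<le> C * cmod (v n) powr (- 1 - e)) \<longrightarrow>
       (\<forall>n. cmod (v n - (of_nat n * p + q / p * of_real (ln (real (Suc n))))) \<le> C')"
    proof (intro exI[of _ "B + K5 * S"] allI impI)
      fix v :: "nat \<Rightarrow> complex" and n
      assume v0: "cmod (v 0) \<le> B" and low: "\<forall>n. R \<le> cmod (v n)"
        and "\<forall>n. R0 \<le> cmod (v n) \<longrightarrow> cmod (v (Suc n) - (v n + p + q / v n)) \<le> C * cmod (v n) powr (- 1 - e)"
      then have step: "cmod (v (Suc n) - (v n + p + q / v n)) \<le> C * cmod (v n) powr (- 1 - e)" for n
        using R(2) order_trans by blast
      have vpos: "cmod (v n) \<ge> 1" "v n \<noteq> 0" for n using low[rule_format, of n] R(1) by auto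
      have inc: "cmod (v (Suc n) - v n - p) \<le> cmod q * inverse (cmod (v n)) + C * cmod (v n) powr (- 1 - e)" for n
      proof -
        have "v (Suc n) - v n - p = q / v n + (v (Suc n) - (v n + p + q / v n))" by simp
        also have "cmod \<dots> \<le> cmod (q / v n) + C * cmod (v n) powr (- 1 - e)"
          by (intro norm_triangle_mono order_refl step)
        finally show ?thesis by (simp add: norm_mult norm_inverse divide_inverse)
      qed
      define x where "x n = v n - of_nat n * p" for n
      have xinc: "x (Suc n) - x n = v (Suc n) - v n - p" for n by (simp add: x_def algebra_simps)
      have x1: "cmod (x n - x 0) \<le> (\<Sum>k<n. cmod p / 4)" for n
      proof (rule telescope_bound)
        fix k show "cmod (x (Suc k) - x k) \<le> cmod p / 4"
          using inc[of k] r[of "cmod (v k)"] low[rule_format, of k] R(3) unfolding xinc by linarith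
      qed
      have vn: "real (Suc n) \<le> K * cmod (v n)" for n
      proof -
        have "cmod (of_nat n * p) \<le> cmod (v n) + cmod (v 0) + cmod (x n - x 0)"
        proof -
          have "of_nat n * p = v n - v 0 - (x n - x 0)" by (simp add: x_def)
          then show ?thesis
            using norm_triangle_ineq4[of "v n - v 0" "x n - x 0"] norm_triangle_ineq4[of "v n" "v 0"] by simp
        qed
        then have "real n * cmod p \<le> cmod (v n) + \<bar>B\<bar> + real n * (cmod p / 4)"
          using x1[of n] v0 by (simp add: norm_mult)
        then have "3 * (real n * cmod p) \<le> 4 * (cmod (v n) + \<bar>B\<bar>)" by simp
        also have "\<dots> \<le> 4 * (cmod (v n) + \<bar>B\<bar> * cmod (v n))"
          using mult_left_mono[OF vpos(1)[of n], of "\<bar>B\<bar>"] by simp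
        finally have "real n \<le> 4 / (3 * cmod p) * (1 + \<bar>B\<bar>) * cmod (v n)"
          using p by (simp add: field_simps)
        then have "real n + 1 \<le> 4 / (3 * cmod p) * (1 + \<bar>B\<bar>) * cmod (v n) + 1 * cmod (v n)"
          using vpos(1)[of n] by linarith
        then show ?thesis by (simp add: K_def algebra_simps)
      qed
      have inv: "inverse (cmod (v n)) \<le> K * inverse (real (Suc n))" for n
      proof -
        have "real (Suc n) > 0" "cmod (v n) > 0" using vpos(2)[of n] by auto
        then show ?thesis using vn[of n] by (simp add: field_simps del: of_nat_Suc)
      qed
      have pw: "cmod (v n) powr (- 1 - e) \<le> K powr (1 + e) * real (Suc n) powr (- (1 + e))" for n
      proof -
        have "inverse (cmod (v n)) powr (1 + e) \<le> (K * inverse (real (Suc n))) powr (1 + e)"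
          using inv[of n] e by (intro powr_mono2) auto
        also have "\<dots> = K powr (1 + e) * real (Suc n) powr (- (1 + e))"
          by (simp only: powr_mult inverse_powr powr_minus)
        also have "inverse (cmod (v n)) powr (1 + e) = cmod (v n) powr (- 1 - e)"
          unfolding inverse_powr powr_minus[symmetric] by simp
        finally show ?thesis .
      qed
      have p1: "real (Suc n) powr (- s) \<le> real (Suc n) powr (- s')" if "s' \<le> s" for n s s'
        using that by (intro powr_mono) auto
      have inv1: "inverse (real (Suc n)) = real (Suc n) powr (- 1)" for n
        by (simp add: powr_minus)
      have x2: "cmod (x n - x 0) \<le> (\<Sum>k<n. K2 * (1 / real (Suc k)))" for n
      proof (rule telescope_bound)
        fix k
        have "C * cmod (v k) powr (- 1 - e) \<le> C * (K powr (1 + e) * real (Suc k) powr (- (1 + e)))"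
          using C by (intro mult_left_mono pw)
        also have "\<dots> \<le> C * (K powr (1 + e) * real (Suc k) powr (- 1))"
          using C e by (intro mult_left_mono p1) auto
        finally have 1: "C * cmod (v k) powr (- 1 - e) \<le> C * K powr (1 + e) * inverse (real (Suc k))"
          unfolding inv1 by simp
        have 2: "cmod q * inverse (cmod (v k)) \<le> cmod q * (K * inverse (real (Suc k)))"
          by (intro mult_left_mono inv) auto
        show "cmod (x (Suc k) - x k) \<le> K2 * (1 / real (Suc k))"
          unfolding xinc K2_def using inc[of k] 1 2 by (simp add: algebra_simps divide_inverse del: of_nat_Suc)
      qed
      have x3: "cmod (v n - of_nat (Suc n) * p) \<le> K3 * sqrt (real (Suc n))" for n
      proof -
        have "cmod (x n - x 0) \<le> K2 * (2 * sqrt (real n))"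
          using x2[of n] mult_left_mono[OF sum_inverse_le_sqrt[of n] K2] unfolding sum_distrib_left by linarith
        also have "\<dots> \<le> K2 * (2 * sqrt (real (Suc n)))" using K2 by (intro mult_left_mono) auto
        finally have a: "cmod (x n - x 0) \<le> K2 * (2 * sqrt (real (Suc n)))" .
        have "v n - of_nat (Suc n) * p = (x n - x 0) + (v 0 - p)" by (simp add: x_def algebra_simps)
        also have "cmod \<dots> \<le> K2 * (2 * sqrt (real (Suc n))) + (\<bar>B\<bar> + cmod p) * 1"
          using v0 norm_triangle_ineq4[of "v 0" p] abs_ge_self[of B] by (intro norm_triangle_mono a) simp
        also have "\<dots> \<le> K2 * (2 * sqrt (real (Suc n))) + (\<bar>B\<bar> + cmod p) * sqrt (real (Suc n))"
          by (intro add_left_mono mult_left_mono) auto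
        finally show ?thesis by (simp add: K3_def algebra_simps)
      qed
      define t where "t n = x n - \<beta> * of_real (ln (real (Suc n)))" for n
      have "cmod (t n - t 0) \<le> (\<Sum>k<n. K5 * real (Suc k) powr (- (1 + e')))" for n
      proof (rule telescope_bound)
        fix k
        let ?m = "real (Suc k)"
        have m: "?m \<ge> 1" "?m > 0" by auto
        \<comment> \<open>Three errors: \<open>v k\<close> is replaced by \<open>(k + 1) * p\<close>
          in \<open>q / v k\<close>, the increment \<open>ln (1 + 1 / (k + 1))\<close> is replaced
          by \<open>1 / (k + 1)\<close>, and the recursion has its own remainder.\<close>
        have eq: "t (Suc k) - t k = (q / v k - \<beta> * of_real (1 / ?m)) - \<beta> * of_real (ln (1 + 1 / ?m) - 1 / ?m)
            + (v (Suc k) - (v k + p + q / v k))"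
        proof -
          have "ln (real (Suc (Suc k))) = ln ?m + ln (1 + 1 / ?m)"
          proof -
            have "real (Suc (Suc k)) = ?m * (1 + 1 / ?m)"
              using m(2) unfolding of_nat_Suc[of "Suc k"] distrib_left by (simp del: of_nat_Suc)
            moreover have "1 + 1 / ?m > 0" by (simp add: add_pos_nonneg)
            ultimately show ?thesis using m(2) by (metis ln_mult_pos)
          qed
          then show ?thesis unfolding t_def x_def by (simp add: algebra_simps)
        qed
        have a: "cmod (q / v k - \<beta> * of_real (1 / ?m)) \<le> cmod q * K3 * K / cmod p * ?m powr (- (1 + e'))"
        proof -
          have "of_real ?m \<noteq> (0::complex)" using m(2) by (metis of_real_eq_0_iff less_irrefl)
          then have "q / v k - \<beta> * of_real (1 / ?m) = q / p * (of_nat (Suc k) * p - v k) * inverse (v k) * of_real (inverse ?m)"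
            using p vpos(2)[of k] by (simp add: \<beta>_def field_simps del: of_nat_Suc)
          then have "cmod (q / v k - \<beta> * of_real (1 / ?m))
              = cmod q / cmod p * cmod (v k - of_nat (Suc k) * p) * inverse (cmod (v k)) * inverse ?m"
            by (simp only: norm_mult norm_divide norm_inverse norm_of_real norm_minus_commute[of "v k"]) simp
          also have "\<dots> \<le> cmod q / cmod p * (K3 * sqrt ?m) * (K * inverse ?m) * inverse ?m"
            using K3 K by (intro mult_mono x3 inv mult_nonneg_nonneg) auto
          also have "\<dots> = cmod q * K3 * K / cmod p * (?m powr (1/2) * ?m powr (- 1) * ?m powr (- 1))"
            by (subst powr_half_sqrt[symmetric]) (simp_all only: inv1 divide_inverse mult_ac of_nat_0_le_iff)
          also have "?m powr (1/2) * ?m powr (- 1) * ?m powr (- 1) = ?m powr (- (3/2))"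
            unfolding powr_add[symmetric] by simp
          also have "cmod q * K3 * K / cmod p * ?m powr (- (3/2)) \<le> cmod q * K3 * K / cmod p * ?m powr (- (1 + e'))"
            using K3 K e' by (intro mult_left_mono p1) auto
          finally show ?thesis .
        qed
        have b: "cmod (\<beta> * of_real (ln (1 + 1 / ?m) - 1 / ?m)) \<le> cmod \<beta> * ?m powr (- (1 + e'))"
        proof -
          have "\<bar>ln (1 + 1 / ?m) - 1 / ?m\<bar> \<le> (1 / ?m)\<^sup>2"
            using m by (intro abs_ln_one_plus_x_minus_x_bound_nonneg) auto
          also have "\<dots> = ?m powr (- 2)" using m(2) by (simp add: powr_minus power_one_over divide_inverse power_inverse)
          also have "\<dots> \<le> ?m powr (- (1 + e'))" using e' by (intro p1) auto
          finally show ?thesis unfolding norm_mult norm_of_real by (intro mult_left_mono) auto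
        qed
        have c: "cmod (v (Suc k) - (v k + p + q / v k)) \<le> C * K powr (1 + e) * ?m powr (- (1 + e'))"
        proof -
          have "C * cmod (v k) powr (- 1 - e) \<le> C * (K powr (1 + e) * ?m powr (- (1 + e)))"
            using C by (intro mult_left_mono pw)
          also have "\<dots> \<le> C * (K powr (1 + e) * ?m powr (- (1 + e')))"
            using C e' by (intro mult_left_mono p1) auto
          finally show ?thesis using step[of k] by simp
        qed
        have "cmod (t (Suc k) - t k) \<le> cmod q * K3 * K / cmod p * ?m powr (- (1 + e')) + cmod \<beta> * ?m powr (- (1 + e'))
            + C * K powr (1 + e) * ?m powr (- (1 + e'))"
          unfolding eq by (intro norm_triangle_mono c order_trans[OF norm_triangle_ineq4] add_mono a b)
        then show "cmod (t (Suc k) - t k) \<le> K5 * ?m powr (- (1 + e'))"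
          by (simp add: K5_def algebra_simps del: of_nat_Suc)
      qed
      then have "cmod (t n - t 0) \<le> K5 * (\<Sum>k<n. real (Suc k) powr (- (1 + e')))"
        unfolding sum_distrib_left .
      also have "\<dots> \<le> K5 * S"
        using S(2) C K K3 by (intro mult_left_mono) (auto simp: K5_def)
      finally have tn: "cmod (t n - t 0) \<le> K5 * S" .
      have "t 0 = v 0" by (simp add: t_def x_def)
      then have "cmod (t n) \<le> B + K5 * S"
        using tn v0 norm_triangle_ineq[of "v 0" "t n - v 0"] by simp
      then show "cmod (v n - (of_nat n * p + q / p * of_real (ln (real (Suc n))))) \<le> B + K5 * S"
        by (simp add: t_def x_def \<beta>_def diff_diff_add)
    qed
  qed
qed

text \<open>The difference of two orbits changes only by \<open>q / a n - q / b n\<close> and by the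
  two remainders. As both orbits have size at least \<open>(t + n * cmod p) / 4\<close>, these
  changes are summable, with a sum that tends to 0 as \<open>t\<close> grows; the initial offset is
  thus nearly preserved for all times.\<close>

lemma parabolic_orbits_parallel:
  fixes p q :: complex and C e R0 :: real
  assumes p: "p \<noteq> 0" "Re p \<ge> 0" and C: "C \<ge> 0" and e: "0 < e" "e \<le> 1"
  obtains T where "T \<ge> 4" and
    "\<And>a b :: nat \<Rightarrow> complex. \<And>t n. T \<le> t \<Longrightarrow> a 0 = of_real t \<Longrightarrow> cmod (b 0 - of_real t) \<le> 1 \<Longrightarrow>
       (\<And>n. R0 \<le> cmod (a n) \<Longrightarrow> cmod (a (Suc n) - (a n + p + q / a n)) \<le> C * cmod (a n) powr (- 1 - e)) \<Longrightarrow>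
       (\<And>n. R0 \<le> cmod (b n) \<Longrightarrow> cmod (b (Suc n) - (b n + p + q / b n)) \<le> C * cmod (b n) powr (- 1 - e)) \<Longrightarrow>
       cmod (a n - b n - (a 0 - b 0)) \<le> 1 / 8"
proof -
  have "((\<lambda>x. cmod q * inverse x + C * x powr (- 1 - e)) \<longlongrightarrow> cmod q * 0 + C * 0) at_top"
    using e by (intro tendsto_intros tendsto_neg_powr filterlim_ident tendsto_inverse_0_at_top) auto
  then have "\<forall>\<^sub>F x in at_top. cmod q * inverse x + C * x powr (- 1 - e) < cmod p / 4"
    using p by (intro order_tendstoD(2)) auto
  then obtain r where r: "\<And>x. x \<ge> r \<Longrightarrow> cmod q * inverse x + C * x powr (- 1 - e) < cmod p / 4"
    unfolding eventually_at_top_linorder by blast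
  define m where "m = min 1 (cmod p)"
  have m: "0 < m" "m \<le> 1" "m \<le> cmod p" using p by (auto simp: m_def)
  obtain S where S: "S > 0" "\<And>n. (\<Sum>k<n. real (Suc k) powr (- (1 + e / 2))) \<le> S"
    using sum_powr_bounded[of "1 + e / 2"] e by auto
  \<comment> \<open>With \<open>y = t + n * cmod p\<close>, the first term bounds
    \<open>cmod q * cmod (a n - b n) / (y / 4) ^ 2\<close> for offsets of at most 2, the second the
    two remainders at size at least \<open>y / 4\<close>.\<close>
  define K where "K = 32 * cmod q + 2 * C * 4 powr (1 + e)"
  define K' where "K' = K * m powr (- (1 + e / 2))"
  have K: "K \<ge> 0" using C by (simp add: K_def)
  have "((\<lambda>x. K' * S * x powr (- (e / 2))) \<longlongrightarrow> K' * S * 0) at_top"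
    using e by (intro tendsto_intros tendsto_neg_powr filterlim_ident) auto
  then have "\<forall>\<^sub>F x in at_top. K' * S * x powr (- (e / 2)) < 1 / 8"
    by (intro order_tendstoD(2)) auto
  then obtain r' where r': "\<And>x. x \<ge> r' \<Longrightarrow> K' * S * x powr (- (e / 2)) < 1 / 8"
    unfolding eventually_at_top_linorder by blast
  define T where "T = max 4 (max r' (4 * max R0 r))"
  have T: "T \<ge> 4" "T \<ge> r'" "T / 4 \<ge> R0" "T / 4 \<ge> r" by (auto simp: T_def)
  have orbit: "(t + n * cmod p) / 4 \<le> cmod (v n)"
    if t: "T \<le> t" and v0: "cmod (v 0 - of_real t) \<le> 1" and
       step: "\<And>n. R0 \<le> cmod (v n) \<Longrightarrow> cmod (v (Suc n) - (v n + p + q / v n)) \<le> C * cmod (v n) powr (- 1 - e)"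
    for v :: "nat \<Rightarrow> complex" and t n
  proof -
    have t4: "t \<ge> 4" using t T by linarith
    have low: "(t + n * cmod p) / 4 \<le> cmod (v n)" if "cmod (v n - v 0 - of_nat n * p) \<le> n * (cmod p / 4)" for n
    proof -
      \<comment> \<open>As \<open>t > 0\<close> and \<open>Re p \<ge> 0\<close>, the vectors
        \<open>t\<close> and \<open>n * p\<close> enclose at most a right angle, so their sum is at
        least as long as if they were perpendicular.\<close>
      have "(t + n * cmod p)\<^sup>2 \<le> 2 * (cmod (of_real t + of_nat n * p))\<^sup>2"
      proof -
        have "(cmod (of_real t + of_nat n * p))\<^sup>2 = (t + n * Re p)\<^sup>2 + (n * Im p)\<^sup>2"
          by (simp add: cmod_power2)
        also have "\<dots> = t\<^sup>2 + 2 * t * (n * Re p) + (n * cmod p)\<^sup>2"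
          by (simp add: power_mult_distrib cmod_power2 power2_sum algebra_simps)
        finally have h1: "(cmod (of_real t + of_nat n * p))\<^sup>2 \<ge> t\<^sup>2 + (n * cmod p)\<^sup>2"
          using t4 p(2) by simp
        have h2: "(t + n * cmod p)\<^sup>2 \<le> 2 * (t\<^sup>2 + (n * cmod p)\<^sup>2)"
          using sum_squares_ge_zero[of "t - n * cmod p" 0] by (simp add: power2_eq_square algebra_simps)
        show ?thesis by (rule order_trans[OF h2]) (rule mult_left_mono[OF h1], simp)
      qed
      \<comment> \<open>\<open>3 / 2\<close> is a rational upper bound for the square root of
        2.\<close>
      also have "\<dots> \<le> (3 / 2 * cmod (of_real t + of_nat n * p))\<^sup>2" by (simp add: power_mult_distrib power2_eq_square)
      finally have "t + n * cmod p \<le> 3 / 2 * cmod (of_real t + of_nat n * p)"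
        by (rule power2_le_imp_le) simp
      moreover have "cmod (of_real t + of_nat n * p) \<le> cmod (v n) + 1 + n * (cmod p / 4)"
      proof -
        have "of_real t + of_nat n * p = v n - (v 0 - of_real t) - (v n - v 0 - of_nat n * p)" by simp
        then show ?thesis
          using norm_triangle_ineq4[of "v n - (v 0 - of_real t)" "v n - v 0 - of_nat n * p"]
            norm_triangle_ineq4[of "v n" "v 0 - of_real t"] that v0 by simp
      qed
      moreover have "n * cmod p \<ge> 0" by simp
      moreover have "(t + x) / 4 \<le> c" if "t + x \<le> 3 / 2 * y" "y \<le> c + 1 + x / 4" "0 \<le> x" for x y c :: real
        using that t4 by simp
      ultimately show ?thesis by simp
    qed
    have "cmod (v n - v 0 - of_nat n * p) \<le> n * (cmod p / 4)" for n
    proof (induction n)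
      case (Suc n)
      have vn: "t / 4 \<le> cmod (v n)" using low[OF Suc] by (rule order_trans[rotated]) simp
      then have "R0 \<le> cmod (v n)" "r \<le> cmod (v n)" using T t by linarith+
      then have s: "cmod (v (Suc n) - (v n + p + q / v n)) \<le> C * cmod (v n) powr (- 1 - e)"
        "cmod q * inverse (cmod (v n)) + C * cmod (v n) powr (- 1 - e) < cmod p / 4"
        using step r by auto
      have "v (Suc n) - v 0 - of_nat (Suc n) * p
          = (v n - v 0 - of_nat n * p) + (q / v n + (v (Suc n) - (v n + p + q / v n)))"
        by (simp add: algebra_simps)
      also have "cmod \<dots> \<le> n * (cmod p / 4) + (cmod q * inverse (cmod (v n)) + C * cmod (v n) powr (- 1 - e))"
        using s(1) by (intro norm_triangle_mono Suc) (auto simp: norm_divide divide_inverse norm_mult norm_inverse)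
      finally show ?case using s(2) by (simp add: algebra_simps)
    qed simp
    then show ?thesis by (rule low)
  qed
  show ?thesis
  proof (rule that[OF T(1)])
    fix a b :: "nat \<Rightarrow> complex" and t n
    assume t: "T \<le> t" and a0: "a 0 = of_real t" and b0: "cmod (b 0 - of_real t) \<le> 1"
      and sa: "\<And>n. R0 \<le> cmod (a n) \<Longrightarrow> cmod (a (Suc n) - (a n + p + q / a n)) \<le> C * cmod (a n) powr (- 1 - e)"
      and sb: "\<And>n. R0 \<le> cmod (b n) \<Longrightarrow> cmod (b (Suc n) - (b n + p + q / b n)) \<le> C * cmod (b n) powr (- 1 - e)"
    have t4: "t \<ge> 4" using t T by linarith
    define y where "y n = t + real n * cmod p" for n
    have y: "y n \<ge> t" "y n \<ge> 4" for n using t4 by (auto simp: y_def add_increasing2)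
    have la: "y n / 4 \<le> cmod (a n)" for n
      using orbit[of t a n] t sa a0 by (simp add: y_def)
    have lb: "y n / 4 \<le> cmod (b n)" for n
      using orbit[of t b n] t sb b0 by (simp add: y_def)
    define d where "d n = a n - b n - (a 0 - b 0)" for n
    define \<eta> where "\<eta> = K' * t powr (- (e / 2))"
    have \<eta>: "\<eta> \<ge> 0" using K by (simp add: \<eta>_def K'_def)
    have \<eta>S: "\<eta> * S \<le> 1 / 8" using r'[of t] t T by (simp add: \<eta>_def mult_ac)
    \<comment> \<open>The exponent is split: \<open>y powr (- (e / 2))\<close> is at most
      \<open>t powr (- (e / 2))\<close> and makes the total small, while
      \<open>y powr (- (1 + e / 2))\<close> is summable because
      \<open>y n \<ge> m * (n + 1)\<close>.\<close>
    have ypow: "K * y n powr (- (1 + e)) \<le> \<eta> * real (Suc n) powr (- (1 + e / 2))" for n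
    proof -
      have "m * real (Suc n) \<le> y n"
      proof -
        have "m * real n \<le> cmod p * real n" using m by (intro mult_right_mono) auto
        then show ?thesis using m t4 by (simp add: y_def algebra_simps)
      qed
      then have "y n powr (- (1 + e / 2)) \<le> (m * real (Suc n)) powr (- (1 + e / 2))"
        using m e by (intro powr_mono2') auto
      moreover have "y n powr (- (e / 2)) \<le> t powr (- (e / 2))"
        using y(1)[of n] t4 e by (intro powr_mono2') auto
      ultimately have "y n powr (- (e / 2)) * y n powr (- (1 + e / 2))
          \<le> t powr (- (e / 2)) * (m * real (Suc n)) powr (- (1 + e / 2))"
        by (intro mult_mono) auto
      moreover have "y n powr (- (e / 2)) * y n powr (- (1 + e / 2)) = y n powr (- (1 + e))"
        unfolding powr_add[symmetric] by (simp add: algebra_simps)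
      ultimately have "K * y n powr (- (1 + e)) \<le> K * (t powr (- (e / 2)) * (m * real (Suc n)) powr (- (1 + e / 2)))"
        using K by (intro mult_left_mono) auto
      then show ?thesis by (simp only: \<eta>_def K'_def powr_mult mult_ac)
    qed
    have "cmod (d n) \<le> \<eta> * (\<Sum>k<n. real (Suc k) powr (- (1 + e / 2)))"
    proof (induction n)
      case (Suc n)
      have "\<eta> * (\<Sum>k<n. real (Suc k) powr (- (1 + e / 2))) \<le> \<eta> * S" using S \<eta> by (intro mult_left_mono) auto
      then have "cmod (d n) \<le> 1" using Suc.IH \<eta>S by linarith
      moreover have "a n - b n = d n - (b 0 - of_real t)" by (simp add: d_def a0)
      ultimately have ab: "cmod (a n - b n) \<le> 2"
        using norm_triangle_ineq4[of "d n" "b 0 - of_real t"] b0 by simp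
      have an: "y n / 4 \<le> cmod (a n)" "y n / 4 \<le> cmod (b n)" by (rule la lb)+
      have y0: "y n / 4 > 0" using y(2)[of n] by linarith
      have nz: "a n \<noteq> 0" "b n \<noteq> 0" using an y0 by auto
      have RT: "R0 \<le> cmod (a n)" "R0 \<le> cmod (b n)" using an y(1)[of n] t T(3) by linarith+
      have q1: "cmod (q / a n - q / b n) \<le> 32 * cmod q * y n powr (- (1 + e))"
      proof -
        have "q / a n - q / b n = q * (b n - a n) / (a n * b n)" using nz by (simp add: field_simps)
        then have "cmod (q / a n - q / b n) = cmod q * cmod (a n - b n) / (cmod (a n) * cmod (b n))"
          by (simp add: norm_mult norm_divide norm_minus_commute)
        also have "\<dots> \<le> cmod q * 2 / ((y n / 4) * (y n / 4))"
          using ab an y0 by (intro frac_le mult_mono mult_left_mono mult_pos_pos) auto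
        also have "\<dots> = 32 * cmod q * y n powr (- 2)"
        proof -
          have "y n powr (- 2) = inverse (y n ^ 2)" using y(2)[of n] by (simp add: powr_minus)
          moreover have "cmod q * 2 / ((y n / 4) * (y n / 4)) = 32 * cmod q * inverse (y n ^ 2)"
            by (simp add: field_simps power2_eq_square)
          ultimately show ?thesis by (simp only:)
        qed
        also have "\<dots> \<le> 32 * cmod q * y n powr (- (1 + e))"
          using e y(2)[of n] by (intro mult_left_mono powr_mono) auto
        finally show ?thesis .
      qed
      have pw: "C * x powr (- 1 - e) \<le> C * 4 powr (1 + e) * y n powr (- (1 + e))" if "y n / 4 \<le> x" for x
      proof -
        have "x powr (- (1 + e)) \<le> (y n / 4) powr (- (1 + e))"
          using that y0 e by (intro powr_mono2') auto
        also have "\<dots> = 4 powr (1 + e) * y n powr (- (1 + e))"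
          by (simp only: divide_inverse powr_mult inverse_powr powr_minus inverse_mult_distrib inverse_inverse_eq mult_ac)
        finally have "x powr (- 1 - e) \<le> 4 powr (1 + e) * y n powr (- (1 + e))" by simp
        from mult_left_mono[OF this C] show ?thesis by (simp only: mult.assoc)
      qed
      have "d (Suc n) = d n + ((q / a n - q / b n) + (a (Suc n) - (a n + p + q / a n))
          - (b (Suc n) - (b n + p + q / b n)))" by (simp add: d_def)
      also have "cmod \<dots> \<le> \<eta> * (\<Sum>k<n. real (Suc k) powr (- (1 + e / 2)))
          + (32 * cmod q * y n powr (- (1 + e)) + C * cmod (a n) powr (- 1 - e) + C * cmod (b n) powr (- 1 - e))"
        by (intro norm_triangle_mono Suc.IH q1 order_trans[OF norm_triangle_ineq4] add_mono sb sa RT)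
      also have "\<dots> \<le> \<eta> * (\<Sum>k<n. real (Suc k) powr (- (1 + e / 2))) + K * y n powr (- (1 + e))"
        using pw[OF an(1)] pw[OF an(2)] by (simp add: K_def algebra_simps)
      also have "\<dots> \<le> \<eta> * (\<Sum>k<Suc n. real (Suc k) powr (- (1 + e / 2)))"
        using ypow[of n] by (simp add: algebra_simps)
      finally show ?case .
    qed (simp add: d_def)
    also have "\<dots> \<le> \<eta> * S" using S \<eta> by (intro mult_left_mono) auto
    finally show "cmod (a n - b n - (a 0 - b 0)) \<le> 1 / 8" using \<eta>S by (simp add: d_def)
  qed
qed

section \<open>A criterion for disjoint frequent hypercyclicity\<close>

lemma univalent_self_map_funpow: "univalent_self_map \<phi> \<Longrightarrow> univalent_self_map (\<phi> ^^ n)"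
proof (induction n)
  case 0
  then show ?case by (auto simp: univalent_self_map_def)
next
  case (Suc n)
  have 1: "\<phi> holomorphic_on unit_disc" "\<phi> ` unit_disc \<subseteq> unit_disc" "inj_on \<phi> unit_disc"
    and 2: "\<phi> ^^ n holomorphic_on unit_disc" "(\<phi> ^^ n) ` unit_disc \<subseteq> unit_disc" "inj_on (\<phi> ^^ n) unit_disc"
    using Suc.prems Suc.IH[OF Suc.prems] by (auto simp: univalent_self_map_def)
  have "\<phi> \<circ> \<phi> ^^ n holomorphic_on unit_disc"
    by (rule holomorphic_on_compose_gen[OF 2(1) 1(1) 2(2)])
  moreover have "inj_on (\<phi> \<circ> \<phi> ^^ n) unit_disc"
    by (rule comp_inj_on[OF 2(3) inj_on_subset[OF 1(3) 2(2)]])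
  moreover have "(\<phi> \<circ> \<phi> ^^ n) ` unit_disc \<subseteq> unit_disc"
    using 1(2) 2(2) unfolding image_comp[symmetric] by blast
  ultimately show ?case unfolding univalent_self_map_def funpow.simps by blast
qed

lemma univalent_funpow_in_disc:
  "univalent_self_map \<phi> \<Longrightarrow> z \<in> unit_disc \<Longrightarrow> (\<phi> ^^ n) z \<in> unit_disc"
  using univalent_self_map_funpow[of \<phi> n] unfolding univalent_self_map_def by blast

lemma composition_operator_funpow:
  assumes "univalent_self_map \<phi>" "f \<in> hol_disc"
  shows "(composition_operator \<phi> ^^ n) f = composition_operator (\<phi> ^^ n) f"
proof (induction n)
  case 0
  then show ?case using assms(2) by (auto simp: composition_operator_def hol_disc_def)
next
  case (Suc n)
  have "\<phi> z \<in> unit_disc" if "z \<in> unit_disc" for z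
    using univalent_funpow_in_disc[OF assms(1) that, of 1] by simp
  moreover have "(composition_operator \<phi> ^^ Suc n) f = composition_operator \<phi> (composition_operator (\<phi> ^^ n) f)"
    by (simp add: Suc)
  ultimately show ?case
    unfolding funpow.simps(2) comp_apply
    by (intro ext) (simp add: Suc composition_operator_def funpow_swap1)
qed

lemma lower_density_mono: "A \<subseteq> B \<Longrightarrow> lower_density A \<le> lower_density B"
  unfolding lower_density_def
  by (intro Liminf_mono always_eventually allI)
    (auto intro!: divide_right_mono card_mono)

definition disjoint_frequent_orbit ::
    "(complex \<Rightarrow> complex) \<Rightarrow> (complex \<Rightarrow> complex) \<Rightarrow> (complex \<Rightarrow> complex) \<Rightarrow> bool" where
  "disjoint_frequent_orbit \<phi> \<psi> f \<longleftrightarrow> f \<in> hol_disc \<and>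
     (\<forall>g\<in>hol_disc. \<forall>h\<in>hol_disc. \<forall>K e. compact K \<longrightarrow> K \<subseteq> unit_disc \<longrightarrow> e > 0 \<longrightarrow>
        lower_density {n. \<forall>z\<in>K. cmod (f ((\<phi> ^^ n) z) - g z) < e \<and> cmod (f ((\<psi> ^^ n) z) - h z) < e} > 0)"

lemma disjoint_frequent_orbit_swap: "disjoint_frequent_orbit \<phi> \<psi> f \<longleftrightarrow> disjoint_frequent_orbit \<psi> \<phi> f"
  unfolding disjoint_frequent_orbit_def by (subst conj_commute[of "cmod _ < _"]) blast

text \<open>Basic product neighbourhoods suffice, since lower density is monotone; the two compact
  sets and tolerances can be replaced by their union and minimum.\<close>

lemma disjointly_frequently_hypercyclic_iff:
  assumes \<phi>: "univalent_self_map \<phi>" and \<psi>: "univalent_self_map \<psi>"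
  shows "disjointly_frequently_hypercyclic hol_disc_topology [composition_operator \<phi>, composition_operator \<psi>]
    \<longleftrightarrow> (\<exists>f. disjoint_frequent_orbit \<phi> \<psi> f)"
proof -
  let ?Ts = "[composition_operator \<phi>, composition_operator \<psi>]"
  have Ts: "((?Ts ! i) ^^ n) f = composition_operator ((if i = 0 then \<phi> else \<psi>) ^^ n) f"
    if "f \<in> hol_disc" "i < 2" for f i n
  proof -
    have "i = 0 \<or> i = 1" using that(2) by auto
    then show ?thesis using composition_operator_funpow[OF \<phi> that(1)] composition_operator_funpow[OF \<psi> that(1)] by auto
  qed
  have Ts_in: "composition_operator ((if i = 0 then \<phi> else \<psi>) ^^ n) f \<in> hol_disc" if "f \<in> hol_disc" for f i n
    using that \<phi> \<psi> by (auto intro!: composition_operator_in_hol_disc univalent_self_map_funpow)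
  have "(\<forall>U. openin (product_topology (\<lambda>_. hol_disc_topology) {..<length ?Ts}) U \<and> U \<noteq> {} \<longrightarrow>
          lower_density {n. (\<lambda>i\<in>{..<length ?Ts}. ((?Ts ! i) ^^ n) f) \<in> U} > 0)
      \<longleftrightarrow> disjoint_frequent_orbit \<phi> \<psi> f" (is "?L \<longleftrightarrow> ?R") if f: "f \<in> hol_disc" for f
  proof
    assume L: ?L
    show ?R unfolding disjoint_frequent_orbit_def
    proof (intro conjI f ballI allI impI)
      fix g h K and e :: real assume gh: "g \<in> hol_disc" "h \<in> hol_disc" and K: "compact K" "K \<subseteq> unit_disc" and e: "e > 0"
      obtain U where U: "openin hol_disc_topology U" "g \<in> U" "U \<subseteq> hol_disc_nbhd K e g"
        by (rule openin_hol_disc_nbhd_contains[OF K e gh(1)])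
      obtain V where V: "openin hol_disc_topology V" "h \<in> V" "V \<subseteq> hol_disc_nbhd K e h"
        by (rule openin_hol_disc_nbhd_contains[OF K e gh(2)])
      define W where "W = (\<Pi>\<^sub>E i\<in>{..<length ?Ts}. if i = 0 then U else V)"
      have "openin (product_topology (\<lambda>_. hol_disc_topology) {..<length ?Ts}) W"
        unfolding W_def using U V by (subst openin_PiE) auto
      moreover have "(\<lambda>i\<in>{..<length ?Ts}. if i = 0 then g else h) \<in> W" using U V by (auto simp: W_def)
      ultimately have "lower_density {n. (\<lambda>i\<in>{..<length ?Ts}. ((?Ts ! i) ^^ n) f) \<in> W} > 0" using L by blast
      moreover have "{n. (\<lambda>i\<in>{..<length ?Ts}. ((?Ts ! i) ^^ n) f) \<in> W}
          \<subseteq> {n. \<forall>z\<in>K. cmod (f ((\<phi> ^^ n) z) - g z) < e \<and> cmod (f ((\<psi> ^^ n) z) - h z) < e}"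
      proof
        fix n assume "n \<in> {n. (\<lambda>i\<in>{..<length ?Ts}. ((?Ts ! i) ^^ n) f) \<in> W}"
        then have "i < 2 \<Longrightarrow> ((?Ts ! i) ^^ n) f \<in> (if i = 0 then U else V)" for i
          by (force simp: W_def PiE_iff)
        from this[of 0] this[of 1]
        have "composition_operator (\<phi> ^^ n) f \<in> hol_disc_nbhd K e g" "composition_operator (\<psi> ^^ n) f \<in> hol_disc_nbhd K e h"
          using U(3) V(3) composition_operator_funpow[OF \<phi> f] composition_operator_funpow[OF \<psi> f] by auto
        then have c: "dist (composition_operator (\<phi> ^^ n) f z) (g z) < e" "dist (composition_operator (\<psi> ^^ n) f z) (h z) < e"
          if "z \<in> K" for z using that by (auto simp: hol_disc_nbhd_def)
        have "cmod (f ((\<phi> ^^ n) z) - g z) < e \<and> cmod (f ((\<psi> ^^ n) z) - h z) < e" if "z \<in> K" for z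
        proof -
          have "z \<in> unit_disc" using that K(2) by blast
          then show ?thesis using c[OF that] by (simp add: composition_operator_def dist_norm)
        qed
        then show "n \<in> {n. \<forall>z\<in>K. cmod (f ((\<phi> ^^ n) z) - g z) < e \<and> cmod (f ((\<psi> ^^ n) z) - h z) < e}" by blast
      qed
      ultimately show "lower_density {n. \<forall>z\<in>K. cmod (f ((\<phi> ^^ n) z) - g z) < e \<and> cmod (f ((\<psi> ^^ n) z) - h z) < e} > 0"
        using lower_density_mono less_le_trans by blast
    qed
  next
    assume R: ?R
    show ?L
    proof (intro allI impI, elim conjE)
      fix U assume U: "openin (product_topology (\<lambda>_. hol_disc_topology) {..<length ?Ts}) U" and "U \<noteq> {}"
      then obtain x where "x \<in> U" by auto
      then obtain V where V': "\<forall>i\<in>{..<length ?Ts}. openin hol_disc_topology (V i)" "x \<in> Pi\<^sub>E {..<length ?Ts} V"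
        "Pi\<^sub>E {..<length ?Ts} V \<subseteq> U"
        using U unfolding openin_product_topology_alt by blast
      then have V: "\<And>i. i < 2 \<Longrightarrow> openin hol_disc_topology (V i)" "x \<in> Pi\<^sub>E {..<length ?Ts} V"
        "Pi\<^sub>E {..<length ?Ts} V \<subseteq> U" by simp_all
      have x: "x i \<in> V i" "x i \<in> hol_disc" if "i < 2" for i
      proof -
        show "x i \<in> V i" using V(2) that by (auto simp: PiE_iff numeral_2_eq_2)
        then show "x i \<in> hol_disc" using V(1)[OF that] openin_subset by fastforce
      qed
      have "\<exists>K e. compact K \<and> K \<subseteq> unit_disc \<and> e > 0 \<and> hol_disc_nbhd K e (x i) \<subseteq> V i" if "i < 2" for i
        using V(1)[OF that] x[OF that] unfolding openin_hol_disc hol_disc_open_def by blast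
      then obtain K e where K: "\<And>i. i < 2 \<Longrightarrow> compact (K i)" "\<And>i. i < 2 \<Longrightarrow> K i \<subseteq> unit_disc"
        "\<And>i. i < 2 \<Longrightarrow> (e i :: real) > 0" "\<And>i. i < 2 \<Longrightarrow> hol_disc_nbhd (K i) (e i) (x i) \<subseteq> V i" for i :: nat
        by metis
      define L d where "L = K 0 \<union> K 1" and "d = min (e 0) (e 1)"
      have "compact L" "L \<subseteq> unit_disc" "d > 0" using K[of 0] K[of 1] by (auto simp: L_def d_def)
      then have "lower_density {n. \<forall>z\<in>L. cmod (f ((\<phi> ^^ n) z) - x 0 z) < d \<and> cmod (f ((\<psi> ^^ n) z) - x 1 z) < d} > 0"
        using R x(2)[of 0] x(2)[of 1] unfolding disjoint_frequent_orbit_def by auto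
      moreover have "{n. \<forall>z\<in>L. cmod (f ((\<phi> ^^ n) z) - x 0 z) < d \<and> cmod (f ((\<psi> ^^ n) z) - x 1 z) < d}
          \<subseteq> {n. (\<lambda>i\<in>{..<length ?Ts}. ((?Ts ! i) ^^ n) f) \<in> U}"
      proof
        fix n assume n: "n \<in> {n. \<forall>z\<in>L. cmod (f ((\<phi> ^^ n) z) - x 0 z) < d \<and> cmod (f ((\<psi> ^^ n) z) - x 1 z) < d}"
        have "composition_operator ((if i = 0 then \<phi> else \<psi>) ^^ n) f \<in> V i" if "i < 2" for i
        proof -
          have mem: "composition_operator ((if i = 0 then \<phi> else \<psi>) ^^ n) f \<in> hol_disc"
            by (rule Ts_in[OF f])
          have "i = 0 \<or> i = 1" using that by auto
          then have "composition_operator ((if i = 0 then \<phi> else \<psi>) ^^ n) f \<in> hol_disc_nbhd (K i) (e i) (x i)"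
            using n K(2)[OF that] mem
            by (auto simp: hol_disc_nbhd_def L_def d_def dist_norm composition_operator_def)
          then show ?thesis using K(4)[OF that] by blast
        qed
        then have "(\<lambda>i\<in>{..<length ?Ts}. ((?Ts ! i) ^^ n) f) \<in> Pi\<^sub>E {..<length ?Ts} V"
          using Ts[OF f] by (auto simp: PiE_iff numeral_2_eq_2)
        then show "n \<in> {n. (\<lambda>i\<in>{..<length ?Ts}. ((?Ts ! i) ^^ n) f) \<in> U}" using V(3) by blast
      qed
      ultimately show "lower_density {n. (\<lambda>i\<in>{..<length ?Ts}. ((?Ts ! i) ^^ n) f) \<in> U} > 0"
        using lower_density_mono less_le_trans by blast
    qed
  qed
  then show ?thesis
    unfolding disjointly_frequently_hypercyclic_def
    by (auto simp: disjoint_frequent_orbit_def)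
qed

section \<open>Countably many targets, escape of images, and the construction of the vector\<close>

lemma ball_polynomial_approximation:
  fixes g :: "complex \<Rightarrow> complex"
  assumes g: "g holomorphic_on unit_disc" and r: "r < 1" and e: "e > 0"
  obtains n where "\<And>z. z \<in> cball 0 r \<Longrightarrow> cmod ((\<Sum>i<n. (deriv ^^ i) g 0 / fact i * z ^ i) - g z) < e"
proof -
  define a where "a i = (deriv ^^ i) g 0 / fact i" for i
  have sums: "(\<lambda>i. a i * z ^ i) sums g z" if "z \<in> unit_disc" for z
    using holomorphic_power_series[OF g that] by (simp add: a_def)
  have "conv_radius a \<ge> 1"
  proof (rule conv_radius_geI_ex')
    fix s :: real assume "0 < s" "ereal s < 1"
    then have "of_real s \<in> unit_disc" by simp
    from sums_summable[OF sums[OF this]] show "summable (\<lambda>n. a n * of_real s ^ n)" .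
  qed
  moreover have "ereal r < 1" using r by simp
  ultimately have "ereal r < conv_radius a" by (rule less_le_trans[rotated])
  from powser_uniform_limit[OF this, of 0]
  have "uniform_limit (cball 0 r) (\<lambda>n x. \<Sum>i<n. a i * x ^ i) (\<lambda>x. suminf (\<lambda>i. a i * x ^ i)) sequentially"
    by simp
  then have "\<forall>\<^sub>F n in sequentially. \<forall>x\<in>cball 0 r. dist (\<Sum>i<n. a i * x ^ i) (suminf (\<lambda>i. a i * x ^ i)) < e"
    using e unfolding uniform_limit_iff by blast
  then obtain n where n: "\<forall>x\<in>cball 0 r. dist (\<Sum>i<n. a i * x ^ i) (suminf (\<lambda>i. a i * x ^ i)) < e"
    unfolding eventually_sequentially by blast
  show ?thesis
  proof (rule that[of n])
    fix z :: complex assume z: "z \<in> cball 0 r"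
    then have s: "suminf (\<lambda>i. a i * z ^ i) = g z" using r by (intro sums_unique[symmetric] sums) auto
    then show "cmod ((\<Sum>i<n. (deriv ^^ i) g 0 / fact i * z ^ i) - g z) < e"
      using n[rule_format, OF z] unfolding s dist_norm unfolding a_def by blast
  qed
qed

lemma countable_dense_polynomials:
  obtains P :: "nat \<Rightarrow> complex \<Rightarrow> complex" where "\<And>i. P i holomorphic_on unit_disc"
    "\<And>g r e. g holomorphic_on unit_disc \<Longrightarrow> r < 1 \<Longrightarrow> e > 0 \<Longrightarrow> \<exists>i. \<forall>z\<in>cball 0 r. cmod (P i z - g z) < e"
proof -
  obtain D :: "complex set" where D: "countable D" "\<And>X. open X \<Longrightarrow> X \<noteq> {} \<Longrightarrow> \<exists>d\<in>D. d \<in> X"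
    by (rule countable_dense_setE) blast
  define poly_of where "poly_of cs z = (\<Sum>i<length cs. cs ! i * z ^ i)" for cs and z :: complex
  define P where "P i = poly_of (from_nat_into (lists D) i)" for i
  have cnt: "countable (lists D)" using D(1) by (rule countable_lists)
  show ?thesis
  proof (rule that[of P])
    show "P i holomorphic_on unit_disc" for i
      unfolding P_def poly_of_def by (intro holomorphic_intros)
    fix g :: "complex \<Rightarrow> complex" and r e :: real
    assume g: "g holomorphic_on unit_disc" and r: "r < 1" and e: "e > 0"
    define a where "a i = (deriv ^^ i) g 0 / fact i" for i
    obtain n where n: "\<And>z. z \<in> cball 0 r \<Longrightarrow> cmod ((\<Sum>i<n. a i * z ^ i) - g z) < e / 2"
      unfolding a_def using ball_polynomial_approximation[OF g r half_gt_zero[OF e]] by blast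
    define d where "d = e / 2 / (n + 1)"
    have d: "d > 0" using e by (simp add: d_def)
    have "\<exists>c. c \<in> D \<and> cmod (a i - c) < d" for i
      using D(2)[of "ball (a i) d"] d by (auto simp: dist_norm)
    then obtain c where c: "\<And>i. c i \<in> D" "\<And>i. cmod (a i - c i) < d" by metis
    have "map c [0..<n] \<in> lists D" using c(1) by auto
    then obtain i where i: "from_nat_into (lists D) i = map c [0..<n]"
      using from_nat_into_surj[OF cnt] by blast
    have Pi: "P i z = (\<Sum>i<n. c i * z ^ i)" for z by (simp add: P_def i poly_of_def)
    show "\<exists>i. \<forall>z\<in>cball 0 r. cmod (P i z - g z) < e"
    proof (intro exI[of _ i] ballI)
      fix z :: complex assume z: "z \<in> cball 0 r"
      have "P i z - g z = (\<Sum>i<n. (c i - a i) * z ^ i) + ((\<Sum>i<n. a i * z ^ i) - g z)"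
        unfolding Pi by (simp add: left_diff_distrib sum_subtractf)
      also have "cmod \<dots> \<le> (\<Sum>i<n. d) + cmod ((\<Sum>i<n. a i * z ^ i) - g z)"
      proof (intro norm_triangle_mono order_refl order_trans[OF norm_sum] sum_mono)
        fix i
        have "cmod (c i - a i) * cmod z ^ i \<le> d * 1"
          using c(2)[of i] z r d by (intro mult_mono power_le_one) (auto simp: norm_minus_commute)
        then show "cmod ((c i - a i) * z ^ i) \<le> d" by (simp add: norm_mult norm_power)
      qed
      also have "(\<Sum>i<n. d) < e / 2"
        using e by (simp add: d_def field_simps)
      finally show "cmod (P i z - g z) < e" using n[OF z] by simp
    qed
  qed
qed

lemma denjoy_wolff_escape:
  assumes \<phi>: "univalent_self_map \<phi>" "denjoy_wolff_point \<phi> \<alpha>"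
    and K: "compact K" "K \<subseteq> unit_disc" and L: "compact L" "L \<subseteq> unit_disc"
  obtains N where "\<And>n. n \<ge> N \<Longrightarrow> (\<phi> ^^ n) ` K \<inter> L = {}"
proof -
  have "cmod \<alpha> = 1" and lim: "uniform_limit K (\<lambda>n. \<phi> ^^ n) (\<lambda>_. \<alpha>) sequentially"
    using \<phi>(2) K by (auto simp: denjoy_wolff_point_def)
  then have "\<alpha> \<notin> L" using L(2) by auto
  then obtain d where d: "d > 0" "\<And>x. x \<in> L \<Longrightarrow> d \<le> dist \<alpha> x"
    using separate_point_closed[OF compact_imp_closed[OF L(1)]] by blast
  then have "\<forall>\<^sub>F n in sequentially. \<forall>z\<in>K. dist ((\<phi> ^^ n) z) \<alpha> < d"
    using lim unfolding uniform_limit_iff by blast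
  then obtain N where N: "\<And>n z. n \<ge> N \<Longrightarrow> z \<in> K \<Longrightarrow> dist ((\<phi> ^^ n) z) \<alpha> < d"
    unfolding eventually_sequentially by blast
  show ?thesis
  proof (rule that[of N])
    fix n assume "n \<ge> N"
    then show "(\<phi> ^^ n) ` K \<inter> L = {}" using N d(2) by (fastforce simp: dist_commute)
  qed
qed

lemma compact_funpow_image:
  assumes "univalent_self_map \<phi>" "compact K" "K \<subseteq> unit_disc"
  shows "compact ((\<phi> ^^ n) ` K)" "(\<phi> ^^ n) ` K \<subseteq> unit_disc"
proof -
  have "\<phi> ^^ n holomorphic_on unit_disc"
    using univalent_self_map_funpow[OF assms(1)] by (simp add: univalent_self_map_def)
  then have "continuous_on K (\<phi> ^^ n)"
    using assms(3) continuous_on_subset holomorphic_on_imp_continuous_on by blast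
  then show "compact ((\<phi> ^^ n) ` K)" using assms(2) by (rule compact_continuous_image)
  show "(\<phi> ^^ n) ` K \<subseteq> unit_disc" using univalent_funpow_in_disc[OF assms(1)] assms(3) by blast
qed

text \<open>The assumption controls pairs with both times large. If one time is below
  \<open>N0\<close>, its image belongs to a finite union of compact sets, from which the images of
  the other map escape.\<close>

lemma separation_unilateral:
  fixes h :: "nat \<Rightarrow> real"
  assumes \<phi>: "univalent_self_map \<phi>" "denjoy_wolff_point \<phi> \<alpha>"
    and \<psi>: "univalent_self_map \<psi>" "denjoy_wolff_point \<psi> \<beta>"
    and K: "compact K" "K \<subseteq> unit_disc"
    and sep: "\<exists>N::nat. \<forall>n\<ge>N. \<forall>m\<ge>N. N < \<bar>h n - m\<bar> \<longrightarrow> (\<phi> ^^ n) ` K \<inter> (\<psi> ^^ m) ` K = {}"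
  obtains N :: nat where
    "\<And>n m. N \<le> n \<or> N \<le> m \<Longrightarrow> N < \<bar>h n - m\<bar> \<Longrightarrow> (\<phi> ^^ n) ` K \<inter> (\<psi> ^^ m) ` K = {}"
proof -
  obtain N0 :: nat where N0: "\<And>n m. n \<ge> N0 \<Longrightarrow> m \<ge> N0 \<Longrightarrow> N0 < \<bar>h n - m\<bar> \<Longrightarrow> (\<phi> ^^ n) ` K \<inter> (\<psi> ^^ m) ` K = {}"
    using sep by blast
  have c: "compact (\<Union>m<N0. (\<xi> ^^ m) ` K)" "(\<Union>m<N0. (\<xi> ^^ m) ` K) \<subseteq> unit_disc"
    if "univalent_self_map \<xi>" for \<xi>
    using compact_funpow_image[OF that K] by (auto intro!: compact_UN)
  obtain N1 where N1: "\<And>n. n \<ge> N1 \<Longrightarrow> (\<phi> ^^ n) ` K \<inter> (\<Union>m<N0. (\<psi> ^^ m) ` K) = {}"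
    using denjoy_wolff_escape[OF \<phi> K c[OF \<psi>(1)]] by blast
  obtain N2 where N2: "\<And>n. n \<ge> N2 \<Longrightarrow> (\<psi> ^^ n) ` K \<inter> (\<Union>m<N0. (\<phi> ^^ m) ` K) = {}"
    using denjoy_wolff_escape[OF \<psi> K c[OF \<phi>(1)]] by blast
  show ?thesis
  proof (rule that[of "max N0 (max N1 N2)"])
    fix n m :: nat assume a: "max N0 (max N1 N2) \<le> n \<or> max N0 (max N1 N2) \<le> m"
      and b: "real (max N0 (max N1 N2)) < \<bar>h n - m\<bar>"
    consider "n \<ge> N0" "m \<ge> N0" | "n < N0" "m \<ge> N2" | "m < N0" "n \<ge> N1" using a by linarith
    then show "(\<phi> ^^ n) ` K \<inter> (\<psi> ^^ m) ` K = {}"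
    proof cases
      case 1 then show ?thesis using b by (intro N0) auto
    next
      case 2 then show ?thesis using N2[of m] by blast
    next
      case 3 then show ?thesis using N1[of n] by blast
    qed
  qed
qed

text \<open>Injectivity allows \<open>\<phi> ^^ n\<close> to be cancelled, which leaves the escape
  of \<open>\<phi> ^^ (m - n)\<close> from \<open>K\<close>.\<close>

lemma funpow_images_disjoint:
  assumes \<phi>: "univalent_self_map \<phi>" and esc: "\<And>n. n \<ge> N \<Longrightarrow> (\<phi> ^^ n) ` K \<inter> K = {}"
    and K: "K \<subseteq> unit_disc" and nm: "n < m" "N \<le> m - n"
  shows "(\<phi> ^^ n) ` K \<inter> (\<phi> ^^ m) ` K = {}"
proof (rule ccontr)
  assume "(\<phi> ^^ n) ` K \<inter> (\<phi> ^^ m) ` K \<noteq> {}"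
  then obtain x y where xy: "x \<in> K" "y \<in> K" "(\<phi> ^^ n) x = (\<phi> ^^ m) y" by auto
  have "\<phi> ^^ m = \<phi> ^^ n \<circ> \<phi> ^^ (m - n)" using nm(1) by (simp add: funpow_add[symmetric])
  then have "(\<phi> ^^ n) x = (\<phi> ^^ n) ((\<phi> ^^ (m - n)) y)" using xy(3) by simp
  moreover have "inj_on (\<phi> ^^ n) unit_disc"
    using univalent_self_map_funpow[OF \<phi>] by (simp add: univalent_self_map_def)
  ultimately have "x = (\<phi> ^^ (m - n)) y"
    using xy K univalent_funpow_in_disc[OF \<phi>] by (meson inj_onD subsetD)
  then show False using esc[OF nm(2)] xy by blast
qed

text \<open>A single function is prescribed on the images of \<open>D k\<close> under both iterates
  for all \<open>n \<in> A k\<close>; there it imitates the two polynomials coded by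
  \<open>k\<close>. Every pair of targets is approximated by such a pair of polynomials, and the
  density of one set \<open>A k\<close> then gives the density of the return times.\<close>

theorem disjoint_frequent_orbit_exists:
  fixes \<tau> \<kappa> :: real
  assumes \<phi>: "univalent_self_map \<phi>" "denjoy_wolff_point \<phi> \<alpha>"
    and \<psi>: "univalent_self_map \<psi>" "denjoy_wolff_point \<psi> \<beta>"
    and \<tau>: "\<tau> > 0" "\<tau> \<noteq> 1 \<or> \<kappa> \<noteq> 0"
    and sep: "\<And>K. compact K \<Longrightarrow> K \<subseteq> unit_disc \<Longrightarrow>
      \<exists>N::nat. \<forall>n\<ge>N. \<forall>m\<ge>N. N < \<bar>\<tau> * n + \<kappa> * ln n - m\<bar> \<longrightarrow> (\<phi> ^^ n) ` K \<inter> (\<psi> ^^ m) ` K = {}"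
  shows "\<exists>f. disjoint_frequent_orbit \<phi> \<psi> f"
proof -
  define r :: "nat \<Rightarrow> real" where "r k = 1 - 1 / (k + 2)" for k
  define D :: "nat \<Rightarrow> complex set" where "D k = cball 0 (r k)" for k
  have r: "0 \<le> r k" "r k < 1" for k by (auto simp: r_def)
  have r_mono: "r k \<le> r l" if "k \<le> l" for k l using that by (simp add: r_def frac_le)
  have D: "compact (D k)" "D k \<subseteq> unit_disc" for k using r(2)[of k] by (auto simp: D_def unit_disc_radius)
  have D_mono: "D k \<subseteq> D l" if "k \<le> l" for k l using r_mono[OF that] by (auto simp: D_def)
  have "\<exists>N::nat. N > 0 \<and> (\<forall>n\<ge>N. (\<phi> ^^ n) ` D k \<inter> D k = {}) \<and> (\<forall>n\<ge>N. (\<psi> ^^ n) ` D k \<inter> D k = {}) \<and>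
      (\<forall>n m. N \<le> n \<or> N \<le> m \<longrightarrow> N < \<bar>\<tau> * n + \<kappa> * ln n - m\<bar> \<longrightarrow> (\<phi> ^^ n) ` D k \<inter> (\<psi> ^^ m) ` D k = {})" for k
  proof -
    obtain N1 where N1: "\<And>n. n \<ge> N1 \<Longrightarrow> (\<phi> ^^ n) ` D k \<inter> D k = {}"
      using denjoy_wolff_escape[OF \<phi> D D] by blast
    obtain N2 where N2: "\<And>n. n \<ge> N2 \<Longrightarrow> (\<psi> ^^ n) ` D k \<inter> D k = {}"
      using denjoy_wolff_escape[OF \<psi> D D] by blast
    obtain N3 :: nat where N3: "\<And>n m. N3 \<le> n \<or> N3 \<le> m \<Longrightarrow> N3 < \<bar>\<tau> * n + \<kappa> * ln n - m\<bar> \<Longrightarrow> (\<phi> ^^ n) ` D k \<inter> (\<psi> ^^ m) ` D k = {}"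
      using separation_unilateral[OF \<phi> \<psi> D sep[OF D]] by blast
    define M where "M = Suc (max N1 (max N2 N3))"
    have M: "M > 0" "N1 \<le> M" "N2 \<le> M" "N3 \<le> M" by (auto simp: M_def)
    have "(\<phi> ^^ n) ` D k \<inter> (\<psi> ^^ m) ` D k = {}" if "M \<le> n \<or> M \<le> m" "M < \<bar>\<tau> * n + \<kappa> * ln n - m\<bar>" for n m :: nat
      using that M(4) by (intro N3) auto
    moreover have "(\<phi> ^^ n) ` D k \<inter> D k = {} \<and> (\<psi> ^^ n) ` D k \<inter> D k = {}" if "M \<le> n" for n
      using that M(2,3) N1[of n] N2[of n] by simp
    ultimately show ?thesis using M(1) by (intro exI[of _ M]) blast
  qed
  then obtain N :: "nat \<Rightarrow> nat" where N: "\<And>k. N k > 0"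
    "\<And>k n. n \<ge> N k \<Longrightarrow> (\<phi> ^^ n) ` D k \<inter> D k = {}" "\<And>k n. n \<ge> N k \<Longrightarrow> (\<psi> ^^ n) ` D k \<inter> D k = {}"
    "\<And>k n m. N k \<le> n \<or> N k \<le> m \<Longrightarrow> N k < \<bar>\<tau> * n + \<kappa> * ln n - m\<bar> \<Longrightarrow> (\<phi> ^^ n) ` D k \<inter> (\<psi> ^^ m) ` D k = {}"
    by metis
  obtain A where A: "\<And>k. lower_density (A k) > 0" "\<And>k n. n \<in> A k \<Longrightarrow> N k \<le> n"
    "\<And>k l n. n \<in> A k \<Longrightarrow> n \<in> A l \<Longrightarrow> k = l"
    "\<And>k l n m. n \<in> A k \<Longrightarrow> m \<in> A l \<Longrightarrow> n < m \<Longrightarrow> N k \<le> m - n \<and> N l \<le> m - n"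
    "\<And>k l n m. n \<in> A k \<Longrightarrow> m \<in> A l \<Longrightarrow>
       N k < \<bar>\<tau> * n + \<kappa> * ln n - m\<bar> \<and> N l < \<bar>\<tau> * n + \<kappa> * ln n - m\<bar>"
    by (rule separated_sets_exist[where N = N, OF \<tau> N(1)]) blast
  obtain P :: "nat \<Rightarrow> complex \<Rightarrow> complex" where P: "\<And>i. P i holomorphic_on unit_disc"
    "\<And>g r e. g holomorphic_on unit_disc \<Longrightarrow> r < 1 \<Longrightarrow> e > 0 \<Longrightarrow> \<exists>i. \<forall>z\<in>cball 0 r. cmod (P i z - g z) < e"
    by (rule countable_dense_polynomials) blast
  define I where "I = {(k, b, n). n \<in> A k \<and> (b \<or> \<not> b)}"
  define \<xi> where "\<xi> b = (if b then \<phi> else \<psi>)" for b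
  define F where "F = (\<lambda>(k::nat, b, n). \<xi> b ^^ n)"
  \<comment> \<open>\<open>k\<close> codes \<open>((i1, i2), j)\<close>, where \<open>i1\<close> is
    the target along \<phi> and \<open>i2\<close> the one along \<psi>. The number \<open>j\<close>
    makes every pair recur with arbitrarily large \<open>k\<close>, hence with radius
    \<open>r k\<close> near 1 and tolerance \<open>1 / (k + 1)\<close> near 0.\<close>
  define Q where "Q = (\<lambda>(k, b, n::nat). P ((if b then fst else snd) (prod_decode (fst (prod_decode k)))))"
  define R where "R = (\<lambda>(k, b::bool, n::nat). r k)"
  define \<epsilon> :: "nat \<times> bool \<times> nat \<Rightarrow> real" where "\<epsilon> = (\<lambda>(k, b, n). 1 / (k + 1))"
  have \<xi>: "univalent_self_map (\<xi> b)" for b using \<phi> \<psi> by (simp add: \<xi>_def)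
  have esc: "n \<ge> N k \<Longrightarrow> (\<xi> b ^^ n) ` D k \<inter> D k = {}" for n k b
    using N(2)[of k n] N(3)[of k n] by (simp add: \<xi>_def)
  have same: "(\<xi> b ^^ n) ` D k \<inter> (\<xi> b ^^ m) ` D l = {}" if "n \<in> A k" "m \<in> A l" "n < m" for b k l n m
  proof -
    define M where "M = max k l"
    have "N M \<le> m - n" using A(4)[OF that] by (simp add: M_def max_def)
    then have "(\<xi> b ^^ n) ` D M \<inter> (\<xi> b ^^ m) ` D M = {}"
      by (intro funpow_images_disjoint[OF \<xi> esc[of M] D(2) that(3)])
    then show ?thesis using D_mono[of k M] D_mono[of l M] by (fastforce simp: M_def)
  qed
  have diff: "(\<phi> ^^ n) ` D k \<inter> (\<psi> ^^ m) ` D l = {}" if "n \<in> A k" "m \<in> A l" for k l n m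
  proof -
    define M where "M = max k l"
    \<comment> \<open>Only the time that belongs to the larger of the two indices is known to reach
      \<open>N M\<close>, hence the one-sided form of the separation.\<close>
    have "N M \<le> n \<or> N M \<le> m" using A(2)[OF that(1)] A(2)[OF that(2)] by (simp add: M_def max_def)
    moreover have "N M < \<bar>\<tau> * n + \<kappa> * ln n - m\<bar>" using A(5)[OF that] by (simp add: M_def max_def)
    ultimately have "(\<phi> ^^ n) ` D M \<inter> (\<psi> ^^ m) ` D M = {}" by (rule N(4))
    then show ?thesis using D_mono[of k M] D_mono[of l M] by (fastforce simp: M_def)
  qed
  have disj: "(\<xi> b ^^ n) ` D k \<inter> (\<xi> c ^^ m) ` D l = {}"
    if "n \<in> A k" "m \<in> A l" "(k, b, n) \<noteq> (l, c, m)" for b c k l n m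
  proof (cases "b = c")
    case True
    have "n \<noteq> m" using that A(3)[of n k l] True by auto
    then consider "n < m" | "m < n" by linarith
    then show ?thesis
    proof cases
      case 1 then show ?thesis using same[OF that(1,2)] True by simp
    next
      case 2 then show ?thesis using same[OF that(2,1), of b] True by (simp add: Int_commute)
    qed
  next
    case False
    then show ?thesis using diff[OF that(1,2)] diff[OF that(2,1)] by (cases b) (auto simp: \<xi>_def Int_commute)
  qed
  obtain f where f: "f holomorphic_on unit_disc"
    "\<And>j u. j \<in> I \<Longrightarrow> u \<in> cball 0 (R j) \<Longrightarrow> cmod (f (F j u) - Q j u) < \<epsilon> j"
  proof (rule approximate_on_disjoint_family[of I F Q R \<epsilon>])
    show "disjoint_family_on (\<lambda>j. F j ` cball 0 (R j)) I"
      unfolding disjoint_family_on_def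
    proof (intro ballI impI)
      fix i j assume ij: "i \<in> I" "j \<in> I" "i \<noteq> j"
      obtain k b n where i: "i = (k, b, n)" by (cases i) auto
      obtain l c m where j: "j = (l, c, m)" by (cases j) auto
      show "F i ` cball 0 (R i) \<inter> F j ` cball 0 (R j) = {}"
        using disj[of n k m l b c] ij by (simp add: i j F_def R_def I_def D_def)
    qed
    show "finite {j \<in> I. F j ` cball 0 (R j) \<inter> cball 0 s \<noteq> {}}" if s: "s < 1" for s
    proof -
      obtain k0 where k0: "s \<le> r k0"
      proof -
        obtain k0 where "1 / real (Suc k0) < 1 - s" using nat_approx_posE[of "1 - s"] s by auto
        moreover have "1 / real (k0 + 2) \<le> 1 / real (Suc k0)" by (intro divide_left_mono) auto
        ultimately have "s \<le> r k0" by (simp add: r_def add.commute)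
        then show ?thesis using that by blast
      qed
      \<comment> \<open>If \<open>k \<ge> k0\<close>, the image would meet its own disc
        \<open>D k\<close>, which times in \<open>A k\<close> exclude. If \<open>k < k0\<close>, it
        lies in the image of \<open>D k0\<close>, which misses \<open>D k0\<close> from time
        \<open>N k0\<close> on.\<close>
      have "{j \<in> I. F j ` cball 0 (R j) \<inter> cball 0 s \<noteq> {}} \<subseteq> {..<k0} \<times> UNIV \<times> {..<N k0}"
      proof
        fix j assume j: "j \<in> {j \<in> I. F j ` cball 0 (R j) \<inter> cball 0 s \<noteq> {}}"
        obtain k b n where jk: "j = (k, b, n)" by (cases j) auto
        have n: "n \<in> A k" and meet: "(\<xi> b ^^ n) ` D k \<inter> D k0 \<noteq> {}"
          using j k0 by (auto simp: jk I_def F_def R_def D_def)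
        have "k < k0"
        proof (rule ccontr)
          assume "\<not> k < k0"
          then have "(\<xi> b ^^ n) ` D k \<inter> D k \<noteq> {}" using meet D_mono[of k0 k] by fastforce
          then show False using esc[OF A(2)[OF n], of b] by blast
        qed
        moreover have "n < N k0"
        proof (rule ccontr)
          assume "\<not> n < N k0"
          then have "(\<xi> b ^^ n) ` D k0 \<inter> D k0 = {}" by (intro esc) auto
          then show False using meet D_mono[of k k0] \<open>k < k0\<close> by fastforce
        qed
        ultimately show "j \<in> {..<k0} \<times> UNIV \<times> {..<N k0}" by (simp add: jk)
      qed
      then show ?thesis by (rule finite_subset) simp
    qed
  qed (use \<xi> univalent_self_map_funpow P(1) r in \<open>auto simp: F_def Q_def R_def \<epsilon>_def split: prod.splits\<close>)
  define f' where "f' z = (if z \<in> unit_disc then f z else 0)" for z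
  have f'_in: "f' \<in> hol_disc"
    using holomorphic_transform[OF f(1), of f'] by (auto simp: hol_disc_def f'_def)
  have app: "cmod (f' ((\<xi> b ^^ n) u) - P ((if b then fst else snd) (prod_decode (fst (prod_decode k)))) u) < 1 / (k + 1)"
    if "n \<in> A k" "u \<in> D k" for b k n u
  proof -
    have "(\<xi> b ^^ n) u \<in> unit_disc" using univalent_funpow_in_disc[OF \<xi>] that(2) D(2) by blast
    then show ?thesis
      using f(2)[of "(k, b, n)" u] that by (simp add: I_def F_def Q_def R_def \<epsilon>_def D_def f'_def)
  qed
  have "disjoint_frequent_orbit \<phi> \<psi> f'"
    unfolding disjoint_frequent_orbit_def
  proof (intro conjI f'_in ballI allI impI)
    fix g h K and e :: real
    assume gh: "g \<in> hol_disc" "h \<in> hol_disc" and K: "compact K" "K \<subseteq> unit_disc" and e: "e > 0"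
    obtain s where s: "s < 1" "K \<subseteq> cball 0 s" using compact_subset_cball[OF K] by metis
    have gh': "g holomorphic_on unit_disc" "h holomorphic_on unit_disc" using gh by (auto simp: hol_disc_def)
    obtain i1 where i1: "\<forall>z\<in>cball 0 s. cmod (P i1 z - g z) < e / 2" using P(2)[OF gh'(1) s(1), of "e / 2"] e by auto
    obtain i2 where i2: "\<forall>z\<in>cball 0 s. cmod (P i2 z - h z) < e / 2" using P(2)[OF gh'(2) s(1), of "e / 2"] e by auto
    obtain j1 where j1: "1 / real (Suc j1) < min (1 - s) (e / 2)"
      using nat_approx_posE[of "min (1 - s) (e / 2)"] s e by auto
    define k where "k = prod_encode (prod_encode (i1, i2), j1)"
    have "j1 \<le> k" unfolding k_def by (rule le_prod_encode_2)
    then have "1 / real (k + 2) \<le> 1 / real (Suc j1)" "1 / real (k + 1) \<le> 1 / real (Suc j1)"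
      by (intro divide_left_mono; simp)+
    then have sk: "s \<le> r k" and ek: "1 / real (k + 1) < e / 2" using j1 by (auto simp: r_def add.commute)
    have KD: "K \<subseteq> D k" using s(2) sk by (auto simp: D_def)
    have "A k \<subseteq> {n. \<forall>z\<in>K. cmod (f' ((\<phi> ^^ n) z) - g z) < e \<and> cmod (f' ((\<psi> ^^ n) z) - h z) < e}"
    proof (intro subsetI CollectI ballI)
      fix n z assume n: "n \<in> A k" and z: "z \<in> K"
      have zD: "z \<in> D k" and zs: "z \<in> cball 0 s" using z KD s(2) by auto
      have a: "cmod (f' ((\<phi> ^^ n) z) - P i1 z) < 1 / (k + 1)" "cmod (f' ((\<psi> ^^ n) z) - P i2 z) < 1 / (k + 1)"
        using app[OF n zD, of True] app[OF n zD, of False] by (simp_all add: k_def \<xi>_def add.commute)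
      have b: "cmod (P i1 z - g z) < e / 2" "cmod (P i2 z - h z) < e / 2" using i1 i2 zs by auto
      have tri: "cmod (x - y) < e" if "cmod (x - w) < 1 / (k + 1)" "cmod (w - y) < e / 2" for x y w :: complex
        using norm_triangle_ineq[of "x - w" "w - y"] that ek by simp
      show "cmod (f' ((\<phi> ^^ n) z) - g z) < e \<and> cmod (f' ((\<psi> ^^ n) z) - h z) < e"
        using tri[OF a(1) b(1)] tri[OF a(2) b(2)] by blast
    qed
    then show "lower_density {n. \<forall>z\<in>K. cmod (f' ((\<phi> ^^ n) z) - g z) < e \<and> cmod (f' ((\<psi> ^^ n) z) - h z) < e} > 0"
      using A(1)[of k] lower_density_mono less_le_trans by blast
  qed
  then show ?thesis by blast
qed

section \<open>Separation of orbits\<close>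

lemma half_plane_orbit_diverges:
  assumes "denjoy_wolff_point \<phi> \<alpha>" "univalent_self_map \<phi>" "compact K" "K \<subseteq> unit_disc"
  obtains N where "\<And>n z. n \<ge> N \<Longrightarrow> z \<in> K \<Longrightarrow> R \<le> cmod (half_plane_coord \<alpha> ((\<phi> ^^ n) z))"
proof -
  have \<alpha>: "cmod \<alpha> = 1" and lim: "uniform_limit K (\<lambda>n. \<phi> ^^ n) (\<lambda>_. \<alpha>) sequentially"
    using assms by (auto simp: denjoy_wolff_point_def)
  define d where "d = 1 / max R 1"
  have d: "d > 0" "R \<le> 1 / d" by (auto simp: d_def)
  then have "\<forall>\<^sub>F n in sequentially. \<forall>z\<in>K. dist ((\<phi> ^^ n) z) \<alpha> < d"
    using lim unfolding uniform_limit_iff by blast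
  then obtain N where N: "\<And>n z. n \<ge> N \<Longrightarrow> z \<in> K \<Longrightarrow> dist ((\<phi> ^^ n) z) \<alpha> < d"
    unfolding eventually_sequentially by blast
  show ?thesis
  proof (rule that[of N])
    fix n z assume nz: "n \<ge> N" "z \<in> K"
    have "(\<phi> ^^ n) z \<noteq> \<alpha>"
      using univalent_funpow_in_disc[OF assms(2), of z n] nz assms(4) \<alpha> by auto
    then have "1 / d \<le> 1 / dist ((\<phi> ^^ n) z) \<alpha>"
      using N[OF nz] d(1) by (intro divide_left_mono) auto
    then show "R \<le> cmod (half_plane_coord \<alpha> ((\<phi> ^^ n) z))"
      using d(2) by (simp add: norm_half_plane_coord[OF \<alpha>])
  qed
qed

lemma half_plane_orbit_bounded:
  assumes "univalent_self_map \<phi>" "cmod \<alpha> = 1" "compact K" "K \<subseteq> unit_disc"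
  obtains B where "B \<ge> 1" "\<And>z. z \<in> K \<Longrightarrow> cmod (half_plane_coord \<alpha> ((\<phi> ^^ n) z)) \<le> B"
proof -
  have "half_plane_coord \<alpha> \<circ> \<phi> ^^ n holomorphic_on unit_disc"
    using univalent_self_map_funpow[OF assms(1), of n] holomorphic_half_plane_coord[OF assms(2)]
    by (intro holomorphic_on_compose_gen[where t = unit_disc]) (auto simp: univalent_self_map_def)
  then have "continuous_on K (half_plane_coord \<alpha> \<circ> \<phi> ^^ n)"
    using assms(4) continuous_on_subset holomorphic_on_imp_continuous_on by blast
  then have "bounded ((half_plane_coord \<alpha> \<circ> \<phi> ^^ n) ` K)"
    using assms(3) compact_continuous_image compact_imp_bounded by blast
  then obtain B where "\<And>z. z \<in> K \<Longrightarrow> cmod (half_plane_coord \<alpha> ((\<phi> ^^ n) z)) \<le> B"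
    by (auto simp: bounded_iff)
  then show ?thesis using that[of "max 1 B"] by (simp add: max.coboundedI2)
qed

text \<open>The recursion estimate applies from the time \<open>N\<close> at which all orbits of
  \<open>K\<close> are beyond \<open>R1\<close>. Counting from \<open>N\<close> instead of 0 changes
  the drift by \<open>N * p\<close> and the logarithm by at most \<open>ln (N + 2)\<close>.\<close>

lemma parabolic_asymptotics:
  assumes \<phi>: "univalent_self_map \<phi>" "denjoy_wolff_point \<phi> \<alpha>"
    and est: "parabolic_estimate \<phi> \<alpha> p q C e R" and p: "p \<noteq> 0"
    and K: "compact K" "K \<subseteq> unit_disc"
  obtains N C' where "\<And>n z. n \<ge> N \<Longrightarrow> z \<in> K \<Longrightarrow>
    cmod (half_plane_coord \<alpha> ((\<phi> ^^ n) z) - (of_nat n * p + q / p * of_real (ln n))) \<le> C'"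
proof -
  have \<alpha>: "cmod \<alpha> = 1" using \<phi>(2) by (auto simp: denjoy_wolff_point_def)
  have est': "C \<ge> 0" "e > 0" and step: "\<And>z. z \<in> unit_disc \<Longrightarrow> R \<le> cmod (half_plane_coord \<alpha> z) \<Longrightarrow>
        cmod (half_plane_coord \<alpha> (\<phi> z) - (half_plane_coord \<alpha> z + p + q / half_plane_coord \<alpha> z))
          \<le> C * cmod (half_plane_coord \<alpha> z) powr (- 1 - e)"
    using est unfolding parabolic_estimate_def by blast+
  obtain R1 where R1: "R1 \<ge> 1" "\<And>B. \<exists>C'. \<forall>v :: nat \<Rightarrow> complex. cmod (v 0) \<le> B \<longrightarrow> (\<forall>n. R1 \<le> cmod (v n)) \<longrightarrow>
       (\<forall>n. R \<le> cmod (v n) \<longrightarrow> cmod (v (Suc n) - (v n + p + q / v n)) \<le> C * cmod (v n) powr (- 1 - e)) \<longrightarrow>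
       (\<forall>n. cmod (v n - (of_nat n * p + q / p * of_real (ln (real (Suc n))))) \<le> C')"
    by (rule parabolic_orbit[where ?R0.0 = R and q = q, OF p est']) blast
  obtain N where N: "\<And>n z. n \<ge> N \<Longrightarrow> z \<in> K \<Longrightarrow> R1 \<le> cmod (half_plane_coord \<alpha> ((\<phi> ^^ n) z))"
    using half_plane_orbit_diverges[OF \<phi>(2,1) K] by blast
  obtain B where B: "\<And>z. z \<in> K \<Longrightarrow> cmod (half_plane_coord \<alpha> ((\<phi> ^^ N) z)) \<le> B"
    using half_plane_orbit_bounded[OF \<phi>(1) \<alpha> K] by blast
  obtain C' where C': "\<And>v :: nat \<Rightarrow> complex. \<And>n. cmod (v 0) \<le> B \<Longrightarrow> (\<And>n. R1 \<le> cmod (v n)) \<Longrightarrow>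
       (\<And>n. R \<le> cmod (v n) \<Longrightarrow> cmod (v (Suc n) - (v n + p + q / v n)) \<le> C * cmod (v n) powr (- 1 - e)) \<Longrightarrow>
       cmod (v n - (of_nat n * p + q / p * of_real (ln (real (Suc n))))) \<le> C'"
    using R1(2)[of B] by blast
  show ?thesis
  proof (rule that[of "Suc N" "C' + (real N * cmod p + cmod (q / p) * ln (N + 2))"])
    fix n z assume n: "n \<ge> Suc N" and z: "z \<in> K"
    define v where "v k = half_plane_coord \<alpha> ((\<phi> ^^ (N + k)) z)" for k
    define k where "k = n - N"
    have k: "n = N + k" "k \<ge> 1" using n by (auto simp: k_def)
    have a: "cmod (v k - (of_nat k * p + q / p * of_real (ln (real (Suc k))))) \<le> C'"
    proof (rule C')
      show "cmod (v 0) \<le> B" using B[OF z] by (simp add: v_def)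
      show "R1 \<le> cmod (v m)" for m using N[of "N + m" z] z by (simp add: v_def)
      show "cmod (v (Suc m) - (v m + p + q / v m)) \<le> C * cmod (v m) powr (- 1 - e)" if "R \<le> cmod (v m)" for m
        using step[of "(\<phi> ^^ (N + m)) z"] that univalent_funpow_in_disc[OF \<phi>(1), of z "N + m"] z K(2)
        by (auto simp: v_def)
    qed
    have l: "\<bar>ln (real n) - ln (real (Suc k))\<bar> \<le> ln (N + 2)"
    proof -
      have "real (Suc k) \<le> real n * real (N + 2)"
      proof -
        have "real (Suc k) \<le> 2 * real n" using k by simp
        also have "\<dots> \<le> real (N + 2) * real n" by (intro mult_right_mono) auto
        finally show ?thesis by (simp add: mult.commute)
      qed
      moreover have "real n \<le> real (Suc k) * real (N + 2)"
        unfolding k(1) by (simp add: algebra_simps)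
      moreover have "real n > 0" "real (Suc k) > 0" "real (N + 2) > 0" using k by auto
      ultimately have "ln (real (Suc k)) \<le> ln (real n * real (N + 2))" "ln (real n) \<le> ln (real (Suc k) * real (N + 2))"
        by (subst ln_le_cancel_iff; simp del: of_nat_Suc)+
      then show ?thesis using \<open>real n > 0\<close> \<open>real (Suc k) > 0\<close> \<open>real (N + 2) > 0\<close>
        by (simp add: ln_mult_pos del: of_nat_Suc)
    qed
    have "half_plane_coord \<alpha> ((\<phi> ^^ n) z) - (of_nat n * p + q / p * of_real (ln n))
        = (v k - (of_nat k * p + q / p * of_real (ln (real (Suc k))))) - (of_nat N * p + q / p * of_real (ln (real n) - ln (real (Suc k))))"
      by (simp add: v_def k(1) algebra_simps)
    also have "cmod \<dots> \<le> C' + (real N * cmod p + cmod (q / p) * ln (N + 2))"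
    proof -
      have "cmod (of_nat N * p) \<le> real N * cmod p" by (simp add: norm_mult)
      moreover have "cmod (q / p * of_real (ln (real n) - ln (real (Suc k)))) \<le> cmod (q / p) * ln (N + 2)"
        unfolding norm_mult norm_of_real using l by (intro mult_left_mono) auto
      ultimately show ?thesis by (rule order_trans[OF norm_triangle_ineq4 add_mono[OF a norm_triangle_mono]])
    qed
    finally show "cmod (half_plane_coord \<alpha> ((\<phi> ^^ n) z) - (of_nat n * p + q / p * of_real (ln n))) \<le> C' + (real N * cmod p + cmod (q / p) * ln (N + 2))" .
  qed
qed

text \<open>The orbit stays in \<open>Re v > 1 / 2\<close>, while its real part divided by
  \<open>n\<close> tends to \<open>Re p\<close>.\<close>

lemma parabolic_drift_Re_nonneg:
  assumes \<phi>: "univalent_self_map \<phi>" "denjoy_wolff_point \<phi> \<alpha>"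
    and est: "parabolic_estimate \<phi> \<alpha> p q C e R" and p: "p \<noteq> 0"
  shows "Re p \<ge> 0"
proof -
  have \<alpha>: "cmod \<alpha> = 1" using \<phi>(2) by (auto simp: denjoy_wolff_point_def)
  obtain N C' where N: "\<And>n z. n \<ge> N \<Longrightarrow> z \<in> {0} \<Longrightarrow>
    cmod (half_plane_coord \<alpha> ((\<phi> ^^ n) z) - (of_nat n * p + q / p * of_real (ln n))) \<le> C'"
    by (rule parabolic_asymptotics[OF \<phi> est p, of "{0}"]) auto
  have "(\<lambda>n. Re p + Re (q / p) * (ln (real n) / real n) + C' * (1 / real n)) \<longlonglongrightarrow> Re p + Re (q / p) * 0 + C' * 0"
    by (intro tendsto_intros lim_ln_over_n lim_1_over_n)
  moreover have "\<forall>\<^sub>F n in sequentially. 0 \<le> Re p + Re (q / p) * (ln (real n) / real n) + C' * (1 / real n)"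
    using eventually_ge_at_top[of N] eventually_gt_at_top[of 0]
  proof eventually_elim
    case (elim n)
    have "Re (half_plane_coord \<alpha> ((\<phi> ^^ n) 0)) > 1 / 2"
      using univalent_funpow_in_disc[OF \<phi>(1)] by (intro half_plane_coord_Re[OF \<alpha>]) auto
    moreover have "Re (half_plane_coord \<alpha> ((\<phi> ^^ n) 0) - (of_nat n * p + q / p * of_real (ln n))) \<le> C'"
      using N[OF elim(1), of 0] complex_Re_le_cmod order_trans by blast
    moreover have "Re (b * of_real x) = Re b * x" for b x by simp
    from this[of "q / p"] have "Re (of_nat n * p + q / p * of_real (ln n)) = n * Re p + Re (q / p) * ln n"
      by (simp del: times_divide_eq_left)
    ultimately have "0 \<le> real n * Re p + Re (q / p) * ln n + C'" by simp
    also have "\<dots> = real n * (Re p + Re (q / p) * (ln (real n) / real n) + C' * (1 / real n))"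
      using elim(2) by (simp add: field_simps)
    finally show ?case using elim(2) by (simp add: zero_le_mult_iff)
  qed
  ultimately have "Re p + Re (q / p) * 0 + C' * 0 \<ge> 0"
    by (intro tendsto_lowerbound) auto
  then show ?thesis by simp
qed

text \<open>Only the logarithm of the size is recorded, because collisions of two hyperbolic maps
  are excluded by size alone.\<close>

lemma hyperbolic_asymptotics:
  assumes \<phi>: "univalent_self_map \<phi>" "denjoy_wolff_point \<phi> \<alpha>"
    and est: "hyperbolic_estimate \<phi> \<alpha> L C e R" and L: "L > 1"
    and K: "compact K" "K \<subseteq> unit_disc"
  obtains N C' where "\<And>n z. n \<ge> N \<Longrightarrow> z \<in> K \<Longrightarrow>
    \<bar>ln (cmod (half_plane_coord \<alpha> ((\<phi> ^^ n) z))) - n * ln L\<bar> \<le> C'"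
proof -
  have \<alpha>: "cmod \<alpha> = 1" using \<phi>(2) by (auto simp: denjoy_wolff_point_def)
  have est': "C \<ge> 0" "e > 0" and step: "\<And>z. z \<in> unit_disc \<Longrightarrow> R \<le> cmod (half_plane_coord \<alpha> z) \<Longrightarrow>
        cmod (half_plane_coord \<alpha> (\<phi> z) - of_real L * half_plane_coord \<alpha> z)
          \<le> C * cmod (half_plane_coord \<alpha> z) powr (1 - e)"
    using est unfolding hyperbolic_estimate_def by blast+
  obtain R1 where R1: "R1 \<ge> 1" "\<And>(v :: nat \<Rightarrow> complex) n. (\<And>n. R \<le> cmod (v n) \<Longrightarrow> cmod (v (Suc n) - of_real L * v n) \<le> C * cmod (v n) powr (1 - e)) \<Longrightarrow>
       R1 \<le> cmod (v 0) \<Longrightarrow> cmod (v n - of_real (L ^ n) * v 0) \<le> 1 / 2 * (L ^ n * cmod (v 0))"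
    by (rule hyperbolic_orbit[where ?R0.0 = R and \<delta> = "1/2", OF L est']) auto
  obtain N where N: "\<And>n z. n \<ge> N \<Longrightarrow> z \<in> K \<Longrightarrow> R1 \<le> cmod (half_plane_coord \<alpha> ((\<phi> ^^ n) z))"
    using half_plane_orbit_diverges[OF \<phi>(2,1) K] by blast
  obtain B where B: "B \<ge> 1" "\<And>z. z \<in> K \<Longrightarrow> cmod (half_plane_coord \<alpha> ((\<phi> ^^ N) z)) \<le> B"
    using half_plane_orbit_bounded[OF \<phi>(1) \<alpha> K] by blast
  show ?thesis
  proof (rule that[of N "ln 2 + ln B + N * ln L"])
    fix n z assume n: "n \<ge> N" and z: "z \<in> K"
    define v where "v k = half_plane_coord \<alpha> ((\<phi> ^^ (N + k)) z)" for k
    define k where "k = n - N"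
    have k: "n = N + k" using n by (auto simp: k_def)
    have v0: "R1 \<le> cmod (v 0)" "cmod (v 0) \<le> B" using N[of N z] B(2)[OF z] z by (auto simp: v_def)
    have a: "cmod (v k - of_real (L ^ k) * v 0) \<le> 1 / 2 * (L ^ k * cmod (v 0))"
    proof (rule R1(2))
      show "R1 \<le> cmod (v 0)" by (rule v0(1))
      show "cmod (v (Suc m) - of_real L * v m) \<le> C * cmod (v m) powr (1 - e)" if "R \<le> cmod (v m)" for m
        using step[of "(\<phi> ^^ (N + m)) z"] that univalent_funpow_in_disc[OF \<phi>(1), of z "N + m"] z K(2)
        by (auto simp: v_def)
    qed
    have n1: "cmod (of_real (L ^ k) * v 0) = L ^ k * cmod (v 0)" using L by (simp add: norm_mult norm_power)
    have pos: "L ^ k * cmod (v 0) > 0" using L v0 R1(1) by (intro mult_pos_pos) auto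
    have "cmod (v k) \<le> 2 * (L ^ k * cmod (v 0))"
      using norm_triangle_ineq[of "v k - of_real (L ^ k) * v 0" "of_real (L ^ k) * v 0"] a n1 pos by simp
    moreover have "1 / 2 * (L ^ k * cmod (v 0)) \<le> cmod (v k)"
      using norm_triangle_ineq2[of "of_real (L ^ k) * v 0" "of_real (L ^ k) * v 0 - v k"] a n1
      by (simp add: norm_minus_commute)
    ultimately have "ln (cmod (v k)) \<le> ln (2 * (L ^ k * cmod (v 0)))" "ln (1 / 2 * (L ^ k * cmod (v 0))) \<le> ln (cmod (v k))"
      using pos by (intro ln_mono; linarith)+
    moreover have "ln (2 * (L ^ k * cmod (v 0))) = ln 2 + (k * ln L + ln (cmod (v 0)))"
      "ln (1 / 2 * (L ^ k * cmod (v 0))) = - ln 2 + (k * ln L + ln (cmod (v 0)))"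
    proof -
      have 0: "cmod (v 0) > 0" "L ^ k > 0" "ln (L ^ k) = k * ln L" using L v0 R1(1) by (auto simp: ln_realpow)
      have 1: "ln (L ^ k * cmod (v 0)) = k * ln L + ln (cmod (v 0))"
        using ln_mult_pos[OF 0(2,1)] 0(3) by simp
      show "ln (2 * (L ^ k * cmod (v 0))) = ln 2 + (k * ln L + ln (cmod (v 0)))"
        using ln_mult_pos[of 2, OF _ pos] 1 by simp
      have "ln (1 / 2 :: real) = - ln 2" by (simp add: ln_div)
      then show "ln (1 / 2 * (L ^ k * cmod (v 0))) = - ln 2 + (k * ln L + ln (cmod (v 0)))"
        using ln_mult_pos[of "1/2", OF _ pos] 1 by simp
    qed
    moreover have "0 \<le> ln (cmod (v 0))" using v0(1) R1(1) by auto
    moreover have "ln (cmod (v 0)) \<le> ln B" using v0 R1(1) by (intro ln_mono) auto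
    moreover have "n * ln L = k * ln L + N * ln L" "N * ln L \<ge> 0" using L by (auto simp: k algebra_simps)
    ultimately have "\<bar>ln (cmod (v k)) - n * ln L\<bar> \<le> ln 2 + ln B + N * ln L" by linarith
    then show "\<bar>ln (cmod (half_plane_coord \<alpha> ((\<phi> ^^ n) z))) - n * ln L\<bar> \<le> ln 2 + ln B + N * ln L"
      by (simp add: v_def k)
  qed
qed

section \<open>Hyperbolic orbits stay in a sector\<close>

lemma Schwarz_Pick:
  assumes g: "g holomorphic_on unit_disc" "g ` unit_disc \<subseteq> unit_disc" and xy: "x \<in> unit_disc" "y \<in> unit_disc"
  shows "cmod (Moebius_function 0 (g y) (g x)) \<le> cmod (Moebius_function 0 y x)"
proof -
  have y: "cmod y < 1" "cmod (- y) < 1" "cmod x < 1" using xy by auto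
  have gy: "cmod (g z) < 1" if "cmod z < 1" for z using g(2) that by force
  define f where "f = Moebius_function 0 (g y) \<circ> (g \<circ> Moebius_function 0 (- y))"
  have m: "Moebius_function 0 (- y) holomorphic_on unit_disc" by (rule Moebius_function_holomorphic[OF y(2)])
  have m1: "Moebius_function 0 (- y) ` unit_disc \<subseteq> unit_disc"
    using Moebius_function_norm_lt_1[OF y(2)] by auto
  have "g \<circ> Moebius_function 0 (- y) holomorphic_on unit_disc" by (rule holomorphic_on_compose_gen[OF m g(1) m1])
  moreover have "(g \<circ> Moebius_function 0 (- y)) ` unit_disc \<subseteq> unit_disc" using m1 g(2) by (auto simp: image_subset_iff)
  ultimately have "f holomorphic_on unit_disc" unfolding f_def
    by (rule holomorphic_on_compose_gen[OF _ Moebius_function_holomorphic[OF gy[OF y(1)]]])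
  moreover have "f 0 = 0"
    by (simp add: f_def Moebius_function_of_zero Moebius_function_eq_zero)
  moreover have "cmod (f z) < 1" if "cmod z < 1" for z
    using Moebius_function_norm_lt_1[OF gy[OF y(1)]] gy Moebius_function_norm_lt_1[OF y(2) that] by (simp add: f_def)
  moreover have "cmod (Moebius_function 0 y x) < 1" using Moebius_function_norm_lt_1 y by blast
  ultimately have "cmod (f (Moebius_function 0 y x)) \<le> cmod (Moebius_function 0 y x)"
    by (rule Schwarz_Lemma)
  moreover have "Moebius_function 0 (- y) (Moebius_function 0 y x) = x"
    by (rule Moebius_function_compose) (use y in auto)
  ultimately show ?thesis by (simp add: f_def)
qed

text \<open>This is the pseudohyperbolic distance in the half-plane. For
  \<open>b = half_plane_coord \<alpha> w\<close> the point \<open>1 - cnj b\<close> is the mirror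
  image of \<open>b\<close> in the line \<open>Re v = 1 / 2\<close>, and the last factor is the
  distance from it to the coordinate of \<open>z\<close>.\<close>

lemma Moebius_half_plane_coord:
  assumes \<alpha>: "cmod \<alpha> = 1" and zw: "z \<in> unit_disc" "w \<in> unit_disc"
  shows "cmod (half_plane_coord \<alpha> w - half_plane_coord \<alpha> z) =
    cmod (Moebius_function 0 w z) * cmod (cnj (half_plane_coord \<alpha> w) + half_plane_coord \<alpha> z - 1)"
proof -
  define a b where "a = half_plane_coord \<alpha> z" and "b = half_plane_coord \<alpha> w"
  have ab: "Re a > 1 / 2" "Re b > 1 / 2" using half_plane_coord_Re[OF \<alpha>] zw by (auto simp: a_def b_def)
  have nz: "a \<noteq> 0" "b \<noteq> 0" "cnj b \<noteq> 0" using ab by auto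
  have ne: "z \<noteq> \<alpha>" "w \<noteq> \<alpha>" using zw \<alpha> by auto
  have z: "z = \<alpha> * (1 - 1 / a)" and w: "w = \<alpha> * (1 - 1 / b)"
    using half_plane_inv_coord[OF \<alpha> ne(1)] half_plane_inv_coord[OF \<alpha> ne(2)] by (auto simp: a_def b_def half_plane_inv_def)
  have aa: "cnj \<alpha> * \<alpha> = 1" using \<alpha> by (metis complex_norm_square mult.commute of_real_1 one_power2)
  have "z - w = \<alpha> * ((a - b) / (a * b))" unfolding z w using nz by (simp add: field_simps)
  then have n: "cmod (z - w) = cmod (a - b) / (cmod a * cmod b)" using \<alpha> by (simp add: norm_mult norm_divide)
  have "cnj w * z = (cnj \<alpha> * \<alpha>) * ((1 - 1 / cnj b) * (1 - 1 / a))" unfolding z w by (simp add: mult_ac)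
  then have "1 - cnj w * z = (cnj b + a - 1) / (cnj b * a)" unfolding aa using nz by (simp add: field_simps)
  then have d: "cmod (1 - cnj w * z) = cmod (cnj b + a - 1) / (cmod a * cmod b)"
    by (simp add: norm_mult norm_divide mult.commute)
  have "Re (cnj b + a - 1) > 0" using ab by simp
  then have "cnj b + a - 1 \<noteq> 0" by (metis less_irrefl zero_complex.sel(1))
  then have "cmod (Moebius_function 0 w z) * cmod (cnj b + a - 1) = cmod (a - b)"
    unfolding Moebius_function_simple norm_divide n d using nz by simp
  then show ?thesis by (simp add: a_def b_def norm_minus_commute)
qed

text \<open>By Schwarz-Pick the pseudohyperbolic distance of consecutive orbit points never
  increases, so it stays below some \<open>\<rho> < 1\<close> uniformly on \<open>K\<close>.
  Consecutive points are nearly \<open>v\<close> and \<open>L * v\<close>; if \<open>Re v\<close>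
  were much smaller than \<open>cmod v\<close>, their distance would be close to 1.\<close>

lemma hyperbolic_orbit_sectorial:
  assumes \<phi>: "univalent_self_map \<phi>" "denjoy_wolff_point \<phi> \<alpha>"
    and est: "hyperbolic_estimate \<phi> \<alpha> L C e R" and L: "L > 1"
    and K: "compact K" "K \<subseteq> unit_disc"
  obtains N M where "\<And>n z. n \<ge> N \<Longrightarrow> z \<in> K \<Longrightarrow>
    cmod (half_plane_coord \<alpha> ((\<phi> ^^ n) z)) \<le> M * Re (half_plane_coord \<alpha> ((\<phi> ^^ n) z))"
proof -
  have \<alpha>: "cmod \<alpha> = 1" using \<phi>(2) by (auto simp: denjoy_wolff_point_def)
  have est': "C \<ge> 0" "e > 0" and step: "\<And>z. z \<in> unit_disc \<Longrightarrow> R \<le> cmod (half_plane_coord \<alpha> z) \<Longrightarrow>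
        cmod (half_plane_coord \<alpha> (\<phi> z) - of_real L * half_plane_coord \<alpha> z)
          \<le> C * cmod (half_plane_coord \<alpha> z) powr (1 - e)"
    using est unfolding hyperbolic_estimate_def by blast+
  have h\<phi>: "\<phi> holomorphic_on unit_disc" "\<phi> ` unit_disc \<subseteq> unit_disc" using \<phi>(1) by (auto simp: univalent_self_map_def)
  have \<phi>D: "cmod (\<phi> z) < 1" if "cmod z < 1" for z using h\<phi>(2) that by force
  have "\<exists>\<rho><1. \<forall>z\<in>K. cmod (Moebius_function 0 (\<phi> z) z) \<le> \<rho>"
  proof (cases "K = {}")
    case False
    have c: "continuous_on K \<phi>" using h\<phi>(1) K(2) continuous_on_subset holomorphic_on_imp_continuous_on by blast
    have nz: "1 - cnj (\<phi> z) * z \<noteq> 0" if "z \<in> K" for z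
    proof
      assume "1 - cnj (\<phi> z) * z = 0"
      then have "cmod (cnj (\<phi> z) * z) = 1" by simp
      moreover have "cmod z < 1" using K(2) that by auto
      then have "cmod (\<phi> z) * cmod z < 1 * 1" using \<phi>D by (intro mult_strict_mono') auto
      ultimately show False by (simp add: norm_mult)
    qed
    have "continuous_on K (\<lambda>z. cmod (Moebius_function 0 (\<phi> z) z))"
      unfolding Moebius_function_simple using nz by (intro continuous_intros c) auto
    then obtain w where w: "w \<in> K" "\<And>z. z \<in> K \<Longrightarrow> cmod (Moebius_function 0 (\<phi> z) z) \<le> cmod (Moebius_function 0 (\<phi> w) w)"
      using continuous_attains_sup[OF K(1) False] by blast
    have "cmod w < 1" using w(1) K(2) by auto
    then have "cmod (Moebius_function 0 (\<phi> w) w) < 1" using Moebius_function_norm_lt_1 \<phi>D by blast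
    then show ?thesis using w(2) by blast
  qed (auto intro: exI[of _ 0])
  then obtain \<rho>0 where \<rho>0: "\<rho>0 < 1" "\<And>z. z \<in> K \<Longrightarrow> cmod (Moebius_function 0 (\<phi> z) z) \<le> \<rho>0" by blast
  define \<rho> where "\<rho> = max \<rho>0 0"
  have \<rho>: "0 \<le> \<rho>" "\<rho> < 1" "\<And>z. z \<in> K \<Longrightarrow> cmod (Moebius_function 0 (\<phi> z) z) \<le> \<rho>"
    using \<rho>0 by (force simp: \<rho>_def)+
  \<comment> \<open>\<open>3 * \<eta>\<close> is half of \<open>(L - 1) * (1 - \<rho>)\<close>: the
    errors use up half of the gap between \<open>(L - 1) * cmod v\<close> and \<open>\<rho>\<close>
    times it, and the other half is left to bound \<open>Re v\<close> from below.\<close>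
  define \<eta> where "\<eta> = (L - 1) * (1 - \<rho>) / 6"
  have \<eta>: "\<eta> > 0" using L \<rho> by (simp add: \<eta>_def)
  have "((\<lambda>x. C * x powr (- e)) \<longlongrightarrow> C * 0) at_top"
    using est' by (intro tendsto_intros tendsto_neg_powr filterlim_ident) auto
  then have "\<forall>\<^sub>F x in at_top. C * x powr (- e) < \<eta>" using \<eta> by (intro order_tendstoD(2)) auto
  then obtain r where r: "\<And>x. x \<ge> r \<Longrightarrow> C * x powr (- e) < \<eta>" unfolding eventually_at_top_linorder by blast
  obtain N where N: "\<And>n z. n \<ge> N \<Longrightarrow> z \<in> K \<Longrightarrow> max (max 1 R) (max r (1 / \<eta>)) \<le> cmod (half_plane_coord \<alpha> ((\<phi> ^^ n) z))"
    using half_plane_orbit_diverges[OF \<phi>(2,1) K] by blast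
  show ?thesis
  proof (rule that[of N "4 / ((L - 1) * (1 - \<rho>))"])
    fix n z assume n: "n \<ge> N" and z: "z \<in> K"
    have zD: "z \<in> unit_disc" "\<phi> z \<in> unit_disc" using z K(2) h\<phi>(2) by blast+
    define x where "x = (\<phi> ^^ n) z"
    define v where "v = half_plane_coord \<alpha> x"
    define w where "w = half_plane_coord \<alpha> (\<phi> x)"
    have xD: "x \<in> unit_disc" using univalent_funpow_in_disc[OF \<phi>(1) zD(1)] by (simp add: x_def)
    have \<phi>x: "\<phi> x = (\<phi> ^^ n) (\<phi> z)" by (simp add: x_def funpow_swap1)
    have \<phi>xD: "\<phi> x \<in> unit_disc" using h\<phi>(2) xD by blast
    have v: "1 \<le> cmod v" "R \<le> cmod v" "r \<le> cmod v" "1 / \<eta> \<le> cmod v"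
      using N[OF n z] by (auto simp: v_def x_def)
    have v\<eta>: "1 \<le> \<eta> * cmod v" using v(4) \<eta> by (simp add: divide_le_eq mult.commute)
    have v0: "Re v > 1 / 2" unfolding v_def by (rule half_plane_coord_Re[OF \<alpha> xD])
    have s: "cmod (w - of_real L * v) \<le> \<eta> * cmod v"
    proof -
      have "cmod (w - of_real L * v) \<le> C * cmod v powr (1 - e)"
        using step[OF xD] v(2) by (simp add: v_def w_def)
      also have "cmod v powr (1 - e) = cmod v powr (- e) * cmod v"
        using v(1) powr_add[of "cmod v" "- e" 1] by simp
      also have "C * (cmod v powr (- e) * cmod v) \<le> \<eta> * cmod v"
        using r[OF v(3)] by (simp add: mult.assoc[symmetric] mult_right_mono)
      finally show ?thesis .
    qed
    have hn: "\<phi> ^^ n holomorphic_on unit_disc" "(\<phi> ^^ n) ` unit_disc \<subseteq> unit_disc"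
      using univalent_self_map_funpow[OF \<phi>(1), of n] by (auto simp: univalent_self_map_def)
    have "cmod (Moebius_function 0 (\<phi> x) x) \<le> cmod (Moebius_function 0 (\<phi> z) z)"
      using Schwarz_Pick[OF hn zD] unfolding \<phi>x unfolding x_def .
    then have "cmod (Moebius_function 0 (\<phi> x) x) \<le> \<rho>" using \<rho>(3)[OF z] by linarith
    then have m: "cmod (w - v) \<le> \<rho> * cmod (cnj w + v - 1)"
      using Moebius_half_plane_coord[OF \<alpha> xD \<phi>xD] unfolding v_def w_def by (simp add: mult_right_mono)
    have lo: "(L - 1) * cmod v \<le> cmod (w - v) + \<eta> * cmod v"
    proof -
      have "of_real (L - 1) * v = (w - v) - (w - of_real L * v)" by (simp add: algebra_simps)
      then have "cmod (of_real (L - 1) * v) \<le> cmod (w - v) + \<eta> * cmod v"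
        using norm_triangle_ineq4[of "w - v" "w - of_real L * v"] s by simp
      then show ?thesis using L by (simp add: norm_mult del: of_real_diff)
    qed
    have "cmod (cnj w + v - 1) \<le> (L - 1) * cmod v + 2 * Re v + 2 * \<eta> * cmod v"
    proof -
      \<comment> \<open>With \<open>w\<close> near \<open>L * v\<close> this isolates
        \<open>2 * Re v\<close>, the term that can keep the quotient of \<open>cmod (w - v)\<close>
        by \<open>cmod (cnj w + v - 1)\<close> away from 1.\<close>
      have eq: "cnj w + v - 1 = (of_real (L - 1) * cnj v + of_real (2 * Re v)) + (cnj (w - of_real L * v) - 1)"
        by (simp add: complex_eq_iff algebra_simps)
      have "cmod (of_real (L - 1) * cnj v + of_real (2 * Re v)) \<le> (L - 1) * cmod v + 2 * Re v"
        using L v0 norm_triangle_ineq[of "of_real (L - 1) * cnj v" "of_real (2 * Re v)"]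
        by (simp add: norm_mult del: of_real_diff of_real_mult)
      moreover have "cmod (cnj (w - of_real L * v) - 1) \<le> \<eta> * cmod v + 1"
        using norm_triangle_ineq4[of "cnj (w - of_real L * v)" 1] s by (simp del: complex_cnj_diff)
      ultimately have "cmod (cnj w + v - 1) \<le> ((L - 1) * cmod v + 2 * Re v) + (\<eta> * cmod v + 1)"
        unfolding eq by (rule norm_triangle_mono)
      then show ?thesis using v\<eta> by linarith
    qed
    then have X: "\<rho> * cmod (cnj w + v - 1) \<le> \<rho> * ((L - 1) * cmod v + 2 * Re v + 2 * \<eta> * cmod v)"
      using \<rho>(1) by (rule mult_left_mono)
    have arith: "a \<le> \<rho> * a + b + 3 * h" if "a \<le> d + h" "d \<le> x" "x \<le> \<rho> * (a + b + 2 * h)" "b \<ge> 0" "h \<ge> 0"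
      for a b d h x
    proof -
      have "a \<le> x + h" using that by linarith
      also have "\<dots> \<le> \<rho> * (a + b + 2 * h) + h" using that by (intro add_right_mono)
      also have "\<dots> = \<rho> * a + \<rho> * (b + 2 * h) + h" by (simp add: algebra_simps)
      also have "\<dots> \<le> \<rho> * a + 1 * (b + 2 * h) + h"
        using that \<rho> by (intro add_mono mult_right_mono order_refl) auto
      finally show ?thesis by simp
    qed
    have "(L - 1) * cmod v \<le> \<rho> * ((L - 1) * cmod v) + 2 * Re v + 3 * (\<eta> * cmod v)"
      using lo m X \<eta> v0 by (intro arith[of _ "cmod (w - v)" _ "\<rho> * cmod (cnj w + v - 1)"]) (auto simp: mult.assoc)
    moreover have "3 * (\<eta> * cmod v) = (L - 1) * (1 - \<rho>) / 2 * cmod v" by (simp add: \<eta>_def)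
    ultimately have "(L - 1) * (1 - \<rho>) * cmod v \<le> 4 * Re v" by (simp add: algebra_simps)
    then have "cmod v \<le> 4 / ((L - 1) * (1 - \<rho>)) * Re v"
      using L \<rho>(2) by (simp add: pos_le_divide_eq mult.commute)
    then show "cmod (half_plane_coord \<alpha> ((\<phi> ^^ n) z)) \<le> 4 / ((L - 1) * (1 - \<rho>)) * Re (half_plane_coord \<alpha> ((\<phi> ^^ n) z))"
      by (simp add: v_def x_def)
  qed
qed

section \<open>Pairs of maps whose images separate\<close>

lemma disjoint_frequent_orbit_distinct_points:
  assumes \<phi>: "univalent_self_map \<phi>" "denjoy_wolff_point \<phi> \<alpha>"
    and \<psi>: "univalent_self_map \<psi>" "denjoy_wolff_point \<psi> \<beta>" and ne: "\<alpha> \<noteq> \<beta>"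
  shows "\<exists>f. disjoint_frequent_orbit \<phi> \<psi> f"
\<comment> \<open>The images tend to different boundary points and are disjoint for all large times;
  \<open>(2, 0)\<close> is an admissible pair.\<close>
proof (rule disjoint_frequent_orbit_exists[OF \<phi> \<psi>, of 2 0])
  fix K :: "complex set" assume K: "compact K" "K \<subseteq> unit_disc"
  define d where "d = dist \<alpha> \<beta> / 2"
  have d: "d > 0" using ne by (simp add: d_def)
  have "\<forall>\<^sub>F n in sequentially. \<forall>z\<in>K. dist ((\<phi> ^^ n) z) \<alpha> < d" "\<forall>\<^sub>F n in sequentially. \<forall>z\<in>K. dist ((\<psi> ^^ n) z) \<beta> < d"
    using \<phi>(2) \<psi>(2) K d unfolding denjoy_wolff_point_def uniform_limit_iff by auto
  then obtain N1 N2 where N: "\<And>n z. n \<ge> N1 \<Longrightarrow> z \<in> K \<Longrightarrow> dist ((\<phi> ^^ n) z) \<alpha> < d"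
    "\<And>n z. n \<ge> N2 \<Longrightarrow> z \<in> K \<Longrightarrow> dist ((\<psi> ^^ n) z) \<beta> < d"
    unfolding eventually_sequentially by blast
  have "(\<phi> ^^ n) ` K \<inter> (\<psi> ^^ m) ` K = {}" if "n \<ge> max N1 N2" "m \<ge> max N1 N2" for n m
  proof (rule ccontr)
    assume "(\<phi> ^^ n) ` K \<inter> (\<psi> ^^ m) ` K \<noteq> {}"
    then obtain x y where xy: "x \<in> K" "y \<in> K" "(\<phi> ^^ n) x = (\<psi> ^^ m) y" by auto
    have "dist \<alpha> \<beta> < d + d"
      using N(1)[of n x] N(2)[of m y] xy that by (intro dist_triangle_less_add[of _ "(\<phi> ^^ n) x"]) (auto simp: dist_commute)
    then show False by (simp add: d_def)
  qed
  then show "\<exists>N::nat. \<forall>n\<ge>N. \<forall>m\<ge>N. real N < \<bar>2 * real n + 0 * ln (real n) - real m\<bar> \<longrightarrow> (\<phi> ^^ n) ` K \<inter> (\<psi> ^^ m) ` K = {}"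
    by blast
qed auto

text \<open>At a collision the two orbits have equal size, so \<open>n * ln L - m * ln L'\<close> is
  bounded; dividing by \<open>ln L'\<close> gives \<open>\<tau> = ln L / ln L'\<close>, which
  differs from 1.\<close>

lemma disjoint_frequent_orbit_hyperbolic:
  assumes \<phi>: "univalent_self_map \<phi>" "denjoy_wolff_point \<phi> \<alpha>" "hyperbolic_estimate \<phi> \<alpha> L C e R" "L > 1"
    and \<psi>: "univalent_self_map \<psi>" "denjoy_wolff_point \<psi> \<alpha>" "hyperbolic_estimate \<psi> \<alpha> L' C' e' R'" "L' > 1"
    and ne: "L \<noteq> L'"
  shows "\<exists>f. disjoint_frequent_orbit \<phi> \<psi> f"
proof (rule disjoint_frequent_orbit_exists[OF \<phi>(1,2) \<psi>(1,2), of "ln L / ln L'" 0])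
  have l: "ln L > 0" "ln L' > 0" using \<phi>(4) \<psi>(4) by auto
  then show "ln L / ln L' > 0" by simp
  have "ln L \<noteq> ln L'" using ne \<phi>(4) \<psi>(4) by simp
  then show "ln L / ln L' \<noteq> 1 \<or> 0 \<noteq> (0::real)" using l by simp
  fix K :: "complex set" assume K: "compact K" "K \<subseteq> unit_disc"
  obtain N1 c1 where N1: "\<And>n z. n \<ge> N1 \<Longrightarrow> z \<in> K \<Longrightarrow> \<bar>ln (cmod (half_plane_coord \<alpha> ((\<phi> ^^ n) z))) - n * ln L\<bar> \<le> c1"
    by (rule hyperbolic_asymptotics[OF \<phi> K]) blast
  obtain N2 c2 where N2: "\<And>n z. n \<ge> N2 \<Longrightarrow> z \<in> K \<Longrightarrow> \<bar>ln (cmod (half_plane_coord \<alpha> ((\<psi> ^^ n) z))) - n * ln L'\<bar> \<le> c2"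
    by (rule hyperbolic_asymptotics[OF \<psi> K]) blast
  define N where "N = max (max N1 N2) (nat \<lceil>(c1 + c2) / ln L'\<rceil>)"
  have "(\<phi> ^^ n) ` K \<inter> (\<psi> ^^ m) ` K = {}" if nm: "n \<ge> N" "m \<ge> N" and far: "real N < \<bar>ln L / ln L' * real n + 0 * ln (real n) - real m\<bar>" for n m
  proof (rule ccontr)
    assume "(\<phi> ^^ n) ` K \<inter> (\<psi> ^^ m) ` K \<noteq> {}"
    then obtain x y where xy: "x \<in> K" "y \<in> K" "(\<phi> ^^ n) x = (\<psi> ^^ m) y" by auto
    have "\<bar>n * ln L - m * ln L'\<bar> \<le> c1 + c2"
      using N1[OF _ xy(1), of n] N2[OF _ xy(2), of m] nm unfolding xy(3) by (simp add: N_def)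
    moreover have "n * ln L - m * ln L' = ln L' * (ln L / ln L' * real n + 0 * ln (real n) - real m)"
      using l by (simp add: field_simps)
    ultimately have "ln L' * \<bar>ln L / ln L' * real n + 0 * ln (real n) - real m\<bar> \<le> c1 + c2"
      using l by (simp only: abs_mult abs_of_pos)
    then have "\<bar>ln L / ln L' * real n + 0 * ln (real n) - real m\<bar> \<le> (c1 + c2) / ln L'"
      using l by (simp add: pos_le_divide_eq mult.commute)
    moreover have "(c1 + c2) / ln L' \<le> N" unfolding N_def by linarith
    ultimately show False using far by linarith
  qed
  then show "\<exists>N::nat. \<forall>n\<ge>N. \<forall>m\<ge>N. real N < \<bar>ln L / ln L' * real n + 0 * ln (real n) - real m\<bar> \<longrightarrow> (\<phi> ^^ n) ` K \<inter> (\<psi> ^^ m) ` K = {}"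
    by blast
qed

text \<open>The hyperbolic orbit stays in a sector, whereas a parabolic orbit with imaginary
  \<open>p\<close> has real part O(ln m) at size comparable to \<open>m\<close>. So they cannot meet
  at large times.\<close>

lemma disjoint_frequent_orbit_mixed:
  assumes \<phi>: "univalent_self_map \<phi>" "denjoy_wolff_point \<phi> \<alpha>" "hyperbolic_estimate \<phi> \<alpha> L C e R" "L > 1"
    and \<psi>: "univalent_self_map \<psi>" "denjoy_wolff_point \<psi> \<alpha>" "parabolic_estimate \<psi> \<alpha> p q C' e' R'" "p \<noteq> 0"
    and p: "Re p = 0"
  shows "\<exists>f. disjoint_frequent_orbit \<phi> \<psi> f"
proof (rule disjoint_frequent_orbit_exists[OF \<phi>(1,2) \<psi>(1,2), of 2 0])
  fix K :: "complex set" assume K: "compact K" "K \<subseteq> unit_disc"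
  obtain N1 M where N1: "\<And>n z. n \<ge> N1 \<Longrightarrow> z \<in> K \<Longrightarrow> cmod (half_plane_coord \<alpha> ((\<phi> ^^ n) z)) \<le> M * Re (half_plane_coord \<alpha> ((\<phi> ^^ n) z))"
    by (rule hyperbolic_orbit_sectorial[OF \<phi> K]) blast
  obtain N2 c where N2: "\<And>n z. n \<ge> N2 \<Longrightarrow> z \<in> K \<Longrightarrow>
      cmod (half_plane_coord \<alpha> ((\<psi> ^^ n) z) - (of_nat n * p + q / p * of_real (ln n))) \<le> c"
    by (rule parabolic_asymptotics[OF \<psi> K]) blast
  define M' where "M' = max M 0"
  define b where "b = cmod (q / p)"
  have "(\<lambda>n. (1 + M') * (b * (ln (real n) / real n) + c * (1 / real n))) \<longlonglongrightarrow> (1 + M') * (b * 0 + c * 0)"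
    by (intro tendsto_intros lim_ln_over_n lim_1_over_n)
  then have "\<forall>\<^sub>F n in sequentially. (1 + M') * (b * (ln (real n) / real n) + c * (1 / real n)) < cmod p"
    using \<psi>(4) by (intro order_tendstoD(2)) auto
  then obtain N3 where N3: "\<And>n. n \<ge> N3 \<Longrightarrow> (1 + M') * (b * (ln (real n) / real n) + c * (1 / real n)) < cmod p"
    unfolding eventually_sequentially by blast
  define N where "N = max (max N1 N2) (max N3 1)"
  have "(\<phi> ^^ n) ` K \<inter> (\<psi> ^^ m) ` K = {}" if nm: "n \<ge> N" "m \<ge> N" for n m
  proof (rule ccontr)
    assume "(\<phi> ^^ n) ` K \<inter> (\<psi> ^^ m) ` K \<noteq> {}"
    then obtain x y where xy: "x \<in> K" "y \<in> K" "(\<phi> ^^ n) x = (\<psi> ^^ m) y" by auto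
    define v where "v = half_plane_coord \<alpha> ((\<psi> ^^ m) y)"
    have \<alpha>: "cmod \<alpha> = 1" using \<phi>(2) by (auto simp: denjoy_wolff_point_def)
    have "Re v > 1 / 2" unfolding v_def
      using univalent_funpow_in_disc[OF \<psi>(1)] xy(2) K(2) by (intro half_plane_coord_Re[OF \<alpha>]) auto
    then have "M * Re v \<le> M' * Re v" by (intro mult_right_mono) (auto simp: M'_def)
    then have sec: "cmod v \<le> M' * Re v" using N1[of n x] nm xy by (simp add: N_def v_def)
    define u where "u = v - of_nat m * p"
    have m1: "m \<ge> 1" using nm by (simp add: N_def)
    have "cmod u \<le> cmod (v - (of_nat m * p + q / p * of_real (ln m))) + cmod (q / p * of_real (ln m))"
      using norm_triangle_ineq[of "v - (of_nat m * p + q / p * of_real (ln m))" "q / p * of_real (ln m)"] by (simp add: u_def)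
    also have "\<dots> \<le> c + b * ln m"
      using N2[of m y] nm xy m1 unfolding norm_mult b_def v_def by (simp add: N_def)
    finally have u: "cmod u \<le> c + b * ln m" .
    have "Re v = Re u" using p by (simp add: u_def)
    then have "Re v \<le> cmod u" using complex_Re_le_cmod[of u] by simp
    then have "M' * Re v \<le> M' * cmod u" by (intro mult_left_mono) (auto simp: M'_def)
    moreover have "cmod (of_nat m * p) \<le> cmod v + cmod u" using norm_triangle_ineq4[of v u] by (simp add: u_def)
    ultimately have "m * cmod p \<le> (1 + M') * cmod u" using sec by (simp add: norm_mult algebra_simps)
    also have "\<dots> \<le> (1 + M') * (c + b * ln m)" using u by (intro mult_left_mono) (auto simp: M'_def)
    also have "\<dots> = m * ((1 + M') * (b * (ln (real m) / real m) + c * (1 / real m)))"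
      using m1 by (simp add: field_simps)
    also have "\<dots> < m * cmod p" using N3[of m] nm m1 by (intro mult_strict_left_mono) (auto simp: N_def)
    finally show False by simp
  qed
  then show "\<exists>N::nat. \<forall>n\<ge>N. \<forall>m\<ge>N. real N < \<bar>2 * real n + 0 * ln (real n) - real m\<bar> \<longrightarrow> (\<phi> ^^ n) ` K \<inter> (\<psi> ^^ m) ` K = {}"
    by blast
qed auto

lemma logarithm_sublinear:
  fixes b c \<mu> :: real
  assumes "\<mu> > 0"
  obtains N :: nat where "\<And>n. n \<ge> N \<Longrightarrow> c + b * ln (real n) < \<mu> * real n"
proof -
  have "(\<lambda>n. b * (ln (real n) / real n) + c * (1 / real n)) \<longlonglongrightarrow> b * 0 + c * 0"
    by (intro tendsto_intros lim_ln_over_n lim_1_over_n)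
  then have "\<forall>\<^sub>F n in sequentially. b * (ln (real n) / real n) + c * (1 / real n) < \<mu>"
    using assms by (intro order_tendstoD(2)) auto
  then obtain N where N: "\<And>n. n \<ge> N \<Longrightarrow> b * (ln (real n) / real n) + c * (1 / real n) < \<mu>"
    unfolding eventually_sequentially by blast
  show ?thesis
  proof (rule that[of "max N 1"])
    fix n :: nat assume n: "n \<ge> max N 1"
    then have "real n * (b * (ln (real n) / real n) + c * (1 / real n)) < real n * \<mu>"
      using N[of n] by (intro mult_strict_left_mono) auto
    moreover have "real n * (b * (ln (real n) / real n) + c * (1 / real n)) = c + b * ln (real n)"
      using n by (simp add: field_simps)
    ultimately show "c + b * ln (real n) < \<mu> * real n" by (simp add: mult.commute)
  qed
qed

lemma drift_terms_bound:
  assumes "n \<ge> 1" "m \<ge> (1::nat)"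
    "cmod (of_nat n * p + \<beta> * of_real (ln n) - (of_nat m * p' + \<beta>' * of_real (ln m))) \<le> c"
  shows "cmod (of_nat n * p - of_nat m * p') \<le> c + (cmod \<beta> + cmod \<beta>') * ln (real (n + m))"
proof -
  have "of_nat n * p - of_nat m * p' = (of_nat n * p + \<beta> * of_real (ln n) - (of_nat m * p' + \<beta>' * of_real (ln m)))
      - (\<beta> * of_real (ln n) - \<beta>' * of_real (ln m))" by simp
  also have "cmod \<dots> \<le> c + (cmod \<beta> * ln n + cmod \<beta>' * ln m)"
    by (intro order_trans[OF norm_triangle_ineq4] add_mono assms(3)) (use assms in \<open>auto simp: norm_mult\<close>)
  also have "\<dots> \<le> c + (cmod \<beta> * ln (real (n + m)) + cmod \<beta>' * ln (real (n + m)))"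
    using assms by (intro add_left_mono add_mono mult_left_mono ln_mono) auto
  finally show ?thesis by (simp add: algebra_simps)
qed

text \<open>With \<open>t = p / p'\<close> no cancellation occurs in \<open>n * t - m\<close>: for
  negative \<open>t\<close> the terms have the same sign, and for nonreal \<open>t\<close> the
  imaginary part controls \<open>n\<close> and then the whole controls \<open>m\<close>.\<close>

lemma nonproportional_drifts:
  fixes p p' :: complex
  assumes p: "p \<noteq> 0" "p' \<noteq> 0" and np: "\<nexists>\<tau>::real. \<tau> > 0 \<and> p = of_real \<tau> * p'"
  obtains c0 where "c0 > 0" "\<And>n m :: nat. c0 * real (n + m) \<le> cmod (of_nat n * p - of_nat m * p')"
proof -
  define t where "t = p / p'"
  have t: "p = t * p'" "t \<noteq> 0" using p by (auto simp: t_def)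
  have "\<exists>A>0. \<forall>n m :: nat. real (n + m) \<le> A * cmod (of_nat n * t - of_nat m)"
  proof (cases "Im t = 0")
    case True
    then have "t = of_real (Re t)" by (simp add: complex_eq_iff)
    then have R: "Re t < 0" using np t p by (metis linorder_less_linear of_real_0)
    show ?thesis
    proof (intro exI[of _ "1 / min 1 (- Re t)"] conjI allI)
      show "1 / min 1 (- Re t) > 0" using R by simp
      fix n m :: nat
      have "cmod (of_nat n * t - of_nat m) \<ge> \<bar>Re (of_nat n * t - of_nat m)\<bar>" by (rule abs_Re_le_cmod)
      moreover have "Re (of_nat n * t - of_nat m) = - (n * (- Re t) + m)" by simp
      moreover have "min 1 (- Re t) * (n + m) \<le> n * (- Re t) + m"
      proof -
        have "min 1 (- Re t) * n \<le> (- Re t) * n" "min 1 (- Re t) * m \<le> 1 * real m" by (intro mult_right_mono; simp)+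
        then show ?thesis by (simp add: algebra_simps)
      qed
      ultimately have "min 1 (- Re t) * (n + m) \<le> cmod (of_nat n * t - of_nat m)" by linarith
      then show "real (n + m) \<le> 1 / min 1 (- Re t) * cmod (of_nat n * t - of_nat m)"
        using R by (simp add: pos_le_divide_eq mult.commute)
    qed
  next
    case False
    define A where "A = 1 / \<bar>Im t\<bar>"
    have A: "A > 0" using False by (simp add: A_def)
    show ?thesis
    proof (intro exI[of _ "A + (1 + A * cmod t)"] conjI allI)
      show "A + (1 + A * cmod t) > 0" using A by (simp add: add_pos_nonneg)
      fix n m :: nat
      let ?d = "cmod (of_nat n * t - of_nat m)"
      have "\<bar>Im (of_nat n * t - of_nat m)\<bar> \<le> ?d" by (rule abs_Im_le_cmod)
      then have n: "real n \<le> A * ?d" using False by (simp add: A_def abs_mult pos_le_divide_eq)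
      have "cmod (of_nat m) \<le> cmod (of_nat n * t) + ?d"
        using norm_triangle_ineq4[of "of_nat n * t" "of_nat n * t - of_nat m"] by simp
      then have "real m \<le> n * cmod t + ?d" by (simp add: norm_mult)
      also have "\<dots> \<le> A * ?d * cmod t + ?d" using n by (intro add_right_mono mult_right_mono) auto
      finally show "real (n + m) \<le> (A + (1 + A * cmod t)) * ?d" using n by (simp add: algebra_simps)
    qed
  qed
  then obtain A where A: "A > 0" "\<And>n m :: nat. real (n + m) \<le> A * cmod (of_nat n * t - of_nat m)" by blast
  show ?thesis
  proof (rule that[of "cmod p' / A"])
    show "cmod p' / A > 0" using A(1) p by simp
    fix n m :: nat
    have "of_nat n * p - of_nat m * p' = (of_nat n * t - of_nat m) * p'" by (simp add: t(1) algebra_simps)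
    then have "cmod (of_nat n * p - of_nat m * p') = cmod (of_nat n * t - of_nat m) * cmod p'" by (simp add: norm_mult)
    moreover have "cmod p' / A * real (n + m) \<le> cmod p' / A * (A * cmod (of_nat n * t - of_nat m))"
      using A p by (intro mult_left_mono A(2)) auto
    ultimately show "cmod p' / A * real (n + m) \<le> cmod (of_nat n * p - of_nat m * p')"
      using A(1) by (simp add: mult.commute)
  qed
qed

text \<open>A collision first forces \<open>m\<close> and \<open>n\<close> to be comparable, because
  the logarithmic terms are sublinear. Then \<open>ln m = ln n + O(1)\<close>, so
  \<open>ln m\<close> may be replaced by \<open>ln n\<close>, and division by \<open>p'\<close>
  gives the relation between the times.\<close>

lemma proportional_drifts:
  fixes p p' :: complex and \<tau> :: real
  assumes p: "p' \<noteq> 0" "\<tau> > 0" "p = of_real \<tau> * p'"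
  obtains N :: nat and c' where "\<And>n m. n \<ge> N \<Longrightarrow> m \<ge> N \<Longrightarrow>
    cmod (of_nat n * p + \<beta> * of_real (ln n) - (of_nat m * p' + \<beta>' * of_real (ln m))) \<le> c \<Longrightarrow>
    cmod (of_real \<tau> * of_nat n + (\<beta> - \<beta>') / p' * of_real (ln n) - of_nat m) \<le> c'"
proof -
  \<comment> \<open>A quarter of both \<tau> and 1, so that an error of
    \<open>\<mu> * (n + m)\<close> can be absorbed by either \<open>\<tau> * n\<close> or
    \<open>m\<close>.\<close>
  define \<mu> where "\<mu> = min \<tau> 1 / 4"
  have \<mu>: "\<mu> > 0" "\<mu> \<le> \<tau> / 4" "\<mu> \<le> 1 / 4" using p(2) by (auto simp: \<mu>_def)
  have "\<mu> * cmod p' > 0" using \<mu>(1) p(1) by simp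
  then obtain N where N: "\<And>n. n \<ge> N \<Longrightarrow> c + (cmod \<beta> + cmod \<beta>') * ln (real n) < \<mu> * cmod p' * real n"
    using logarithm_sublinear by metis
  define c4 where "c4 = \<bar>ln (2 * \<tau> + 1)\<bar> + \<bar>ln (2 / \<tau>)\<bar>"
  show ?thesis
  proof (rule that[of "max N 1" "c / cmod p' + cmod (\<beta>' / p') * c4"])
    fix n m :: nat assume nm: "n \<ge> max N 1" "m \<ge> max N 1"
      and col: "cmod (of_nat n * p + \<beta> * of_real (ln n) - (of_nat m * p' + \<beta>' * of_real (ln m))) \<le> c"
    have nm1: "real n \<ge> 1" "real m \<ge> 1" using nm by auto
    have "cmod (of_nat n * p - of_nat m * p') \<le> \<mu> * cmod p' * real (n + m)"
      using drift_terms_bound[OF _ _ col] nm N[of "n + m"] by simp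
    moreover have "of_nat n * p - of_nat m * p' = of_real (\<tau> * n - m) * p'" by (simp add: p(3) algebra_simps)
    ultimately have "\<bar>\<tau> * n - m\<bar> * cmod p' \<le> \<mu> * real (n + m) * cmod p'" by (simp add: norm_mult mult_ac del: of_real_diff)
    then have "\<bar>\<tau> * n - m\<bar> \<le> \<mu> * real (n + m)" using p(1) by simp
    then have D: "\<tau> * n - m \<le> \<mu> * n + \<mu> * m" "m - \<tau> * n \<le> \<mu> * n + \<mu> * m" by (simp_all add: algebra_simps abs_le_iff)
    have m: "\<mu> * m \<le> m / 4" using \<mu>(3) nm1(2) mult_right_mono[of \<mu> "1/4" m] by simp
    have n: "\<mu> * n \<le> n / 4" using \<mu>(3) nm1(1) mult_right_mono[of \<mu> "1/4" n] by simp
    have n2: "\<mu> * n \<le> \<tau> * n / 4" using \<mu>(2) nm1(1) mult_right_mono[of \<mu> "\<tau>/4" n] by simp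
    have "0 \<le> \<tau> * n" using p(2) by simp
    then have "real m \<le> 2 * (\<tau> * n) + n" using D m n by linarith
    then have b1: "real m \<le> (2 * \<tau> + 1) * n" by (simp add: algebra_simps)
    have "\<tau> * n \<le> 2 * m" using D m n2 nm1 by linarith
    then have b2: "real n \<le> 2 / \<tau> * m" using p(2) by (simp add: field_simps)
    have "ln (real m) \<le> ln ((2 * \<tau> + 1) * n)" "ln (real n) \<le> ln (2 / \<tau> * m)"
      using b1 b2 nm1 by (intro ln_mono; linarith)+
    moreover have "ln ((2 * \<tau> + 1) * n) = ln (2 * \<tau> + 1) + ln n" "ln (2 / \<tau> * m) = ln (2 / \<tau>) + ln m"
      using p(2) nm1 by (intro ln_mult_pos; simp)+
    ultimately have l: "\<bar>ln (real m) - ln (real n)\<bar> \<le> c4" unfolding c4_def by linarith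
    have "of_real \<tau> * of_nat n + (\<beta> - \<beta>') / p' * of_real (ln n) - of_nat m
       = (of_nat n * p + \<beta> * of_real (ln n) - (of_nat m * p' + \<beta>' * of_real (ln m))) / p' + \<beta>' / p' * of_real (ln (real m) - ln (real n))"
      unfolding p(3) using p(1) by (simp add: field_simps)
    also have "cmod \<dots> \<le> c / cmod p' + cmod (\<beta>' / p') * c4"
    proof (rule norm_triangle_mono)
      show "cmod ((of_nat n * p + \<beta> * of_real (ln n) - (of_nat m * p' + \<beta>' * of_real (ln m))) / p') \<le> c / cmod p'"
        unfolding norm_divide using col by (intro divide_right_mono) auto
      show "cmod (\<beta>' / p' * of_real (ln (real m) - ln (real n))) \<le> cmod (\<beta>' / p') * c4"
        unfolding norm_mult norm_of_real using l by (intro mult_left_mono) auto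
    qed
    finally show "cmod (of_real \<tau> * of_nat n + (\<beta> - \<beta>') / p' * of_real (ln n) - of_nat m) \<le> c / cmod p' + cmod (\<beta>' / p') * c4" .
  qed
qed

text \<open>Drifts in different directions separate linearly. Drifts in the same direction leave
  collisions near the curve \<open>m = \<tau> * n + Re \<kappa> * ln n\<close>, and if this is
  \<open>m = n\<close>, the orbits move apart logarithmically across the direction of
  motion.\<close>

lemma disjoint_frequent_orbit_parabolic:
  assumes \<phi>: "univalent_self_map \<phi>" "denjoy_wolff_point \<phi> \<alpha>" "parabolic_estimate \<phi> \<alpha> p q C e R" "p \<noteq> 0"
    and \<psi>: "univalent_self_map \<psi>" "denjoy_wolff_point \<psi> \<alpha>" "parabolic_estimate \<psi> \<alpha> p' q' C' e' R'" "p' \<noteq> 0"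
    and ne: "(p, q) \<noteq> (p', q')"
  shows "\<exists>f. disjoint_frequent_orbit \<phi> \<psi> f"
proof -
  define \<beta> \<beta>' where "\<beta> = q / p" and "\<beta>' = q' / p'"
  have collide: "\<exists>N c. \<forall>n\<ge>N. \<forall>m\<ge>N. (\<phi> ^^ n) ` K \<inter> (\<psi> ^^ m) ` K \<noteq> {} \<longrightarrow>
      cmod (of_nat n * p + \<beta> * of_real (ln n) - (of_nat m * p' + \<beta>' * of_real (ln m))) \<le> c"
    if K: "compact K" "K \<subseteq> unit_disc" for K
  proof -
    obtain N1 c1 where N1: "\<And>n z. n \<ge> N1 \<Longrightarrow> z \<in> K \<Longrightarrow>
        cmod (half_plane_coord \<alpha> ((\<phi> ^^ n) z) - (of_nat n * p + q / p * of_real (ln n))) \<le> c1"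
      by (rule parabolic_asymptotics[OF \<phi> K]) blast
    obtain N2 c2 where N2: "\<And>n z. n \<ge> N2 \<Longrightarrow> z \<in> K \<Longrightarrow>
        cmod (half_plane_coord \<alpha> ((\<psi> ^^ n) z) - (of_nat n * p' + q' / p' * of_real (ln n))) \<le> c2"
      by (rule parabolic_asymptotics[OF \<psi> K]) blast
    show ?thesis
    proof (intro exI[of _ "max N1 N2"] exI[of _ "c2 + c1"] allI impI)
      fix n m assume nm: "n \<ge> max N1 N2" "m \<ge> max N1 N2" and "(\<phi> ^^ n) ` K \<inter> (\<psi> ^^ m) ` K \<noteq> {}"
      then obtain x y where xy: "x \<in> K" "y \<in> K" "(\<phi> ^^ n) x = (\<psi> ^^ m) y" by auto
      define v where "v = half_plane_coord \<alpha> ((\<psi> ^^ m) y)"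
      have a: "cmod (v - (of_nat n * p + \<beta> * of_real (ln n))) \<le> c1"
        using N1[of n x] nm xy by (simp add: v_def \<beta>_def)
      have b: "cmod (v - (of_nat m * p' + \<beta>' * of_real (ln m))) \<le> c2"
        using N2[of m y] nm xy by (simp add: v_def \<beta>'_def)
      have "of_nat n * p + \<beta> * of_real (ln n) - (of_nat m * p' + \<beta>' * of_real (ln m))
          = (v - (of_nat m * p' + \<beta>' * of_real (ln m))) - (v - (of_nat n * p + \<beta> * of_real (ln n)))" by simp
      then show "cmod (of_nat n * p + \<beta> * of_real (ln n) - (of_nat m * p' + \<beta>' * of_real (ln m))) \<le> c2 + c1"
        using order_trans[OF norm_triangle_ineq4 add_mono[OF b a]] by (simp only:)
    qed
  qed
  show ?thesis
  proof (cases "\<exists>\<tau>::real. \<tau> > 0 \<and> p = of_real \<tau> * p'")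
    case False
    obtain c0 where c0: "c0 > 0" "\<And>n m :: nat. c0 * real (n + m) \<le> cmod (of_nat n * p - of_nat m * p')"
      by (rule nonproportional_drifts[OF \<phi>(4) \<psi>(4) False]) blast
    show ?thesis
    proof (rule disjoint_frequent_orbit_exists[OF \<phi>(1,2) \<psi>(1,2), of 2 0])
      fix K :: "complex set" assume K: "compact K" "K \<subseteq> unit_disc"
      obtain N c where N: "\<And>n m. n \<ge> N \<Longrightarrow> m \<ge> N \<Longrightarrow> (\<phi> ^^ n) ` K \<inter> (\<psi> ^^ m) ` K \<noteq> {} \<Longrightarrow>
          cmod (of_nat n * p + \<beta> * of_real (ln n) - (of_nat m * p' + \<beta>' * of_real (ln m))) \<le> c"
        using collide[OF K] by blast
      obtain M where M: "\<And>n. n \<ge> M \<Longrightarrow> c + (cmod \<beta> + cmod \<beta>') * ln (real n) < c0 * real n"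
        using logarithm_sublinear[OF c0(1)] by metis
      have "(\<phi> ^^ n) ` K \<inter> (\<psi> ^^ m) ` K = {}" if nm: "n \<ge> max (max N M) 1" "m \<ge> max (max N M) 1" for n m
      proof (rule ccontr)
        assume "(\<phi> ^^ n) ` K \<inter> (\<psi> ^^ m) ` K \<noteq> {}"
        then have "cmod (of_nat n * p + \<beta> * of_real (ln n) - (of_nat m * p' + \<beta>' * of_real (ln m))) \<le> c"
          using nm by (intro N) auto
        then have "cmod (of_nat n * p - of_nat m * p') \<le> c + (cmod \<beta> + cmod \<beta>') * ln (real (n + m))"
          using nm by (intro drift_terms_bound) auto
        then show False using c0(2)[of n m] M[of "n + m"] nm by linarith
      qed
      then show "\<exists>N::nat. \<forall>n\<ge>N. \<forall>m\<ge>N. real N < \<bar>2 * real n + 0 * ln (real n) - real m\<bar> \<longrightarrow> (\<phi> ^^ n) ` K \<inter> (\<psi> ^^ m) ` K = {}"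
        by blast
    qed auto
  next
    case True
    then obtain \<tau> :: real where \<tau>: "\<tau> > 0" "p = of_real \<tau> * p'" by blast
    \<comment> \<open>The relative logarithmic drift in units of \<open>p'\<close>: the real part is
      along the direction of motion and can be compensated by a change of \<open>m\<close>, the
      imaginary part is transversal to it.\<close>
    define \<kappa> where "\<kappa> = (\<beta> - \<beta>') / p'"
    have close: "\<exists>N::nat. \<exists>c'. \<forall>n\<ge>N. \<forall>m\<ge>N. (\<phi> ^^ n) ` K \<inter> (\<psi> ^^ m) ` K \<noteq> {} \<longrightarrow>
        \<bar>\<tau> * n + Re \<kappa> * ln n - m\<bar> \<le> c' \<and> \<bar>Im \<kappa>\<bar> * ln n \<le> c'"
      if K: "compact K" "K \<subseteq> unit_disc" for K
    proof -
      obtain N c where N: "\<And>n m. n \<ge> N \<Longrightarrow> m \<ge> N \<Longrightarrow> (\<phi> ^^ n) ` K \<inter> (\<psi> ^^ m) ` K \<noteq> {} \<Longrightarrow>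
          cmod (of_nat n * p + \<beta> * of_real (ln n) - (of_nat m * p' + \<beta>' * of_real (ln m))) \<le> c"
        using collide[OF K] by blast
      obtain M :: nat and c' where M: "\<And>n m. n \<ge> M \<Longrightarrow> m \<ge> M \<Longrightarrow>
          cmod (of_nat n * p + \<beta> * of_real (ln n) - (of_nat m * p' + \<beta>' * of_real (ln m))) \<le> c \<Longrightarrow>
          cmod (of_real \<tau> * of_nat n + (\<beta> - \<beta>') / p' * of_real (ln n) - of_nat m) \<le> c'"
        by (rule proportional_drifts[OF \<psi>(4) \<tau>]) blast
      show ?thesis
      proof (intro exI[of _ "max (max N M) 1"] exI[of _ c'] allI impI)
        fix n m assume nm: "n \<ge> max (max N M) 1" "m \<ge> max (max N M) 1" and "(\<phi> ^^ n) ` K \<inter> (\<psi> ^^ m) ` K \<noteq> {}"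
        then have "cmod (of_real \<tau> * of_nat n + \<kappa> * of_real (ln n) - of_nat m) \<le> c'"
          unfolding \<kappa>_def by (intro M N) auto
        then have "\<bar>Re (of_real \<tau> * of_nat n + \<kappa> * of_real (ln n) - of_nat m)\<bar> \<le> c'"
          "\<bar>Im (of_real \<tau> * of_nat n + \<kappa> * of_real (ln n) - of_nat m)\<bar> \<le> c'"
          using abs_Re_le_cmod abs_Im_le_cmod order_trans by blast+
        moreover have "ln (real n) \<ge> 0" using nm by auto
        ultimately show "\<bar>\<tau> * n + Re \<kappa> * ln n - m\<bar> \<le> c' \<and> \<bar>Im \<kappa>\<bar> * ln n \<le> c'"
          by (simp add: abs_mult)
      qed
    qed
    show ?thesis
    proof (cases "\<tau> \<noteq> 1 \<or> Re \<kappa> \<noteq> 0")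
      case True
      show ?thesis
      proof (rule disjoint_frequent_orbit_exists[OF \<phi>(1,2) \<psi>(1,2) \<tau>(1) True])
        fix K :: "complex set" assume K: "compact K" "K \<subseteq> unit_disc"
        obtain N :: nat and c' where N: "\<And>n m. n \<ge> N \<Longrightarrow> m \<ge> N \<Longrightarrow> (\<phi> ^^ n) ` K \<inter> (\<psi> ^^ m) ` K \<noteq> {} \<Longrightarrow>
          \<bar>\<tau> * n + Re \<kappa> * ln n - m\<bar> \<le> c'"
          using close[OF K] by blast
        have "(\<phi> ^^ n) ` K \<inter> (\<psi> ^^ m) ` K = {}"
          if "n \<ge> max N (nat \<lceil>c'\<rceil>)" "m \<ge> max N (nat \<lceil>c'\<rceil>)" "max N (nat \<lceil>c'\<rceil>) < \<bar>\<tau> * n + Re \<kappa> * ln n - m\<bar>" for n m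
        proof (rule ccontr)
          assume "(\<phi> ^^ n) ` K \<inter> (\<psi> ^^ m) ` K \<noteq> {}"
          then have "\<bar>\<tau> * n + Re \<kappa> * ln n - m\<bar> \<le> c'" using that by (intro N) auto
          then show False using that(3) by linarith
        qed
        then show "\<exists>N::nat. \<forall>n\<ge>N. \<forall>m\<ge>N. real N < \<bar>\<tau> * real n + Re \<kappa> * ln (real n) - real m\<bar> \<longrightarrow> (\<phi> ^^ n) ` K \<inter> (\<psi> ^^ m) ` K = {}"
          by blast
      qed
    next
      case False
      then have t1: "\<tau> = 1" "Re \<kappa> = 0" by auto
      then have "p = p'" using \<tau>(2) by simp
      then have "\<kappa> \<noteq> 0" using ne \<phi>(4) by (auto simp: \<kappa>_def \<beta>_def \<beta>'_def)
      \<comment> \<open>With \<open>p = p'\<close>, the difference between \<open>q\<close> and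
        \<open>q'\<close> now shows only in the transversal direction. For each \<open>K\<close> a
        collision bounds \<open>\<bar>Im \<kappa>\<bar> * ln n\<close>, hence
        \<open>n\<close>.\<close>
      then have Im: "\<bar>Im \<kappa>\<bar> > 0" using t1 by (simp add: complex_eq_iff)
      show ?thesis
      proof (rule disjoint_frequent_orbit_exists[OF \<phi>(1,2) \<psi>(1,2), of 2 0])
        fix K :: "complex set" assume K: "compact K" "K \<subseteq> unit_disc"
        obtain N :: nat and c' where N: "\<And>n m. n \<ge> N \<Longrightarrow> m \<ge> N \<Longrightarrow> (\<phi> ^^ n) ` K \<inter> (\<psi> ^^ m) ` K \<noteq> {} \<Longrightarrow>
          \<bar>Im \<kappa>\<bar> * ln n \<le> c'"
          using close[OF K] by blast
        define M where "M = nat \<lceil>exp (c' / \<bar>Im \<kappa>\<bar> + 1)\<rceil>"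
        have "(\<phi> ^^ n) ` K \<inter> (\<psi> ^^ m) ` K = {}" if "n \<ge> max N M" "m \<ge> max N M" for n m
        proof (rule ccontr)
          assume "(\<phi> ^^ n) ` K \<inter> (\<psi> ^^ m) ` K \<noteq> {}"
          then have "\<bar>Im \<kappa>\<bar> * ln n \<le> c'" using that by (intro N) auto
          then have "ln n \<le> c' / \<bar>Im \<kappa>\<bar>" using Im by (simp add: pos_le_divide_eq mult.commute)
          moreover have "exp (c' / \<bar>Im \<kappa>\<bar> + 1) \<le> real n" using that(1) unfolding M_def by linarith
          then have "c' / \<bar>Im \<kappa>\<bar> + 1 \<le> ln n" using less_le_trans[OF exp_gt_zero] by (subst ln_ge_iff) blast+
          ultimately show False by linarith
        qed
        then show "\<exists>N::nat. \<forall>n\<ge>N. \<forall>m\<ge>N. real N < \<bar>2 * real n + 0 * ln (real n) - real m\<bar> \<longrightarrow> (\<phi> ^^ n) ` K \<inter> (\<psi> ^^ m) ` K = {}"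
          by blast
      qed auto
    qed
  qed
qed

section \<open>Obstructions\<close>

lemma lower_density_posD:
  assumes "lower_density A > 0"
  obtains c :: real where "c > 0" "\<forall>\<^sub>F n in sequentially. c * real n < real (card (A \<inter> {1..n}))"
proof -
  obtain c where c: "0 < ereal c" "ereal c < lower_density A" using ereal_dense2[OF assms] by blast
  have "\<forall>\<^sub>F n in sequentially. ereal c < ereal (real (card (A \<inter> {1..n})) / real n)"
    using c(2) unfolding lower_density_def by (rule less_LiminfD)
  then have "\<forall>\<^sub>F n in sequentially. c * real n < real (card (A \<inter> {1..n}))"
    using eventually_gt_at_top[of 0] by eventually_elim (simp add: pos_less_divide_eq)
  then show ?thesis using that c(1) by simp
qed

lemma lower_density_pos_unbounded:
  assumes "lower_density A > 0"
  obtains n where "n \<ge> N" "n \<in> A"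
proof -
  obtain c :: real where c: "c > 0" "\<forall>\<^sub>F n in sequentially. c * real n < real (card (A \<inter> {1..n}))"
    by (rule lower_density_posD[OF assms])
  obtain M where M: "\<And>n. n \<ge> M \<Longrightarrow> c * real n < real (card (A \<inter> {1..n}))"
    using c(2) unfolding eventually_sequentially by blast
  define n where "n = max M (nat \<lceil>N / c\<rceil>)"
  have "N / c \<le> n" unfolding n_def by linarith
  then have "real N \<le> c * n" using c(1) by (simp add: divide_le_eq mult.commute)
  then have "N < card (A \<inter> {1..n})" using M[of n] by (simp add: n_def)
  moreover have "card (A \<inter> {1..n}) \<le> N" if "A \<subseteq> {..<N}"
    using card_mono[of "{..<N}" "A \<inter> {1..n}"] that by auto
  ultimately have "\<not> A \<subseteq> {..<N}" by linarith
  then obtain m where "m \<in> A" "\<not> m < N" by blast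
  then show ?thesis using that[of m] by simp
qed

lemma const_in_hol_disc: "(\<lambda>z. if z \<in> unit_disc then c else 0) \<in> hol_disc"
  using holomorphic_transform[of "\<lambda>_. c" unit_disc "\<lambda>z. if z \<in> unit_disc then c else 0"]
  by (auto simp: hol_disc_def)

text \<open>The constant targets 1 along \<phi> and 0 along \<psi> contradict each other at the
  common point of the two orbits, and a single time \<open>n\<close> is enough for this.\<close>

lemma shadowing_excludes_orbit:
  assumes "z \<in> unit_disc" "compact K" "K \<subseteq> unit_disc"
    and shadow: "\<And>n. (\<phi> ^^ n) z \<in> (\<psi> ^^ n) ` K"
  shows "\<not> disjoint_frequent_orbit \<phi> \<psi> f"
proof
  assume f: "disjoint_frequent_orbit \<phi> \<psi> f"
  define S where "S = {n. \<forall>w\<in>insert z K. cmod (f ((\<phi> ^^ n) w) - (if w \<in> unit_disc then 1 else 0)) < 1 / 2 \<and>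
      cmod (f ((\<psi> ^^ n) w) - (if w \<in> unit_disc then 0 else 0)) < 1 / 2}"
  have "lower_density S > 0"
    unfolding S_def
    by (rule f[unfolded disjoint_frequent_orbit_def, THEN conjunct2, rule_format,
          OF const_in_hol_disc const_in_hol_disc compact_insert[OF assms(2)]])
      (use assms in auto)
  then obtain n where n: "n \<in> S" by (rule lower_density_pos_unbounded[of _ 0])
  obtain w where w: "w \<in> K" "(\<phi> ^^ n) z = (\<psi> ^^ n) w" using shadow by blast
  have "cmod (f ((\<phi> ^^ n) z) - 1) < 1 / 2" "cmod (f ((\<psi> ^^ n) w)) < 1 / 2"
    using n assms(1) w(1) by (auto simp: S_def)
  then show False
    using w(2) norm_triangle_ineq4[of "f ((\<phi> ^^ n) z)" "f ((\<phi> ^^ n) z) - 1"] by simp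
qed

text \<open>A quantitative open mapping theorem for the injective map \<open>G\<close>: if the
  circle about \<open>w\<close> is moved to distance at least \<open>r\<close> from
  \<open>G w\<close>, the image of the ball covers the ball of radius \<open>r\<close> about
  \<open>G w\<close>. It turns orbits that are close into orbits that coincide.\<close>

lemma half_plane_open_image:
  fixes n :: nat
  assumes \<psi>: "univalent_self_map \<psi>" and \<alpha>: "cmod \<alpha> = 1" and x: "x \<in> unit_disc"
    and \<rho>: "\<rho> > 0" "cball w \<rho> \<subseteq> {v. Re v > 1 / 2}"
  defines "G \<equiv> \<lambda>v. half_plane_coord \<alpha> ((\<psi> ^^ n) (half_plane_inv \<alpha> v))"
  assumes bd: "\<And>v. v \<in> sphere w \<rho> \<Longrightarrow> r \<le> cmod (G v - G w)"
    and near: "cmod (half_plane_coord \<alpha> x - G w) < r"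
  shows "x \<in> (\<psi> ^^ n) ` half_plane_inv \<alpha> ` cball w \<rho>"
proof -
  let ?P = "{v. Re v > 1 / 2}"
  have P: "open ?P" using open_halfspace_Re_gt[of "1 / 2"] by simp
  have inv: "half_plane_inv \<alpha> v \<in> unit_disc" if "v \<in> ?P" for v
    using half_plane_inv_in_disc[OF \<alpha>] that by simp
  have \<psi>n: "\<psi> ^^ n holomorphic_on unit_disc" "(\<psi> ^^ n) ` unit_disc \<subseteq> unit_disc" "inj_on (\<psi> ^^ n) unit_disc"
    using univalent_self_map_funpow[OF \<psi>, of n] by (auto simp: univalent_self_map_def)
  have "(\<psi> ^^ n) \<circ> half_plane_inv \<alpha> holomorphic_on ?P"
    using inv by (intro holomorphic_on_compose_gen[OF holomorphic_half_plane_inv \<psi>n(1)]) auto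
  then have "half_plane_coord \<alpha> \<circ> ((\<psi> ^^ n) \<circ> half_plane_inv \<alpha>) holomorphic_on ?P"
    using inv \<psi>n(2) by (intro holomorphic_on_compose_gen[OF _ holomorphic_half_plane_coord[OF \<alpha>]]) auto
  then have hG: "G holomorphic_on ?P" by (simp add: G_def o_def)
  have ninv: "half_plane_inv \<alpha> (G v) = (\<psi> ^^ n) (half_plane_inv \<alpha> v)" if "v \<in> ?P" for v
  proof -
    have "(\<psi> ^^ n) (half_plane_inv \<alpha> v) \<in> unit_disc" using inv[OF that] \<psi>n(2) by blast
    then have "(\<psi> ^^ n) (half_plane_inv \<alpha> v) \<noteq> \<alpha>" using \<alpha> by auto
    then show ?thesis unfolding G_def by (rule half_plane_inv_coord[OF \<alpha>])
  qed
  have injG: "inj_on G ?P"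
  proof (rule inj_onI)
    fix u v assume uv: "u \<in> ?P" "v \<in> ?P" "G u = G v"
    then have "(\<psi> ^^ n) (half_plane_inv \<alpha> u) = (\<psi> ^^ n) (half_plane_inv \<alpha> v)" using ninv by metis
    then have "half_plane_inv \<alpha> u = half_plane_inv \<alpha> v" using \<psi>n(3) inv uv by (meson inj_onD)
    then have "half_plane_coord \<alpha> (half_plane_inv \<alpha> u) = half_plane_coord \<alpha> (half_plane_inv \<alpha> v)" by simp
    then show "u = v" using uv by (subst (asm) (1 2) half_plane_coord_inv[OF \<alpha>]) auto
  qed
  have bP: "ball w \<rho> \<subseteq> ?P" using \<rho>(2) ball_subset_cball by blast
  have "ball (G w) r \<subseteq> G ` ball w \<rho>"
  proof (rule ball_subset_open_map_image)
    show "continuous_on (closure (ball w \<rho>)) G"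
      using \<rho> hG by (auto intro: continuous_on_subset[OF holomorphic_on_imp_continuous_on])
    show "open (G ` interior (ball w \<rho>))"
      using open_mapping_thm3[OF holomorphic_on_subset[OF hG bP] open_ball inj_on_subset[OF injG bP]]
      by (simp add: interior_open)
    show "0 < r" using near norm_ge_zero order.strict_trans1 by blast
  qed (use \<rho> bd in auto)
  moreover have "half_plane_coord \<alpha> x \<in> ball (G w) r" using near by (simp add: dist_norm norm_minus_commute)
  ultimately obtain v where v: "v \<in> ball w \<rho>" "half_plane_coord \<alpha> x = G v" by blast
  have "x \<noteq> \<alpha>" using x \<alpha> by auto
  then have "x = half_plane_inv \<alpha> (G v)" using half_plane_inv_coord[OF \<alpha>] v(2) by metis
  also have "\<dots> = (\<psi> ^^ n) (half_plane_inv \<alpha> v)" using ninv v(1) bP by blast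
  finally show ?thesis using v(1) by auto
qed

lemma half_plane_inv_compact:
  assumes "cmod \<alpha> = 1" "compact S" "S \<subseteq> {v. Re v > 1 / 2}"
  shows "compact (half_plane_inv \<alpha> ` S)" "half_plane_inv \<alpha> ` S \<subseteq> unit_disc"
proof -
  have "continuous_on S (half_plane_inv \<alpha>)"
    using holomorphic_half_plane_inv assms(3) holomorphic_on_imp_continuous_on continuous_on_subset by blast
  then show "compact (half_plane_inv \<alpha> ` S)" using assms(2) by (rule compact_continuous_image)
  show "half_plane_inv \<alpha> ` S \<subseteq> unit_disc" using half_plane_inv_in_disc[OF assms(1)] assms(3) by auto
qed

lemma cball_subset_half_plane: "Re w - \<rho> > 1 / 2 \<Longrightarrow> cball w \<rho> \<subseteq> {v. Re v > 1 / 2}"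
proof
  fix v assume "Re w - \<rho> > 1 / 2" "v \<in> cball w \<rho>"
  moreover have "Re w - Re v \<le> cmod (w - v)" using complex_Re_le_cmod[of "w - v"] by simp
  ultimately show "v \<in> {v. Re v > 1 / 2}" by (simp add: dist_norm)
qed

section \<open>Pairs of maps whose orbits meet too often\<close>

lemma norm_diff_lower_bound:
  fixes a b A B :: complex
  assumes "cmod (a - A) \<le> x" "cmod (b - B) \<le> y"
  shows "cmod (A - B) - x - y \<le> cmod (a - b)"
proof -
  have "A - B = (a - b) - (a - A) + (b - B)" by simp
  also have "cmod \<dots> \<le> (cmod (a - b) + x) + y"
    by (rule norm_triangle_mono[OF order_trans[OF norm_triangle_ineq4 add_left_mono[OF assms(1)]] assms(2)])
  finally show ?thesis by simp
qed

text \<open>In the coordinate, \<open>\<psi> ^^ n\<close> moves the unit ball about a large real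
  \<open>w\<close> almost by a translation, namely along the \<phi>-orbit of \<open>w\<close>, with
  an error that does not grow with \<open>n\<close>. The image therefore contains the orbit
  point.\<close>

lemma no_disjoint_orbit_parabolic:
  assumes \<phi>: "univalent_self_map \<phi>" "denjoy_wolff_point \<phi> \<alpha>" "parabolic_estimate \<phi> \<alpha> p q C e R" "p \<noteq> 0"
    and \<psi>: "univalent_self_map \<psi>" "parabolic_estimate \<psi> \<alpha> p q C' e' R'"
  shows "\<not> disjoint_frequent_orbit \<phi> \<psi> f"
proof -
  have \<alpha>: "cmod \<alpha> = 1" using \<phi>(2) by (auto simp: denjoy_wolff_point_def)
  have Re: "Re p \<ge> 0" by (rule parabolic_drift_Re_nonneg[OF \<phi>])
  define c d s where "c = max C C'" and "d = min e e'" and "s = max R R'"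
  have d0: "0 < d" using \<phi>(3) \<psi>(2) by (auto simp: parabolic_estimate_def d_def)
  have est: "parabolic_estimate \<phi> \<alpha> p q c d s" "parabolic_estimate \<psi> \<alpha> p q c d s"
    using d0 by (auto intro!: parabolic_estimate_mono[OF \<phi>(3)] parabolic_estimate_mono[OF \<psi>(2)] simp: c_def d_def s_def)
  have step: "cmod (half_plane_coord \<alpha> ((\<xi> ^^ Suc n) z) - (half_plane_coord \<alpha> ((\<xi> ^^ n) z) + p + q / half_plane_coord \<alpha> ((\<xi> ^^ n) z)))
          \<le> c * cmod (half_plane_coord \<alpha> ((\<xi> ^^ n) z)) powr (- 1 - d)"
    if "univalent_self_map \<xi>" "parabolic_estimate \<xi> \<alpha> p q c d s" "z \<in> unit_disc" "s \<le> cmod (half_plane_coord \<alpha> ((\<xi> ^^ n) z))" for \<xi> z n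
    using that univalent_funpow_in_disc[OF that(1,3), of n] unfolding parabolic_estimate_def by simp
  have cd: "c \<ge> 0" "d \<le> 1" using est(1) by (auto simp: parabolic_estimate_def)
  obtain T where T: "T \<ge> 4" "\<And>a b :: nat \<Rightarrow> complex. \<And>t n. T \<le> t \<Longrightarrow> a 0 = of_real t \<Longrightarrow> cmod (b 0 - of_real t) \<le> 1 \<Longrightarrow>
       (\<And>n. s \<le> cmod (a n) \<Longrightarrow> cmod (a (Suc n) - (a n + p + q / a n)) \<le> c * cmod (a n) powr (- 1 - d)) \<Longrightarrow>
       (\<And>n. s \<le> cmod (b n) \<Longrightarrow> cmod (b (Suc n) - (b n + p + q / b n)) \<le> c * cmod (b n) powr (- 1 - d)) \<Longrightarrow>
       cmod (a n - b n - (a 0 - b 0)) \<le> 1 / 8"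
    by (rule parabolic_orbits_parallel[OF \<phi>(4) Re cd(1) d0 cd(2)]) blast
  define w where "w = complex_of_real T"
  have Pw: "cball w 1 \<subseteq> {v. Re v > 1 / 2}" by (rule cball_subset_half_plane) (use T in \<open>simp add: w_def\<close>)
  define z where "z = half_plane_inv \<alpha> w"
  have wP: "w \<in> {v. Re v > 1 / 2}" using Pw by force
  have zD: "z \<in> unit_disc" using half_plane_inv_in_disc[OF \<alpha>] wP by (simp add: z_def)
  have V: "half_plane_coord \<alpha> (half_plane_inv \<alpha> v) = v" if "v \<in> {v. Re v > 1 / 2}" for v
    using that by (intro half_plane_coord_inv[OF \<alpha>]) auto
  show ?thesis
  proof (rule shadowing_excludes_orbit[OF zD half_plane_inv_compact[OF \<alpha> compact_cball Pw]])
    fix n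
    define G where "G v = half_plane_coord \<alpha> ((\<psi> ^^ n) (half_plane_inv \<alpha> v))" for v
    have close: "cmod (half_plane_coord \<alpha> ((\<phi> ^^ n) z) - G v - (w - v)) \<le> 1 / 8" if v: "v \<in> cball w 1" for v
    proof -
      have vP: "v \<in> {v. Re v > 1 / 2}" using v Pw by blast
      have vD: "half_plane_inv \<alpha> v \<in> unit_disc" using half_plane_inv_in_disc[OF \<alpha>] vP by simp
      define a where "a n = half_plane_coord \<alpha> ((\<phi> ^^ n) z)" for n
      define b where "b n = half_plane_coord \<alpha> ((\<psi> ^^ n) (half_plane_inv \<alpha> v))" for n
      have ab: "a 0 = of_real T" "b 0 = v" using V[OF wP] V[OF vP] by (simp_all add: a_def b_def z_def w_def)
      have "cmod (a n - b n - (a 0 - b 0)) \<le> 1 / 8"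
      proof (rule T(2)[of T])
        show "cmod (b 0 - of_real T) \<le> 1" using v by (simp add: ab w_def dist_norm norm_minus_commute)
      qed (use ab step[OF \<phi>(1) est(1) zD] step[OF \<psi>(1) est(2) vD] in \<open>auto simp: a_def b_def\<close>)
      then show ?thesis by (simp add: ab) (simp add: a_def b_def G_def w_def)
    qed
    show "(\<phi> ^^ n) z \<in> (\<psi> ^^ n) ` half_plane_inv \<alpha> ` cball w 1"
    \<comment> \<open>\<open>3 / 4\<close> is the radius 1 less an error of \<open>1 / 8\<close> on
      the circle and another at the centre.\<close>
    proof (rule half_plane_open_image[where n = n and r = "3/4",
          OF \<psi>(1) \<alpha> univalent_funpow_in_disc[OF \<phi>(1) zD] zero_less_one Pw, folded G_def])
      have c0: "cmod (half_plane_coord \<alpha> ((\<phi> ^^ n) z) - G w) \<le> 1 / 8" using close[of w] by simp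
      then show "cmod (half_plane_coord \<alpha> ((\<phi> ^^ n) z) - G w) < 3 / 4" by simp
      fix v assume v: "v \<in> sphere w 1"
      then have v1: "v \<in> cball w 1" "cmod (w - v) = 1" by (auto simp: dist_norm)
      have "cmod (G v - (half_plane_coord \<alpha> ((\<phi> ^^ n) z) - (w - v))) \<le> 1 / 8"
        using close[OF v1(1)] by (subst norm_minus_commute) (simp add: algebra_simps)
      moreover have "cmod (G w - half_plane_coord \<alpha> ((\<phi> ^^ n) z)) \<le> 1 / 8"
        using c0 by (simp add: norm_minus_commute)
      ultimately have "cmod (half_plane_coord \<alpha> ((\<phi> ^^ n) z) - (w - v) - half_plane_coord \<alpha> ((\<phi> ^^ n) z)) - 1 / 8 - 1 / 8 \<le> cmod (G v - G w)"
        by (rule norm_diff_lower_bound)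
      moreover have "half_plane_coord \<alpha> ((\<phi> ^^ n) z) - (w - v) - half_plane_coord \<alpha> ((\<phi> ^^ n) z) = - (w - v)" by simp
      ultimately show "3 / 4 \<le> cmod (G v - G w)" using v1(2) by (simp only: norm_minus_cancel)
    qed
  qed
qed

text \<open>Both iterates are multiplication by \<open>L ^ n\<close> up to a small relative error
  that is uniform in \<open>n\<close>, so \<open>\<psi> ^^ n\<close> of a ball about
  \<open>w\<close> with radius proportional to \<open>cmod w\<close> covers the orbit point of
  \<phi>.\<close>

lemma no_disjoint_orbit_hyperbolic:
  assumes \<phi>: "univalent_self_map \<phi>" "denjoy_wolff_point \<phi> \<alpha>" "hyperbolic_estimate \<phi> \<alpha> L C e R" "L > 1"
    and \<psi>: "univalent_self_map \<psi>" "hyperbolic_estimate \<psi> \<alpha> L C' e' R'"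
  shows "\<not> disjoint_frequent_orbit \<phi> \<psi> f"
proof -
  have \<alpha>: "cmod \<alpha> = 1" using \<phi>(2) by (auto simp: denjoy_wolff_point_def)
  have c: "C \<ge> 0" "e > 0" "C' \<ge> 0" "e' > 0" using \<phi>(3) \<psi>(2) by (auto simp: hyperbolic_estimate_def)
  have step: "cmod (half_plane_coord \<alpha> ((\<xi> ^^ Suc n) z) - of_real L * half_plane_coord \<alpha> ((\<xi> ^^ n) z))
          \<le> c * cmod (half_plane_coord \<alpha> ((\<xi> ^^ n) z)) powr (1 - d)"
    if "univalent_self_map \<xi>" "hyperbolic_estimate \<xi> \<alpha> L c d s" "z \<in> unit_disc" "s \<le> cmod (half_plane_coord \<alpha> ((\<xi> ^^ n) z))" for \<xi> z n c d s
    using that univalent_funpow_in_disc[OF that(1,3), of n] unfolding hyperbolic_estimate_def by simp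
  obtain R1 where R1: "R1 \<ge> 1" "\<And>(v :: nat \<Rightarrow> complex) n. (\<And>n. R \<le> cmod (v n) \<Longrightarrow> cmod (v (Suc n) - of_real L * v n) \<le> C * cmod (v n) powr (1 - e)) \<Longrightarrow>
       R1 \<le> cmod (v 0) \<Longrightarrow> cmod (v n - of_real (L ^ n) * v 0) \<le> 1 / 16 * (L ^ n * cmod (v 0))"
    by (rule hyperbolic_orbit[where ?R0.0 = R and \<delta> = "1/16", OF \<phi>(4) c(1,2)]) auto
  obtain R2 where R2: "R2 \<ge> 1" "\<And>(v :: nat \<Rightarrow> complex) n. (\<And>n. R' \<le> cmod (v n) \<Longrightarrow> cmod (v (Suc n) - of_real L * v n) \<le> C' * cmod (v n) powr (1 - e')) \<Longrightarrow>
       R2 \<le> cmod (v 0) \<Longrightarrow> cmod (v n - of_real (L ^ n) * v 0) \<le> 1 / 16 * (L ^ n * cmod (v 0))"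
    by (rule hyperbolic_orbit[where ?R0.0 = R' and \<delta> = "1/16", OF \<phi>(4) c(3,4)]) auto
  \<comment> \<open>The centre \<open>t\<close> is beyond \<open>R1\<close>, and the whole ball of
    radius \<open>t / 2\<close> about it is beyond \<open>R2\<close>.\<close>
  define t where "t = 2 * max R1 R2"
  have t: "t \<ge> 2" "R1 \<le> t" "R2 \<le> t / 2" using R1(1) R2(1) by (auto simp: t_def)
  define w where "w = complex_of_real t"
  have Pw: "cball w (t / 2) \<subseteq> {v. Re v > 1 / 2}" by (rule cball_subset_half_plane) (use t in \<open>simp add: w_def\<close>)
  define z where "z = half_plane_inv \<alpha> w"
  have wP: "w \<in> {v. Re v > 1 / 2}" using t by (simp add: w_def)
  have zD: "z \<in> unit_disc" using half_plane_inv_in_disc[OF \<alpha>] wP by (simp add: z_def)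
  have V: "half_plane_coord \<alpha> (half_plane_inv \<alpha> v) = v" if "v \<in> {v. Re v > 1 / 2}" for v
    using that by (intro half_plane_coord_inv[OF \<alpha>]) auto
  have cw: "cmod w = t" using t by (simp add: w_def)
  show ?thesis
  proof (rule shadowing_excludes_orbit[OF zD half_plane_inv_compact[OF \<alpha> compact_cball Pw]])
    fix n
    define G where "G v = half_plane_coord \<alpha> ((\<psi> ^^ n) (half_plane_inv \<alpha> v))" for v
    define x where "x = half_plane_coord \<alpha> ((\<phi> ^^ n) z)"
    have Ln: "L ^ n > 0" using \<phi>(4) by simp
    have x: "cmod (x - of_real (L ^ n) * w) \<le> 1 / 16 * (L ^ n * t)"
      using R1(2)[of "\<lambda>n. half_plane_coord \<alpha> ((\<phi> ^^ n) z)" n] step[OF \<phi>(1,3) zD] V[OF wP] t cw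
      by (simp add: x_def z_def)
    have G: "cmod (G v - of_real (L ^ n) * v) \<le> 3 / 32 * (L ^ n * t)" if v: "v \<in> cball w (t / 2)" for v
    proof -
      have vP: "v \<in> {v. Re v > 1 / 2}" using v Pw by blast
      have vD: "half_plane_inv \<alpha> v \<in> unit_disc" using half_plane_inv_in_disc[OF \<alpha>] vP by simp
      have "cmod (w - v) \<le> t / 2" using v by (simp add: dist_norm)
      then have cv: "t / 2 \<le> cmod v" "cmod v \<le> 3 / 2 * t"
        using norm_triangle_ineq2[of w v] norm_triangle_ineq2[of v w] cw by (auto simp: norm_minus_commute)
      have "cmod (G v - of_real (L ^ n) * v) \<le> 1 / 16 * (L ^ n * cmod v)"
        using R2(2)[of "\<lambda>n. half_plane_coord \<alpha> ((\<psi> ^^ n) (half_plane_inv \<alpha> v))" n] step[OF \<psi>(1,2) vD] V[OF vP] t cv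
        by (simp add: G_def)
      also have "\<dots> \<le> 1 / 16 * (L ^ n * (3 / 2 * t))" using cv Ln by (intro mult_left_mono) auto
      finally show ?thesis by simp
    qed
    have Gw: "cmod (G w - of_real (L ^ n) * w) \<le> 1 / 16 * (L ^ n * t)"
      using R2(2)[of "\<lambda>n. half_plane_coord \<alpha> ((\<psi> ^^ n) (half_plane_inv \<alpha> w))" n] step[OF \<psi>(1,2), of "half_plane_inv \<alpha> w"] zD V[OF wP] t cw
      by (simp add: G_def z_def)
    have t2: "0 < t / 2" using t by simp
    have Lt: "L ^ n * t > 0" using Ln t by (intro mult_pos_pos) auto
    show "(\<phi> ^^ n) z \<in> (\<psi> ^^ n) ` half_plane_inv \<alpha> ` cball w (t / 2)"
    \<comment> \<open>\<open>11 / 32 = 1 / 2 - 3 / 32 - 1 / 16\<close>: the scaled radius less the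
      error on the circle, where \<open>cmod v \<le> 3 / 2 * t\<close>, and less the error at the
      centre.\<close>
    proof (rule half_plane_open_image[where n = n and r = "11 / 32 * (L ^ n * t)",
          OF \<psi>(1) \<alpha> univalent_funpow_in_disc[OF \<phi>(1) zD] t2 Pw, folded G_def])
      have "cmod (x - G w) \<le> 1 / 16 * (L ^ n * t) + 1 / 16 * (L ^ n * t)"
        using order_trans[OF norm_triangle_ineq4 add_mono[OF x Gw]] by simp
      then show "cmod (half_plane_coord \<alpha> ((\<phi> ^^ n) z) - G w) < 11 / 32 * (L ^ n * t)"
        using Lt unfolding x_def by linarith
      fix v assume v: "v \<in> sphere w (t / 2)"
      then have v1: "v \<in> cball w (t / 2)" "cmod (v - w) = t / 2" by (auto simp: dist_norm norm_minus_commute)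
      have d: "cmod (of_real (L ^ n) * v - of_real (L ^ n) * w) = L ^ n * (t / 2)"
        using v1(2) Ln by (simp add: right_diff_distrib[symmetric] norm_mult del: of_real_power)
      then show "11 / 32 * (L ^ n * t) \<le> cmod (G v - G w)"
        using norm_diff_lower_bound[OF G[OF v1(1)] Gw] unfolding d by (simp add: algebra_simps)
    qed
  qed
qed

text \<open>Equal times need not produce a coincidence here, so densities are compared. For each
  \<open>n\<close> at which \<open>f\<close> is near 0 on \<open>\<phi> ^^ n\<close> of a fixed
  compact set, that image contains \<open>(\<psi> ^^ m) 0\<close> for a long range of
  \<open>m\<close>, and no such \<open>m\<close> can be a time at which \<open>f\<close> is near 1
  there. With the range long enough this contradicts the density of the latter times.\<close>

lemma no_disjoint_orbit_mixed:
  assumes \<phi>: "univalent_self_map \<phi>" "denjoy_wolff_point \<phi> \<alpha>" "hyperbolic_estimate \<phi> \<alpha> L C e R" "L > 1"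
    and \<psi>: "univalent_self_map \<psi>" "denjoy_wolff_point \<psi> \<alpha>" "parabolic_estimate \<psi> \<alpha> p q C' e' R'" "p \<noteq> 0"
    and Re: "Re p \<noteq> 0"
  shows "\<not> disjoint_frequent_orbit \<phi> \<psi> f"
proof
  assume f: "disjoint_frequent_orbit \<phi> \<psi> f"
  have \<alpha>: "cmod \<alpha> = 1" using \<phi>(2) by (auto simp: denjoy_wolff_point_def)
  have Rep: "Re p > 0" using parabolic_drift_Re_nonneg[OF \<psi>] Re by simp
  \<comment> \<open>The cosine of the angle between \<open>p\<close> and the positive axis; the
    \<psi>-orbit of 0 eventually stays in the sector
    \<open>Re v \<ge> c / 2 * cmod v\<close>.\<close>
  define c where "c = Re p / cmod p"
  have p0: "cmod p > 0" using \<psi>(4) by simp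
  have c: "0 < c" "c \<le> 1" "c * cmod p = Re p"
    using Rep p0 complex_Re_le_cmod[of p] by (auto simp: c_def divide_le_eq)
  \<comment> \<open>A ball of radius \<open>c / 4 * cmod w\<close> about a point \<open>w\<close> of
    the sector keeps real parts at least \<open>c / 4 * cmod w\<close>.\<close>
  define \<eta> where "\<eta> = c / 4"
  have \<eta>: "0 < \<eta>" "\<eta> \<le> 1 / 4" using c by (auto simp: \<eta>_def)
  have ce: "C \<ge> 0" "e > 0" using \<phi>(3) by (auto simp: hyperbolic_estimate_def)
  have step: "cmod (half_plane_coord \<alpha> ((\<phi> ^^ Suc n) z) - of_real L * half_plane_coord \<alpha> ((\<phi> ^^ n) z))
          \<le> C * cmod (half_plane_coord \<alpha> ((\<phi> ^^ n) z)) powr (1 - e)"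
    if "z \<in> unit_disc" "R \<le> cmod (half_plane_coord \<alpha> ((\<phi> ^^ n) z))" for z n
    using that \<phi>(3) univalent_funpow_in_disc[OF \<phi>(1) that(1), of n] unfolding hyperbolic_estimate_def by simp
  obtain R1 where R1: "R1 \<ge> 1" "\<And>(v :: nat \<Rightarrow> complex) n. (\<And>n. R \<le> cmod (v n) \<Longrightarrow> cmod (v (Suc n) - of_real L * v n) \<le> C * cmod (v n) powr (1 - e)) \<Longrightarrow>
       R1 \<le> cmod (v 0) \<Longrightarrow> cmod (v n - of_real (L ^ n) * v 0) \<le> \<eta> / 16 * (L ^ n * cmod (v 0))"
    by (rule hyperbolic_orbit[where ?R0.0 = R and \<delta> = "\<eta> / 16", OF \<phi>(4) ce]) (use \<eta> in auto)
  \<comment> \<open>\<open>2 * R1\<close> keeps these balls beyond \<open>R1\<close>, and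
    \<open>4 / c\<close> keeps their real parts at least 1.\<close>
  define R0 where "R0 = max (2 * R1) (4 / c)"
  have R0: "2 * R1 \<le> R0" "4 / c \<le> R0" "R0 > 0" using R1(1) by (auto simp: R0_def)
  \<comment> \<open>Here \<open>w\<close> is the coordinate of \<open>x\<close> divided by
    \<open>L ^ n\<close>. Since \<open>\<phi> ^^ n\<close> is close to this scaling,
    \<open>x\<close> has an exact preimage in a ball about \<open>w\<close>, and that ball is
    confined by \<open>cmod w\<close> alone, independently of \<open>n\<close>.\<close>
  have surround: "x \<in> (\<phi> ^^ n) ` half_plane_inv \<alpha> ` cball w (\<eta> * cmod w) \<and>
      cball w (\<eta> * cmod w) \<subseteq> {v. 1 \<le> Re v \<and> cmod v \<le> 2 * cmod w}"
    if x: "x \<in> unit_disc" "half_plane_coord \<alpha> x = of_real (L ^ n) * w"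
      and w: "R0 \<le> cmod w" "c / 2 * cmod w \<le> Re w" for x w n
  proof -
    define t where "t = cmod w"
    have t: "t \<ge> R0" "t > 0" using w R0 by (auto simp: t_def)
    have Ln: "L ^ n > 0" using \<phi>(4) by simp
    have Lt: "L ^ n * t > 0" using Ln t by simp
    have sub: "1 \<le> Re v" "t / 2 \<le> cmod v" "cmod v \<le> 2 * t" if "v \<in> cball w (\<eta> * t)" for v
    proof -
      have d: "cmod (w - v) \<le> \<eta> * t" using that by (simp add: dist_norm)
      have "4 / c * c \<le> t * c" using t R0 c by (intro mult_right_mono) auto
      then have "1 \<le> c / 4 * t" using c by (simp add: mult.commute)
      moreover have "Re w - Re v \<le> cmod (w - v)" using complex_Re_le_cmod[of "w - v"] by simp
      ultimately show "1 \<le> Re v" using d w(2) by (simp add: t_def \<eta>_def)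
      have "\<eta> * t \<le> 1 / 4 * t" using \<eta> t by (intro mult_right_mono) auto
      then have d4: "cmod (w - v) \<le> t / 4" using d by simp
      show "t / 2 \<le> cmod v" "cmod v \<le> 2 * t"
        using norm_triangle_ineq2[of w v] norm_triangle_ineq2[of v w] d4 t by (auto simp: norm_minus_commute t_def)
    qed
    define G where "G v = half_plane_coord \<alpha> ((\<phi> ^^ n) (half_plane_inv \<alpha> v))" for v
    have P: "cball w (\<eta> * t) \<subseteq> {v. Re v > 1 / 2}" using sub(1) by fastforce
    have G: "cmod (G v - of_real (L ^ n) * v) \<le> \<eta> / 16 * (L ^ n * cmod v)" if v: "v \<in> cball w (\<eta> * t)" for v
    proof -
      have vP: "Re v > 1 / 2" using P v by auto
      have vD: "half_plane_inv \<alpha> v \<in> unit_disc" by (rule half_plane_inv_in_disc[OF \<alpha> vP])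
      have V: "half_plane_coord \<alpha> (half_plane_inv \<alpha> v) = v" using vP by (intro half_plane_coord_inv[OF \<alpha>]) auto
      have "R1 \<le> cmod v" using sub(2)[OF v] t R0 by linarith
      then show ?thesis
        using R1(2)[of "\<lambda>n. half_plane_coord \<alpha> ((\<phi> ^^ n) (half_plane_inv \<alpha> v))" n] step[OF vD] V by (simp add: G_def)
    qed
    have \<eta>t: "\<eta> * t > 0" using \<eta> t by simp
    have wc: "w \<in> cball w (\<eta> * t)" using \<eta>t by simp
    have small: "\<eta> * (L ^ n * t) > 0" using \<eta> Lt by simp
    have Gw: "cmod (G w - of_real (L ^ n) * w) \<le> \<eta> * (L ^ n * t) / 16" using G[OF wc] by (simp add: t_def)
    have "x \<in> (\<phi> ^^ n) ` half_plane_inv \<alpha> ` cball w (\<eta> * t)"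
    \<comment> \<open>\<open>13 / 16 = 1 - 1 / 8 - 1 / 16\<close>, from the errors on the circle and
      at the centre.\<close>
    proof (rule half_plane_open_image[where n = n and r = "13 / 16 * (\<eta> * (L ^ n * t))",
          OF \<phi>(1) \<alpha> x(1) \<eta>t P, folded G_def])
      show "cmod (half_plane_coord \<alpha> x - G w) < 13 / 16 * (\<eta> * (L ^ n * t))"
        using Gw small unfolding x(2) by (subst norm_minus_commute) linarith
      fix v assume v: "v \<in> sphere w (\<eta> * t)"
      then have v1: "v \<in> cball w (\<eta> * t)" "cmod (v - w) = \<eta> * t" by (auto simp: dist_norm norm_minus_commute)
      note G[OF v1(1)]
      also have "\<eta> / 16 * (L ^ n * cmod v) \<le> \<eta> / 16 * (L ^ n * (2 * t))"
        using sub(3)[OF v1(1)] \<eta> Ln by (intro mult_left_mono) auto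
      also have "\<dots> = \<eta> * (L ^ n * t) / 8" by simp
      finally have Gv: "cmod (G v - of_real (L ^ n) * v) \<le> \<eta> * (L ^ n * t) / 8" .
      have d: "cmod (of_real (L ^ n) * v - of_real (L ^ n) * w) = \<eta> * (L ^ n * t)"
        using v1(2) Ln by (simp add: right_diff_distrib[symmetric] norm_mult del: of_real_power)
      show "13 / 16 * (\<eta> * (L ^ n * t)) \<le> cmod (G v - G w)"
        using norm_diff_lower_bound[OF Gv Gw] unfolding d by linarith
    qed
    then show ?thesis using sub unfolding t_def by fastforce
  qed
  obtain N C1 where N: "\<And>m z. m \<ge> N \<Longrightarrow> z \<in> {0} \<Longrightarrow>
    cmod (half_plane_coord \<alpha> ((\<psi> ^^ m) z) - (of_nat m * p + q / p * of_real (ln m))) \<le> C1"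
    by (rule parabolic_asymptotics[OF \<psi>, of "{0}"]) auto
  define v where "v m = half_plane_coord \<alpha> ((\<psi> ^^ m) 0)" for m
  have "c / 4 * cmod p > 0" using c(1) p0 by (intro mult_pos_pos) auto
  then obtain N' where N': "\<And>m. m \<ge> N' \<Longrightarrow> C1 + cmod (q / p) * ln (real m) < c / 4 * cmod p * real m"
    using logarithm_sublinear by metis
  define M where "M = max (max N N') 1"
  have vm: "3 / 4 * (cmod p * m) \<le> cmod (v m)" "cmod (v m) \<le> 5 / 4 * (cmod p * m)" "c / 2 * cmod (v m) \<le> Re (v m)"
    if m: "m \<ge> M" for m
  proof -
    have m': "m \<ge> N" "m \<ge> N'" "real m \<ge> 1" using m by (auto simp: M_def)
    have "v m - of_nat m * p = (v m - (of_nat m * p + q / p * of_real (ln m))) + q / p * of_real (ln m)" by simp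
    also have "cmod \<dots> \<le> C1 + cmod (q / p) * ln m"
    proof (rule norm_triangle_mono)
      show "cmod (v m - (of_nat m * p + q / p * of_real (ln m))) \<le> C1" using N[OF m'(1), of 0] by (simp add: v_def)
      show "cmod (q / p * of_real (ln m)) \<le> cmod (q / p) * ln m"
        using m'(3) unfolding norm_mult norm_of_real by simp
    qed
    finally have d: "cmod (v m - of_nat m * p) \<le> c / 4 * (cmod p * m)" using N'[OF m'(2)] by (simp add: mult.assoc)
    have cp: "cmod (of_nat m * p) = cmod p * m" by (simp add: norm_mult mult.commute)
    have pm: "cmod p * m \<ge> 0" by simp
    have "c / 4 * (cmod p * m) \<le> 1 / 4 * (cmod p * m)" using c pm by (intro mult_right_mono) auto
    then have d1: "cmod (v m - of_nat m * p) \<le> 1 / 4 * (cmod p * m)" using d by linarith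
    show "3 / 4 * (cmod p * m) \<le> cmod (v m)"
      using norm_triangle_ineq2[of "of_nat m * p" "of_nat m * p - v m"] d1 cp by (simp add: norm_minus_commute)
    show up: "cmod (v m) \<le> 5 / 4 * (cmod p * m)"
      using norm_triangle_ineq[of "of_nat m * p" "v m - of_nat m * p"] d1 cp by simp
    have "Re (of_nat m * p) - Re (v m) \<le> cmod (v m - of_nat m * p)"
      using complex_Re_le_cmod[of "of_nat m * p - v m"] by (simp add: norm_minus_commute)
    moreover have "Re (of_nat m * p) = c * (cmod p * m)" using c(3) by (simp add: mult.assoc[symmetric])
    moreover have "c / 4 * (cmod p * m) = 1 / 4 * (c * (cmod p * m))" by simp
    ultimately have "3 / 4 * (c * (cmod p * m)) \<le> Re (v m)" using d by linarith
    moreover have "c * cmod (v m) \<le> c * (5 / 4 * (cmod p * m))" using up c by (intro mult_left_mono) auto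
    moreover have "c * (cmod p * m) \<ge> 0" using c by simp
    ultimately show "c / 2 * cmod (v m) \<le> Re (v m)" by (simp add: algebra_simps)
  qed
  define B where "B = {m. \<forall>z\<in>{0}. cmod (f ((\<phi> ^^ m) z) - (if z \<in> unit_disc then 0 else 0)) < 1 / 2 \<and>
      cmod (f ((\<psi> ^^ m) z) - (if z \<in> unit_disc then 1 else 0)) < 1 / 2}"
  have "lower_density B > 0" unfolding B_def
    by (rule f[unfolded disjoint_frequent_orbit_def, THEN conjunct2, rule_format,
          OF const_in_hol_disc const_in_hol_disc]) auto
  then obtain b where b: "b > 0" "\<forall>\<^sub>F n in sequentially. b * real n < real (card (B \<inter> {1..n}))"
    by (rule lower_density_posD)
  obtain Y where Y: "\<And>n. n \<ge> Y \<Longrightarrow> b * real n < real (card (B \<inter> {1..n}))"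
    using b(2) unfolding eventually_sequentially by blast
  have B1: "1 / 2 < cmod (f ((\<psi> ^^ m) 0))" if "m \<in> B" for m
  proof -
    have "cmod (f ((\<psi> ^^ m) 0) - 1) < 1 / 2" using that by (simp add: B_def)
    then show ?thesis using norm_triangle_ineq2[of 1 "1 - f ((\<psi> ^^ m) 0)"] by (simp add: norm_minus_commute)
  qed
  \<comment> \<open>The solution of \<open>b * (4 / 5 * T) = 4 / 3 * R0 + 2\<close>: the density
    bound at the end of the gap then exceeds everything that can lie before the gap, with 2 to spare
    for rounding.\<close>
  define T where "T = (4 / 3 * R0 + 2) * 5 / (4 * b)"
  have T: "T > 0" "b * (4 / 5 * T) = 4 / 3 * R0 + 2" using b(1) R0(3) by (auto simp: T_def field_simps)
  \<comment> \<open>It contains the balls from \<open>surround\<close> about all admissible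
    \<open>w\<close> with \<open>cmod w \<le> T\<close>, and it is fixed before \<open>n\<close> is
    chosen.\<close>
  define S where "S = {w. 1 \<le> Re w} \<inter> cball 0 (2 * T)"
  have "compact S" unfolding S_def
    by (intro closed_Int_compact compact_cball closed_halfspace_Re_ge)
  moreover have "S \<subseteq> {w. Re w > 1 / 2}" by (auto simp: S_def)
  ultimately have K: "compact (half_plane_inv \<alpha> ` S)" "half_plane_inv \<alpha> ` S \<subseteq> unit_disc"
    using half_plane_inv_compact[OF \<alpha>] by blast+
  define A where "A = {n. \<forall>z\<in>half_plane_inv \<alpha> ` S. cmod (f ((\<phi> ^^ n) z) - (if z \<in> unit_disc then 0 else 0)) < 1 / 2 \<and>
      cmod (f ((\<psi> ^^ n) z) - (if z \<in> unit_disc then 1 else 0)) < 1 / 2}"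
  have A: "lower_density A > 0" unfolding A_def
    by (rule f[unfolded disjoint_frequent_orbit_def, THEN conjunct2, rule_format,
          OF const_in_hol_disc const_in_hol_disc K]) auto
  have "filterlim (\<lambda>n. L ^ n) at_top sequentially"
    using filterlim_realpow_sequentially_gt1[of L] \<phi>(4) by (intro filterlim_at_infinity_imp_filterlim_at_top) auto
  then have "\<forall>\<^sub>F n in sequentially. cmod p * ((real M + real Y + b + 2) / min 1 (min R0 (4 / 5 * T))) \<le> L ^ n"
    unfolding filterlim_at_top by blast
  then obtain N2 where N2: "\<And>n. n \<ge> N2 \<Longrightarrow> cmod p * ((real M + real Y + b + 2) / min 1 (min R0 (4 / 5 * T))) \<le> L ^ n"
    unfolding eventually_sequentially by blast
  obtain n where n: "n \<ge> N2" "n \<in> A" by (rule lower_density_pos_unbounded[OF A])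
  \<comment> \<open>The approximate time at which the \<psi>-orbit of 0 reaches size
    \<open>L ^ n\<close>.\<close>
  define Q where "Q = L ^ n / cmod p"
  have L0: "L ^ n > 0" using \<phi>(4) by simp
  have Q0: "Q > 0" using L0 p0 by (simp add: Q_def)
  define \<mu> where "\<mu> = min 1 (min R0 (4 / 5 * T))"
  have \<mu>: "\<mu> > 0" "\<mu> \<le> 1" "\<mu> \<le> R0" "\<mu> \<le> 4 / 5 * T" using R0(3) T(1) by (auto simp: \<mu>_def)
  have "(real M + real Y + b + 2) / \<mu> \<le> Q" using N2[OF n(1)] p0 by (simp add: Q_def pos_le_divide_eq mult.commute \<mu>_def)
  then have Q1: "real M + real Y + b + 2 \<le> \<mu> * Q" using \<mu>(1) by (simp add: divide_le_eq mult.commute)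
  have \<mu>Q: "\<mu> * Q \<le> 1 * Q" "\<mu> * Q \<le> R0 * Q" "\<mu> * Q \<le> 4 / 5 * T * Q" using \<mu> Q0 by (intro mult_right_mono; simp)+
  \<comment> \<open>As \<open>cmod (v m)\<close> lies between \<open>3 / 4\<close> and
    \<open>5 / 4\<close> of \<open>m * cmod p\<close>, every \<open>m\<close> with
    \<open>4 / 3 * R0 * Q < m \<le> 4 / 5 * T * Q\<close> has
    \<open>R0 * L ^ n \<le> cmod (v m) \<le> T * L ^ n\<close>.\<close>
  define y where "y = nat \<lfloor>4 / 5 * T * Q\<rfloor>"
  have y: "real y \<le> 4 / 5 * T * Q" "4 / 5 * T * Q - 1 < real y"
    using T(1) Q0 by (simp_all add: y_def) linarith+
  define x where "x = 4 / 3 * R0 * Q"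
  have avoid: "real m \<le> x" if m: "m \<in> B \<inter> {1..y}" for m
  proof (rule ccontr)
    assume mx: "\<not> real m \<le> x"
    have RQ: "R0 * Q > 0" using R0 Q0 by simp
    then have "real M \<le> m" using mx \<mu>Q(2) Q1 b(1) unfolding x_def by simp
    then have mM: "m \<ge> M" by simp
    have e1: "cmod p * Q = L ^ n" using p0 by (simp add: Q_def)
    have "R0 * L ^ n \<le> 3 / 4 * (cmod p * m)"
    proof -
      have "3 / 4 * (cmod p * x) \<le> 3 / 4 * (cmod p * m)" using mx p0 by (intro mult_left_mono) auto
      moreover have "3 / 4 * (cmod p * x) = R0 * (cmod p * Q)" by (simp add: x_def)
      ultimately show ?thesis by (simp only: e1)
    qed
    then have lo: "R0 * L ^ n \<le> cmod (v m)" using vm(1)[OF mM] by linarith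
    have "5 / 4 * (cmod p * m) \<le> T * L ^ n"
    proof -
      have "real m \<le> 4 / 5 * T * Q" using m y(1) by auto
      then have "5 / 4 * (cmod p * m) \<le> 5 / 4 * (cmod p * (4 / 5 * T * Q))" using p0 by (intro mult_left_mono) auto
      also have "\<dots> = T * (cmod p * Q)" by simp
      finally show ?thesis by (simp only: e1)
    qed
    then have hi: "cmod (v m) \<le> T * L ^ n" using vm(2)[OF mM] by linarith
    define w where "w = v m / of_real (L ^ n)"
    have vw: "v m = of_real (L ^ n) * w" using \<phi>(4) by (simp add: w_def)
    have cw: "cmod (v m) = L ^ n * cmod w" "Re (v m) = L ^ n * Re w"
      using L0 unfolding vw by (simp_all add: norm_mult del: of_real_power)
    have w: "R0 \<le> cmod w" "cmod w \<le> T" "c / 2 * cmod w \<le> Re w"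
    proof -
      show "R0 \<le> cmod w" using lo L0 unfolding cw by (simp add: mult.commute)
      show "cmod w \<le> T" using hi L0 unfolding cw by (simp add: mult.commute)
      have "L ^ n * (c / 2 * cmod w) \<le> L ^ n * Re w" using vm(3)[OF mM] unfolding cw by (simp only: mult_ac)
      then show "c / 2 * cmod w \<le> Re w" using L0 by simp
    qed
    have "(\<psi> ^^ m) 0 \<in> unit_disc" using univalent_funpow_in_disc[OF \<psi>(1)] by simp
    from surround[OF this vw[unfolded v_def] w(1,3)]
    obtain u where u: "u \<in> cball w (\<eta> * cmod w)" "(\<psi> ^^ m) 0 = (\<phi> ^^ n) (half_plane_inv \<alpha> u)"
      "1 \<le> Re u" "cmod u \<le> 2 * cmod w" by blast
    then have "u \<in> S" using w(2) by (simp add: S_def)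
    then have "cmod (f ((\<phi> ^^ n) (half_plane_inv \<alpha> u))) < 1 / 2" using n(2) by (auto simp: A_def)
    then show False using B1[of m] m u(2) by simp
  qed
  have x0: "x \<ge> 0" using R0 Q0 by (simp add: x_def)
  have "B \<inter> {1..y} \<subseteq> {1..nat \<lfloor>x\<rfloor>}"
  proof
    fix m assume m: "m \<in> B \<inter> {1..y}"
    then show "m \<in> {1..nat \<lfloor>x\<rfloor>}" using avoid[OF m] by (auto simp: le_nat_floor)
  qed
  then have "card (B \<inter> {1..y}) \<le> nat \<lfloor>x\<rfloor>" using card_mono[of "{1..nat \<lfloor>x\<rfloor>}" "B \<inter> {1..y}"] by simp
  then have "real (card (B \<inter> {1..y})) \<le> x" using x0 by linarith
  moreover have "real Y + 1 \<le> 4 / 5 * T * Q" using Q1 \<mu>Q(3) b(1) by linarith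
  then have "Y \<le> y" using y(2) by linarith
  \<comment> \<open>All elements of \<open>B\<close> up to \<open>y\<close> are at most
    \<open>x\<close>, while there are more than \<open>b * y\<close> of them. By the choice of
    \<open>T\<close> this leaves \<open>2 * Q < b\<close>, which the size of \<open>n\<close>
    excludes.\<close>
  ultimately have "b * y < x" using Y[of y] by linarith
  moreover have "b * (4 / 5 * T * Q - 1) \<le> b * y" using y(2) b(1) by (intro mult_left_mono) auto
  moreover have "b * (4 / 5 * T * Q - 1) = x + 2 * Q - b"
  proof -
    have "b * (4 / 5 * T * Q - 1) = (b * (4 / 5 * T)) * Q - b" by (simp add: algebra_simps)
    then show ?thesis unfolding T(2) x_def by (simp add: algebra_simps)
  qed
  ultimately have "2 * Q < b" by linarith
  then show False using Q1 \<mu>Q(1) Q0 by linarith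
qed

section \<open>The characterization\<close>

lemma parabolic_imp_not_hyperbolic:
  assumes "parabolic \<phi> \<alpha>"
  shows "\<not> hyperbolic \<phi> \<alpha>"
proof
  assume "hyperbolic \<phi> \<alpha>"
  then obtain d :: real where d: "d < 1" "has_angular_derivative \<phi> \<alpha> (of_real d)" by (auto simp: hyperbolic_def)
  have "\<alpha> \<in> sphere 0 1" using assms by (simp add: parabolic_def denjoy_wolff_point_def)
  then have "1 = complex_of_real d"
    by (rule has_angular_derivative_unique[OF _ _ d(2)]) (use assms in \<open>simp add: parabolic_def\<close>)
  then show False using d(1) by (metis less_irrefl of_real_eq_1_iff)
qed

text \<open>Regularity provides some expansion with a nonzero second coefficient; uniqueness of
  expansions identifies its coefficients with the boundary derivatives.\<close>

lemma regular_parabolic_estimate: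
  assumes "regular_parabolic \<phi> \<alpha>"
  defines "a \<equiv> boundary_deriv2 \<phi> \<alpha>" and "b \<equiv> boundary_deriv3 \<phi> \<alpha>"
  obtains C e R where "parabolic_estimate \<phi> \<alpha> (\<alpha> * a / 2) ((\<alpha> * a / 2)^2 - \<alpha>^2 * b / 6) C e R"
    "\<alpha> * a / 2 \<noteq> 0" "denjoy_wolff_point \<phi> \<alpha>" "parabolic \<phi> \<alpha>" "\<not> hyperbolic \<phi> \<alpha>"
proof -
  have p: "parabolic \<phi> \<alpha>" and "\<exists>a b. a \<noteq> 0 \<and> parabolic_expansion \<phi> \<alpha> a b"
    using assms(1) by (auto simp: regular_parabolic_def)
  then obtain a' b' where ab: "a' \<noteq> 0" "parabolic_expansion \<phi> \<alpha> a' b'" by blast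
  have dw: "denjoy_wolff_point \<phi> \<alpha>" using p by (simp add: parabolic_def)
  have \<alpha>: "\<alpha> \<in> sphere 0 1" using dw by (simp add: denjoy_wolff_point_def)
  have eq: "a = a'" "b = b'" unfolding a_def b_def by (rule boundary_deriv_eq[OF \<alpha> ab(2)])+
  have "\<alpha> * a / 2 \<noteq> 0" using \<alpha> ab(1) eq by auto
  moreover obtain C e R where "parabolic_estimate \<phi> \<alpha> (\<alpha> * a / 2) ((\<alpha> * a / 2)^2 - \<alpha>^2 * b / 6) C e R"
    unfolding eq using parabolic_expansion_estimate[OF _ ab(2)] \<alpha> by auto
  ultimately show ?thesis using that dw p parabolic_imp_not_hyperbolic by blast
qed

lemma regular_hyperbolic_estimate:
  assumes "regular_hyperbolic \<phi> \<alpha>"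
  obtains d C e R where "0 < d" "d < 1" "angular_derivative \<phi> \<alpha> = of_real d" "hyperbolic_estimate \<phi> \<alpha> (1 / d) C e R"
    "1 / d > 1" "denjoy_wolff_point \<phi> \<alpha>" "hyperbolic \<phi> \<alpha>" "\<not> parabolic \<phi> \<alpha>"
proof -
  have h: "hyperbolic \<phi> \<alpha>" and exp: "hyperbolic_expansion \<phi> \<alpha> (angular_derivative \<phi> \<alpha>)"
    using assms by (auto simp: regular_hyperbolic_def)
  then obtain d :: real where d: "0 < d" "d < 1" "has_angular_derivative \<phi> \<alpha> (of_real d)" by (auto simp: hyperbolic_def)
  have dw: "denjoy_wolff_point \<phi> \<alpha>" using h by (simp add: hyperbolic_def)
  have \<alpha>: "\<alpha> \<in> sphere 0 1" using dw by (simp add: denjoy_wolff_point_def)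
  have ad: "angular_derivative \<phi> \<alpha> = of_real d" by (rule angular_derivative_eq[OF \<alpha> d(3)])
  obtain C e R where "hyperbolic_estimate \<phi> \<alpha> (1 / d) C e R"
    using \<alpha> exp d(1) unfolding ad by (auto intro: hyperbolic_expansion_estimate[of \<alpha> d \<phi>])
  moreover have "1 / d > 1" using d by simp
  moreover have "\<not> parabolic \<phi> \<alpha>" using parabolic_imp_not_hyperbolic h by blast
  ultimately show ?thesis using that[OF d(1,2) ad] dw h by blast
qed

lemma imaginary_iff: "z \<in> range (\<lambda>t::real. \<i> * complex_of_real t) \<longleftrightarrow> Re z = 0"
proof
  assume "Re z = 0"
  then have "z = \<i> * complex_of_real (Im z)" by (simp add: complex_eq_iff)
  then show "z \<in> range (\<lambda>t::real. \<i> * complex_of_real t)" by blast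
qed auto

text \<open>The drift of the parabolic map is
  \<open>p = \<alpha> * boundary_deriv2 \<psi> \<alpha> / 2\<close>, so the condition says
  \<open>Re p = 0\<close>: its orbits approach the boundary point tangentially.\<close>

lemma disjoint_orbit_mixed_iff:
  assumes "univalent_self_map \<phi>" "regular_hyperbolic \<phi> \<alpha>" "univalent_self_map \<psi>" "regular_parabolic \<psi> \<alpha>"
  shows "(\<exists>f. disjoint_frequent_orbit \<phi> \<psi> f) \<longleftrightarrow>
    \<alpha> * boundary_deriv2 \<psi> \<alpha> \<in> range (\<lambda>t::real. \<i> * complex_of_real t)"
proof -
  obtain d C e R where h: "hyperbolic_estimate \<phi> \<alpha> (1 / d) C e R" "1 / d > 1" "denjoy_wolff_point \<phi> \<alpha>"
    by (rule regular_hyperbolic_estimate[OF assms(2)]) blast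
  obtain C' e' R' where p: "parabolic_estimate \<psi> \<alpha> (\<alpha> * boundary_deriv2 \<psi> \<alpha> / 2)
      ((\<alpha> * boundary_deriv2 \<psi> \<alpha> / 2)^2 - \<alpha>^2 * boundary_deriv3 \<psi> \<alpha> / 6) C' e' R'"
    "\<alpha> * boundary_deriv2 \<psi> \<alpha> / 2 \<noteq> 0" "denjoy_wolff_point \<psi> \<alpha>"
    by (rule regular_parabolic_estimate[OF assms(4)]) blast
  have "Re (\<alpha> * boundary_deriv2 \<psi> \<alpha> / 2) = 0 \<longleftrightarrow> Re (\<alpha> * boundary_deriv2 \<psi> \<alpha>) = 0"
    by (simp add: Re_divide_numeral del: times_complex.simps)
  then show ?thesis
    unfolding imaginary_iff
    using disjoint_frequent_orbit_mixed[OF assms(1) h(3,1,2) assms(3) p(3,1,2)]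
      no_disjoint_orbit_mixed[OF assms(1) h(3,1,2) assms(3) p(3,1,2)] by blast
qed

theorem theorem1p3:
  fixes \<phi>\<^sub>1 \<phi>\<^sub>2 :: "complex \<Rightarrow> complex" and \<alpha>\<^sub>1 \<alpha>\<^sub>2 :: complex
  assumes "univalent_self_map \<phi>\<^sub>1" and "univalent_self_map \<phi>\<^sub>2"
    and "denjoy_wolff_point \<phi>\<^sub>1 \<alpha>\<^sub>1" and "denjoy_wolff_point \<phi>\<^sub>2 \<alpha>\<^sub>2"
    and "regular_parabolic \<phi>\<^sub>1 \<alpha>\<^sub>1 \<or> regular_hyperbolic \<phi>\<^sub>1 \<alpha>\<^sub>1"
    and "regular_parabolic \<phi>\<^sub>2 \<alpha>\<^sub>2 \<or> regular_hyperbolic \<phi>\<^sub>2 \<alpha>\<^sub>2"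
  shows
    "(\<alpha>\<^sub>1 \<noteq> \<alpha>\<^sub>2 \<longrightarrow>
        disjointly_frequently_hypercyclic hol_disc_topology
          [composition_operator \<phi>\<^sub>1, composition_operator \<phi>\<^sub>2]) \<and>
     (\<forall>\<alpha>. \<alpha>\<^sub>1 = \<alpha> \<and> \<alpha>\<^sub>2 = \<alpha> \<longrightarrow>
        (disjointly_frequently_hypercyclic hol_disc_topology
           [composition_operator \<phi>\<^sub>1, composition_operator \<phi>\<^sub>2]
         \<longleftrightarrow>
           (hyperbolic \<phi>\<^sub>1 \<alpha> \<and> hyperbolic \<phi>\<^sub>2 \<alpha> \<and>
              angular_derivative \<phi>\<^sub>1 \<alpha> \<noteq> angular_derivative \<phi>\<^sub>2 \<alpha>)
         \<or> (parabolic \<phi>\<^sub>1 \<alpha> \<and> parabolic \<phi>\<^sub>2 \<alpha> \<and>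
              (boundary_deriv2 \<phi>\<^sub>1 \<alpha>, boundary_deriv3 \<phi>\<^sub>1 \<alpha>)
                \<noteq> (boundary_deriv2 \<phi>\<^sub>2 \<alpha>, boundary_deriv3 \<phi>\<^sub>2 \<alpha>))
         \<or> (hyperbolic \<phi>\<^sub>1 \<alpha> \<and> parabolic \<phi>\<^sub>2 \<alpha> \<and>
              \<alpha> * boundary_deriv2 \<phi>\<^sub>2 \<alpha> \<in> range (\<lambda>t::real. \<i> * complex_of_real t))
         \<or> (parabolic \<phi>\<^sub>1 \<alpha> \<and> hyperbolic \<phi>\<^sub>2 \<alpha> \<and>
              \<alpha> * boundary_deriv2 \<phi>\<^sub>1 \<alpha> \<in> range (\<lambda>t::real. \<i> * complex_of_real t))))"
proof (intro conjI impI allI)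
  note iff = disjointly_frequently_hypercyclic_iff[OF assms(1,2)]
  show "disjointly_frequently_hypercyclic hol_disc_topology [composition_operator \<phi>\<^sub>1, composition_operator \<phi>\<^sub>2]"
    if "\<alpha>\<^sub>1 \<noteq> \<alpha>\<^sub>2"
    unfolding iff by (rule disjoint_frequent_orbit_distinct_points[OF assms(1,3,2,4) that])
  fix \<alpha> assume "\<alpha>\<^sub>1 = \<alpha> \<and> \<alpha>\<^sub>2 = \<alpha>"
  then have \<alpha>: "\<alpha>\<^sub>1 = \<alpha>" "\<alpha>\<^sub>2 = \<alpha>" by auto
  have sph: "\<alpha> \<noteq> 0" using assms(3) \<alpha> by (auto simp: denjoy_wolff_point_def)
  note hyp = regular_hyperbolic_estimate and par = regular_parabolic_estimate
  consider (hh) "regular_hyperbolic \<phi>\<^sub>1 \<alpha>" "regular_hyperbolic \<phi>\<^sub>2 \<alpha>"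
    | (pp) "regular_parabolic \<phi>\<^sub>1 \<alpha>" "regular_parabolic \<phi>\<^sub>2 \<alpha>"
    | (hp) "regular_hyperbolic \<phi>\<^sub>1 \<alpha>" "regular_parabolic \<phi>\<^sub>2 \<alpha>"
    | (ph) "regular_parabolic \<phi>\<^sub>1 \<alpha>" "regular_hyperbolic \<phi>\<^sub>2 \<alpha>"
    using assms(5,6) \<alpha> by blast
  then show "disjointly_frequently_hypercyclic hol_disc_topology
           [composition_operator \<phi>\<^sub>1, composition_operator \<phi>\<^sub>2]
         \<longleftrightarrow>
           (hyperbolic \<phi>\<^sub>1 \<alpha> \<and> hyperbolic \<phi>\<^sub>2 \<alpha> \<and>
              angular_derivative \<phi>\<^sub>1 \<alpha> \<noteq> angular_derivative \<phi>\<^sub>2 \<alpha>)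
         \<or> (parabolic \<phi>\<^sub>1 \<alpha> \<and> parabolic \<phi>\<^sub>2 \<alpha> \<and>
              (boundary_deriv2 \<phi>\<^sub>1 \<alpha>, boundary_deriv3 \<phi>\<^sub>1 \<alpha>)
                \<noteq> (boundary_deriv2 \<phi>\<^sub>2 \<alpha>, boundary_deriv3 \<phi>\<^sub>2 \<alpha>))
         \<or> (hyperbolic \<phi>\<^sub>1 \<alpha> \<and> parabolic \<phi>\<^sub>2 \<alpha> \<and>
              \<alpha> * boundary_deriv2 \<phi>\<^sub>2 \<alpha> \<in> range (\<lambda>t::real. \<i> * complex_of_real t))
         \<or> (parabolic \<phi>\<^sub>1 \<alpha> \<and> hyperbolic \<phi>\<^sub>2 \<alpha> \<and>
              \<alpha> * boundary_deriv2 \<phi>\<^sub>1 \<alpha> \<in> range (\<lambda>t::real. \<i> * complex_of_real t))"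
  proof cases
    case hh
    obtain d1 C1 e1 R1 where h1: "0 < d1" "angular_derivative \<phi>\<^sub>1 \<alpha> = of_real d1" "hyperbolic_estimate \<phi>\<^sub>1 \<alpha> (1 / d1) C1 e1 R1"
      "1 / d1 > 1" "denjoy_wolff_point \<phi>\<^sub>1 \<alpha>" "hyperbolic \<phi>\<^sub>1 \<alpha>" "\<not> parabolic \<phi>\<^sub>1 \<alpha>" by (rule hyp[OF hh(1)]) blast
    obtain d2 C2 e2 R2 where h2: "0 < d2" "angular_derivative \<phi>\<^sub>2 \<alpha> = of_real d2" "hyperbolic_estimate \<phi>\<^sub>2 \<alpha> (1 / d2) C2 e2 R2"
      "1 / d2 > 1" "denjoy_wolff_point \<phi>\<^sub>2 \<alpha>" "hyperbolic \<phi>\<^sub>2 \<alpha>" "\<not> parabolic \<phi>\<^sub>2 \<alpha>" by (rule hyp[OF hh(2)]) blast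
    have "(\<exists>f. disjoint_frequent_orbit \<phi>\<^sub>1 \<phi>\<^sub>2 f) \<longleftrightarrow> d1 \<noteq> d2"
    proof (cases "d1 = d2")
      case True
      then show ?thesis using no_disjoint_orbit_hyperbolic[OF assms(1) h1(5,3,4) assms(2)] h2(3) by blast
    next
      case False
      then have "1 / d1 \<noteq> 1 / d2" using h1(1) h2(1) by simp
      then show ?thesis using disjoint_frequent_orbit_hyperbolic[OF assms(1) h1(5,3,4) assms(2) h2(5,3,4)] False by blast
    qed
    then show ?thesis unfolding iff using h1 h2 by simp
  next
    case pp
    define p1 p2 where "p1 = \<alpha> * boundary_deriv2 \<phi>\<^sub>1 \<alpha> / 2" and "p2 = \<alpha> * boundary_deriv2 \<phi>\<^sub>2 \<alpha> / 2"
    define q1 q2 where "q1 = p1^2 - \<alpha>^2 * boundary_deriv3 \<phi>\<^sub>1 \<alpha> / 6" and "q2 = p2^2 - \<alpha>^2 * boundary_deriv3 \<phi>\<^sub>2 \<alpha> / 6"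
    obtain C1 e1 R1 where h1: "parabolic_estimate \<phi>\<^sub>1 \<alpha> p1 q1 C1 e1 R1" "p1 \<noteq> 0" "denjoy_wolff_point \<phi>\<^sub>1 \<alpha>"
      "parabolic \<phi>\<^sub>1 \<alpha>" "\<not> hyperbolic \<phi>\<^sub>1 \<alpha>"
      unfolding q1_def p1_def by (rule par[OF pp(1)]) blast
    obtain C2 e2 R2 where h2: "parabolic_estimate \<phi>\<^sub>2 \<alpha> p2 q2 C2 e2 R2" "p2 \<noteq> 0" "denjoy_wolff_point \<phi>\<^sub>2 \<alpha>"
      "parabolic \<phi>\<^sub>2 \<alpha>" "\<not> hyperbolic \<phi>\<^sub>2 \<alpha>"
      unfolding q2_def p2_def by (rule par[OF pp(2)]) blast
    \<comment> \<open>As \<open>\<alpha> \<noteq> 0\<close>, \<open>p\<close> determines the second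
      derivative, and then \<open>q\<close> the third.\<close>
    have eq: "(p1, q1) = (p2, q2) \<longleftrightarrow> (boundary_deriv2 \<phi>\<^sub>1 \<alpha>, boundary_deriv3 \<phi>\<^sub>1 \<alpha>) = (boundary_deriv2 \<phi>\<^sub>2 \<alpha>, boundary_deriv3 \<phi>\<^sub>2 \<alpha>)"
      using sph by (auto simp: p1_def p2_def q1_def q2_def)
    have "(\<exists>f. disjoint_frequent_orbit \<phi>\<^sub>1 \<phi>\<^sub>2 f) \<longleftrightarrow> (p1, q1) \<noteq> (p2, q2)"
    proof (cases "(p1, q1) = (p2, q2)")
      case True
      then show ?thesis using no_disjoint_orbit_parabolic[OF assms(1) h1(3,1,2) assms(2)] h2(1) by blast
    next
      case False
      then show ?thesis using disjoint_frequent_orbit_parabolic[OF assms(1) h1(3,1,2) assms(2) h2(3,1,2)] by blast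
    qed
    then show ?thesis unfolding iff eq using h1 h2 by simp
  next
    case hp
    have "hyperbolic \<phi>\<^sub>1 \<alpha>" "\<not> parabolic \<phi>\<^sub>1 \<alpha>" by (rule hyp[OF hp(1)]; blast)+
    moreover have "parabolic \<phi>\<^sub>2 \<alpha>" "\<not> hyperbolic \<phi>\<^sub>2 \<alpha>" by (rule par[OF hp(2)]; blast)+
    ultimately show ?thesis unfolding iff using disjoint_orbit_mixed_iff[OF assms(1) hp(1) assms(2) hp(2)] by blast
  next
    case ph
    have "hyperbolic \<phi>\<^sub>2 \<alpha>" "\<not> parabolic \<phi>\<^sub>2 \<alpha>" by (rule hyp[OF ph(2)]; blast)+
    moreover have "parabolic \<phi>\<^sub>1 \<alpha>" "\<not> hyperbolic \<phi>\<^sub>1 \<alpha>" by (rule par[OF ph(1)]; blast)+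
    \<comment> \<open>The orbit condition is symmetric in the two maps, so this is the preceding
      case with the roles exchanged.\<close>
    ultimately show ?thesis
      unfolding iff using disjoint_orbit_mixed_iff[OF assms(2) ph(2) assms(1) ph(1)] disjoint_frequent_orbit_swap by blast
  qed
qed

end
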